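(* Let $n$ be a positive integer. The functor $j^*:\mathscr{A}_n\to\mathscr{P}_n$, $j^*(\mathbf f)(V)=\mathbf f(V^{\otimes n})$, has a right adjoint functor $j_*$ defined by $$j_*(F)(M)=\mathrm{Hom}_{\mathscr{P}_n}(j^*(\mathbf h_M),F)=\mathrm{Hom}_{\mathscr{P}_n}(\mathrm{Hom}_{\mathfrak{S}_n}(M,(-)^{\otimes n}),F),$$ where $M$ is a finite-dimensional representation of $\mathfrak{S}_n$. It also has a left adjoint functor $j_!$ defined by $$j_!(F)=\mathbb{D}(j_*(\mathbb{D}F)).$$ In other words, $(j_!F)(M)^\vee=\mathrm{Hom}_{\mathscr{P}_n}(F,(-)^{\otimes n}\otimes_{\mathfrak{S}_n}M^\vee)$.
   Context: $\mathbb{K}$ is a field of positive characteristic; $\mathscr{V}$ is the category of finite-dimensional $\mathbb{K}$-vector spaces, $W^\vee$ the dual of $W$; ${}_{\mathfrak{S}_n}\mathscr{V}$ is the category of finite-dimensional representations of the symmetric group $\mathfrak{S}_n$; $\mathscr{A}_n$ is the category of covariant $\mathbb{K}$-linear functors ${}_{\mathfrak{S}_n}\mathscr{V}\to\mathscr{V}$; $\mathbf h_M=\mathrm{Hom}_{\mathfrak{S}_n}(M,-)$; $X\otimes_{\mathfrak{S}_n}M$ denotes the coinvariants $(X\otimes M)_{\mathfrak{S}_n}$ for the diagonal action. $\Gamma^n\mathscr{V}$ is the category with the same objects as $\mathscr{V}$ and $\mathrm{Hom}_{\Gamma^n\mathscr{V}}(V,W)=(\mathrm{Hom}(V,W)^{\otimes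 n})^{\mathfrak{S}_n}\cong\mathrm{Hom}_{\mathfrak{S}_n}(V^{\otimes n},W^{\otimes n})$; $\mathscr{P}_n$ (homogeneous strict polynomial functors of degree $n$) is the category of $\mathbb{K}$-linear functors $\Gamma^n\mathscr{V}\to\mathscr{V}$. The dualities are $(\mathbb{D}\mathbf f)(M)=\mathbf f(M^\vee)^\vee$ on $\mathscr{A}_n$ and $(\mathbb{D}F)(V)=F(V^\vee)^\vee$ on $\mathscr{P}_n$. *)

theory Defs
  imports
    "Jordan_Normal_Form.VS_Connect"
    "HOL-Algebra.AbelCoset"
    "HOL-Algebra.Sym_Groups"
    "HOL-Library.FuncSet"
begin

hide_const (open) Modules.module_hom Modules.module Multiset.mult Polynomial.smult

section \<open>Vector spaces over a field\<close>

text \<open>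
  The ground field is a type \<open>'k\<close> of class \<^class>\<open>field\<close>.  A vector space is a module record
  \<open>V\<close> with \<open>vectorspace class_ring V\<close>, so that its underlying set is a subset of a type.  The fields
  \<open>mult\<close> and \<open>one\<close> of the record are junk.
\<close>

definition fdvs :: "('k::field, 'a) module \<Rightarrow> bool" where
  "fdvs V \<longleftrightarrow> vectorspace class_ring V \<and> vectorspace.fin_dim class_ring V"

text \<open>Linear maps are extensional (\<open>undefined\<close> outside the source), so that they form a vector space.\<close>

definition lin :: "('k::field, 'a) module \<Rightarrow> ('k, 'b) module \<Rightarrow> ('a \<Rightarrow> 'b) set" where
  "lin V W = module_hom class_ring V W \<inter> extensional (carrier V)"

definition Lin :: "('k::field, 'a) module \<Rightarrow> ('k, 'b) module \<Rightarrow> ('k, 'a \<Rightarrow> 'b) module" where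
  "Lin V W = \<lparr> carrier = lin V W, mult = undefined, one = undefined,
     zero = (\<lambda>x\<in>carrier V. \<zero>\<^bsub>W\<^esub>),
     add = (\<lambda>f g. \<lambda>x\<in>carrier V. f x \<oplus>\<^bsub>W\<^esub> g x),
     smult = (\<lambda>c f. \<lambda>x\<in>carrier V. c \<odot>\<^bsub>W\<^esub> f x) \<rparr>"

definition scalars :: "('k::field, 'k) module" where
  "scalars = \<lparr> carrier = UNIV, mult = (*), one = 1, zero = 0, add = (+), smult = (*) \<rparr>"

definition dual_space :: "('k::field, 'a) module \<Rightarrow> ('k, 'a \<Rightarrow> 'k) module" where
  "dual_space V = Lin V scalars"

definition quotient_space :: "('k::field, 'a) module \<Rightarrow> 'a set \<Rightarrow> ('k, 'a set) module" where
  "quotient_space V D = \<lparr> carrier = a_rcosets\<^bsub>V\<^esub> D, mult = undefined, one = undefined,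
     zero = D,
     add = set_add V,
     smult = (\<lambda>c A. set_add V D ((\<lambda>x. c \<odot>\<^bsub>V\<^esub> x) ` A)) \<rparr>"

text \<open>
  The category of finite-dimensional vector spaces consists of the spaces whose elements lie in a
  type \<open>'u\<close>, which plays the role of the universe.  Constructions such as duals or spaces of natural
  transformations live on other types.  They are brought back by fixing, for every space \<open>X\<close>, an
  isomorphism \<open>enc X\<close> onto a space \<open>small X\<close> with elements in \<open>'u\<close>.  For finite-dimensional \<open>X\<close>
  this is possible as soon as \<open>'u\<close> is large enough to contain all lists of scalars.
\<close>

definition is_copy :: "('k::field, 'a) module \<Rightarrow> ('k, 'u) module \<Rightarrow> ('a \<Rightarrow> 'u) \<Rightarrow> bool" where
  "is_copy X Y e \<longleftrightarrow> fdvs Y \<and> e \<in> lin X Y \<and> bij_betw e (carrier X) (carrier Y)"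

definition small_copy :: "('k::field, 'a) module \<Rightarrow> ('k, 'u) module \<times> ('a \<Rightarrow> 'u)" where
  "small_copy X = (SOME (Y, e). is_copy X Y e)"

definition small :: "('k::field, 'a) module \<Rightarrow> ('k, 'u) module" where
  "small X = fst (small_copy X)"

definition enc :: "('k::field, 'a) module \<Rightarrow> 'a \<Rightarrow> 'u" where
  "enc X = snd (small_copy X)"

definition dec :: "('k::field, 'a) module \<Rightarrow> 'u \<Rightarrow> 'a" where
  "dec X = inv_into (carrier X) (enc X)"

definition small_map ::
    "('k::field, 'a) module \<Rightarrow> ('k, 'b) module \<Rightarrow> ('a \<Rightarrow> 'b) \<Rightarrow> 'u \<Rightarrow> 'u" where
  "small_map X Y f = (\<lambda>u\<in>carrier (small X). enc Y (f (dec X u)))"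

definition vdual :: "('k::field, 'u) module \<Rightarrow> ('k, 'u) module" where
  "vdual V = small (dual_space V)"

text \<open>The transpose \<open>vdual W \<rightarrow> vdual V\<close> of a linear map \<open>f : V \<rightarrow> W\<close>.\<close>

definition vdual_map ::
    "('k::field, 'u) module \<Rightarrow> ('k, 'u) module \<Rightarrow> ('u \<Rightarrow> 'u) \<Rightarrow> 'u \<Rightarrow> 'u" where
  "vdual_map V W f =
     small_map (dual_space W) (dual_space V) (\<lambda>\<xi>. compose (carrier V) \<xi> f)"


section \<open>Linear categories, functors, adjunctions\<close>

text \<open>
  \<open>Mor C a b\<close> is the space of morphisms \<open>a \<rightarrow> b\<close>, and \<open>Cmp C a b c g f\<close> is the composite of
  \<open>f : a \<rightarrow> b\<close> and \<open>g : b \<rightarrow> c\<close>.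
\<close>

record ('k, 'o, 'm) lcat =
  Obj :: "'o set"
  Mor :: "'o \<Rightarrow> 'o \<Rightarrow> ('k, 'm) module"
  Idn :: "'o \<Rightarrow> 'm"
  Cmp :: "'o \<Rightarrow> 'o \<Rightarrow> 'o \<Rightarrow> 'm \<Rightarrow> 'm \<Rightarrow> 'm"

definition linear_category :: "('k::field, 'o, 'm) lcat \<Rightarrow> bool" where
  "linear_category C \<longleftrightarrow>
     (\<forall>a\<in>Obj C. \<forall>b\<in>Obj C. vectorspace class_ring (Mor C a b)) \<and>
     (\<forall>a\<in>Obj C. Idn C a \<in> carrier (Mor C a a)) \<and>
     (\<forall>a\<in>Obj C. \<forall>b\<in>Obj C. \<forall>c\<in>Obj C.
        (\<forall>f\<in>carrier (Mor C a b). (\<lambda>g. Cmp C a b c g f) \<in> module_hom class_ring (Mor C b c) (Mor C a c)) \<and>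
        (\<forall>g\<in>carrier (Mor C b c). (\<lambda>f. Cmp C a b c g f) \<in> module_hom class_ring (Mor C a b) (Mor C a c))) \<and>
     (\<forall>a\<in>Obj C. \<forall>b\<in>Obj C. \<forall>f\<in>carrier (Mor C a b).
        Cmp C a a b f (Idn C a) = f \<and> Cmp C a b b (Idn C b) f = f) \<and>
     (\<forall>a\<in>Obj C. \<forall>b\<in>Obj C. \<forall>c\<in>Obj C. \<forall>d\<in>Obj C.
        \<forall>f\<in>carrier (Mor C a b). \<forall>g\<in>carrier (Mor C b c). \<forall>h\<in>carrier (Mor C c d).
        Cmp C a c d h (Cmp C a b c g f) = Cmp C a b d (Cmp C b c d h g) f)"

text \<open>\<open>mo F a b\<close> is the action of a functor \<open>F\<close> on the morphisms \<open>a \<rightarrow> b\<close>.\<close>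

record ('o, 'm, 'p, 'q) ftor =
  ob :: "'o \<Rightarrow> 'p"
  mo :: "'o \<Rightarrow> 'o \<Rightarrow> 'm \<Rightarrow> 'q"

definition is_functor ::
    "('k::field, 'o, 'm) lcat \<Rightarrow> ('k, 'p, 'q) lcat \<Rightarrow> ('o, 'm, 'p, 'q) ftor \<Rightarrow> bool" where
  "is_functor C D F \<longleftrightarrow>
     (\<forall>a\<in>Obj C. ob F a \<in> Obj D) \<and>
     (\<forall>a\<in>Obj C. \<forall>b\<in>Obj C. \<forall>f\<in>carrier (Mor C a b).
        mo F a b f \<in> carrier (Mor D (ob F a) (ob F b))) \<and>
     (\<forall>a\<in>Obj C. mo F a a (Idn C a) = Idn D (ob F a)) \<and>
     (\<forall>a\<in>Obj C. \<forall>b\<in>Obj C. \<forall>c\<in>Obj C. \<forall>f\<in>carrier (Mor C a b). \<forall>g\<in>carrier (Mor C b c).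
        mo F a c (Cmp C a b c g f) = Cmp D (ob F a) (ob F b) (ob F c) (mo F b c g) (mo F a b f))"

definition linear_functor ::
    "('k::field, 'o, 'm) lcat \<Rightarrow> ('k, 'p, 'q) lcat \<Rightarrow> ('o, 'm, 'p, 'q) ftor \<Rightarrow> bool" where
  "linear_functor C D F \<longleftrightarrow> is_functor C D F \<and>
     (\<forall>a\<in>Obj C. \<forall>b\<in>Obj C. mo F a b \<in> module_hom class_ring (Mor C a b) (Mor D (ob F a) (ob F b)))"

definition nat_trans ::
    "('k::field, 'o, 'm) lcat \<Rightarrow> ('k, 'p, 'q) lcat \<Rightarrow> ('o, 'm, 'p, 'q) ftor \<Rightarrow> ('o, 'm, 'p, 'q) ftor
      \<Rightarrow> ('o \<Rightarrow> 'q) set" where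
  "nat_trans C D F G = {\<eta>. \<eta> \<in> extensional (Obj C) \<and>
     (\<forall>a\<in>Obj C. \<eta> a \<in> carrier (Mor D (ob F a) (ob G a))) \<and>
     (\<forall>a\<in>Obj C. \<forall>b\<in>Obj C. \<forall>f\<in>carrier (Mor C a b).
        Cmp D (ob F a) (ob G a) (ob G b) (mo G a b f) (\<eta> a) =
        Cmp D (ob F a) (ob F b) (ob G b) (\<eta> b) (mo F a b f))}"

text \<open>The category of linear functors \<open>C \<rightarrow> D\<close> and natural transformations.\<close>

definition Fun ::
    "('k::field, 'o, 'm) lcat \<Rightarrow> ('k, 'p, 'q) lcat \<Rightarrow> ('k, ('o, 'm, 'p, 'q) ftor, 'o \<Rightarrow> 'q) lcat" where
  "Fun C D = \<lparr> Obj = {F. linear_functor C D F},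
     Mor = (\<lambda>F G. \<lparr> carrier = nat_trans C D F G, mult = undefined, one = undefined,
       zero = (\<lambda>a\<in>Obj C. \<zero>\<^bsub>Mor D (ob F a) (ob G a)\<^esub>),
       add = (\<lambda>\<eta> \<theta>. \<lambda>a\<in>Obj C. \<eta> a \<oplus>\<^bsub>Mor D (ob F a) (ob G a)\<^esub> \<theta> a),
       smult = (\<lambda>c \<eta>. \<lambda>a\<in>Obj C. c \<odot>\<^bsub>Mor D (ob F a) (ob G a)\<^esub> \<eta> a) \<rparr>),
     Idn = (\<lambda>F. \<lambda>a\<in>Obj C. Idn D (ob F a)),
     Cmp = (\<lambda>F G H \<theta> \<eta>. \<lambda>a\<in>Obj C. Cmp D (ob F a) (ob G a) (ob H a) (\<theta> a) (\<eta> a)) \<rparr>"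

text \<open>\<open>adjoint C D L R\<close>: the functor \<open>L : C \<rightarrow> D\<close> is left adjoint to \<open>R : D \<rightarrow> C\<close>.\<close>

definition adjoint ::
    "('k::field, 'o, 'm) lcat \<Rightarrow> ('k, 'p, 'q) lcat \<Rightarrow> ('o, 'm, 'p, 'q) ftor \<Rightarrow> ('p, 'q, 'o, 'm) ftor \<Rightarrow> bool"
  where
  "adjoint C D L R \<longleftrightarrow>
     linear_category C \<and> linear_category D \<and> is_functor C D L \<and> is_functor D C R \<and>
     (\<exists>\<phi>. (\<forall>c\<in>Obj C. \<forall>d\<in>Obj D.
            bij_betw (\<phi> c d) (carrier (Mor D (ob L c) d)) (carrier (Mor C c (ob R d)))) \<and>
          (\<forall>c\<in>Obj C. \<forall>c'\<in>Obj C. \<forall>d\<in>Obj D. \<forall>d'\<in>Obj D.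
            \<forall>u\<in>carrier (Mor C c' c). \<forall>v\<in>carrier (Mor D d d'). \<forall>g\<in>carrier (Mor D (ob L c) d).
              \<phi> c' d' (Cmp D (ob L c') d d' v (Cmp D (ob L c') (ob L c) d g (mo L c' c u))) =
              Cmp C c' (ob R d) (ob R d') (mo R d d' v) (Cmp C c' c (ob R d) (\<phi> c d g) u)))"

definition Vect :: "('k::field, ('k, 'u) module, 'u \<Rightarrow> 'u) lcat" where
  "Vect = \<lparr> Obj = {V. fdvs V}, Mor = Lin, Idn = (\<lambda>V. \<lambda>x\<in>carrier V. x),
     Cmp = (\<lambda>U V W g f. compose (carrier U) g f) \<rparr>"


section \<open>Representations of the symmetric group\<close>

record ('k, 'u) rep =
  rsp :: "('k, 'u) module"
  act :: "(nat \<Rightarrow> nat) \<Rightarrow> 'u \<Rightarrow> 'u"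

definition is_rep :: "nat \<Rightarrow> ('k::field, 'u) rep \<Rightarrow> bool" where
  "is_rep n M \<longleftrightarrow> fdvs (rsp M) \<and>
     (\<forall>\<sigma>\<in>carrier (sym_group n). act M \<sigma> \<in> lin (rsp M) (rsp M)) \<and>
     act M \<one>\<^bsub>sym_group n\<^esub> = (\<lambda>x\<in>carrier (rsp M). x) \<and>
     (\<forall>\<sigma>\<in>carrier (sym_group n). \<forall>\<tau>\<in>carrier (sym_group n).
        act M (\<sigma> \<otimes>\<^bsub>sym_group n\<^esub> \<tau>) = compose (carrier (rsp M)) (act M \<sigma>) (act M \<tau>))"

definition equivariant :: "nat \<Rightarrow> ('k::field, 'u) rep \<Rightarrow> ('k, 'u) rep \<Rightarrow> ('u \<Rightarrow> 'u) set" where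
  "equivariant n M N = {f \<in> lin (rsp M) (rsp N).
     \<forall>\<sigma>\<in>carrier (sym_group n). \<forall>x\<in>carrier (rsp M). f (act M \<sigma> x) = act N \<sigma> (f x)}"

definition HomS :: "nat \<Rightarrow> ('k::field, 'u) rep \<Rightarrow> ('k, 'u) rep \<Rightarrow> ('k, 'u \<Rightarrow> 'u) module" where
  "HomS n M N = (Lin (rsp M) (rsp N)) \<lparr> carrier := equivariant n M N \<rparr>"

definition Rep :: "nat \<Rightarrow> ('k::field, ('k, 'u) rep, 'u \<Rightarrow> 'u) lcat" where
  "Rep n = \<lparr> Obj = {M. is_rep n M}, Mor = HomS n, Idn = (\<lambda>M. \<lambda>x\<in>carrier (rsp M). x),
     Cmp = (\<lambda>L M N g f. compose (carrier (rsp L)) g f) \<rparr>"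

definition dual_rep :: "nat \<Rightarrow> ('k::field, 'u) rep \<Rightarrow> ('k, 'u) rep" where
  "dual_rep n M = \<lparr> rsp = vdual (rsp M),
     act = (\<lambda>\<sigma>. vdual_map (rsp M) (rsp M) (act M (inv\<^bsub>sym_group n\<^esub> \<sigma>))) \<rparr>"


section \<open>Tensor products and coinvariants\<close>

definition tuples :: "nat \<Rightarrow> ('k, 'a) module \<Rightarrow> (nat \<Rightarrow> 'a) set" where
  "tuples n V = {1..n} \<rightarrow>\<^sub>E carrier V"

definition multilinear ::
    "nat \<Rightarrow> ('k::field, 'a) module \<Rightarrow> ('k, 'b) module \<Rightarrow> ((nat \<Rightarrow> 'a) \<Rightarrow> 'b) \<Rightarrow> bool" where
  "multilinear n V W m \<longleftrightarrow> m \<in> tuples n V \<rightarrow> carrier W \<and>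
     (\<forall>v\<in>tuples n V. \<forall>i\<in>{1..n}. (\<lambda>x. m (v(i := x))) \<in> module_hom class_ring V W)"

definition is_tensor_power ::
    "nat \<Rightarrow> ('k::field, 'a) module \<Rightarrow> ('k, 'u) module \<Rightarrow> ((nat \<Rightarrow> 'a) \<Rightarrow> 'u) \<Rightarrow> bool" where
  "is_tensor_power n V T t \<longleftrightarrow> fdvs T \<and> multilinear n V T t \<and>
     (\<forall>(W :: ('k, 'u) module) m. vectorspace class_ring W \<and> multilinear n V W m \<longrightarrow>
        (\<exists>!f. f \<in> lin T W \<and> (\<forall>v\<in>tuples n V. f (t v) = m v)))"

text \<open>
  \<open>V\<^sup>\<otimes>\<^sup>n\<close>, for finite-dimensional \<open>V\<close>, with the map \<open>(v\<^sub>1, \<dots>, v\<^sub>n) \<mapsto> v\<^sub>1 \<otimes> \<dots> \<otimes> v\<^sub>n\<close>: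
  a solution of the universal problem, chosen with elements in the universe \<open>'u\<close>.
\<close>

definition tensor_power ::
    "nat \<Rightarrow> ('k::field, 'a) module \<Rightarrow> ('k, 'u) module \<times> ((nat \<Rightarrow> 'a) \<Rightarrow> 'u)" where
  "tensor_power n V = (SOME (T, t). is_tensor_power n V T t)"

definition tpow :: "nat \<Rightarrow> ('k::field, 'a) module \<Rightarrow> ('k, 'u) module" where
  "tpow n V = fst (tensor_power n V)"

definition pure :: "nat \<Rightarrow> ('k::field, 'a) module \<Rightarrow> (nat \<Rightarrow> 'a) \<Rightarrow> 'u" where
  "pure n V = snd (tensor_power n V)"

text \<open>The linear map on \<open>V\<^sup>\<otimes>\<^sup>n\<close> induced by a multilinear map.\<close>

definition tlift ::
    "nat \<Rightarrow> ('k::field, 'a) module \<Rightarrow> ('k, 'b) module \<Rightarrow> ((nat \<Rightarrow> 'a) \<Rightarrow> 'b) \<Rightarrow> 'u \<Rightarrow> 'b" where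
  "tlift n V W m = (THE f. f \<in> lin (tpow n V) W \<and> (\<forall>v\<in>tuples n V. f (pure n V v) = m v))"

text \<open>\<open>\<sigma> (v\<^sub>1 \<otimes> \<dots> \<otimes> v\<^sub>n)\<close> has \<open>v\<^sub>i\<close> in position \<open>\<sigma> i\<close>; this is a left action.\<close>

definition tpow_act :: "nat \<Rightarrow> ('k::field, 'a) module \<Rightarrow> (nat \<Rightarrow> nat) \<Rightarrow> 'u \<Rightarrow> 'u" where
  "tpow_act n V \<sigma> = tlift n V (tpow n V) (\<lambda>v. pure n V (v \<circ> inv\<^bsub>sym_group n\<^esub> \<sigma>))"

definition tpow_rep :: "nat \<Rightarrow> ('k::field, 'a) module \<Rightarrow> ('k, 'u) rep" where
  "tpow_rep n V = \<lparr> rsp = tpow n V, act = tpow_act n V \<rparr>"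

definition bilinear ::
    "('k::field, 'a) module \<Rightarrow> ('k, 'b) module \<Rightarrow> ('k, 'c) module \<Rightarrow> ('a \<Rightarrow> 'b \<Rightarrow> 'c) \<Rightarrow> bool" where
  "bilinear X Y W b \<longleftrightarrow>
     (\<forall>x\<in>carrier X. b x \<in> module_hom class_ring Y W) \<and>
     (\<forall>y\<in>carrier Y. (\<lambda>x. b x y) \<in> module_hom class_ring X W)"

definition is_tensor_product ::
    "('k::field, 'u) module \<Rightarrow> ('k, 'u) module \<Rightarrow> ('k, 'u) module \<Rightarrow> ('u \<Rightarrow> 'u \<Rightarrow> 'u) \<Rightarrow> bool" where
  "is_tensor_product X Y T t \<longleftrightarrow> fdvs T \<and> bilinear X Y T t \<and>
     (\<forall>(W :: ('k, 'u) module) b. vectorspace class_ring W \<and> bilinear X Y W b \<longrightarrow>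
        (\<exists>!f. f \<in> lin T W \<and> (\<forall>x\<in>carrier X. \<forall>y\<in>carrier Y. f (t x y) = b x y)))"

definition tensor_product ::
    "('k::field, 'u) module \<Rightarrow> ('k, 'u) module \<Rightarrow> ('k, 'u) module \<times> ('u \<Rightarrow> 'u \<Rightarrow> 'u)" where
  "tensor_product X Y = (SOME (T, t). is_tensor_product X Y T t)"

definition tens :: "('k::field, 'u) module \<Rightarrow> ('k, 'u) module \<Rightarrow> ('k, 'u) module" where
  "tens X Y = fst (tensor_product X Y)"

definition tens_elem :: "('k::field, 'u) module \<Rightarrow> ('k, 'u) module \<Rightarrow> 'u \<Rightarrow> 'u \<Rightarrow> 'u" where
  "tens_elem X Y = snd (tensor_product X Y)"

text \<open>The map \<open>f \<otimes> g : X \<otimes> Y \<rightarrow> X' \<otimes> Y'\<close>.\<close>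

definition tens_map ::
    "('k::field, 'u) module \<Rightarrow> ('k, 'u) module \<Rightarrow> ('k, 'u) module \<Rightarrow> ('k, 'u) module
      \<Rightarrow> ('u \<Rightarrow> 'u) \<Rightarrow> ('u \<Rightarrow> 'u) \<Rightarrow> 'u \<Rightarrow> 'u" where
  "tens_map X Y X' Y' f g = (THE h. h \<in> lin (tens X Y) (tens X' Y') \<and>
     (\<forall>x\<in>carrier X. \<forall>y\<in>carrier Y. h (tens_elem X Y x y) = tens_elem X' Y' (f x) (g y)))"

definition tens_rep :: "('k::field, 'u) rep \<Rightarrow> ('k, 'u) rep \<Rightarrow> ('k, 'u) rep" where
  "tens_rep M N = \<lparr> rsp = tens (rsp M) (rsp N),
     act = (\<lambda>\<sigma>. tens_map (rsp M) (rsp N) (rsp M) (rsp N) (act M \<sigma>) (act N \<sigma>)) \<rparr>"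

definition coinv_kernel :: "nat \<Rightarrow> ('k::field, 'u) rep \<Rightarrow> 'u set" where
  "coinv_kernel n M = LinearCombinations.module.span class_ring (rsp M)
     {act M \<sigma> x \<ominus>\<^bsub>rsp M\<^esub> x | \<sigma> x. \<sigma> \<in> carrier (sym_group n) \<and> x \<in> carrier (rsp M)}"

definition coinvariants :: "nat \<Rightarrow> ('k::field, 'u) rep \<Rightarrow> ('k, 'u set) module" where
  "coinvariants n M = quotient_space (rsp M) (coinv_kernel n M)"

text \<open>The bifunctor \<open>M \<otimes>\<^sub>S\<^sub>n N\<close> of coinvariants of the diagonal action.\<close>

definition tensS :: "nat \<Rightarrow> ('k::field, 'u) rep \<Rightarrow> ('k, 'u) rep \<Rightarrow> ('k, 'u) module" where
  "tensS n M N = small (coinvariants n (tens_rep M N))"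

definition tensS_map ::
    "nat \<Rightarrow> ('k::field, 'u) rep \<Rightarrow> ('k, 'u) rep \<Rightarrow> ('k, 'u) rep \<Rightarrow> ('k, 'u) rep
      \<Rightarrow> ('u \<Rightarrow> 'u) \<Rightarrow> ('u \<Rightarrow> 'u) \<Rightarrow> 'u \<Rightarrow> 'u" where
  "tensS_map n M N M' N' f g =
     small_map (coinvariants n (tens_rep M N)) (coinvariants n (tens_rep M' N'))
       (\<lambda>A. set_add (rsp (tens_rep M' N')) (coinv_kernel n (tens_rep M' N'))
              (tens_map (rsp M) (rsp N) (rsp M') (rsp N') f g ` A))"


section \<open>The categories \<open>\<A>\<^sub>n\<close> and \<open>\<P>\<^sub>n\<close>\<close>

text \<open>
  \<open>\<Gamma>\<^sup>n\<V>\<close>: the morphisms \<open>V \<rightarrow> W\<close> are the invariant tensors in \<open>Hom(V,W)\<^sup>\<otimes>\<^sup>n\<close>; composition is the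
  bilinear extension of
  \<open>(g\<^sub>1 \<otimes> \<dots> \<otimes> g\<^sub>n) (f\<^sub>1 \<otimes> \<dots> \<otimes> f\<^sub>n) = (g\<^sub>1 f\<^sub>1) \<otimes> \<dots> \<otimes> (g\<^sub>n f\<^sub>n)\<close>.
\<close>

definition Gam_mor :: "nat \<Rightarrow> ('k::field, 'u) module \<Rightarrow> ('k, 'u) module \<Rightarrow> ('k, 'u) module" where
  "Gam_mor n V W = (tpow n (Lin V W)) \<lparr> carrier :=
     {x \<in> carrier (tpow n (Lin V W)). \<forall>\<sigma>\<in>carrier (sym_group n). tpow_act n (Lin V W) \<sigma> x = x} \<rparr>"

definition Gam_cmp ::
    "nat \<Rightarrow> ('k::field, 'u) module \<Rightarrow> ('k, 'u) module \<Rightarrow> ('k, 'u) module \<Rightarrow> 'u \<Rightarrow> 'u \<Rightarrow> 'u" where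
  "Gam_cmp n U V W y x =
     tlift n (Lin V W) (Lin (tpow n (Lin U V)) (tpow n (Lin U W)))
       (\<lambda>g. tlift n (Lin U V) (tpow n (Lin U W))
         (\<lambda>f. pure n (Lin U W) (\<lambda>i\<in>{1..n}. compose (carrier U) (g i) (f i)))) y x"

definition Gam :: "nat \<Rightarrow> ('k::field, ('k, 'u) module, 'u) lcat" where
  "Gam n = \<lparr> Obj = {V. fdvs V}, Mor = Gam_mor n,
     Idn = (\<lambda>V. pure n (Lin V V) (\<lambda>i\<in>{1..n}. \<lambda>x\<in>carrier V. x)),
     Cmp = Gam_cmp n \<rparr>"

text \<open>
  The canonical map \<open>Hom(V,W)\<^sup>\<otimes>\<^sup>n \<rightarrow> Hom(V\<^sup>\<otimes>\<^sup>n, W\<^sup>\<otimes>\<^sup>n)\<close>, which identifies the morphisms \<open>V \<rightarrow> W\<close> of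
  \<open>\<Gamma>\<^sup>n\<V>\<close> with the equivariant maps \<open>V\<^sup>\<otimes>\<^sup>n \<rightarrow> W\<^sup>\<otimes>\<^sup>n\<close>.
\<close>

definition Gam_real :: "nat \<Rightarrow> ('k::field, 'u) module \<Rightarrow> ('k, 'u) module \<Rightarrow> 'u \<Rightarrow> 'u \<Rightarrow> 'u" where
  "Gam_real n V W =
     tlift n (Lin V W) (Lin (tpow n V) (tpow n W))
       (\<lambda>f. tlift n V (tpow n W) (\<lambda>v. pure n W (\<lambda>i\<in>{1..n}. f i (v i))))"

type_synonym ('k, 'u) aftor = "(('k, 'u) rep, 'u \<Rightarrow> 'u, ('k, 'u) module, 'u \<Rightarrow> 'u) ftor"
type_synonym ('k, 'u) acat = "('k, ('k, 'u) aftor, ('k, 'u) rep \<Rightarrow> 'u \<Rightarrow> 'u) lcat"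
type_synonym ('k, 'u) pftor = "(('k, 'u) module, 'u, ('k, 'u) module, 'u \<Rightarrow> 'u) ftor"
type_synonym ('k, 'u) pcat = "('k, ('k, 'u) pftor, ('k, 'u) module \<Rightarrow> 'u \<Rightarrow> 'u) lcat"

definition A_cat :: "nat \<Rightarrow> ('k::field, 'u) acat" where
  "A_cat n = Fun (Rep n) Vect"

definition P_cat :: "nat \<Rightarrow> ('k::field, 'u) pcat" where
  "P_cat n = Fun (Gam n) Vect"


section \<open>Dualities\<close>

text \<open>
  A contravariant self-functor \<open>d\<close> of \<open>C\<close> (with \<open>mo d a b f : ob d b \<rightarrow> ob d a\<close> for \<open>f : a \<rightarrow> b\<close>)
  induces the duality \<open>a \<mapsto> F(d a)\<^sup>\<or>\<close> on functors \<open>F : C \<rightarrow> Vect\<close>; it is contravariant in \<open>F\<close>.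
\<close>

definition dual_ftor ::
    "('o, 'm, 'o, 'm) ftor \<Rightarrow> ('o, 'm, ('k::field, 'u) module, 'u \<Rightarrow> 'u) ftor
      \<Rightarrow> ('o, 'm, ('k, 'u) module, 'u \<Rightarrow> 'u) ftor" where
  "dual_ftor d F = \<lparr> ob = (\<lambda>a. vdual (ob F (ob d a))),
     mo = (\<lambda>a b f. vdual_map (ob F (ob d b)) (ob F (ob d a)) (mo F (ob d b) (ob d a) (mo d a b f))) \<rparr>"

definition dual_nt ::
    "('k::field, 'o, 'm) lcat \<Rightarrow> ('o, 'm, 'o, 'm) ftor \<Rightarrow> ('o, 'm, ('k, 'u) module, 'u \<Rightarrow> 'u) ftor
      \<Rightarrow> ('o, 'm, ('k, 'u) module, 'u \<Rightarrow> 'u) ftor \<Rightarrow> ('o \<Rightarrow> 'u \<Rightarrow> 'u) \<Rightarrow> ('o \<Rightarrow> 'u \<Rightarrow> 'u)" where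
  "dual_nt C d F G \<alpha> = (\<lambda>a\<in>Obj C. vdual_map (ob F (ob d a)) (ob G (ob d a)) (\<alpha> (ob d a)))"

definition Rep_dual :: "nat \<Rightarrow> (('k::field, 'u) rep, 'u \<Rightarrow> 'u, ('k, 'u) rep, 'u \<Rightarrow> 'u) ftor" where
  "Rep_dual n = \<lparr> ob = dual_rep n, mo = (\<lambda>M N f. vdual_map (rsp M) (rsp N) f) \<rparr>"

text \<open>On \<open>\<Gamma>\<^sup>n\<V>\<close>, duality is induced by \<open>f\<^sub>1 \<otimes> \<dots> \<otimes> f\<^sub>n \<mapsto> f\<^sub>1\<^sup>\<or> \<otimes> \<dots> \<otimes> f\<^sub>n\<^sup>\<or>\<close>.\<close>

definition Gam_dual :: "nat \<Rightarrow> (('k::field, 'u) module, 'u, ('k, 'u) module, 'u) ftor" where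
  "Gam_dual n = \<lparr> ob = vdual,
     mo = (\<lambda>V W. tlift n (Lin V W) (tpow n (Lin (vdual W) (vdual V)))
            (\<lambda>f. pure n (Lin (vdual W) (vdual V)) (\<lambda>i\<in>{1..n}. vdual_map V W (f i)))) \<rparr>"

definition DA :: "nat \<Rightarrow> ('k::field, 'u) aftor \<Rightarrow> ('k, 'u) aftor" where
  "DA n = dual_ftor (Rep_dual n)"

definition DA_map ::
    "nat \<Rightarrow> ('k::field, 'u) aftor \<Rightarrow> ('k, 'u) aftor \<Rightarrow> (('k, 'u) rep \<Rightarrow> 'u \<Rightarrow> 'u) \<Rightarrow> ('k, 'u) rep \<Rightarrow> 'u \<Rightarrow> 'u"
  where "DA_map n = dual_nt (Rep n) (Rep_dual n)"

definition DP :: "nat \<Rightarrow> ('k::field, 'u) pftor \<Rightarrow> ('k, 'u) pftor" where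
  "DP n = dual_ftor (Gam_dual n)"

definition DP_map ::
    "nat \<Rightarrow> ('k::field, 'u) pftor \<Rightarrow> ('k, 'u) pftor \<Rightarrow> (('k, 'u) module \<Rightarrow> 'u \<Rightarrow> 'u) \<Rightarrow> ('k, 'u) module \<Rightarrow> 'u \<Rightarrow> 'u"
  where "DP_map n = dual_nt (Gam n) (Gam_dual n)"


section \<open>The functors \<open>j\<^sup>*\<close>, \<open>j\<^sub>*\<close> and \<open>j\<^sub>!\<close>\<close>

definition jstar_ob :: "nat \<Rightarrow> ('k::field, 'u) aftor \<Rightarrow> ('k, 'u) pftor" where
  "jstar_ob n f = \<lparr> ob = (\<lambda>V. ob f (tpow_rep n V)),
     mo = (\<lambda>V W x. mo f (tpow_rep n V) (tpow_rep n W) (Gam_real n V W x)) \<rparr>"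

definition jstar_nt ::
    "nat \<Rightarrow> (('k::field, 'u) rep \<Rightarrow> 'u \<Rightarrow> 'u) \<Rightarrow> (('k, 'u) module \<Rightarrow> 'u \<Rightarrow> 'u)" where
  "jstar_nt n \<eta> = (\<lambda>V\<in>Obj (Gam n). \<eta> (tpow_rep n V))"

definition jstar :: "nat \<Rightarrow>
    (('k::field, 'u) aftor, ('k, 'u) rep \<Rightarrow> 'u \<Rightarrow> 'u, ('k, 'u) pftor, ('k, 'u) module \<Rightarrow> 'u \<Rightarrow> 'u) ftor" where
  "jstar n = \<lparr> ob = jstar_ob n, mo = (\<lambda>f g. jstar_nt n) \<rparr>"

text \<open>The functor \<open>h\<^sub>M\<close> and the natural transformation \<open>h\<^sub>N \<rightarrow> h\<^sub>M\<close> induced by \<open>\<phi> : M \<rightarrow> N\<close>.\<close>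

definition h_ftor :: "nat \<Rightarrow> ('k::field, 'u) rep \<Rightarrow> ('k, 'u) aftor" where
  "h_ftor n M = \<lparr> ob = (\<lambda>N. small (HomS n M N)),
     mo = (\<lambda>N N' f. small_map (HomS n M N) (HomS n M N') (\<lambda>\<psi>. compose (carrier (rsp M)) f \<psi>)) \<rparr>"

definition h_nt ::
    "nat \<Rightarrow> ('k::field, 'u) rep \<Rightarrow> ('k, 'u) rep \<Rightarrow> ('u \<Rightarrow> 'u) \<Rightarrow> ('k, 'u) rep \<Rightarrow> 'u \<Rightarrow> 'u" where
  "h_nt n M N \<phi> = (\<lambda>L\<in>Obj (Rep n).
     small_map (HomS n N L) (HomS n M L) (\<lambda>\<psi>. compose (carrier (rsp M)) \<psi> \<phi>))"

definition jlow_space :: "nat \<Rightarrow> ('k::field, 'u) pftor \<Rightarrow> ('k, 'u) rep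
    \<Rightarrow> ('k, ('k, 'u) module \<Rightarrow> 'u \<Rightarrow> 'u) module" where
  "jlow_space n F M = Mor (P_cat n) (jstar_ob n (h_ftor n M)) F"

definition jlow_ob :: "nat \<Rightarrow> ('k::field, 'u) pftor \<Rightarrow> ('k, 'u) aftor" where
  "jlow_ob n F = \<lparr> ob = (\<lambda>M. small (jlow_space n F M)),
     mo = (\<lambda>M N \<phi>. small_map (jlow_space n F M) (jlow_space n F N)
       (\<lambda>\<eta>. Cmp (P_cat n) (jstar_ob n (h_ftor n N)) (jstar_ob n (h_ftor n M)) F
              \<eta> (jstar_nt n (h_nt n M N \<phi>)))) \<rparr>"

definition jlow_nt ::
    "nat \<Rightarrow> ('k::field, 'u) pftor \<Rightarrow> ('k, 'u) pftor \<Rightarrow> (('k, 'u) module \<Rightarrow> 'u \<Rightarrow> 'u)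
      \<Rightarrow> ('k, 'u) rep \<Rightarrow> 'u \<Rightarrow> 'u" where
  "jlow_nt n F G \<alpha> = (\<lambda>M\<in>Obj (Rep n). small_map (jlow_space n F M) (jlow_space n G M)
     (\<lambda>\<eta>. Cmp (P_cat n) (jstar_ob n (h_ftor n M)) F G \<alpha> \<eta>))"

definition jlow :: "nat \<Rightarrow>
    (('k::field, 'u) pftor, ('k, 'u) module \<Rightarrow> 'u \<Rightarrow> 'u, ('k, 'u) aftor, ('k, 'u) rep \<Rightarrow> 'u \<Rightarrow> 'u) ftor" where
  "jlow n = \<lparr> ob = jlow_ob n, mo = jlow_nt n \<rparr>"

definition jshriek :: "nat \<Rightarrow>
    (('k::field, 'u) pftor, ('k, 'u) module \<Rightarrow> 'u \<Rightarrow> 'u, ('k, 'u) aftor, ('k, 'u) rep \<Rightarrow> 'u \<Rightarrow> 'u) ftor" where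
  "jshriek n = \<lparr> ob = (\<lambda>F. DA n (ob (jlow n) (DP n F))),
     mo = (\<lambda>F G \<alpha>. DA_map n (ob (jlow n) (DP n G)) (ob (jlow n) (DP n F))
            (mo (jlow n) (DP n G) (DP n F) (DP_map n F G \<alpha>))) \<rparr>"

text \<open>
  The functor \<open>V \<mapsto> V\<^sup>\<otimes>\<^sup>n \<otimes>\<^sub>S\<^sub>n N\<close>, and the natural transformation induced by \<open>f : N \<rightarrow> N'\<close>.
\<close>

definition coinv_ftor :: "nat \<Rightarrow> ('k::field, 'u) rep \<Rightarrow> ('k, 'u) pftor" where
  "coinv_ftor n N = \<lparr> ob = (\<lambda>V. tensS n (tpow_rep n V) N),
     mo = (\<lambda>V W x. tensS_map n (tpow_rep n V) N (tpow_rep n W) N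
            (Gam_real n V W x) (\<lambda>y\<in>carrier (rsp N). y)) \<rparr>"

definition coinv_nt ::
    "nat \<Rightarrow> ('k::field, 'u) rep \<Rightarrow> ('k, 'u) rep \<Rightarrow> ('u \<Rightarrow> 'u) \<Rightarrow> ('k, 'u) module \<Rightarrow> 'u \<Rightarrow> 'u" where
  "coinv_nt n N N' f = (\<lambda>V\<in>Obj (Gam n). tensS_map n (tpow_rep n V) N (tpow_rep n V) N'
     (\<lambda>x\<in>carrier (tpow n V). x) f)"

end

theory Submission
  imports Defs
begin

text \<open>
  By the Yoneda lemma, an element of \<open>f(M)\<close> is a transformation \<open>h\<^sub>M \<rightarrow> f\<close>; restricting it along \<open>j\<close> and
  composing with \<open>j\<^sup>*f \<rightarrow> F\<close> gives \<open>f \<rightarrow> j\<^sub>*F\<close>, and this is inverted by evaluating at \<open>M = V\<^sup>\<otimes>\<^sup>n\<close> on the identity.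
  That \<open>j\<^sub>*F\<close> has finite-dimensional values is a polarization argument: \<open>id\<^sup>\<otimes>\<^sup>n\<close> on any \<open>V\<close> is a linear
  combination of \<open>e\<^sup>\<otimes>\<^sup>n\<close> with \<open>e\<close> of rank at most \<open>n\<close>, so that a transformation in \<open>\<P>\<^sub>n\<close> is determined
  by its component at one space of dimension \<open>n\<close>.

  The isomorphism \<open>(V\<^sup>\<or>)\<^sup>\<otimes>\<^sup>n \<cong> (V\<^sup>\<otimes>\<^sup>n)\<^sup>\<or>\<close> shows that \<open>j\<^sup>*\<close> commutes with the dualities, which therefore turn
  the right adjoint of \<open>j\<^sup>*\<close> into a left adjoint. Finally \<open>Hom\<^sub>S\<^sub>n(N, (V\<^sup>\<or>)\<^sup>\<otimes>\<^sup>n)\<close> and \<open>V\<^sup>\<otimes>\<^sup>n \<otimes>\<^sub>S\<^sub>n N\<close> are in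
  perfect duality, so the functor of coinvariants is the dual of \<open>j\<^sup>*h\<^sub>N\<close>; for \<open>N = M\<^sup>\<or>\<close> this gives
  \<open>(j\<^sub>!F)(M)\<^sup>\<or> = Hom(j\<^sup>*h\<^sub>N, \<D>F) \<cong> Hom(F, \<D>(j\<^sup>*h\<^sub>N)) \<cong> Hom(F, (-)\<^sup>\<otimes>\<^sup>n \<otimes>\<^sub>S\<^sub>n N)\<close>.
\<close>

section \<open>Vector spaces and bases\<close>

text \<open>The values of j_*F are spaces of natural transformations between functors on a whole
  universe of vector spaces. They become objects of \<open>Vect\<close> only through
  \<open>small\<close>, whose choice is controlled for finite-dimensional arguments; so the
  finiteness argument has to precede the proof that j_*F is a functor at all. The bound n on the
  rank comes from the n tensor factors: an alternating sum over all subsets of a set with more than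
  n elements annihilates a product of n additive functions of the subset. No factorial is inverted,
  as positive characteristic demands.

  The formula for j_* is the pointwise right Kan extension along the functor taking V to its n-th
  tensor power.

  Tensor powers, tensor products and small copies are choices by \<open>SOME\<close>, known only
  through their defining properties. Identities are therefore tested on pure tensors, or by pairing
  with a dual space, and equality of linear maps is agreement on the carrier because the maps are
  extensional.\<close>

abbreviation vs :: "('k::field, 'a) module \<Rightarrow> bool" where
  "vs V \<equiv> vectorspace class_ring V"

abbreviation lhom :: "('k::field, 'a) module \<Rightarrow> ('k, 'b) module \<Rightarrow> ('a \<Rightarrow> 'b) set" where
  "lhom V W \<equiv> module_hom class_ring V W"

text \<open>Negatives come for free: \<open>(-1) \<odot> x\<close> is one, because scalars
  distribute over sums and \<open>0 \<odot> x\<close> is zero.\<close>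

lemma vsI:
  assumes "\<zero>\<^bsub>V\<^esub> \<in> carrier V"
    and "\<And>x y. x \<in> carrier V \<Longrightarrow> y \<in> carrier V \<Longrightarrow> x \<oplus>\<^bsub>V\<^esub> y \<in> carrier V"
    and "\<And>c x. x \<in> carrier V \<Longrightarrow> c \<odot>\<^bsub>V\<^esub> x \<in> carrier V"
    and "\<And>x y z. x \<in> carrier V \<Longrightarrow> y \<in> carrier V \<Longrightarrow> z \<in> carrier V \<Longrightarrow>
           (x \<oplus>\<^bsub>V\<^esub> y) \<oplus>\<^bsub>V\<^esub> z = x \<oplus>\<^bsub>V\<^esub> (y \<oplus>\<^bsub>V\<^esub> z)"
    and "\<And>x y. x \<in> carrier V \<Longrightarrow> y \<in> carrier V \<Longrightarrow> x \<oplus>\<^bsub>V\<^esub> y = y \<oplus>\<^bsub>V\<^esub> x"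
    and "\<And>x. x \<in> carrier V \<Longrightarrow> x \<oplus>\<^bsub>V\<^esub> \<zero>\<^bsub>V\<^esub> = x"
    and "\<And>x. x \<in> carrier V \<Longrightarrow> 0 \<odot>\<^bsub>V\<^esub> x = \<zero>\<^bsub>V\<^esub>"
    and "\<And>x. x \<in> carrier V \<Longrightarrow> 1 \<odot>\<^bsub>V\<^esub> x = x"
    and "\<And>r s x. x \<in> carrier V \<Longrightarrow> (r + s) \<odot>\<^bsub>V\<^esub> x = r \<odot>\<^bsub>V\<^esub> x \<oplus>\<^bsub>V\<^esub> s \<odot>\<^bsub>V\<^esub> x"
    and "\<And>r x y. x \<in> carrier V \<Longrightarrow> y \<in> carrier V \<Longrightarrow> r \<odot>\<^bsub>V\<^esub> (x \<oplus>\<^bsub>V\<^esub> y) = r \<odot>\<^bsub>V\<^esub> x \<oplus>\<^bsub>V\<^esub> r \<odot>\<^bsub>V\<^esub> y"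
    and "\<And>r s x. x \<in> carrier V \<Longrightarrow> (r * s) \<odot>\<^bsub>V\<^esub> x = r \<odot>\<^bsub>V\<^esub> (s \<odot>\<^bsub>V\<^esub> x)"
  shows "vs (V :: ('k::field, 'a) module)"
proof -
  have neg: "\<exists>y\<in>carrier V. x \<oplus>\<^bsub>V\<^esub> y = \<zero>\<^bsub>V\<^esub>" if "x \<in> carrier V" for x
    using assms(3)[OF that, of "-1"] assms(9)[OF that, of 1 "-1"] assms(7,8)[OF that]
    by (intro bexI[of _ "(-1) \<odot>\<^bsub>V\<^esub> x"]) auto
  have "Module.module class_ring V"
    by (rule module_criteria)
      (use assms neg class_field in \<open>auto simp: field_def domain_def\<close>)
  then show ?thesis
    unfolding vectorspace_def using class_field by auto
qed

lemma vs_module: "vs V \<Longrightarrow> Module.module class_ring V"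
  by (simp add: vectorspace_def)

lemma vs_zero [simp]: "vs V \<Longrightarrow> \<zero>\<^bsub>V\<^esub> \<in> carrier V"
  and vs_add [simp]: "vs V \<Longrightarrow> x \<in> carrier V \<Longrightarrow> y \<in> carrier V \<Longrightarrow> x \<oplus>\<^bsub>V\<^esub> y \<in> carrier V"
  and vs_smult [simp]: "vs V \<Longrightarrow> x \<in> carrier V \<Longrightarrow> r \<odot>\<^bsub>V\<^esub> x \<in> carrier V"
  and vs_assoc: "vs V \<Longrightarrow> x \<in> carrier V \<Longrightarrow> y \<in> carrier V \<Longrightarrow> z \<in> carrier V \<Longrightarrow>
           (x \<oplus>\<^bsub>V\<^esub> y) \<oplus>\<^bsub>V\<^esub> z = x \<oplus>\<^bsub>V\<^esub> (y \<oplus>\<^bsub>V\<^esub> z)"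
  and vs_comm: "vs V \<Longrightarrow> x \<in> carrier V \<Longrightarrow> y \<in> carrier V \<Longrightarrow> x \<oplus>\<^bsub>V\<^esub> y = y \<oplus>\<^bsub>V\<^esub> x"
  and vs_lcomm: "vs V \<Longrightarrow> x \<in> carrier V \<Longrightarrow> y \<in> carrier V \<Longrightarrow> z \<in> carrier V \<Longrightarrow>
           x \<oplus>\<^bsub>V\<^esub> (y \<oplus>\<^bsub>V\<^esub> z) = y \<oplus>\<^bsub>V\<^esub> (x \<oplus>\<^bsub>V\<^esub> z)"
  and vs_add0 [simp]: "vs V \<Longrightarrow> x \<in> carrier V \<Longrightarrow> x \<oplus>\<^bsub>V\<^esub> \<zero>\<^bsub>V\<^esub> = x"
  and vs_0add [simp]: "vs V \<Longrightarrow> x \<in> carrier V \<Longrightarrow> \<zero>\<^bsub>V\<^esub> \<oplus>\<^bsub>V\<^esub> x = x"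
  and vs_0smult [simp]: "vs V \<Longrightarrow> x \<in> carrier V \<Longrightarrow> 0 \<odot>\<^bsub>V\<^esub> x = \<zero>\<^bsub>V\<^esub>"
  and vs_smult0 [simp]: "vs V \<Longrightarrow> r \<odot>\<^bsub>V\<^esub> \<zero>\<^bsub>V\<^esub> = \<zero>\<^bsub>V\<^esub>"
  and vs_1smult [simp]: "vs V \<Longrightarrow> x \<in> carrier V \<Longrightarrow> 1 \<odot>\<^bsub>V\<^esub> x = x"
  and vs_distl: "vs V \<Longrightarrow> x \<in> carrier V \<Longrightarrow> (r + s) \<odot>\<^bsub>V\<^esub> x = r \<odot>\<^bsub>V\<^esub> x \<oplus>\<^bsub>V\<^esub> s \<odot>\<^bsub>V\<^esub> x"
  and vs_distr: "vs V \<Longrightarrow> x \<in> carrier V \<Longrightarrow> y \<in> carrier V \<Longrightarrow>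
           r \<odot>\<^bsub>V\<^esub> (x \<oplus>\<^bsub>V\<^esub> y) = r \<odot>\<^bsub>V\<^esub> x \<oplus>\<^bsub>V\<^esub> r \<odot>\<^bsub>V\<^esub> y"
  and vs_smult_smult: "vs V \<Longrightarrow> x \<in> carrier V \<Longrightarrow> r \<odot>\<^bsub>V\<^esub> (s \<odot>\<^bsub>V\<^esub> x) = (r * s) \<odot>\<^bsub>V\<^esub> x"
  and vs_minus: "vs V \<Longrightarrow> x \<in> carrier V \<Longrightarrow> y \<in> carrier V \<Longrightarrow> x \<ominus>\<^bsub>V\<^esub> y = x \<oplus>\<^bsub>V\<^esub> (-1) \<odot>\<^bsub>V\<^esub> y"
  for V :: "('k::field, 'a) module" and r s :: 'k
proof -
  assume "vs V"
  then interpret vectorspace class_ring V .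
  show "\<zero>\<^bsub>V\<^esub> \<in> carrier V" "x \<in> carrier V \<Longrightarrow> y \<in> carrier V \<Longrightarrow> x \<oplus>\<^bsub>V\<^esub> y \<in> carrier V"
    "x \<in> carrier V \<Longrightarrow> r \<odot>\<^bsub>V\<^esub> x \<in> carrier V"
    "x \<in> carrier V \<Longrightarrow> x \<oplus>\<^bsub>V\<^esub> \<zero>\<^bsub>V\<^esub> = x"
    "x \<in> carrier V \<Longrightarrow> \<zero>\<^bsub>V\<^esub> \<oplus>\<^bsub>V\<^esub> x = x"
    "r \<odot>\<^bsub>V\<^esub> \<zero>\<^bsub>V\<^esub> = \<zero>\<^bsub>V\<^esub>"
    "x \<in> carrier V \<Longrightarrow> y \<in> carrier V \<Longrightarrow> z \<in> carrier V \<Longrightarrow>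
           (x \<oplus>\<^bsub>V\<^esub> y) \<oplus>\<^bsub>V\<^esub> z = x \<oplus>\<^bsub>V\<^esub> (y \<oplus>\<^bsub>V\<^esub> z)"
    "x \<in> carrier V \<Longrightarrow> y \<in> carrier V \<Longrightarrow> x \<oplus>\<^bsub>V\<^esub> y = y \<oplus>\<^bsub>V\<^esub> x"
    "x \<in> carrier V \<Longrightarrow> y \<in> carrier V \<Longrightarrow> z \<in> carrier V \<Longrightarrow>
           x \<oplus>\<^bsub>V\<^esub> (y \<oplus>\<^bsub>V\<^esub> z) = y \<oplus>\<^bsub>V\<^esub> (x \<oplus>\<^bsub>V\<^esub> z)"
    "x \<in> carrier V \<Longrightarrow> y \<in> carrier V \<Longrightarrow> r \<odot>\<^bsub>V\<^esub> (x \<oplus>\<^bsub>V\<^esub> y) = r \<odot>\<^bsub>V\<^esub> x \<oplus>\<^bsub>V\<^esub> r \<odot>\<^bsub>V\<^esub> y"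
    using smult_r_null[of r]
    by (auto intro: M.a_assoc M.a_comm M.add.m_lcomm smult_r_distr)
  show "x \<in> carrier V \<Longrightarrow> 1 \<odot>\<^bsub>V\<^esub> x = x" "x \<in> carrier V \<Longrightarrow> 0 \<odot>\<^bsub>V\<^esub> x = \<zero>\<^bsub>V\<^esub>"
    using smult_one[of x] smult_l_null[of x] by auto
  show "x \<in> carrier V \<Longrightarrow> (r + s) \<odot>\<^bsub>V\<^esub> x = r \<odot>\<^bsub>V\<^esub> x \<oplus>\<^bsub>V\<^esub> s \<odot>\<^bsub>V\<^esub> x"
    "x \<in> carrier V \<Longrightarrow> r \<odot>\<^bsub>V\<^esub> (s \<odot>\<^bsub>V\<^esub> x) = (r * s) \<odot>\<^bsub>V\<^esub> x"
    using smult_l_distr[of r s x] smult_assoc1[of r s x] by auto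
  show "x \<ominus>\<^bsub>V\<^esub> y = x \<oplus>\<^bsub>V\<^esub> (-1) \<odot>\<^bsub>V\<^esub> y" if "x \<in> carrier V" "y \<in> carrier V"
    using M.minus_equality[of "(-1) \<odot>\<^bsub>V\<^esub> y" y] smult_l_distr[of "-1" 1 y] smult_one[of y] smult_l_null[of y] that
    by (simp add: a_minus_def)
qed

lemma vs_diffl: "vs V \<Longrightarrow> x \<in> carrier V \<Longrightarrow> (r - s) \<odot>\<^bsub>V\<^esub> x = r \<odot>\<^bsub>V\<^esub> x \<oplus>\<^bsub>V\<^esub> (- s) \<odot>\<^bsub>V\<^esub> x"
  using vs_distl[of V x r "- s"] by simp

lemmas vs_ac = vs_assoc vs_comm vs_lcomm

lemma vs_cancel: "vs V \<Longrightarrow> x \<in> carrier V \<Longrightarrow> x \<oplus>\<^bsub>V\<^esub> (-1) \<odot>\<^bsub>V\<^esub> x = \<zero>\<^bsub>V\<^esub>"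
  using vs_distl[of V x 1 "-1"] by simp

text \<open>Differences are written with \<open>(-1) \<odot>\<close>, the form in which linear maps
  pass through them by simplification. Separating families of functionals, which detect zero,
  thereby detect equality.\<close>

lemma vs_eq_iff:
  assumes "vs V" "x \<in> carrier V" "y \<in> carrier V"
  shows "x = y \<longleftrightarrow> x \<oplus>\<^bsub>V\<^esub> (-1) \<odot>\<^bsub>V\<^esub> y = \<zero>\<^bsub>V\<^esub>"
proof
  assume "x \<oplus>\<^bsub>V\<^esub> (-1) \<odot>\<^bsub>V\<^esub> y = \<zero>\<^bsub>V\<^esub>"
  then have "(x \<oplus>\<^bsub>V\<^esub> (-1) \<odot>\<^bsub>V\<^esub> y) \<oplus>\<^bsub>V\<^esub> y = y" using assms by simp
  moreover have "(x \<oplus>\<^bsub>V\<^esub> (-1) \<odot>\<^bsub>V\<^esub> y) \<oplus>\<^bsub>V\<^esub> y = x"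
    using assms vs_cancel[of V y] by (simp add: vs_assoc vs_comm[of V _ y])
  ultimately show "x = y" by simp
qed (use assms vs_cancel in auto)

section \<open>Linear maps and spaces of linear maps\<close>

lemma lhomI:
  assumes "\<And>x. x \<in> carrier V \<Longrightarrow> f x \<in> carrier W"
    and "\<And>x y. x \<in> carrier V \<Longrightarrow> y \<in> carrier V \<Longrightarrow> f (x \<oplus>\<^bsub>V\<^esub> y) = f x \<oplus>\<^bsub>W\<^esub> f y"
    and "\<And>r x. x \<in> carrier V \<Longrightarrow> f (r \<odot>\<^bsub>V\<^esub> x) = r \<odot>\<^bsub>W\<^esub> f x"
  shows "f \<in> lhom V W"
  using assms by (auto simp: LinearCombinations.module_hom_def)

lemma lhom_closed: "f \<in> lhom V W \<Longrightarrow> x \<in> carrier V \<Longrightarrow> f x \<in> carrier W"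
  and lhom_add: "f \<in> lhom V W \<Longrightarrow> x \<in> carrier V \<Longrightarrow> y \<in> carrier V \<Longrightarrow> f (x \<oplus>\<^bsub>V\<^esub> y) = f x \<oplus>\<^bsub>W\<^esub> f y"
  and lhom_smult: "f \<in> lhom V W \<Longrightarrow> x \<in> carrier V \<Longrightarrow> f (r \<odot>\<^bsub>V\<^esub> x) = r \<odot>\<^bsub>W\<^esub> f x"
  by (auto simp: LinearCombinations.module_hom_def)

lemma lhom_zero: "f \<in> lhom V W \<Longrightarrow> vs V \<Longrightarrow> vs W \<Longrightarrow> f \<zero>\<^bsub>V\<^esub> = \<zero>\<^bsub>W\<^esub>"
  using lhom_smult[of f V W "\<zero>\<^bsub>V\<^esub>" 0] lhom_closed[of f V W "\<zero>\<^bsub>V\<^esub>"] by auto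

lemmas lhom_simps = lhom_closed lhom_add lhom_smult

lemma lhom_cong: "f \<in> lhom V W \<Longrightarrow> vs V \<Longrightarrow> (\<And>x. x \<in> carrier V \<Longrightarrow> g x = f x) \<Longrightarrow> g \<in> lhom V W"
  by (intro lhomI) (auto simp: lhom_simps)

lemma lhom_compose: "f \<in> lhom U V \<Longrightarrow> g \<in> lhom V W \<Longrightarrow> (\<lambda>x. g (f x)) \<in> lhom U W"
  by (intro lhomI) (auto simp: lhom_simps)

lemma lhom_id: "(\<lambda>x. x) \<in> lhom V V"
  by (intro lhomI) auto

lemma lhom_inv:
  assumes "f \<in> lhom V W" "bij_betw f (carrier V) (carrier W)" "vs V"
  shows "inv_into (carrier V) f \<in> lhom W V"
proof -
  let ?g = "inv_into (carrier V) f"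
  have c: "?g y \<in> carrier V" "f (?g y) = y" if "y \<in> carrier W" for y
    using assms(2) that by (auto simp: bij_betw_def inv_into_into f_inv_into_f)
  have i: "?g (f x) = x" if "x \<in> carrier V" for x
    using assms(2) that by (auto simp: bij_betw_def)
  show ?thesis
  proof (rule lhomI)
    show "?g (x \<oplus>\<^bsub>W\<^esub> y) = ?g x \<oplus>\<^bsub>V\<^esub> ?g y" if "x \<in> carrier W" "y \<in> carrier W" for x y
      using i[of "?g x \<oplus>\<^bsub>V\<^esub> ?g y"] c that assms by (simp add: lhom_add)
    show "?g (r \<odot>\<^bsub>W\<^esub> x) = r \<odot>\<^bsub>V\<^esub> ?g x" if "x \<in> carrier W" for r x
      using i[of "r \<odot>\<^bsub>V\<^esub> ?g x"] c that assms by (simp add: lhom_smult)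
  qed (use c in auto)
qed

lemma lhom_inj_iff:
  assumes "f \<in> lhom V W" "vs V" "vs W"
  shows "inj_on f (carrier V) \<longleftrightarrow> (\<forall>x\<in>carrier V. f x = \<zero>\<^bsub>W\<^esub> \<longrightarrow> x = \<zero>\<^bsub>V\<^esub>)"
proof
  assume "inj_on f (carrier V)"
  then show "\<forall>x\<in>carrier V. f x = \<zero>\<^bsub>W\<^esub> \<longrightarrow> x = \<zero>\<^bsub>V\<^esub>"
    using lhom_zero[OF assms] assms(2) by (metis inj_onD vs_zero)
next
  assume *: "\<forall>x\<in>carrier V. f x = \<zero>\<^bsub>W\<^esub> \<longrightarrow> x = \<zero>\<^bsub>V\<^esub>"
  show "inj_on f (carrier V)"
  proof (rule inj_onI)
    fix x y assume xy: "x \<in> carrier V" "y \<in> carrier V" "f x = f y"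
    then have "f (x \<oplus>\<^bsub>V\<^esub> (-1) \<odot>\<^bsub>V\<^esub> y) = \<zero>\<^bsub>W\<^esub>"
      using assms by (simp add: lhom_simps[OF assms(1)] vs_cancel)
    then show "x = y"
      using * xy assms vs_eq_iff[of V x y] by simp
  qed
qed

lemma scalars_simps [simp]:
  "carrier scalars = UNIV" "\<zero>\<^bsub>scalars\<^esub> = 0" "x \<oplus>\<^bsub>scalars\<^esub> y = x + y" "x \<odot>\<^bsub>scalars\<^esub> y = x * y"
  by (auto simp: scalars_def)

lemma vs_scalars [simp]: "vs (scalars :: ('k::field, 'k) module)"
  by (rule vsI) (auto simp: algebra_simps)

lemma vs_sub:
  assumes "vs V" "S \<subseteq> carrier V" "\<zero>\<^bsub>V\<^esub> \<in> S"
    and "\<And>x y. x \<in> S \<Longrightarrow> y \<in> S \<Longrightarrow> x \<oplus>\<^bsub>V\<^esub> y \<in> S" "\<And>r x. x \<in> S \<Longrightarrow> r \<odot>\<^bsub>V\<^esub> x \<in> S"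
  shows "vs (V\<lparr>carrier := S\<rparr>)"
  by (rule vsI) (use assms in \<open>auto simp: subset_iff vs_ac vs_distl vs_distr vs_smult_smult\<close>)

text \<open>Both \<open>Lin V W\<close> and the spaces of natural transformations are this record
  with a smaller carrier, so by \<open>vs_sub\<close> their vector space axioms reduce to closure
  under the operations.\<close>

definition prod_space :: "'i set \<Rightarrow> ('i \<Rightarrow> ('k::field, 'a) module) \<Rightarrow> ('k, 'i \<Rightarrow> 'a) module" where
  "prod_space A V = \<lparr> carrier = (\<Pi>\<^sub>E i\<in>A. carrier (V i)), mult = undefined, one = undefined,
     zero = (\<lambda>i\<in>A. \<zero>\<^bsub>V i\<^esub>), add = (\<lambda>f g. \<lambda>i\<in>A. f i \<oplus>\<^bsub>V i\<^esub> g i),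
     smult = (\<lambda>c f. \<lambda>i\<in>A. c \<odot>\<^bsub>V i\<^esub> f i) \<rparr>"

lemma vs_prod_space:
  assumes "\<And>i. i \<in> A \<Longrightarrow> vs (V i)"
  shows "vs (prod_space A V)"
proof -
  have *: "f i \<in> carrier (V i)" if "f \<in> (\<Pi>\<^sub>E i\<in>A. carrier (V i))" "i \<in> A" for f i
    using that by auto
  have e: "f = (\<lambda>i\<in>A. g i)" if "f \<in> (\<Pi>\<^sub>E i\<in>A. carrier (V i))" "\<And>i. i \<in> A \<Longrightarrow> f i = g i" for f g
    using that by (intro extensionalityI[of f A]) (auto simp: PiE_iff)
  show ?thesis
    by (rule vsI; (simp add: prod_space_def)?;
        (rule restrict_ext | rule e[symmetric] | rule restrict_PiE_iff[THEN iffD2, rule_format])?)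
      (use assms in \<open>auto simp: vs_ac vs_distl vs_distr vs_smult_smult *\<close>)
qed

lemma Lin_simps [simp]:
  "carrier (Lin V W) = lin V W" "\<zero>\<^bsub>Lin V W\<^esub> = (\<lambda>x\<in>carrier V. \<zero>\<^bsub>W\<^esub>)"
  "f \<oplus>\<^bsub>Lin V W\<^esub> g = (\<lambda>x\<in>carrier V. f x \<oplus>\<^bsub>W\<^esub> g x)"
  "c \<odot>\<^bsub>Lin V W\<^esub> f = (\<lambda>x\<in>carrier V. c \<odot>\<^bsub>W\<^esub> f x)"
  by (auto simp: Lin_def)

lemma linI: "f \<in> lhom V W \<Longrightarrow> f \<in> extensional (carrier V) \<Longrightarrow> f \<in> lin V W"
  and lin_lhom: "f \<in> lin V W \<Longrightarrow> f \<in> lhom V W"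
  and lin_ext: "f \<in> lin V W \<Longrightarrow> f \<in> extensional (carrier V)"
  by (auto simp: lin_def)

lemmas lin_closed = lhom_closed[OF lin_lhom]
lemmas lin_add = lhom_add[OF lin_lhom]
lemmas lin_smult = lhom_smult[OF lin_lhom]
lemmas lin_zero = lhom_zero[OF lin_lhom]
lemmas lin_simps = lin_closed lin_add lin_smult

lemma lin_restrict: "f \<in> lhom V W \<Longrightarrow> vs V \<Longrightarrow> (\<lambda>x\<in>carrier V. f x) \<in> lin V W"
  by (intro linI) (auto intro: lhom_cong)

lemma lin_eqI: "f \<in> lin V W \<Longrightarrow> g \<in> lin V W' \<Longrightarrow> (\<And>x. x \<in> carrier V \<Longrightarrow> f x = g x) \<Longrightarrow> f = g"
  by (auto simp: lin_def intro: extensionalityI)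

lemma lin_compose: "f \<in> lin U V \<Longrightarrow> g \<in> lhom V W \<Longrightarrow> vs U \<Longrightarrow> compose (carrier U) g f \<in> lin U W"
  unfolding compose_def using lhom_compose[OF lin_lhom, of f U V g W] by (intro lin_restrict) auto

lemma lin_id: "vs V \<Longrightarrow> (\<lambda>x\<in>carrier V. x) \<in> lin V V"
  by (intro lin_restrict lhom_id)

lemma lhom_plus:
  assumes "f \<in> lhom V W" "g \<in> lhom V W" "vs V" "vs W"
  shows "(\<lambda>x. f x \<oplus>\<^bsub>W\<^esub> g x) \<in> lhom V W"
  by (intro lhomI; use assms in \<open>simp add: lhom_simps[OF assms(1)] lhom_simps[OF assms(2)] vs_ac vs_distr\<close>)

lemma lhom_scale:
  assumes "f \<in> lhom V W" "vs V" "vs W"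
  shows "(\<lambda>x. c \<odot>\<^bsub>W\<^esub> f x) \<in> lhom V W"
  by (intro lhomI; use assms in \<open>simp add: lhom_simps[OF assms(1)] vs_distr vs_smult_smult mult.commute\<close>)

lemma lhom_const_zero: "vs W \<Longrightarrow> (\<lambda>x. \<zero>\<^bsub>W\<^esub>) \<in> lhom V W"
  by (intro lhomI) simp_all

lemma vs_Lin [simp]:
  assumes "vs V" "vs W"
  shows "vs (Lin V W)"
proof -
  have eq: "Lin V W = (prod_space (carrier V) (\<lambda>_. W))\<lparr>carrier := lin V W\<rparr>"
    by (simp add: Lin_def prod_space_def)
  show ?thesis
    unfolding eq
  proof (rule vs_sub[OF vs_prod_space])
    show "lin V W \<subseteq> carrier (prod_space (carrier V) (\<lambda>_. W))"
      by (rule subsetI) (simp add: prod_space_def PiE_iff lin_closed lin_ext)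
  qed (use assms in \<open>simp_all add: prod_space_def lin_restrict lhom_const_zero lhom_plus lhom_scale lin_lhom\<close>)
qed

text \<open>A finite basis \<open>b\<close> together with its coordinate functions \<open>c\<close>.
  Biorthogonality stands for independence; spanning is replaced by the last clause, that the
  coordinates separate points. This form avoids finite sums of vectors.\<close>

definition bas :: "('k::field, 'a) module \<Rightarrow> 'i set \<Rightarrow> ('i \<Rightarrow> 'a) \<Rightarrow> ('i \<Rightarrow> 'a \<Rightarrow> 'k) \<Rightarrow> bool" where
  "bas V I b c \<longleftrightarrow> finite I \<and> vs V \<and> (\<forall>i\<in>I. b i \<in> carrier V) \<and> (\<forall>i\<in>I. c i \<in> lhom V scalars) \<and>
     (\<forall>i\<in>I. \<forall>j\<in>I. c i (b j) = (if i = j then 1 else 0)) \<and>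
     (\<forall>x\<in>carrier V. (\<forall>i\<in>I. c i x = 0) \<longrightarrow> x = \<zero>\<^bsub>V\<^esub>)"

lemma basD:
  assumes "bas V I b c"
  shows "finite I" "vs V" "i \<in> I \<Longrightarrow> b i \<in> carrier V" "i \<in> I \<Longrightarrow> c i \<in> lhom V scalars"
    "i \<in> I \<Longrightarrow> j \<in> I \<Longrightarrow> c i (b j) = (if i = j then 1 else 0)"
    "x \<in> carrier V \<Longrightarrow> (\<And>i. i \<in> I \<Longrightarrow> c i x = 0) \<Longrightarrow> x = \<zero>\<^bsub>V\<^esub>"
  using assms by (auto simp: bas_def)

text \<open>Spanning in the form of an induction principle. The inner induction is on the set
  \<open>J\<close> of coordinates allowed to be nonzero: subtracting
  \<open>c j x \<odot> b j\<close> clears coordinate \<open>j\<close> and leaves the others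
  unchanged.\<close>

lemma bas_induct:
  assumes V: "bas V I b c" and x: "x \<in> carrier V"
    and "P \<zero>\<^bsub>V\<^esub>" and step: "\<And>x r i. x \<in> carrier V \<Longrightarrow> P x \<Longrightarrow> i \<in> I \<Longrightarrow> P (x \<oplus>\<^bsub>V\<^esub> r \<odot>\<^bsub>V\<^esub> b i)"
  shows "P x"
proof -
  note B = basD[OF V]
  have "\<forall>x\<in>carrier V. (\<forall>i\<in>I - J. c i x = 0) \<longrightarrow> P x" if "finite J" "J \<subseteq> I" for J
    using that
  proof (induction J)
    case empty
    then show ?case using B(6) assms(3) by auto
  next
    case (insert j J)
    show ?case
    proof (intro ballI impI)
      fix x assume x: "x \<in> carrier V" "\<forall>i\<in>I - insert j J. c i x = 0"
      have j: "j \<in> I" using insert by simp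
      let ?y = "x \<oplus>\<^bsub>V\<^esub> (- c j x) \<odot>\<^bsub>V\<^esub> b j"
      have y: "?y \<in> carrier V" using x j B by simp
      have "c i ?y = 0" if "i \<in> I - J" for i
        using that x j B(2,3) B(5)[of i j] by (auto simp: lhom_simps[OF B(4)])
      then have "P ?y" using insert y by blast
      then have "P (?y \<oplus>\<^bsub>V\<^esub> c j x \<odot>\<^bsub>V\<^esub> b j)" by (rule step[OF y _ j])
      moreover have "?y \<oplus>\<^bsub>V\<^esub> c j x \<odot>\<^bsub>V\<^esub> b j = x"
        using x j B(2,3) vs_distl[of V "b j" "- c j x" "c j x", symmetric] by (simp add: vs_assoc)
      ultimately show "P x" by simp
    qed
  qed
  from this[OF B(1)] x show ?thesis by simp
qed

lemma bas_ext:
  assumes "bas V I b c" "f \<in> lhom V W" "g \<in> lhom V W" "vs W"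
    "\<And>i. i \<in> I \<Longrightarrow> f (b i) = g (b i)" "x \<in> carrier V"
  shows "f x = g x"
  using assms(1,6)
  by (rule bas_induct)
    (use assms basD[OF assms(1)] in \<open>auto simp: lhom_simps[OF assms(2)] lhom_simps[OF assms(3)] lhom_zero[of _ V W]\<close>)

lemma bas_vec:
  assumes V: "bas V I b c"
  shows "\<exists>x\<in>carrier V. \<forall>i\<in>I. c i x = a i"
proof -
  note B = basD[OF V]
  have "\<exists>x\<in>carrier V. \<forall>i\<in>I. c i x = (if i \<in> J then a i else 0)" if "finite J" "J \<subseteq> I" for J
    using that
  proof (induction J)
    case empty
    have "c i \<zero>\<^bsub>V\<^esub> = 0" if "i \<in> I" for i
      using lhom_zero[OF B(4)[OF that]] B(2) by simp
    then show ?case using B(2) by (intro bexI[of _ "\<zero>\<^bsub>V\<^esub>"]) auto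
  next
    case (insert j J)
    then obtain x where x: "x \<in> carrier V" "\<forall>i\<in>I. c i x = (if i \<in> J then a i else 0)" by auto
    have "c i (x \<oplus>\<^bsub>V\<^esub> a j \<odot>\<^bsub>V\<^esub> b j) = (if i \<in> insert j J then a i else 0)" if "i \<in> I" for i
      using x insert that B(2,3) B(5)[of i j] by (auto simp: lhom_simps[OF B(4)])
    then show ?case using x insert B by (intro bexI[of _ "x \<oplus>\<^bsub>V\<^esub> a j \<odot>\<^bsub>V\<^esub> b j"]) auto
  qed
  from this[OF B(1)] show ?thesis by auto
qed

text \<open>The map is the sum of the maps \<open>x \<mapsto> c j x \<odot> w j\<close>, assembled
  by adding one index at a time.\<close>

lemma bas_lin_ex:
  assumes V: "bas V I b c" and "vs W" and w: "\<And>i. i \<in> I \<Longrightarrow> w i \<in> carrier W"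
  shows "\<exists>f\<in>lin V W. \<forall>i\<in>I. f (b i) = w i"
proof -
  note B = basD[OF V]
  have "\<exists>f\<in>lhom V W. \<forall>i\<in>I. f (b i) = (if i \<in> J then w i else \<zero>\<^bsub>W\<^esub>)" if "finite J" "J \<subseteq> I" for J
    using that
  proof (induction J)
    case empty
    show ?case by (intro bexI[of _ "\<lambda>x. \<zero>\<^bsub>W\<^esub>"]) (use \<open>vs W\<close> in \<open>auto intro!: lhomI\<close>)
  next
    case (insert j J)
    then obtain f where f: "f \<in> lhom V W" "\<forall>i\<in>I. f (b i) = (if i \<in> J then w i else \<zero>\<^bsub>W\<^esub>)" by auto
    have j: "j \<in> I" using insert by simp
    have "(\<lambda>x. f x \<oplus>\<^bsub>W\<^esub> c j x \<odot>\<^bsub>W\<^esub> w j) \<in> lhom V W"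
      by (rule lhomI) (use w[OF j] assms(2) B(2) in \<open>simp_all add: lhom_simps[OF f(1)]
          lhom_simps[OF B(4)[OF j]] vs_distl vs_distr vs_smult_smult vs_ac\<close>)
    moreover have "f (b i) \<oplus>\<^bsub>W\<^esub> c j (b i) \<odot>\<^bsub>W\<^esub> w j = (if i \<in> insert j J then w i else \<zero>\<^bsub>W\<^esub>)" if "i \<in> I" for i
      using that f insert w assms(2) B(5)[of j i] j by auto
    ultimately show ?case by (intro bexI[of _ "\<lambda>x. f x \<oplus>\<^bsub>W\<^esub> c j x \<odot>\<^bsub>W\<^esub> w j"]) auto
  qed
  from this[OF B(1)] obtain f where "f\<in>lhom V W" "\<forall>i\<in>I. f (b i) = w i" by auto
  then show ?thesis using B by (intro bexI[of _ "\<lambda>x\<in>carrier V. f x"]) (auto intro: lin_restrict)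
qed

lemma bas_reindex:
  assumes "bas V I b c" "bij_betw h J I"
  shows "bas V J (b \<circ> h) (c \<circ> h)"
  using assms bij_betw_finite[of h J I] bij_betw_apply[OF assms(2)] bij_betw_imp_surj_on[OF assms(2)]
    bij_betw_imp_inj_on[OF assms(2)]
  unfolding bas_def by (auto simp: inj_on_def image_iff)

lemma bas_fdvs:
  assumes V: "bas V I b c"
  shows "fdvs V"
proof -
  note B = basD[OF V]
  interpret vectorspace class_ring V by (rule B(2))
  have sub: "b ` I \<subseteq> carrier V" using B by auto
  have sm: "submodule class_ring (span (b ` I)) V" by (rule span_is_submodule[OF sub])
  have "x \<in> span (b ` I)" if "x \<in> carrier V" for x
    using V that
  proof (rule bas_induct)
    fix x r i assume "x \<in> carrier V" "x \<in> span (b ` I)" "i \<in> I"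
    moreover then have "b i \<in> span (b ` I)" using in_own_span[OF sub] by blast
    ultimately show "x \<oplus>\<^bsub>V\<^esub> r \<odot>\<^bsub>V\<^esub> b i \<in> span (b ` I)"
      using submodule.m_closed[OF sm] submodule.smult_closed[OF sm] by simp
  qed (rule submodule.zero_closed[OF sm])
  then have "span (b ` I) = carrier V"
    using submodule.subset[OF sm] by auto
  then show ?thesis
    unfolding fdvs_def fin_dim_def using B sub by blast
qed

lemma fdvs_vs [simp]: "fdvs V \<Longrightarrow> vs V"
  by (simp add: fdvs_def)

text \<open>Link to the library's notion of basis. The coefficients of a vector are made unique by
  taking them extensional on \<open>B\<close>, and uniqueness gives linearity of each coordinate.
  The index set is an initial segment so that coordinates can be put into a list.\<close>

lemma fdvs_bas:
  assumes "fdvs V"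
  shows "\<exists>d b c. bas V {..<d::nat} b c"
proof -
  interpret vectorspace class_ring V using assms by simp
  obtain B where B: "finite B" "basis B"
    using assms finite_basis_exists unfolding fdvs_def by blast
  have Bc: "B \<subseteq> carrier V" using B by (simp add: basis_def)
  have uniq: "\<exists>!a. a \<in> B \<rightarrow>\<^sub>E UNIV \<and> lincomb a B = x" if "x \<in> carrier V" for x
    using basis_criterion[OF B(1) Bc] B(2) that by simp
  define co where "co x = (THE a. a \<in> B \<rightarrow>\<^sub>E UNIV \<and> lincomb a B = x)" for x
  have co: "co x \<in> B \<rightarrow>\<^sub>E UNIV" "lincomb (co x) B = x" if "x \<in> carrier V" for x
    using theI'[OF uniq[OF that]] by (auto simp: co_def)
  have coI: "co x i = a i" if "i \<in> B" "x \<in> carrier V" "lincomb a B = x" for a x i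
  proof -
    have "lincomb (restrict a B) B = x"
      using that(3) Bc by (auto cong: lincomb_cong)
    then have "co x = restrict a B"
      using uniq[OF that(2)] co[OF that(2)] by auto
    then show ?thesis using that by simp
  qed
  have add: "co (x \<oplus>\<^bsub>V\<^esub> y) i = co x i + co y i" if "x \<in> carrier V" "y \<in> carrier V" "i \<in> B" for x y i
  proof (rule coI)
    have "lincomb (\<lambda>v. co x v \<oplus>\<^bsub>class_ring\<^esub> co y v) B = lincomb (co x) B \<oplus>\<^bsub>V\<^esub> lincomb (co y) B"
      by (rule lincomb_sum[OF B(1) Bc]) auto
    then show "lincomb (\<lambda>i. co x i + co y i) B = x \<oplus>\<^bsub>V\<^esub> y" using co that by simp
  qed (use that in auto)
  have smult: "co (r \<odot>\<^bsub>V\<^esub> x) i = r * co x i" if "x \<in> carrier V" "i \<in> B" for r x i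
  proof (rule coI)
    have "lincomb (\<lambda>v. r \<otimes>\<^bsub>class_ring\<^esub> co x v) B = r \<odot>\<^bsub>V\<^esub> lincomb (co x) B"
      by (rule lincomb_smult[OF Bc]) auto
    then show "lincomb (\<lambda>i. r * co x i) B = r \<odot>\<^bsub>V\<^esub> x" using co that by simp
  qed (use that in auto)
  have "co j i = (if i = j then 1 else 0)" if "i \<in> B" "j \<in> B" for i j
  proof (rule coI[OF that(1)])
    show j: "j \<in> carrier V" using Bc that by auto
    have "lincomb (\<lambda>i. if i = j then 1 else 0) B
       = ((if j = j then 1 else 0) \<odot>\<^bsub>V\<^esub> j) \<oplus>\<^bsub>V\<^esub> lincomb (\<lambda>i. if i = j then 1 else 0) (B - {j})"
      by (rule lincomb_del2[OF B(1) Bc]) (use that in auto)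
    also have "lincomb (\<lambda>i. if i = j then 1 else 0) (B - {j}) = \<zero>\<^bsub>V\<^esub>"
      unfolding lincomb_def by (rule M.add.finprod_one_eqI) (use Bc smult_l_null in \<open>auto\<close>)
    finally show "lincomb (\<lambda>i. if i = j then 1 else 0) B = j" using j smult_one[OF j] by simp
  qed
  moreover have "x = \<zero>\<^bsub>V\<^esub>" if "x \<in> carrier V" "\<forall>i\<in>B. co x i = 0" for x
  proof -
    have "lincomb (co x) B = \<zero>\<^bsub>V\<^esub>"
      unfolding lincomb_def by (rule M.add.finprod_one_eqI) (use that Bc smult_l_null in \<open>auto\<close>)
    then show ?thesis using co that by simp
  qed
  ultimately have "bas V B (\<lambda>i. i) (\<lambda>i x. co x i)"
    using B Bc add smult vectorspace_axioms by (auto simp: bas_def intro!: lhomI)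
  moreover obtain h where "bij_betw h {..<card B} B"
    using ex_bij_betw_nat_finite[OF B(1)] by (auto simp: atLeast0LessThan)
  ultimately show ?thesis using bas_reindex by blast
qed

text \<open>Gaussian elimination on a finite separating family. A functional that vanishes on
  \<open>V\<close> is dropped. Otherwise it is normalized at some \<open>b0\<close>, the space is
  split into the kernel \<open>K\<close> and the line through \<open>b0\<close>, and a basis of
  \<open>K\<close> is extended by \<open>b0\<close>. Subspaces and Hom spaces are shown to be
  finite-dimensional by exhibiting such a family.\<close>

lemma sep_bas:
  assumes "finite J" "vs V" "\<And>j. j \<in> J \<Longrightarrow> s j \<in> lhom V scalars"
    "\<And>x. x \<in> carrier V \<Longrightarrow> (\<And>j. j \<in> J \<Longrightarrow> s j x = 0) \<Longrightarrow> x = \<zero>\<^bsub>V\<^esub>"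
  shows "\<exists>d b c. bas V {..<d::nat} b c"
  using assms
proof (induction J arbitrary: V)
  case empty
  then have "bas V {..<0::nat} undefined undefined" by (auto simp: bas_def)
  then show ?case by blast
next
  case (insert j J)
  show ?case
  proof (cases "\<forall>x\<in>carrier V. s j x = 0")
    case True
    show ?thesis
      by (rule insert.IH) (use insert.prems True in \<open>auto, metis\<close>)
  next
    case False
    note j = insert.prems(2)[of j, simplified]
    note V = insert.prems(1)
    obtain x0 where x0: "x0 \<in> carrier V" "s j x0 \<noteq> 0" using False by auto
    define b0 where "b0 = inverse (s j x0) \<odot>\<^bsub>V\<^esub> x0"
    have b0: "b0 \<in> carrier V" "s j b0 = 1"
      using x0 V by (auto simp: b0_def lhom_simps[OF j])
    define K where "K = {x \<in> carrier V. s j x = 0}"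
    let ?V = "V\<lparr>carrier := K\<rparr>"
    have sz: "s j \<zero>\<^bsub>V\<^esub> = 0" using lhom_zero[OF j V] by simp
    have vK: "vs ?V"
      by (rule vs_sub[OF V]) (use V sz in \<open>auto simp: K_def lhom_simps[OF j]\<close>)
    have "\<exists>d b c. bas ?V {..<d::nat} b c"
    proof (rule insert.IH[OF vK])
      show "s i \<in> lhom ?V scalars" if "i \<in> J" for i
        using insert.prems(2)[of i] that by (auto simp: LinearCombinations.module_hom_def K_def)
      show "x = \<zero>\<^bsub>?V\<^esub>" if "x \<in> carrier ?V" "\<And>i. i \<in> J \<Longrightarrow> s i x = 0" for x
        using insert.prems(3)[of x] that by (auto simp: K_def)
    qed
    then obtain d b c where B: "bas ?V {..<d::nat} b c" by blast
    note B = basD[OF B]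
    \<comment> \<open>The projection onto the kernel along \<open>b0\<close>. Composing with it
      extends the coordinates of \<open>K\<close> to \<open>V\<close> in such a way that they vanish
      at \<open>b0\<close>.\<close>
    define q where "q x = x \<oplus>\<^bsub>V\<^esub> (- s j x) \<odot>\<^bsub>V\<^esub> b0" for x
    have q: "q \<in> lhom V ?V"
      by (rule lhomI) (use V b0 in \<open>simp_all add: q_def K_def lhom_simps[OF j] vs_distl vs_diffl vs_distr vs_smult_smult vs_ac\<close>)
    have qK: "q x = x" if "x \<in> K" for x using that V b0 by (simp add: q_def K_def)
    have qb: "q b0 = \<zero>\<^bsub>V\<^esub>" using b0 V by (simp add: q_def vs_cancel)
    have bK: "b i \<in> K" if "i < d" for i using B(3) that by simp
    have cz: "c i \<zero>\<^bsub>V\<^esub> = 0" if "i < d" for i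
      using lhom_zero[OF B(4) vK] that by simp
    have "bas V {..<Suc d} (\<lambda>i. if i < d then b i else b0) (\<lambda>i. if i < d then \<lambda>x. c i (q x) else s j)"
      unfolding bas_def
    proof (intro conjI ballI impI V)
      show "(if i < d then b i else b0) \<in> carrier V" for i using bK[of i] b0 by (auto simp: K_def)
      show "(if i < d then \<lambda>x. c i (q x) else s j) \<in> lhom V scalars" for i
        using lhom_compose[OF q B(4)] j by auto
      show "(if i < d then \<lambda>x. c i (q x) else s j) (if i' < d then b i' else b0) = (if i = i' then 1 else 0)"
        if "i \<in> {..<Suc d}" "i' \<in> {..<Suc d}" for i i'
        using that B(5)[of i i'] qK[OF bK] qb cz b0 bK by (auto simp: K_def less_Suc_eq)
      show "x = \<zero>\<^bsub>V\<^esub>" if x: "x \<in> carrier V"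
        "\<forall>i\<in>{..<Suc d}. (if i < d then \<lambda>x. c i (q x) else s j) x = 0" for x
      proof -
        have sx: "s j x = 0" using bspec[OF x(2), of d] by simp
        then have xK: "x \<in> K" using x by (simp add: K_def)
        have "c i x = 0" if "i < d" for i using bspec[OF x(2), of i] that qK[OF xK] by simp
        then show ?thesis using B(6)[of x] xK by simp
      qed
    qed auto
    then show ?thesis by blast
  qed
qed

lemma fdvs_sep:
  assumes "finite J" "vs V" "\<And>j. j \<in> J \<Longrightarrow> s j \<in> lhom V scalars"
    "\<And>x. x \<in> carrier V \<Longrightarrow> (\<And>j. j \<in> J \<Longrightarrow> s j x = 0) \<Longrightarrow> x = \<zero>\<^bsub>V\<^esub>"
  shows "fdvs V"
  using sep_bas[of J V s] assms bas_fdvs by blast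

lemma fdvs_inj:
  assumes "fdvs W" "vs V" "f \<in> lhom V W" "inj_on f (carrier V)"
  shows "fdvs V"
proof -
  obtain d b c where "bas W {..<d::nat} b c" using fdvs_bas[OF assms(1)] by blast
  note B = basD[OF this]
  show ?thesis
  proof (rule fdvs_sep[of "{..<d}" V "\<lambda>i x. c i (f x)"])
    show "(\<lambda>x. c i (f x)) \<in> lhom V scalars" if "i \<in> {..<d}" for i
      using lhom_compose[OF assms(3) B(4)] that by simp
    show "x = \<zero>\<^bsub>V\<^esub>" if "x \<in> carrier V" "\<And>j. j \<in> {..<d} \<Longrightarrow> c j (f x) = 0" for x
    proof -
      have "f x = \<zero>\<^bsub>W\<^esub>" by (rule B(6)) (use that in \<open>auto simp: lhom_simps[OF assms(3)]\<close>)
      then show ?thesis using lhom_inj_iff[OF assms(3,2)] assms that by simp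
    qed
  qed (use assms in auto)
qed

lemma fdvs_sub:
  assumes "fdvs V" "S \<subseteq> carrier V" "\<zero>\<^bsub>V\<^esub> \<in> S"
    and "\<And>x y. x \<in> S \<Longrightarrow> y \<in> S \<Longrightarrow> x \<oplus>\<^bsub>V\<^esub> y \<in> S" "\<And>r x. x \<in> S \<Longrightarrow> r \<odot>\<^bsub>V\<^esub> x \<in> S"
  shows "fdvs (V\<lparr>carrier := S\<rparr>)"
  by (rule fdvs_inj[OF assms(1), of _ "\<lambda>x. x"])
    (use assms in \<open>auto intro!: vs_sub lhomI inj_onI\<close>)

lemma fdvs_surj:
  assumes "fdvs V" "vs W" "f \<in> lhom V W" "f ` carrier V = carrier W"
  shows "fdvs W"
proof -
  interpret linear_map class_ring V W f
    using assms by (auto simp: linear_map_def mod_hom_def mod_hom_axioms_def vs_module)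
  show ?thesis
    using rank_nullity_main(2) assms by (simp add: fdvs_def)
qed

lemma fdvs_scalars [simp]: "fdvs (scalars :: ('k::field, 'k) module)"
  by (rule fdvs_sep[of "{()}" _ "\<lambda>_ x. x"]) (auto intro: lhom_id)

lemma lhom_eval: "vs V \<Longrightarrow> x \<in> carrier V \<Longrightarrow> (\<lambda>f. f x) \<in> lhom (Lin V W) W"
  by (rule lhomI) (auto simp: lin_closed)

text \<open>The matrix entries of a linear map form a finite separating family of
  functionals.\<close>

lemma fdvs_Lin [simp]:
  assumes "fdvs V" "fdvs W"
  shows "fdvs (Lin V W)"
proof -
  obtain d b c where V: "bas V {..<d::nat} b c" using fdvs_bas[OF assms(1)] by blast
  obtain d' b' c' where "bas W {..<d'::nat} b' c'" using fdvs_bas[OF assms(2)] by blast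
  note B = basD[OF V] and B' = basD[OF this]
  show ?thesis
  proof (rule fdvs_sep[of "{..<d} \<times> {..<d'}" _ "\<lambda>(i, j) f. c' j (f (b i))"])
    show "(case ij of (i, j) \<Rightarrow> \<lambda>f. c' j (f (b i))) \<in> lhom (Lin V W) scalars" if "ij \<in> {..<d} \<times> {..<d'}" for ij
      using that lhom_compose[OF lhom_eval[OF B(2,3)] B'(4)] by auto
    show "f = \<zero>\<^bsub>Lin V W\<^esub>" if f: "f \<in> carrier (Lin V W)"
      "\<And>ij. ij \<in> {..<d} \<times> {..<d'} \<Longrightarrow> (case ij of (i, j) \<Rightarrow> \<lambda>f. c' j (f (b i))) f = 0" for f
    proof -
      have "f (b i) = \<zero>\<^bsub>W\<^esub>" if "i < d" for i
        by (rule B'(6)) (use f(1) f(2)[of "(i, _)"] that B(3) in \<open>auto simp: lin_closed\<close>)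
      moreover have "(\<lambda>x. \<zero>\<^bsub>W\<^esub>) \<in> lhom V W" using assms by (intro lhomI) simp_all
      ultimately have "f x = \<zero>\<^bsub>W\<^esub>" if "x \<in> carrier V" for x
        using bas_ext[OF V lin_lhom[of f V W], of "\<lambda>x. \<zero>\<^bsub>W\<^esub>" x] f(1) that assms by simp
      then show ?thesis using f by (auto intro!: extensionalityI[OF lin_ext])
    qed
  qed (use assms in auto)
qed

section \<open>Copies in the universe and duals\<close>

lemma is_copyD:
  assumes "is_copy X Y e"
  shows "fdvs Y" "e \<in> lin X Y" "bij_betw e (carrier X) (carrier Y)"
  using assms by (auto simp: is_copy_def)

text \<open>Transport of structure: the operations on the image are pulled back along
  \<open>g\<close>, the inverse of \<open>e\<close>.\<close>

lemma copy_transport: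
  fixes X :: "('k::field, 'a) module" and e :: "'a \<Rightarrow> 'b"
  assumes X: "fdvs X" and inj: "inj_on e (carrier X)"
  shows "\<exists>Y. is_copy X Y (restrict e (carrier X))"
proof -
  define g where "g = inv_into (carrier X) e"
  have ge [simp]: "g (e x) = x" if "x \<in> carrier X" for x
    using inj that by (simp add: g_def)
  define Y :: "('k, 'b) module" where "Y = \<lparr> carrier = e ` carrier X, mult = undefined, one = undefined, zero = e \<zero>\<^bsub>X\<^esub>,
    add = (\<lambda>u v. e (g u \<oplus>\<^bsub>X\<^esub> g v)), smult = (\<lambda>r u. e (r \<odot>\<^bsub>X\<^esub> g u)) \<rparr>"
  have Y [simp]: "carrier Y = e ` carrier X" "\<zero>\<^bsub>Y\<^esub> = e \<zero>\<^bsub>X\<^esub>" "u \<oplus>\<^bsub>Y\<^esub> v = e (g u \<oplus>\<^bsub>X\<^esub> g v)"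
    "r \<odot>\<^bsub>Y\<^esub> u = e (r \<odot>\<^bsub>X\<^esub> g u)" for u v r
    by (simp_all add: Y_def)
  note vX = fdvs_vs[OF X]
  have vY: "vs Y"
    by (rule vsI) (use vX in \<open>auto simp: vs_ac vs_distl vs_distr vs_smult_smult\<close>)
  have e: "e \<in> lhom X Y" by (rule lhomI) (use vX in auto)
  have "fdvs Y" by (rule fdvs_surj[OF X vY e]) simp
  moreover have "bij_betw (restrict e (carrier X)) (carrier X) (carrier Y)"
    using inj by (simp add: bij_betw_def)
  ultimately show ?thesis
    using lin_restrict[OF e vX] by (auto simp: is_copy_def)
qed

locale univ =
  fixes \<iota> :: "'k::field list \<Rightarrow> 'u"
  assumes inj_iota: "inj \<iota>"
begin

text \<open>A vector is coded by the list of its coordinates. This is where the size of the universe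
  enters.\<close>

lemma copy_exists:
  fixes X :: "('k, 'a) module"
  assumes X: "fdvs X"
  shows "\<exists>(Y :: ('k, 'u) module) e. is_copy X Y e"
proof -
  obtain d b c where "bas X {..<d::nat} b c" using fdvs_bas[OF X] by blast
  note B = basD[OF this]
  define e where "e x = \<iota> (map (\<lambda>i. c i x) [0..<d])" for x
  have "inj_on e (carrier X)"
  proof (rule inj_onI)
    fix x y assume xy: "x \<in> carrier X" "y \<in> carrier X" "e x = e y"
    then have eq: "c i x = c i y" if "i < d" for i
      using inj_iota that by (auto simp: e_def inj_eq)
    have "x \<oplus>\<^bsub>X\<^esub> (-1) \<odot>\<^bsub>X\<^esub> y = \<zero>\<^bsub>X\<^esub>"
      by (rule B(6)) (use xy B(2) eq in \<open>simp_all add: lhom_simps[OF B(4)]\<close>)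
    then show "x = y" using vs_eq_iff[OF B(2) xy(1,2)] by simp
  qed
  from copy_transport[OF X this] show ?thesis by blast
qed

lemma small_is_copy:
  fixes X :: "('k, 'a) module"
  assumes "fdvs X"
  shows "is_copy X (small X :: ('k, 'u) module) (enc X)"
proof -
  have "\<exists>p. case p of (Y :: ('k, 'u) module, e) \<Rightarrow> is_copy X Y e"
    using copy_exists[OF assms] by auto
  from someI_ex[OF this] show ?thesis
    by (simp add: small_def enc_def small_copy_def case_prod_unfold)
qed

context
  fixes X :: "('k, 'a) module"
  assumes X: "fdvs X"
begin

lemma fdvs_small [simp]: "fdvs (small X :: ('k, 'u) module)"
  and enc_lin: "(enc X :: 'a \<Rightarrow> 'u) \<in> lin X (small X)"
  and enc_bij: "bij_betw (enc X :: 'a \<Rightarrow> 'u) (carrier X) (carrier (small X))"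
  using is_copyD[OF small_is_copy[OF X]] by auto

lemma enc_lhom: "(enc X :: 'a \<Rightarrow> 'u) \<in> lhom X (small X)"
  using enc_lin by (rule lin_lhom)

lemma dec_lhom: "(dec X :: 'u \<Rightarrow> 'a) \<in> lhom (small X) X"
  unfolding dec_def by (rule lhom_inv[OF enc_lhom enc_bij]) (simp add: X)

lemma enc_closed [simp]: "x \<in> carrier X \<Longrightarrow> (enc X x :: 'u) \<in> carrier (small X)"
  by (rule lhom_closed[OF enc_lhom])

lemma dec_closed [simp]: "(u :: 'u) \<in> carrier (small X) \<Longrightarrow> dec X u \<in> carrier X"
  by (rule lhom_closed[OF dec_lhom])

lemma dec_enc [simp]: "x \<in> carrier X \<Longrightarrow> dec X (enc X x :: 'u) = x"
  using enc_bij by (auto simp: dec_def bij_betw_def)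

lemma enc_dec [simp]: "(u :: 'u) \<in> carrier (small X) \<Longrightarrow> enc X (dec X u) = u"
  using enc_bij by (auto simp: dec_def bij_betw_def f_inv_into_f)

lemma dec_bij: "bij_betw (dec X :: 'u \<Rightarrow> 'a) (carrier (small X)) (carrier X)"
  by (rule bij_betw_byWitness[of _ "enc X"]) auto

lemma small_map_apply:
  "(u :: 'u) \<in> carrier (small X) \<Longrightarrow> small_map X Y f u = enc Y (f (dec X u))"
  by (simp add: small_map_def)

end

lemma small_map_lin:
  fixes X :: "('k, 'a) module" and Y :: "('k, 'b) module"
  assumes "fdvs X" "fdvs Y" "f \<in> lhom X Y"
  shows "(small_map X Y f :: 'u \<Rightarrow> 'u) \<in> lin (small X) (small Y)"
  unfolding small_map_def
  by (rule lin_restrict[OF lhom_compose[OF lhom_compose[OF dec_lhom assms(3)] enc_lhom]])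
    (simp_all add: assms)

section \<open>Dual spaces and the evaluation pairing\<close>

lemma dual_space_carrier [simp]: "carrier (dual_space V) = lin V scalars"
  by (simp add: dual_space_def)

lemma fdvs_dual_space [simp]: "fdvs V \<Longrightarrow> fdvs (dual_space V)"
  by (simp add: dual_space_def)

lemma vs_dual_space [simp]: "vs V \<Longrightarrow> vs (dual_space V)"
  by (simp add: dual_space_def)

lemma dual_space_simps [simp]:
  "\<zero>\<^bsub>dual_space V\<^esub> = (\<lambda>x\<in>carrier V. 0)"
  "f \<oplus>\<^bsub>dual_space V\<^esub> g = (\<lambda>x\<in>carrier V. f x + g x)"
  "c \<odot>\<^bsub>dual_space V\<^esub> f = (\<lambda>x\<in>carrier V. c * f x)"
  by (simp_all add: dual_space_def)

lemma functional_ext: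
  assumes "fdvs V" "x \<in> carrier V" "y \<in> carrier V" "\<And>f. f \<in> lin V scalars \<Longrightarrow> f x = f y"
  shows "x = y"
proof -
  obtain d b c where "bas V {..<d::nat} b c" using fdvs_bas[OF assms(1)] by blast
  note B = basD[OF this]
  have "c i x = c i y" if "i < d" for i
    using assms(4)[OF lin_restrict[OF B(4) B(2)]] that assms by simp
  then have "x \<oplus>\<^bsub>V\<^esub> (-1) \<odot>\<^bsub>V\<^esub> y = \<zero>\<^bsub>V\<^esub>"
    by (intro B(6)) (use assms B(2) in \<open>simp_all add: lhom_simps[OF B(4)]\<close>)
  then show ?thesis using vs_eq_iff[of V x y] assms by simp
qed

text \<open>Take for \<open>x\<close> the vector whose coordinates are the values of
  \<open>m\<close> on the dual basis. Then \<open>m\<close> and evaluation at \<open>x\<close> agree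
  on a basis of the dual space.\<close>

lemma double_dual_surj:
  assumes V: "fdvs V" and m: "m \<in> lhom (dual_space V) scalars"
  shows "\<exists>x\<in>carrier V. \<forall>f\<in>lin V scalars. m f = f x"
proof -
  obtain d b c where V: "bas V {..<d::nat} b c" using fdvs_bas[OF V] by blast
  note B = basD[OF V]
  let ?c = "\<lambda>i. restrict (c i) (carrier V)"
  have cl: "?c i \<in> lin V scalars" if "i < d" for i
    using lin_restrict[OF B(4) B(2)] that by simp
  have ev: "(\<lambda>f. f x) \<in> lhom (dual_space V) scalars" if "x \<in> carrier V" for x
    unfolding dual_space_def by (rule lhom_eval[OF B(2) that])
  have D: "bas (dual_space V) {..<d} ?c (\<lambda>i f. f (b i))"
    unfolding bas_def
  proof (intro conjI ballI impI)
    show "f = \<zero>\<^bsub>dual_space V\<^esub>" if "f \<in> carrier (dual_space V)" "\<forall>i\<in>{..<d}. f (b i) = 0" for f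
    proof -
      have "f x = 0" if "x \<in> carrier V" for x
        using bas_ext[OF V, of f scalars "\<lambda>x. 0" x] lhom_const_zero[of scalars V] \<open>f \<in> _\<close> that \<open>\<forall>i\<in>_. _\<close>
        by (simp add: lin_lhom)
      then show ?thesis using that by (auto intro!: extensionalityI[OF lin_ext])
    qed
  qed (use B cl ev in \<open>auto\<close>)
  obtain x where x: "x \<in> carrier V" "\<forall>i\<in>{..<d}. c i x = m (?c i)"
    using bas_vec[OF V, of "\<lambda>i. m (?c i)"] by blast
  have "m f = f x" if "f \<in> lin V scalars" for f
    using bas_ext[OF D m ev[OF x(1)]] that x by simp
  then show ?thesis using x by blast
qed

text \<open>Elements of \<open>vdual V\<close> are codes in the universe. \<open>app\<close>
  evaluates such a code and \<open>mkd\<close> codes a functional. Through \<open>app_ext\<close>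
  and \<open>app_separates\<close>, later identities in duals are tested by evaluation instead of by
  unfolding \<open>enc\<close> and \<open>dec\<close>.\<close>

definition app :: "('k, 'u) module \<Rightarrow> 'u \<Rightarrow> 'u \<Rightarrow> 'k" where
  "app V \<xi> = dec (dual_space V) \<xi>"

definition mkd :: "('k, 'u) module \<Rightarrow> ('u \<Rightarrow> 'k) \<Rightarrow> 'u" where
  "mkd V f = enc (dual_space V) (\<lambda>x\<in>carrier V. f x)"

context
  fixes V :: "('k, 'u) module"
  assumes V: "fdvs V"
begin

lemma fdvs_vdual [simp]: "fdvs (vdual V)"
  by (simp add: vdual_def V)

lemma app_lin: "\<xi> \<in> carrier (vdual V) \<Longrightarrow> app V \<xi> \<in> lin V scalars"
  using dec_closed[of "dual_space V" \<xi>] V by (simp add: app_def vdual_def)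

lemma app_lhom: "\<xi> \<in> carrier (vdual V) \<Longrightarrow> app V \<xi> \<in> lhom V scalars"
  by (rule lin_lhom[OF app_lin])

lemma app_lhom_left: "x \<in> carrier V \<Longrightarrow> (\<lambda>\<xi>. app V \<xi> x) \<in> lhom (vdual V) scalars"
  using lhom_compose[OF dec_lhom[of "dual_space V"] lhom_eval[of V x scalars, folded dual_space_def]] V
  by (simp add: app_def vdual_def)

lemma mkd_closed [simp]: "f \<in> lhom V scalars \<Longrightarrow> mkd V f \<in> carrier (vdual V)"
  by (simp add: mkd_def vdual_def V lin_restrict)

lemma app_mkd [simp]: "f \<in> lhom V scalars \<Longrightarrow> x \<in> carrier V \<Longrightarrow> app V (mkd V f) x = f x"
  by (simp add: mkd_def app_def V lin_restrict)

lemma app_ext: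
  assumes "\<xi> \<in> carrier (vdual V)" "\<zeta> \<in> carrier (vdual V)"
    and "\<And>x. x \<in> carrier V \<Longrightarrow> app V \<xi> x = app V \<zeta> x"
  shows "\<xi> = \<zeta>"
proof -
  have "dec (dual_space V) \<xi> = dec (dual_space V) \<zeta>"
    using lin_eqI[OF app_lin app_lin] assms by (simp add: app_def)
  then show ?thesis
    using assms(1,2) enc_dec[of "dual_space V"] V by (metis fdvs_dual_space vdual_def)
qed

lemma app_separates:
  assumes "x \<in> carrier V" "y \<in> carrier V" "\<And>\<xi>. \<xi> \<in> carrier (vdual V) \<Longrightarrow> app V \<xi> x = app V \<xi> y"
  shows "x = y"
proof (rule functional_ext[OF V assms(1,2)])
  fix f assume "f \<in> lin V scalars"
  then show "f x = f y" using assms(3)[of "mkd V f"] assms(1,2) by (simp add: lin_lhom)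
qed

text \<open>Reflexivity of finite-dimensional spaces, carried over from
  \<open>double_dual_surj\<close> through the coding of the dual.\<close>

lemma app_surj:
  assumes m: "m \<in> lhom (vdual V) scalars"
  shows "\<exists>x\<in>carrier V. \<forall>\<xi>\<in>carrier (vdual V). m \<xi> = app V \<xi> x"
proof -
  have "(\<lambda>f. m (enc (dual_space V) f)) \<in> lhom (dual_space V) scalars"
    using lhom_compose[OF enc_lhom[of "dual_space V"] m[unfolded vdual_def]] V by simp
  from double_dual_surj[OF V this] obtain x where x: "x \<in> carrier V"
    "\<And>f. f\<in>lin V scalars \<Longrightarrow> m (enc (dual_space V) f) = f x" by blast
  have "m \<xi> = app V \<xi> x" if "\<xi> \<in> carrier (vdual V)" for \<xi>
    using x(2)[OF app_lin[OF that]] that V by (simp add: app_def vdual_def)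
  then show ?thesis using x by blast
qed

end

lemma vdual_map_lin:
  fixes V W :: "('k, 'u) module"
  assumes "fdvs V" "fdvs W" "f \<in> lin V W"
  shows "vdual_map V W f \<in> lin (vdual W) (vdual V)"
  unfolding vdual_map_def vdual_def
proof (rule small_map_lin)
  show "(\<lambda>\<xi>. compose (carrier V) \<xi> f) \<in> lhom (dual_space W) (dual_space V)"
    by (rule lhomI) (use assms in \<open>auto simp: compose_def lin_simps[OF assms(3)]
      intro!: restrict_ext lin_compose[OF assms(3), unfolded compose_def] lin_lhom\<close>)
qed (use assms in auto)

lemma app_vdual_map [simp]:
  fixes V W :: "('k, 'u) module"
  assumes "fdvs V" "fdvs W" "f \<in> lin V W" "\<xi> \<in> carrier (vdual W)" "x \<in> carrier V"
  shows "app V (vdual_map V W f \<xi>) x = app W \<xi> (f x)"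
proof -
  have "compose (carrier V) (dec (dual_space W) \<xi>) f \<in> lin V scalars"
    using lin_compose[OF assms(3) app_lhom[OF assms(2,4)]] assms by (simp add: app_def)
  then show ?thesis
    using assms by (simp add: app_def vdual_map_def small_map_apply vdual_def compose_def)
qed

lemmas vdual_map_closed = lin_closed[OF vdual_map_lin]

definition evd :: "('k, 'u) module \<Rightarrow> 'u \<Rightarrow> 'u" where
  "evd V = (\<lambda>x\<in>carrier V. mkd (vdual V) (\<lambda>\<xi>. app V \<xi> x))"

lemma evd_closed: "fdvs V \<Longrightarrow> x \<in> carrier V \<Longrightarrow> evd V x \<in> carrier (vdual (vdual V))"
  by (simp add: evd_def app_lhom_left)

lemma app_evd [simp]:
  "fdvs V \<Longrightarrow> x \<in> carrier V \<Longrightarrow> \<xi> \<in> carrier (vdual V) \<Longrightarrow> app (vdual V) (evd V x) \<xi> = app V \<xi> x"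
  by (simp add: evd_def app_lhom_left)

lemma evd_lin:
  assumes V: "fdvs V"
  shows "evd V \<in> lin V (vdual (vdual V))"
proof (rule linI)
  note vv = fdvs_vs[OF fdvs_vdual[OF fdvs_vdual[OF V]]]
  show "evd V \<in> lhom V (vdual (vdual V))"
  proof (rule lhomI)
    fix x y :: 'u and r assume x: "x \<in> carrier V"
    show "evd V x \<in> carrier (vdual (vdual V))" using V x by (rule evd_closed)
    show "evd V (r \<odot>\<^bsub>V\<^esub> x) = r \<odot>\<^bsub>vdual (vdual V)\<^esub> evd V x"
      by (rule app_ext[of "vdual V"]) (use V x vv in \<open>simp_all add: evd_closed
        lhom_simps[OF app_lhom_left[OF fdvs_vdual]] lhom_simps[OF app_lhom]\<close>)
    assume y: "y \<in> carrier V"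
    show "evd V (x \<oplus>\<^bsub>V\<^esub> y) = evd V x \<oplus>\<^bsub>vdual (vdual V)\<^esub> evd V y"
      by (rule app_ext[of "vdual V"]) (use V x y vv in \<open>simp_all add: evd_closed
        lhom_simps[OF app_lhom_left[OF fdvs_vdual]] lhom_simps[OF app_lhom]\<close>)
  qed
qed (simp add: evd_def)

lemma evd_bij:
  assumes V: "fdvs V"
  shows "bij_betw (evd V) (carrier V) (carrier (vdual (vdual V)))"
proof (rule bij_betw_imageI)
  show "inj_on (evd V) (carrier V)"
  proof (rule inj_onI)
    fix x y assume xy: "x \<in> carrier V" "y \<in> carrier V" "evd V x = evd V y"
    show "x = y"
      by (rule app_separates[OF V xy(1,2)]) (use app_evd[OF V xy(1)] app_evd[OF V xy(2)] xy(3) in simp)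
  qed
  show "evd V ` carrier V = carrier (vdual (vdual V))"
  proof safe
    fix m assume m: "m \<in> carrier (vdual (vdual V))"
    from app_surj[OF V app_lhom[OF fdvs_vdual[OF V] m]] obtain x
      where x: "x \<in> carrier V" "\<forall>\<xi>\<in>carrier (vdual V). app (vdual V) m \<xi> = app V \<xi> x" by blast
    have "m = evd V x"
      by (rule app_ext[of "vdual V"]) (use V m x in \<open>auto simp: evd_closed\<close>)
    then show "m \<in> evd V ` carrier V" using x by blast
  qed (use evd_closed V in auto)
qed

lemma evd_natural:
  assumes "fdvs V" "fdvs W" "f \<in> lin V W" "x \<in> carrier V"
  shows "vdual_map (vdual W) (vdual V) (vdual_map V W f) (evd V x) = evd W (f x)"
  by (rule app_ext[of "vdual W"])
    (use assms in \<open>simp_all add: evd_closed vdual_map_closed vdual_map_lin lin_closed[of f V W]\<close>)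

lemma vdual_map_compose:
  fixes U V W :: "('k, 'u) module"
  assumes "fdvs U" "fdvs V" "fdvs W" "f \<in> lin U V" "g \<in> lin V W" "\<xi> \<in> carrier (vdual W)"
  shows "vdual_map U W (compose (carrier U) g f) \<xi> = vdual_map U V f (vdual_map V W g \<xi>)"
  by (rule app_ext[of U])
    (use assms in \<open>simp_all add: vdual_map_closed lin_compose[OF _ lin_lhom] compose_eq lin_closed[of f U V]\<close>)

lemma vdual_map_id:
  fixes V :: "('k, 'u) module"
  assumes "fdvs V" "\<xi> \<in> carrier (vdual V)"
  shows "vdual_map V V (\<lambda>x\<in>carrier V. x) \<xi> = \<xi>"
  by (rule app_ext[of V]) (use assms in \<open>simp_all add: vdual_map_closed lin_id\<close>)

text \<open>Serves two purposes below: dual functors act linearly on morphisms, and tensoring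
  transposes together, as \<open>Gam_dual\<close> does, is multilinear.\<close>

lemma vdual_map_lhom:
  fixes V W :: "('k, 'u) module"
  assumes "fdvs V" "fdvs W"
  shows "(\<lambda>f. vdual_map V W f) \<in> lhom (Lin V W) (Lin (vdual W) (vdual V))"
proof -
  have v: "vs (vdual V)" "vs (vdual W)" "vs (Lin V W)" using assms by simp_all
  show ?thesis
  proof (rule lhomI)
    fix f g r assume f: "f \<in> carrier (Lin V W)"
    show "vdual_map V W f \<in> carrier (Lin (vdual W) (vdual V))" using assms f by (simp add: vdual_map_lin)
    show "vdual_map V W (r \<odot>\<^bsub>Lin V W\<^esub> f) = r \<odot>\<^bsub>Lin (vdual W) (vdual V)\<^esub> vdual_map V W f"
    proof (rule lin_eqI[OF vdual_map_lin])
      show "vdual_map V W (r \<odot>\<^bsub>Lin V W\<^esub> f) \<xi> = (r \<odot>\<^bsub>Lin (vdual W) (vdual V)\<^esub> vdual_map V W f) \<xi>"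
        if "\<xi> \<in> carrier (vdual W)" for \<xi>
        by (rule app_ext[of V]) (use assms f v that vs_smult[OF v(3) f, of r] in \<open>simp_all add: vdual_map_closed
          lhom_simps[OF app_lhom_left] lhom_simps[OF app_lhom[of W]] lin_closed[of _ V W]\<close>)
    qed (use assms f v vs_smult[OF v(3) f, of r] vs_smult[OF vs_Lin[OF v(2,1)], of "vdual_map V W f" r]
        in \<open>simp_all add: vdual_map_lin\<close>)
    assume g: "g \<in> carrier (Lin V W)"
    show "vdual_map V W (f \<oplus>\<^bsub>Lin V W\<^esub> g) = vdual_map V W f \<oplus>\<^bsub>Lin (vdual W) (vdual V)\<^esub> vdual_map V W g"
    proof (rule lin_eqI[OF vdual_map_lin])
      show "vdual_map V W (f \<oplus>\<^bsub>Lin V W\<^esub> g) \<xi> =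
          (vdual_map V W f \<oplus>\<^bsub>Lin (vdual W) (vdual V)\<^esub> vdual_map V W g) \<xi>"
        if "\<xi> \<in> carrier (vdual W)" for \<xi>
        by (rule app_ext[of V]) (use assms f g v that vs_add[OF v(3) f g] in \<open>simp_all add: vdual_map_closed
          lhom_simps[OF app_lhom_left] lhom_simps[OF app_lhom[of W]] lin_closed[of _ V W]\<close>)
    qed (use assms f g v vs_add[OF v(3) f g] vs_add[OF vs_Lin[OF v(2,1)], of "vdual_map V W f" "vdual_map V W g"]
        in \<open>simp_all add: vdual_map_lin\<close>)
  qed
qed

lemma vdual_map_bij:
  fixes V W :: "('k, 'u) module"
  assumes V: "fdvs V" and W: "fdvs W" and f: "f \<in> lin V W" "bij_betw f (carrier V) (carrier W)"
  shows "bij_betw (vdual_map V W f) (carrier (vdual W)) (carrier (vdual V))"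
proof -
  let ?g = "restrict (inv_into (carrier V) f) (carrier W)"
  have g: "?g \<in> lin W V"
    by (rule lin_restrict[OF lhom_inv[OF lin_lhom[OF f(1)] f(2)]]) (use V W in auto)
  have fg: "f (?g y) = y" if "y \<in> carrier W" for y
    using that f(2) by (simp add: bij_betw_def f_inv_into_f)
  have gf: "?g (f x) = x" if "x \<in> carrier V" for x
    using that f by (simp add: bij_betw_def lin_closed)
  show ?thesis
  proof (rule bij_betw_byWitness[of _ "vdual_map W V ?g"])
    show "\<forall>\<xi>\<in>carrier (vdual W). vdual_map W V ?g (vdual_map V W f \<xi>) = \<xi>"
    proof
      fix \<xi> assume "\<xi> \<in> carrier (vdual W)"
      then show "vdual_map W V ?g (vdual_map V W f \<xi>) = \<xi>"
        by (intro app_ext[OF W]) (use V W f g fg in \<open>simp_all add: vdual_map_closed lin_closed[OF g] del: restrict_apply restrict_apply'\<close>)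
    qed
    show "\<forall>\<xi>\<in>carrier (vdual V). vdual_map V W f (vdual_map W V ?g \<xi>) = \<xi>"
    proof
      fix \<xi> assume "\<xi> \<in> carrier (vdual V)"
      then show "vdual_map V W f (vdual_map W V ?g \<xi>) = \<xi>"
        by (intro app_ext[OF V]) (use V W f g gf in \<open>simp_all add: vdual_map_closed lin_closed[OF f(1)] del: restrict_apply restrict_apply'\<close>)
    qed
  qed (use vdual_map_closed[OF V W f(1)] vdual_map_closed[OF W V g] in auto)
qed

end

section \<open>Tensor powers\<close>

lemma tuples_upd [simp]: "v \<in> tuples n V \<Longrightarrow> x \<in> carrier V \<Longrightarrow> i \<in> {1..n} \<Longrightarrow> v(i := x) \<in> tuples n V"
  by (auto simp: tuples_def PiE_iff extensional_def)

lemma tuples_mem: "v \<in> tuples n V \<Longrightarrow> i \<in> {1..n} \<Longrightarrow> v i \<in> carrier V"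
  by (auto simp: tuples_def)

lemma tuples_restrict: "(\<And>i. i \<in> {1..n} \<Longrightarrow> f i \<in> carrier V) \<Longrightarrow> (\<lambda>i\<in>{1..n}. f i) \<in> tuples n V"
  by (simp add: tuples_def)

lemma tuples_eqI: "v \<in> tuples n V \<Longrightarrow> w \<in> tuples n W \<Longrightarrow> (\<And>i. i \<in> {1..n} \<Longrightarrow> v i = w i) \<Longrightarrow> v = w"
  by (rule extensionalityI[of _ "{1..n}"]) (auto simp: tuples_def PiE_iff)

lemma multilinearI:
  assumes "\<And>v. v \<in> tuples n V \<Longrightarrow> m v \<in> carrier W"
    "\<And>v i. v \<in> tuples n V \<Longrightarrow> i \<in> {1..n} \<Longrightarrow> (\<lambda>x. m (v(i := x))) \<in> lhom V W"
  shows "multilinear n V W m"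
  using assms by (auto simp: multilinear_def)

lemma multilinear_closed: "multilinear n V W m \<Longrightarrow> v \<in> tuples n V \<Longrightarrow> m v \<in> carrier W"
  and multilinear_lhom: "multilinear n V W m \<Longrightarrow> v \<in> tuples n V \<Longrightarrow> i \<in> {1..n} \<Longrightarrow> (\<lambda>x. m (v(i := x))) \<in> lhom V W"
  by (auto simp: multilinear_def)

lemma multilinear_compose:
  assumes "multilinear n V W m" "f \<in> lhom W W'"
  shows "multilinear n V W' (\<lambda>v. f (m v))"
  by (rule multilinearI)
    (use assms in \<open>auto intro: lhom_closed[OF assms(2)] multilinear_closed lhom_compose[OF multilinear_lhom]\<close>)

lemma multilinear_map:
  assumes m: "multilinear n V W m" and f: "\<And>i. i \<in> {1..n} \<Longrightarrow> f i \<in> lhom U V" and U: "vs U"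
  shows "multilinear n U W (\<lambda>v. m (\<lambda>i\<in>{1..n}. f i (v i)))"
proof (rule multilinearI)
  fix v assume v: "v \<in> tuples n U"
  have t: "(\<lambda>i\<in>{1..n}. f i (v i)) \<in> tuples n V"
    using v f by (intro tuples_restrict) (auto simp: lhom_closed[OF f] tuples_mem)
  then show "m (\<lambda>i\<in>{1..n}. f i (v i)) \<in> carrier W" by (rule multilinear_closed[OF m])
  fix i assume i: "i \<in> {1..n}"
  have "(\<lambda>j\<in>{1..n}. f j ((v(i := x)) j)) = (\<lambda>i\<in>{1..n}. f i (v i))(i := f i x)" for x
    using i by auto
  then show "(\<lambda>x. m (\<lambda>j\<in>{1..n}. f j ((v(i := x)) j))) \<in> lhom U W"
    using lhom_compose[OF f[OF i] multilinear_lhom[OF m t i]] by simp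
qed

lemma tuples_perm:
  assumes "s permutes {1..n}" "v \<in> tuples n V"
  shows "v \<circ> s \<in> tuples n V"
  using assms permutes_in_image[OF assms(1)] permutes_not_in[OF assms(1)]
  by (auto simp: tuples_def PiE_iff extensional_def)

lemma multilinear_perm:
  assumes m: "multilinear n V W m" and s: "s permutes {1..n}"
  shows "multilinear n V W (\<lambda>v. m (v \<circ> s))"
proof (rule multilinearI)
  fix v assume v: "v \<in> tuples n V"
  then show "m (v \<circ> s) \<in> carrier W" using m tuples_perm[OF s] by (auto intro: multilinear_closed)
  fix i assume i: "i \<in> {1..n}"
  then have i': "inv' s i \<in> {1..n}" using permutes_in_image[OF permutes_inv[OF s]] by simp
  have "(v(i := x)) \<circ> s = (v \<circ> s)(inv' s i := x)" for x
    using permutes_inverses[OF s] by (auto simp: fun_eq_iff)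
  then show "(\<lambda>x. m (v(i := x) \<circ> s)) \<in> lhom V W"
    using multilinear_lhom[OF m tuples_perm[OF s v] i'] by simp
qed

lemma multilinear_prod:
  assumes "\<And>i. i \<in> {1..n} \<Longrightarrow> f i \<in> lhom V scalars"
  shows "multilinear n V scalars (\<lambda>v. \<Prod>i\<in>{1..n}. f i (v i))"
proof (rule multilinearI)
  fix v i assume v: "v \<in> tuples n V" and i: "i \<in> {1..n}"
  have "(\<Prod>j\<in>{1..n}. f j ((v(i := x)) j)) = f i x * (\<Prod>j\<in>{1..n} - {i}. f j (v j))" for x
    using i by (subst prod.remove[of _ i]) (auto intro!: prod.cong)
  then show "(\<lambda>x. \<Prod>j\<in>{1..n}. f j ((v(i := x)) j)) \<in> lhom V scalars"
    by (intro lhomI) (simp_all add: lhom_simps[OF assms[OF i]] algebra_simps)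
qed simp

text \<open>\<open>J\<close> is the set of positions whose entries are arbitrary rather than basis
  vectors. Enlarging it by one position is an application of \<open>bas_ext\<close> in that
  variable.\<close>

lemma multilinear_ext:
  assumes V: "bas V I b c" and m: "multilinear n V W m" "multilinear n V W m'" and W: "vs W"
    and eq: "\<And>\<phi>. \<phi> \<in> {1..n} \<rightarrow>\<^sub>E I \<Longrightarrow> m (\<lambda>i\<in>{1..n}. b (\<phi> i)) = m' (\<lambda>i\<in>{1..n}. b (\<phi> i))"
    and v: "v \<in> tuples n V"
  shows "m v = m' v"
proof -
  have "\<forall>v\<in>tuples n V. (\<forall>i\<in>{1..n} - J. v i \<in> b ` I) \<longrightarrow> m v = m' v" if "finite J" "J \<subseteq> {1..n}" for J
    using that
  proof (induction J)
    case empty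
    show ?case
    proof (intro ballI impI)
      fix v assume v: "v \<in> tuples n V" "\<forall>i\<in>{1..n} - {}. v i \<in> b ` I"
      define \<phi> where "\<phi> = (\<lambda>i\<in>{1..n}. inv_into I b (v i))"
      have "\<phi> \<in> {1..n} \<rightarrow>\<^sub>E I" using v by (auto simp: \<phi>_def inv_into_into)
      moreover have "v = (\<lambda>i\<in>{1..n}. b (\<phi> i))"
        using v by (intro extensionalityI[of _ "{1..n}"]) (auto simp: \<phi>_def f_inv_into_f tuples_def PiE_iff)
      ultimately show "m v = m' v" using eq by metis
    qed
  next
    case (insert j J)
    show ?case
    proof (intro ballI impI)
      fix v assume v: "v \<in> tuples n V" "\<forall>i\<in>{1..n} - insert j J. v i \<in> b ` I"
      have j: "j \<in> {1..n}" using insert by simp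
      have "m (v(j := v j)) = m' (v(j := v j))"
      proof (rule bas_ext[OF V multilinear_lhom[OF m(1) v(1) j] multilinear_lhom[OF m(2) v(1) j] W])
        fix i assume i: "i \<in> I"
        then have "v(j := b i) \<in> tuples n V" using v j basD(3)[OF V] by simp
        moreover have "\<forall>k\<in>{1..n} - J. (v(j := b i)) k \<in> b ` I" using v i by auto
        ultimately show "m (v(j := b i)) = m' (v(j := b i))" using insert by blast
      qed (rule tuples_mem[OF v(1) j])
      then show "m v = m' v" by simp
    qed
  qed
  from this[of "{1..n}"] v show ?thesis by simp
qed

text \<open>The definition \<open>is_tensor_power\<close> quantifies over targets inside the
  universe. A basis consisting of the pure tensors of basis vectors gives the universal property for
  targets of every type, in particular for the scalars and for spaces of linear maps.\<close>

lemma tensor_universal: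
  assumes V: "bas V I b c" and t: "multilinear n V T t"
    and T: "bas T ({1..n} \<rightarrow>\<^sub>E I) (\<lambda>\<phi>. t (\<lambda>i\<in>{1..n}. b (\<phi> i))) C"
    and W: "vs W" and m: "multilinear n V W m"
  shows "\<exists>!f. f \<in> lin T W \<and> (\<forall>v\<in>tuples n V. f (t v) = m v)"
proof -
  have bt: "(\<lambda>i\<in>{1..n}. b (\<phi> i)) \<in> tuples n V" if "\<phi> \<in> {1..n} \<rightarrow>\<^sub>E I" for \<phi>
    by (intro tuples_restrict basD(3)[OF V] PiE_mem[OF that])
  obtain f where f: "f \<in> lin T W"
    "\<And>\<phi>. \<phi> \<in> {1..n} \<rightarrow>\<^sub>E I \<Longrightarrow> f (t (\<lambda>i\<in>{1..n}. b (\<phi> i))) = m (\<lambda>i\<in>{1..n}. b (\<phi> i))"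
    using bas_lin_ex[OF T W, of "\<lambda>\<phi>. m (\<lambda>i\<in>{1..n}. b (\<phi> i))"] multilinear_closed[OF m bt] by blast
  show ?thesis
  proof (rule ex1I[of _ f], intro conjI ballI)
    show "f (t v) = m v" if "v \<in> tuples n V" for v
      by (rule multilinear_ext[OF V multilinear_compose[OF t lin_lhom[OF f(1)]] m W f(2) that])
    show "g = f" if g: "g \<in> lin T W \<and> (\<forall>v\<in>tuples n V. g (t v) = m v)" for g
    proof (rule lin_eqI[of _ T W _ W])
      show "g x = f x" if "x \<in> carrier T" for x
        by (rule bas_ext[OF T, of _ W]) (use g f W bt that in \<open>auto simp: lin_lhom\<close>)
    qed (use f g in auto)
  qed (rule f)
qed

lemma bas_prod_space:
  assumes "finite I"
  shows "bas (prod_space I (\<lambda>_. scalars :: ('k::field, 'k) module)) I (\<lambda>i. \<lambda>j\<in>I. if i = j then 1 else 0) (\<lambda>i f. f i)"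
proof -
  have "f = (\<lambda>i\<in>I. 0)" if "f \<in> I \<rightarrow>\<^sub>E UNIV" "\<forall>i\<in>I. f i = 0" for f :: "'a \<Rightarrow> 'k"
    using that by (intro extensionalityI[of f I]) (auto simp: PiE_iff)
  then show ?thesis
    using assms vs_prod_space[of I "\<lambda>_. scalars :: ('k, 'k) module"]
    by (auto simp: bas_def prod_space_def intro!: lhomI)
qed

text \<open>The n-th tensor power realized as scalar functions on multi-indices: a tuple of vectors
  goes to the family of all products of their coordinates.\<close>

lemma tensor_model:
  fixes V :: "('k::field, 'a) module" and n :: nat
  assumes V: "bas V I b c"
  defines "\<Phi> \<equiv> {1..n} \<rightarrow>\<^sub>E I"
  defines "T \<equiv> prod_space \<Phi> (\<lambda>_. scalars :: ('k, 'k) module)"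
  defines "t \<equiv> \<lambda>v. \<lambda>\<phi>\<in>\<Phi>. \<Prod>i\<in>{1..n}. c (\<phi> i) (v i)"
  shows "multilinear n V T t" "bas T \<Phi> (\<lambda>\<phi>. t (\<lambda>i\<in>{1..n}. b (\<phi> i))) (\<lambda>\<phi> f. f \<phi>)"
proof -
  note B = basD[OF V]
  have fin: "finite \<Phi>" using B by (simp add: \<Phi>_def finite_PiE)
  show "multilinear n V T t"
  proof (rule multilinearI)
    fix v i assume v: "v \<in> tuples n V" and i: "i \<in> {1..n}"
    have "(\<lambda>x. \<Prod>j\<in>{1..n}. c (\<phi> j) ((v(i := x)) j)) \<in> lhom V scalars" if "\<phi> \<in> \<Phi>" for \<phi>
      by (rule multilinear_lhom[OF multilinear_prod[of n "\<lambda>i. c (\<phi> i)"] v i])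
        (rule B(4)[OF PiE_mem[OF that[unfolded \<Phi>_def]]])
    note h = lhom_simps[OF this]
    show "(\<lambda>x. t (v(i := x))) \<in> lhom V T"
      by (rule lhomI) (use h in \<open>auto simp: T_def t_def prod_space_def intro!: restrict_ext\<close>)
  qed (auto simp: T_def t_def prod_space_def)
  have "t (\<lambda>i\<in>{1..n}. b (\<phi> i)) = (\<lambda>\<psi>\<in>\<Phi>. if \<phi> = \<psi> then 1 else 0)" if \<phi>: "\<phi> \<in> \<Phi>" for \<phi>
    unfolding t_def
  proof (rule restrict_ext)
    fix \<psi> assume \<psi>: "\<psi> \<in> \<Phi>"
    have "(\<Prod>i\<in>{1..n}. c (\<psi> i) ((\<lambda>i\<in>{1..n}. b (\<phi> i)) i)) = (\<Prod>i\<in>{1..n}. if \<psi> i = \<phi> i then 1 else 0)"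
      using \<psi> \<phi> B(5) by (intro prod.cong) (auto simp: \<Phi>_def PiE_iff)
    also have "\<dots> = (if \<phi> = \<psi> then 1 else 0)"
    proof (cases "\<phi> = \<psi>")
      case False
      then obtain i where "i \<in> {1..n}" "\<psi> i \<noteq> \<phi> i"
        using PiE_ext[OF \<phi>[unfolded \<Phi>_def] \<psi>[unfolded \<Phi>_def]] by fastforce
      then show ?thesis using False by (auto intro!: prod_zero)
    qed simp
    finally show "(\<Prod>i\<in>{1..n}. c (\<psi> i) ((\<lambda>i\<in>{1..n}. b (\<phi> i)) i)) = (if \<phi> = \<psi> then 1 else 0)" .
  qed
  then show "bas T \<Phi> (\<lambda>\<phi>. t (\<lambda>i\<in>{1..n}. b (\<phi> i))) (\<lambda>\<phi> f. f \<phi>)"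
    using bas_prod_space[OF fin] unfolding T_def bas_def by simp
qed

context univ
begin

lemma tensor_power_exists:
  fixes V :: "('k, 'a) module"
  assumes V: "fdvs V"
  shows "\<exists>(T :: ('k, 'u) module) t. is_tensor_power n V T t"
proof -
  obtain d b c where B: "bas V {..<d::nat} b c" using fdvs_bas[OF V] by blast
  note M = tensor_model[OF B, of n]
  let ?T = "prod_space ({1..n} \<rightarrow>\<^sub>E {..<d}) (\<lambda>_. scalars :: ('k, 'k) module)"
  let ?t = "\<lambda>v. \<lambda>\<phi>\<in>{1..n} \<rightarrow>\<^sub>E {..<d}. \<Prod>i\<in>{1..n}. c (\<phi> i) (v i)"
  have fd: "fdvs ?T" using bas_fdvs[OF M(2)] .
  let ?S = "small ?T :: ('k, 'u) module"
  have mS: "multilinear n V ?S (\<lambda>v. enc ?T (?t v))"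
    by (rule multilinear_compose[OF M(1) enc_lhom[OF fd]])
  have bS: "bas ?S ({1..n} \<rightarrow>\<^sub>E {..<d}) (\<lambda>\<phi>. enc ?T (?t (\<lambda>i\<in>{1..n}. b (\<phi> i)))) (\<lambda>\<phi> u. dec ?T u \<phi>)"
  proof -
    note Bs = basD[OF M(2)]
    show ?thesis
      unfolding bas_def
    proof (intro conjI ballI impI)
      show "u = \<zero>\<^bsub>?S\<^esub>" if u: "u \<in> carrier ?S" "\<forall>\<phi>\<in>{1..n} \<rightarrow>\<^sub>E {..<d}. dec ?T u \<phi> = 0" for u
      proof -
        have "dec ?T u = \<zero>\<^bsub>?T\<^esub>" by (rule Bs(6)) (use u fd in auto)
        then have "enc ?T (dec ?T u) = \<zero>\<^bsub>?S\<^esub>" using lhom_zero[OF enc_lhom[OF fd]] fd by simp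
        then show ?thesis using u fd by simp
      qed
      show "(\<lambda>u. dec ?T u \<phi>) \<in> lhom ?S scalars" if "\<phi> \<in> {1..n} \<rightarrow>\<^sub>E {..<d}" for \<phi>
        by (rule lhom_compose[OF dec_lhom[OF fd] Bs(4)[OF that]])
      show "vs ?S" using fd by simp
      show "finite ({1..n} \<rightarrow>\<^sub>E {..<d})" by (rule Bs(1))
      fix \<phi> assume \<phi>: "\<phi> \<in> {1..n} \<rightarrow>\<^sub>E {..<d}"
      note b\<phi> = Bs(3)[OF \<phi>]
      show "enc ?T (?t (\<lambda>i\<in>{1..n}. b (\<phi> i))) \<in> carrier ?S"
        by (rule enc_closed[OF fd b\<phi>])
      fix \<psi> assume \<psi>: "\<psi> \<in> {1..n} \<rightarrow>\<^sub>E {..<d}"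
      show "dec ?T (enc ?T (?t (\<lambda>i\<in>{1..n}. b (\<phi> i))) :: 'u) \<psi> = (if \<psi> = \<phi> then 1 else 0)"
        using Bs(5)[OF \<psi> \<phi>] dec_enc[OF fd b\<phi>] by simp
    qed
  qed
  have "is_tensor_power n V ?S (\<lambda>v. enc ?T (?t v))"
    unfolding is_tensor_power_def
    by (intro conjI allI impI fdvs_small[OF fd] mS tensor_universal[OF B mS bS]) auto
  then show ?thesis by blast
qed

text \<open>The tensor power is an arbitrary choice, so its basis has to be recovered from the
  universal property. The comparison map \<open>g\<close> to the model has the left inverse
  \<open>k\<close>, by uniqueness in \<open>T\<close>; hence the coordinates of the model, pulled
  back along \<open>g\<close>, separate the points of \<open>T\<close>.\<close>

lemma tensor_power_basis:
  fixes V :: "('k, 'a) module" and T :: "('k, 'u) module"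
  assumes V: "bas V I b c" and T: "is_tensor_power n V T t"
  shows "\<exists>C. bas T ({1..n} \<rightarrow>\<^sub>E I) (\<lambda>\<phi>. t (\<lambda>i\<in>{1..n}. b (\<phi> i))) C"
proof -
  note M = tensor_model[OF V, of n]
  let ?\<Phi> = "{1..n} \<rightarrow>\<^sub>E I"
  let ?T = "prod_space ?\<Phi> (\<lambda>_. scalars :: ('k, 'k) module)"
  let ?t = "\<lambda>v. \<lambda>\<phi>\<in>?\<Phi>. \<Prod>i\<in>{1..n}. c (\<phi> i) (v i)"
  have fd: "fdvs ?T" using bas_fdvs[OF M(2)] .
  have fT: "fdvs T" and mt: "multilinear n V T t"
    and uT: "\<And>(W :: ('k, 'u) module) m. vs W \<Longrightarrow> multilinear n V W m \<Longrightarrow> \<exists>!f. f \<in> lin T W \<and> (\<forall>v\<in>tuples n V. f (t v) = m v)"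
    using T by (auto simp: is_tensor_power_def)
  \<comment> \<open>The model has its elements outside the universe, while the universal property of
    \<open>T\<close> speaks of targets inside it. So \<open>T\<close> is mapped to a small copy of
    the model and the result is decoded.\<close>
  obtain h where h: "h \<in> lin T (small ?T :: ('k, 'u) module)" "\<forall>v\<in>tuples n V. h (t v) = enc ?T (?t v)"
    using ex1_implies_ex[OF uT[OF fdvs_vs[OF fdvs_small[OF fd]] multilinear_compose[OF M(1) enc_lhom[OF fd]]]]
    by blast
  define g where "g x = dec ?T (h x)" for x
  have g: "g \<in> lhom T ?T" unfolding g_def by (rule lhom_compose[OF lin_lhom[OF h(1)] dec_lhom[OF fd]])
  have gt: "g (t v) = ?t v" if "v \<in> tuples n V" for v
    using h that dec_enc[OF fd multilinear_closed[OF M(1) that]] by (simp add: g_def)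
  obtain k where k: "k \<in> lin ?T T" "\<forall>v\<in>tuples n V. k (?t v) = t v"
    using ex1_implies_ex[OF tensor_universal[OF V M fdvs_vs[OF fT] mt]] by blast
  have kg: "k (g x) = x" if x: "x \<in> carrier T" for x
  proof -
    have 1: "(\<lambda>x\<in>carrier T. k (g x)) \<in> lin T T" "(\<lambda>x\<in>carrier T. x) \<in> lin T T"
      using lin_restrict[OF lhom_compose[OF g lin_lhom[OF k(1)]]] lin_id[OF fdvs_vs[OF fT]] fT by auto
    have 2: "\<forall>v\<in>tuples n V. (\<lambda>x\<in>carrier T. k (g x)) (t v) = t v" "\<forall>v\<in>tuples n V. (\<lambda>x\<in>carrier T. x) (t v) = t v"
      using gt k(2) multilinear_closed[OF mt] by simp_all
    have "(\<lambda>x\<in>carrier T. k (g x)) = (\<lambda>x\<in>carrier T. x)"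
      using uT[OF fdvs_vs[OF fT] mt] 1 2 by blast
    then show ?thesis using x by (metis restrict_apply')
  qed
  note Bs = basD[OF M(2)]
  have bt: "(\<lambda>i\<in>{1..n}. b (\<phi> i)) \<in> tuples n V" if "\<phi> \<in> ?\<Phi>" for \<phi>
    by (intro tuples_restrict basD(3)[OF V] PiE_mem[OF that])
  have "bas T ?\<Phi> (\<lambda>\<phi>. t (\<lambda>i\<in>{1..n}. b (\<phi> i))) (\<lambda>\<phi> x. g x \<phi>)"
    unfolding bas_def
  proof (intro conjI ballI impI)
    show "x = \<zero>\<^bsub>T\<^esub>" if x: "x \<in> carrier T" "\<forall>\<phi>\<in>?\<Phi>. g x \<phi> = 0" for x
    proof -
      have "g x = \<zero>\<^bsub>?T\<^esub>" by (rule Bs(6)) (use x lhom_closed[OF g] in auto)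
      then show ?thesis using kg[OF x(1)] lin_zero[OF k(1)] fT fd by simp
    qed
    show "(\<lambda>x. g x \<phi>) \<in> lhom T scalars" if "\<phi> \<in> ?\<Phi>" for \<phi>
      by (rule lhom_compose[OF g Bs(4)[OF that]])
    show "finite ?\<Phi>" by (rule Bs(1))
    show "vs T" using fT by simp
    fix \<phi> assume \<phi>: "\<phi> \<in> ?\<Phi>"
    show "t (\<lambda>i\<in>{1..n}. b (\<phi> i)) \<in> carrier T" by (rule multilinear_closed[OF mt bt[OF \<phi>]])
    fix \<psi> assume \<psi>: "\<psi> \<in> ?\<Phi>"
    show "g (t (\<lambda>i\<in>{1..n}. b (\<phi> i))) \<psi> = (if \<psi> = \<phi> then 1 else 0)"
      using Bs(5)[OF \<psi> \<phi>] gt[OF bt[OF \<phi>]] by simp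
  qed
  then show ?thesis by blast
qed

context
  fixes V :: "('k, 'a) module" and n :: nat
  assumes V: "fdvs V"
begin

lemma tpow_is_tensor_power: "is_tensor_power n V (tpow n V :: ('k, 'u) module) (pure n V)"
proof -
  have "\<exists>p. case p of (T :: ('k, 'u) module, t) \<Rightarrow> is_tensor_power n V T t"
    using tensor_power_exists[OF V] by auto
  from someI_ex[OF this] show ?thesis
    by (simp add: tpow_def pure_def tensor_power_def case_prod_unfold)
qed

lemma fdvs_tpow [simp]: "fdvs (tpow n V :: ('k, 'u) module)"
  and pure_multilinear: "multilinear n V (tpow n V :: ('k, 'u) module) (pure n V)"
  using tpow_is_tensor_power by (auto simp: is_tensor_power_def)

lemma pure_closed [simp]: "v \<in> tuples n V \<Longrightarrow> pure n V v \<in> carrier (tpow n V :: ('k, 'u) module)"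
  by (rule multilinear_closed[OF pure_multilinear])

lemma tlift_ex1:
  fixes W :: "('k, 'b) module"
  assumes W: "vs W" and m: "multilinear n V W m"
  shows "\<exists>!f. f \<in> lin (tpow n V :: ('k, 'u) module) W \<and> (\<forall>v\<in>tuples n V. f (pure n V v) = m v)"
proof -
  obtain d b c where B: "bas V {..<d::nat} b c" using fdvs_bas[OF V] by blast
  obtain C where C: "bas (tpow n V :: ('k, 'u) module) ({1..n} \<rightarrow>\<^sub>E {..<d}) (\<lambda>\<phi>. pure n V (\<lambda>i\<in>{1..n}. b (\<phi> i))) C"
    using tensor_power_basis[OF B tpow_is_tensor_power] by blast
  show ?thesis by (rule tensor_universal[OF B pure_multilinear C W m])
qed

lemma tlift_lin:
  fixes W :: "('k, 'b) module"
  assumes "vs W" "multilinear n V W m"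
  shows "tlift n V W m \<in> lin (tpow n V :: ('k, 'u) module) W"
  using theI'[OF tlift_ex1[OF assms]] by (simp add: tlift_def)

lemma tlift_pure [simp]:
  fixes W :: "('k, 'b) module"
  assumes "vs W" "multilinear n V W m" "v \<in> tuples n V"
  shows "tlift n V W m (pure n V v :: 'u) = m v"
  using theI'[OF tlift_ex1[OF assms(1,2)]] assms(3) by (simp add: tlift_def)

lemma tpow_ext:
  fixes W :: "('k, 'b) module"
  assumes W: "vs W" and f: "f \<in> lhom (tpow n V :: ('k, 'u) module) W" and g: "g \<in> lhom (tpow n V) W"
    and eq: "\<And>v. v \<in> tuples n V \<Longrightarrow> f (pure n V v) = g (pure n V v)" and x: "x \<in> carrier (tpow n V)"
  shows "f x = g x"
proof -
  have m: "multilinear n V W (\<lambda>v. f (pure n V v))"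
    by (rule multilinear_compose[OF pure_multilinear f])
  have "restrict f (carrier (tpow n V)) = restrict g (carrier (tpow n V))"
    using tlift_ex1[OF W m] lin_restrict[OF f] lin_restrict[OF g] eq
    by (auto simp: Ex1_def) (metis (no_types, lifting) pure_closed restrict_apply')
  then show ?thesis using x by (metis restrict_apply')
qed

lemma bas_tpow:
  assumes B: "bas V I b c"
  shows "bas (tpow n V :: ('k, 'u) module) ({1..n} \<rightarrow>\<^sub>E I) (\<lambda>\<phi>. pure n V (\<lambda>i\<in>{1..n}. b (\<phi> i)))
    (\<lambda>\<phi>. tlift n V scalars (\<lambda>v. \<Prod>i\<in>{1..n}. c (\<phi> i) (v i)))"
proof -
  let ?T = "tpow n V :: ('k, 'u) module"
  obtain C where C: "bas ?T ({1..n} \<rightarrow>\<^sub>E I) (\<lambda>\<phi>. pure n V (\<lambda>i\<in>{1..n}. b (\<phi> i))) C"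
    using tensor_power_basis[OF B tpow_is_tensor_power] by blast
  note Bs = basD[OF C] and B' = basD[OF B]
  have m: "multilinear n V scalars (\<lambda>v. \<Prod>i\<in>{1..n}. c (\<phi> i) (v i))" if "\<phi> \<in> {1..n} \<rightarrow>\<^sub>E I" for \<phi>
    by (rule multilinear_prod) (rule B'(4)[OF PiE_mem[OF that]])
  note l = tlift_lin[OF vs_scalars m]
  have bt: "(\<lambda>i\<in>{1..n}. b (\<phi> i)) \<in> tuples n V" if "\<phi> \<in> {1..n} \<rightarrow>\<^sub>E I" for \<phi>
    by (intro tuples_restrict B'(3) PiE_mem[OF that])
  have ev: "(\<Prod>i\<in>{1..n}. c (\<psi> i) ((\<lambda>i\<in>{1..n}. b (\<phi> i)) i)) = (if \<psi> = \<phi> then 1 else 0)"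
    if "\<psi> \<in> {1..n} \<rightarrow>\<^sub>E I" "\<phi> \<in> {1..n} \<rightarrow>\<^sub>E I" for \<phi> \<psi>
    using basD(5)[OF tensor_model(2)[OF B] that] that by simp
  have eq: "tlift n V scalars (\<lambda>v. \<Prod>i\<in>{1..n}. c (\<phi> i) (v i)) x = C \<phi> x"
    if "\<phi> \<in> {1..n} \<rightarrow>\<^sub>E I" "x \<in> carrier ?T" for \<phi> x
    by (rule bas_ext[OF C lin_lhom[OF l[OF that(1)]] Bs(4)[OF that(1)]])
      (use that Bs(5) ev bt m in simp_all)
  show ?thesis
    unfolding bas_def
  proof (intro conjI ballI impI)
    fix \<phi> assume \<phi>: "\<phi> \<in> {1..n} \<rightarrow>\<^sub>E I"
    show "tlift n V scalars (\<lambda>v. \<Prod>i\<in>{1..n}. c (\<phi> i) (v i)) \<in> lhom ?T scalars"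
      using l[OF \<phi>] by (rule lin_lhom)
    show "pure n V (\<lambda>i\<in>{1..n}. b (\<phi> i)) \<in> carrier ?T" by (rule Bs(3)[OF \<phi>])
    fix \<psi> assume \<psi>: "\<psi> \<in> {1..n} \<rightarrow>\<^sub>E I"
    show "tlift n V scalars (\<lambda>v. \<Prod>i\<in>{1..n}. c (\<phi> i) (v i)) (pure n V (\<lambda>i\<in>{1..n}. b (\<psi> i)) :: 'u) =
      (if \<phi> = \<psi> then 1 else 0)"
      using eq[OF \<phi> Bs(3)[OF \<psi>]] Bs(5)[OF \<phi> \<psi>] by simp
  next
    fix x assume x: "x \<in> carrier ?T"
      "\<forall>\<phi>\<in>{1..n} \<rightarrow>\<^sub>E I. tlift n V scalars (\<lambda>v. \<Prod>i\<in>{1..n}. c (\<phi> i) (v i)) x = 0"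
    show "x = \<zero>\<^bsub>?T\<^esub>" by (rule Bs(6)) (use x eq in auto)
  qed (use Bs in auto)
qed

text \<open>The products of functionals include the coordinate functions of \<open>bas_tpow\<close>.
  They serve as test functionals in \<open>kap_bij\<close> and in the polarization argument, because
  they turn a pure tensor into a product of n scalars.\<close>

lemma tpow_separates:
  assumes "x \<in> carrier (tpow n V :: ('k, 'u) module)"
    "\<And>f. f \<in> tuples n (dual_space V) \<Longrightarrow> tlift n V scalars (\<lambda>v. \<Prod>i\<in>{1..n}. f i (v i)) x = 0"
  shows "x = \<zero>\<^bsub>tpow n V\<^esub>"
proof -
  obtain d b c where B: "bas V {..<d::nat} b c" using fdvs_bas[OF V] by blast
  have B': "bas V {..<d} b (\<lambda>i. restrict (c i) (carrier V))"
    using B basD(4)[OF B, THEN lin_restrict, THEN lin_lhom] basD(2)[OF B] by (simp add: bas_def)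
  show ?thesis
  proof (rule basD(6)[OF bas_tpow[OF B'] assms(1)])
    fix \<phi> assume \<phi>: "\<phi> \<in> {1..n} \<rightarrow>\<^sub>E {..<d}"
    define f where "f = (\<lambda>i\<in>{1..n}. restrict (c (\<phi> i)) (carrier V))"
    have "restrict (c (\<phi> i)) (carrier V) \<in> carrier (dual_space V)" if "i \<in> {1..n}" for i
      using lin_restrict[OF basD(4)[OF B PiE_mem[OF \<phi> that]]] V by simp
    then have "f \<in> tuples n (dual_space V)"
      unfolding f_def by (intro tuples_restrict)
    moreover have "(\<lambda>v. \<Prod>i\<in>{1..n}. f i (v i)) = (\<lambda>v. \<Prod>i\<in>{1..n}. restrict (c (\<phi> i)) (carrier V) (v i))"
      by (intro ext prod.cong) (simp_all add: f_def)
    ultimately show "tlift n V scalars (\<lambda>v. \<Prod>i\<in>{1..n}. restrict (c (\<phi> i)) (carrier V) (v i)) x = 0"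
      using assms(2) by metis
  qed
qed

end

lemma tpow_ext2:
  fixes V :: "('k, 'a) module" and U :: "('k, 'b) module" and W :: "('k, 'c) module"
  assumes V: "fdvs V" and U: "fdvs U" and W: "vs W"
    and f: "\<And>x. x \<in> carrier (tpow n V :: ('k, 'u) module) \<Longrightarrow> (\<lambda>y. f x y) \<in> lhom (tpow n U :: ('k, 'u) module) W"
      "\<And>y. y \<in> carrier (tpow n U) \<Longrightarrow> (\<lambda>x. f x y) \<in> lhom (tpow n V) W"
    and g: "\<And>x. x \<in> carrier (tpow n V :: ('k, 'u) module) \<Longrightarrow> (\<lambda>y. g x y) \<in> lhom (tpow n U :: ('k, 'u) module) W"
      "\<And>y. y \<in> carrier (tpow n U) \<Longrightarrow> (\<lambda>x. g x y) \<in> lhom (tpow n V) W"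
    and eq: "\<And>v u. v \<in> tuples n V \<Longrightarrow> u \<in> tuples n U \<Longrightarrow> f (pure n V v) (pure n U u) = g (pure n V v) (pure n U u)"
    and x: "x \<in> carrier (tpow n V)" and y: "y \<in> carrier (tpow n U)"
  shows "f x y = g x y"
proof (rule tpow_ext[OF V W f(2)[OF y] g(2)[OF y] _ x])
  fix v assume v: "v \<in> tuples n V"
  show "f (pure n V v) y = g (pure n V v) y"
    by (rule tpow_ext[OF U W f(1) g(1) _ y]) (use V v eq in auto)
qed

text \<open>Currying: a function that is multilinear in each of two tuples induces a bilinear map on
  the two tensor powers. \<open>Gam_cmp\<close>, \<open>Gam_real\<close> and \<open>kap_form\<close>
  all arise in this way. The work is to see that the inner lift depends linearly on each entry of
  the outer tuple.\<close>

lemma tlift2: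
  fixes V :: "('k, 'a) module" and U :: "('k, 'b) module" and W :: "('k, 'c) module"
  assumes V: "fdvs V" and U: "fdvs U" and W: "vs W"
    and B: "\<And>v. v \<in> tuples n V \<Longrightarrow> multilinear n U W (\<lambda>u. B v u)"
      "\<And>u. u \<in> tuples n U \<Longrightarrow> multilinear n V W (\<lambda>v. B v u)"
  defines "\<beta> \<equiv> tlift n V (Lin (tpow n U :: ('k, 'u) module) W) (\<lambda>v. tlift n U W (B v)) :: 'u \<Rightarrow> 'u \<Rightarrow> 'c"
  shows "\<beta> \<in> lin (tpow n V) (Lin (tpow n U) W)"
    and "v \<in> tuples n V \<Longrightarrow> u \<in> tuples n U \<Longrightarrow> \<beta> (pure n V v) (pure n U u) = B v u"
proof -
  let ?L = "Lin (tpow n U :: ('k, 'u) module) W"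
  have vL: "vs ?L" using U W by simp
  note l = tlift_lin[OF U W B(1)]
  have m: "multilinear n V ?L (\<lambda>v. tlift n U W (B v))"
  proof (rule multilinearI)
    fix v i assume v: "v \<in> tuples n V" and i: "i \<in> {1..n}"
    note t = tuples_upd[OF v _ i]
    note hB = lhom_simps[OF multilinear_lhom[OF B(2) v i]]
    show "(\<lambda>x. tlift n U W (B (v(i := x)))) \<in> lhom V ?L"
    proof (rule lhomI)
      fix x y r assume x: "x \<in> carrier V"
      show "tlift n U W (B (v(i := x))) \<in> carrier ?L" using l[OF t[OF x]] by simp
      have rx: "r \<odot>\<^bsub>V\<^esub> x \<in> carrier V" using V x by simp
      show "tlift n U W (B (v(i := r \<odot>\<^bsub>V\<^esub> x))) = r \<odot>\<^bsub>?L\<^esub> tlift n U W (B (v(i := x)))"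
      proof (rule lin_eqI[OF l[OF t[OF rx]]])
        have *: "r \<odot>\<^bsub>?L\<^esub> tlift n U W (B (v(i := x))) \<in> lin (tpow n U) W"
          using vs_smult[OF vL] l[OF t[OF x]] by (simp del: Lin_simps(4))
        then show "r \<odot>\<^bsub>?L\<^esub> tlift n U W (B (v(i := x))) \<in> lin (tpow n U) W" .
        show "tlift n U W (B (v(i := r \<odot>\<^bsub>V\<^esub> x))) z = (r \<odot>\<^bsub>?L\<^esub> tlift n U W (B (v(i := x)))) z"
          if "z \<in> carrier (tpow n U)" for z
          by (rule tpow_ext[OF U W lin_lhom[OF l[OF t[OF rx]]] lin_lhom[OF *] _ that])
            (use x t rx U W B hB in simp)
      qed
      assume y: "y \<in> carrier V"
      have xy: "x \<oplus>\<^bsub>V\<^esub> y \<in> carrier V" using V x y by simp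
      show "tlift n U W (B (v(i := x \<oplus>\<^bsub>V\<^esub> y))) = tlift n U W (B (v(i := x))) \<oplus>\<^bsub>?L\<^esub> tlift n U W (B (v(i := y)))"
      proof (rule lin_eqI[OF l[OF t[OF xy]]])
        have *: "tlift n U W (B (v(i := x))) \<oplus>\<^bsub>?L\<^esub> tlift n U W (B (v(i := y))) \<in> lin (tpow n U) W"
          using vs_add[OF vL] l[OF t[OF x]] l[OF t[OF y]] by (simp del: Lin_simps(3))
        then show "tlift n U W (B (v(i := x))) \<oplus>\<^bsub>?L\<^esub> tlift n U W (B (v(i := y))) \<in> lin (tpow n U) W" .
        show "tlift n U W (B (v(i := x \<oplus>\<^bsub>V\<^esub> y))) z = (tlift n U W (B (v(i := x))) \<oplus>\<^bsub>?L\<^esub> tlift n U W (B (v(i := y)))) z"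
          if "z \<in> carrier (tpow n U)" for z
          by (rule tpow_ext[OF U W lin_lhom[OF l[OF t[OF xy]]] lin_lhom[OF *] _ that])
            (use x y t xy U W B hB in simp)
      qed
    qed
  qed (use l in simp)
  show "\<beta> \<in> lin (tpow n V) ?L" unfolding \<beta>_def by (rule tlift_lin[OF V vL m])
  show "v \<in> tuples n V \<Longrightarrow> u \<in> tuples n U \<Longrightarrow> \<beta> (pure n V v) (pure n U u) = B v u"
    unfolding \<beta>_def using V vL m U W B by simp
qed

end

section \<open>Linear categories and dualities\<close>

lemma linear_categoryD:
  assumes "linear_category C"
  shows lc_vs: "a \<in> Obj C \<Longrightarrow> b \<in> Obj C \<Longrightarrow> vs (Mor C a b)"
    and lc_idn: "a \<in> Obj C \<Longrightarrow> Idn C a \<in> carrier (Mor C a a)"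
    and lc_left: "a \<in> Obj C \<Longrightarrow> b \<in> Obj C \<Longrightarrow> c \<in> Obj C \<Longrightarrow> f \<in> carrier (Mor C a b) \<Longrightarrow>
      (\<lambda>g. Cmp C a b c g f) \<in> lhom (Mor C b c) (Mor C a c)"
    and lc_right: "a \<in> Obj C \<Longrightarrow> b \<in> Obj C \<Longrightarrow> c \<in> Obj C \<Longrightarrow> g \<in> carrier (Mor C b c) \<Longrightarrow>
      (\<lambda>f. Cmp C a b c g f) \<in> lhom (Mor C a b) (Mor C a c)"
    and lc_idr: "a \<in> Obj C \<Longrightarrow> b \<in> Obj C \<Longrightarrow> f \<in> carrier (Mor C a b) \<Longrightarrow> Cmp C a a b f (Idn C a) = f"
    and lc_idl: "a \<in> Obj C \<Longrightarrow> b \<in> Obj C \<Longrightarrow> f \<in> carrier (Mor C a b) \<Longrightarrow> Cmp C a b b (Idn C b) f = f"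
    and lc_assoc: "a \<in> Obj C \<Longrightarrow> b \<in> Obj C \<Longrightarrow> c \<in> Obj C \<Longrightarrow> d \<in> Obj C \<Longrightarrow> f \<in> carrier (Mor C a b) \<Longrightarrow>
      g \<in> carrier (Mor C b c) \<Longrightarrow> h \<in> carrier (Mor C c d) \<Longrightarrow>
      Cmp C a b d (Cmp C b c d h g) f = Cmp C a c d h (Cmp C a b c g f)"
  using assms by (simp_all add: linear_category_def)

lemma lc_cmp:
  "linear_category C \<Longrightarrow> a \<in> Obj C \<Longrightarrow> b \<in> Obj C \<Longrightarrow> c \<in> Obj C \<Longrightarrow> f \<in> carrier (Mor C a b) \<Longrightarrow>
    g \<in> carrier (Mor C b c) \<Longrightarrow> Cmp C a b c g f \<in> carrier (Mor C a c)"
  by (rule lhom_closed[OF lc_left])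

lemma is_functorD:
  assumes "is_functor C D F"
  shows ftor_ob: "a \<in> Obj C \<Longrightarrow> ob F a \<in> Obj D"
    and ftor_mo: "a \<in> Obj C \<Longrightarrow> b \<in> Obj C \<Longrightarrow> f \<in> carrier (Mor C a b) \<Longrightarrow>
      mo F a b f \<in> carrier (Mor D (ob F a) (ob F b))"
    and ftor_idn: "a \<in> Obj C \<Longrightarrow> mo F a a (Idn C a) = Idn D (ob F a)"
    and ftor_cmp: "a \<in> Obj C \<Longrightarrow> b \<in> Obj C \<Longrightarrow> c \<in> Obj C \<Longrightarrow> f \<in> carrier (Mor C a b) \<Longrightarrow>
      g \<in> carrier (Mor C b c) \<Longrightarrow>
      mo F a c (Cmp C a b c g f) = Cmp D (ob F a) (ob F b) (ob F c) (mo F b c g) (mo F a b f)"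
  using assms by (simp_all add: is_functor_def)

lemma linear_functorD:
  assumes "linear_functor C D F"
  shows "is_functor C D F"
    "a \<in> Obj C \<Longrightarrow> b \<in> Obj C \<Longrightarrow> mo F a b \<in> lhom (Mor C a b) (Mor D (ob F a) (ob F b))"
  using assms by (simp_all add: linear_functor_def)

lemma nat_transD:
  assumes "\<eta> \<in> nat_trans C D F G"
  shows nt_ext: "\<eta> \<in> extensional (Obj C)"
    and nt_closed: "a \<in> Obj C \<Longrightarrow> \<eta> a \<in> carrier (Mor D (ob F a) (ob G a))"
    and nt_natural: "a \<in> Obj C \<Longrightarrow> b \<in> Obj C \<Longrightarrow> f \<in> carrier (Mor C a b) \<Longrightarrow>
      Cmp D (ob F a) (ob G a) (ob G b) (mo G a b f) (\<eta> a) = Cmp D (ob F a) (ob F b) (ob G b) (\<eta> b) (mo F a b f)"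
  using assms by (simp_all add: nat_trans_def)

lemma nat_transI:
  assumes "\<eta> \<in> extensional (Obj C)"
    "\<And>a. a \<in> Obj C \<Longrightarrow> \<eta> a \<in> carrier (Mor D (ob F a) (ob G a))"
    "\<And>a b f. a \<in> Obj C \<Longrightarrow> b \<in> Obj C \<Longrightarrow> f \<in> carrier (Mor C a b) \<Longrightarrow>
      Cmp D (ob F a) (ob G a) (ob G b) (mo G a b f) (\<eta> a) = Cmp D (ob F a) (ob F b) (ob G b) (\<eta> b) (mo F a b f)"
  shows "\<eta> \<in> nat_trans C D F G"
  using assms by (simp add: nat_trans_def)

lemma Fun_simps [simp]:
  "Obj (Fun C D) = {F. linear_functor C D F}"
  "carrier (Mor (Fun C D) F G) = nat_trans C D F G"
  "\<zero>\<^bsub>Mor (Fun C D) F G\<^esub> = (\<lambda>a\<in>Obj C. \<zero>\<^bsub>Mor D (ob F a) (ob G a)\<^esub>)"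
  "\<eta> \<oplus>\<^bsub>Mor (Fun C D) F G\<^esub> \<theta> = (\<lambda>a\<in>Obj C. \<eta> a \<oplus>\<^bsub>Mor D (ob F a) (ob G a)\<^esub> \<theta> a)"
  "c \<odot>\<^bsub>Mor (Fun C D) F G\<^esub> \<eta> = (\<lambda>a\<in>Obj C. c \<odot>\<^bsub>Mor D (ob F a) (ob G a)\<^esub> \<eta> a)"
  "Idn (Fun C D) F = (\<lambda>a\<in>Obj C. Idn D (ob F a))"
  "Cmp (Fun C D) F G H \<theta> \<eta> = (\<lambda>a\<in>Obj C. Cmp D (ob F a) (ob G a) (ob H a) (\<theta> a) (\<eta> a))"
  by (simp_all add: Fun_def)

text \<open>Natural transformations are cut out of a product over the objects by equations that are
  linear because composition in \<open>D\<close> is linear in each argument.\<close>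

lemma vs_Fun:
  assumes D: "linear_category D" and F: "linear_functor C D F" and G: "linear_functor C D G"
  shows "vs (Mor (Fun C D) F G)"
proof -
  have eq: "Mor (Fun C D) F G =
      (prod_space (Obj C) (\<lambda>a. Mor D (ob F a) (ob G a)))\<lparr>carrier := nat_trans C D F G\<rparr>"
    by (simp add: Fun_def prod_space_def)
  note F' = linear_functorD(1)[OF F] and G' = linear_functorD(1)[OF G]
  note oF = ftor_ob[OF F'] and oG = ftor_ob[OF G']
  show ?thesis
    unfolding eq
  proof (rule vs_sub[OF vs_prod_space])
    show "vs (Mor D (ob F a) (ob G a))" if "a \<in> Obj C" for a
      using lc_vs[OF D] oF oG that by simp
    show "nat_trans C D F G \<subseteq> carrier (prod_space (Obj C) (\<lambda>a. Mor D (ob F a) (ob G a)))"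
      by (rule subsetI) (simp add: prod_space_def nat_trans_def PiE_iff)
    show "\<zero>\<^bsub>prod_space (Obj C) (\<lambda>a. Mor D (ob F a) (ob G a))\<^esub> \<in> nat_trans C D F G"
    proof (rule nat_transI)
      fix a b f assume H: "a \<in> Obj C" "b \<in> Obj C" "f \<in> carrier (Mor C a b)"
      note o = oF[OF H(1)] oG[OF H(1)] oF[OF H(2)] oG[OF H(2)]
      show "Cmp D (ob F a) (ob G a) (ob G b) (mo G a b f) (\<zero>\<^bsub>prod_space (Obj C) (\<lambda>a. Mor D (ob F a) (ob G a))\<^esub> a) =
         Cmp D (ob F a) (ob F b) (ob G b) (\<zero>\<^bsub>prod_space (Obj C) (\<lambda>a. Mor D (ob F a) (ob G a))\<^esub> b) (mo F a b f)"
        using H lhom_zero[OF lc_right[OF D o(1,2,4) ftor_mo[OF G' H]]] lhom_zero[OF lc_left[OF D o(1,3,4) ftor_mo[OF F' H]]] o lc_vs[OF D]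
        by (simp add: prod_space_def)
    qed (use lc_vs[OF D] oF oG in \<open>auto simp: prod_space_def\<close>)
  next
    fix \<eta> \<theta> assume E: "\<eta> \<in> nat_trans C D F G" "\<theta> \<in> nat_trans C D F G"
    show "\<eta> \<oplus>\<^bsub>prod_space (Obj C) (\<lambda>a. Mor D (ob F a) (ob G a))\<^esub> \<theta> \<in> nat_trans C D F G"
    proof (rule nat_transI)
      fix a b f assume H: "a \<in> Obj C" "b \<in> Obj C" "f \<in> carrier (Mor C a b)"
      note o = oF[OF H(1)] oG[OF H(1)] oF[OF H(2)] oG[OF H(2)]
      show "Cmp D (ob F a) (ob G a) (ob G b) (mo G a b f) ((\<eta> \<oplus>\<^bsub>prod_space (Obj C) (\<lambda>a. Mor D (ob F a) (ob G a))\<^esub> \<theta>) a) =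
         Cmp D (ob F a) (ob F b) (ob G b) ((\<eta> \<oplus>\<^bsub>prod_space (Obj C) (\<lambda>a. Mor D (ob F a) (ob G a))\<^esub> \<theta>) b) (mo F a b f)"
        using H lhom_add[OF lc_right[OF D o(1,2,4) ftor_mo[OF G' H]] nt_closed[OF E(1) H(1)] nt_closed[OF E(2) H(1)]]
          lhom_add[OF lc_left[OF D o(1,3,4) ftor_mo[OF F' H]] nt_closed[OF E(1) H(2)] nt_closed[OF E(2) H(2)]]
          nt_natural[OF E(1) H] nt_natural[OF E(2) H]
        by (simp add: prod_space_def)
    qed (use lc_vs[OF D] oF oG nt_closed[OF E(1)] nt_closed[OF E(2)] in \<open>auto simp: prod_space_def\<close>)
  next
    fix r \<eta> assume E: "\<eta> \<in> nat_trans C D F G"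
    show "r \<odot>\<^bsub>prod_space (Obj C) (\<lambda>a. Mor D (ob F a) (ob G a))\<^esub> \<eta> \<in> nat_trans C D F G"
    proof (rule nat_transI)
      fix a b f assume H: "a \<in> Obj C" "b \<in> Obj C" "f \<in> carrier (Mor C a b)"
      note o = oF[OF H(1)] oG[OF H(1)] oF[OF H(2)] oG[OF H(2)]
      show "Cmp D (ob F a) (ob G a) (ob G b) (mo G a b f) ((r \<odot>\<^bsub>prod_space (Obj C) (\<lambda>a. Mor D (ob F a) (ob G a))\<^esub> \<eta>) a) =
         Cmp D (ob F a) (ob F b) (ob G b) ((r \<odot>\<^bsub>prod_space (Obj C) (\<lambda>a. Mor D (ob F a) (ob G a))\<^esub> \<eta>) b) (mo F a b f)"
        using H lhom_smult[OF lc_right[OF D o(1,2,4) ftor_mo[OF G' H]] nt_closed[OF E H(1)]]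
          lhom_smult[OF lc_left[OF D o(1,3,4) ftor_mo[OF F' H]] nt_closed[OF E H(2)]] nt_natural[OF E H]
        by (simp add: prod_space_def)
    qed (use lc_vs[OF D] oF oG nt_closed[OF E] in \<open>auto simp: prod_space_def\<close>)
  qed
qed

lemma nat_trans_cmp:
  assumes D: "linear_category D" and F: "is_functor C D F" "is_functor C D G" "is_functor C D H"
    and E: "\<eta> \<in> nat_trans C D F G" "\<theta> \<in> nat_trans C D G H"
  shows "(\<lambda>a\<in>Obj C. Cmp D (ob F a) (ob G a) (ob H a) (\<theta> a) (\<eta> a)) \<in> nat_trans C D F H"
proof (rule nat_transI)
  fix a b f assume A: "a \<in> Obj C" "b \<in> Obj C" "f \<in> carrier (Mor C a b)"
  note o = ftor_ob[OF F(1)] ftor_ob[OF F(2)] ftor_ob[OF F(3)]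
  note m = ftor_mo[OF F(1) A] ftor_mo[OF F(2) A] ftor_mo[OF F(3) A]
  note n = nt_closed[OF E(1)] nt_closed[OF E(2)]
  note s = lc_assoc[OF D]
  have "Cmp D (ob F a) (ob H a) (ob H b) (mo H a b f) (Cmp D (ob F a) (ob G a) (ob H a) (\<theta> a) (\<eta> a)) =
    Cmp D (ob F a) (ob G a) (ob H b) (Cmp D (ob G a) (ob H a) (ob H b) (mo H a b f) (\<theta> a)) (\<eta> a)"
    using s[OF o(1)[OF A(1)] o(2)[OF A(1)] o(3)[OF A(1)] o(3)[OF A(2)] n(1)[OF A(1)] n(2)[OF A(1)] m(3)] by simp
  also have "\<dots> = Cmp D (ob F a) (ob G b) (ob H b) (\<theta> b) (Cmp D (ob F a) (ob G a) (ob G b) (mo G a b f) (\<eta> a))"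
    using s[OF o(1)[OF A(1)] o(2)[OF A(1)] o(2)[OF A(2)] o(3)[OF A(2)] n(1)[OF A(1)] m(2) n(2)[OF A(2)]]
      nt_natural[OF E(2) A] by simp
  also have "\<dots> = Cmp D (ob F a) (ob F b) (ob H b) (Cmp D (ob F b) (ob G b) (ob H b) (\<theta> b) (\<eta> b)) (mo F a b f)"
    using s[OF o(1)[OF A(1)] o(1)[OF A(2)] o(2)[OF A(2)] o(3)[OF A(2)] m(1) n(1)[OF A(2)] n(2)[OF A(2)]]
      nt_natural[OF E(1) A] by simp
  finally show "Cmp D (ob F a) (ob H a) (ob H b) (mo H a b f) ((\<lambda>a\<in>Obj C. Cmp D (ob F a) (ob G a) (ob H a) (\<theta> a) (\<eta> a)) a) =
    Cmp D (ob F a) (ob F b) (ob H b) ((\<lambda>a\<in>Obj C. Cmp D (ob F a) (ob G a) (ob H a) (\<theta> a) (\<eta> a)) b) (mo F a b f)"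
    using A by simp
next
  fix a assume a: "a \<in> Obj C"
  show "(\<lambda>a\<in>Obj C. Cmp D (ob F a) (ob G a) (ob H a) (\<theta> a) (\<eta> a)) a \<in> carrier (Mor D (ob F a) (ob H a))"
    using a lc_cmp[OF D ftor_ob[OF F(1)] ftor_ob[OF F(2)] ftor_ob[OF F(3)] nt_closed[OF E(1)] nt_closed[OF E(2)]] by simp
qed simp

text \<open>Every law is inherited componentwise from \<open>D\<close>.\<close>

lemma Fun_linear_category:
  assumes D: "linear_category D"
  shows "linear_category (Fun C D)"
  unfolding linear_category_def
proof (intro conjI ballI)
  fix F G assume "F \<in> Obj (Fun C D)" "G \<in> Obj (Fun C D)"
  then show "vs (Mor (Fun C D) F G)" using vs_Fun[OF D] by simp
next
  fix F assume "F \<in> Obj (Fun C D)"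
  then have F: "is_functor C D F" by (simp add: linear_functor_def)
  show "Idn (Fun C D) F \<in> carrier (Mor (Fun C D) F F)"
    unfolding Fun_simps
    by (rule nat_transI)
      (use lc_idn[OF D ftor_ob[OF F]] lc_idr[OF D ftor_ob[OF F] ftor_ob[OF F] ftor_mo[OF F]]
        lc_idl[OF D ftor_ob[OF F] ftor_ob[OF F] ftor_mo[OF F]] in auto)
next
  fix F G H \<eta> assume o: "F \<in> Obj (Fun C D)" "G \<in> Obj (Fun C D)" "H \<in> Obj (Fun C D)"
    and e: "\<eta> \<in> carrier (Mor (Fun C D) F G)"
  then have F: "is_functor C D F" "is_functor C D G" "is_functor C D H" by (auto simp: linear_functor_def)
  note oo = ftor_ob[OF F(1)] ftor_ob[OF F(2)] ftor_ob[OF F(3)]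
  have e: "\<eta> \<in> nat_trans C D F G" using e by simp
  show "(\<lambda>\<theta>. Cmp (Fun C D) F G H \<theta> \<eta>) \<in> lhom (Mor (Fun C D) G H) (Mor (Fun C D) F H)"
    by (rule lhomI)
      (use nat_trans_cmp[OF D F e] in \<open>auto intro!: restrict_ext simp: lhom_simps[OF lc_left[OF D oo nt_closed[OF e]]] nt_closed\<close>)
next
  fix F G H \<eta> assume o: "F \<in> Obj (Fun C D)" "G \<in> Obj (Fun C D)" "H \<in> Obj (Fun C D)"
    and e: "\<eta> \<in> carrier (Mor (Fun C D) G H)"
  then have F: "is_functor C D F" "is_functor C D G" "is_functor C D H" by (auto simp: linear_functor_def)
  note oo = ftor_ob[OF F(1)] ftor_ob[OF F(2)] ftor_ob[OF F(3)]
  have e: "\<eta> \<in> nat_trans C D G H" using e by simp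
  show "(\<lambda>\<theta>. Cmp (Fun C D) F G H \<eta> \<theta>) \<in> lhom (Mor (Fun C D) F G) (Mor (Fun C D) F H)"
    by (rule lhomI)
      (use nat_trans_cmp[OF D F _ e] in \<open>auto intro!: restrict_ext simp: lhom_simps[OF lc_right[OF D oo nt_closed[OF e]]] nt_closed\<close>)
next
  fix F G \<eta> assume o: "F \<in> Obj (Fun C D)" "G \<in> Obj (Fun C D)"
    and e: "\<eta> \<in> carrier (Mor (Fun C D) F G)"
  then have F: "is_functor C D F" "is_functor C D G" by (auto simp: linear_functor_def)
  have e: "\<eta> \<in> nat_trans C D F G" using e by simp
  note id = lc_idr[OF D ftor_ob[OF F(1)] ftor_ob[OF F(2)] nt_closed[OF e]]
    lc_idl[OF D ftor_ob[OF F(1)] ftor_ob[OF F(2)] nt_closed[OF e]]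
  show "Cmp (Fun C D) F F G \<eta> (Idn (Fun C D) F) = \<eta>" "Cmp (Fun C D) F G G (Idn (Fun C D) G) \<eta> = \<eta>"
    by (rule extensionalityI[OF _ nt_ext[OF e]]; simp add: id)+
next
  fix F G H K \<eta> \<theta> \<kappa> assume o: "F \<in> Obj (Fun C D)" "G \<in> Obj (Fun C D)" "H \<in> Obj (Fun C D)" "K \<in> Obj (Fun C D)"
    and e: "\<eta> \<in> carrier (Mor (Fun C D) F G)" "\<theta> \<in> carrier (Mor (Fun C D) G H)" "\<kappa> \<in> carrier (Mor (Fun C D) H K)"
  then have F: "is_functor C D F" "is_functor C D G" "is_functor C D H" "is_functor C D K" by (auto simp: linear_functor_def)
  show "Cmp (Fun C D) F H K \<kappa> (Cmp (Fun C D) F G H \<theta> \<eta>) = Cmp (Fun C D) F G K (Cmp (Fun C D) G H K \<kappa> \<theta>) \<eta>"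
    unfolding Fun_simps
  proof (rule restrict_ext)
    fix a assume a: "a \<in> Obj C"
    have e': "\<eta> a \<in> carrier (Mor D (ob F a) (ob G a))" "\<theta> a \<in> carrier (Mor D (ob G a) (ob H a))"
      "\<kappa> a \<in> carrier (Mor D (ob H a) (ob K a))"
      using e a by (auto dest: nt_closed)
    show "Cmp D (ob F a) (ob H a) (ob K a) (\<kappa> a) ((\<lambda>a\<in>Obj C. Cmp D (ob F a) (ob G a) (ob H a) (\<theta> a) (\<eta> a)) a) =
      Cmp D (ob F a) (ob G a) (ob K a) ((\<lambda>a\<in>Obj C. Cmp D (ob G a) (ob H a) (ob K a) (\<kappa> a) (\<theta> a)) a) (\<eta> a)"
      using a lc_assoc[OF D ftor_ob[OF F(1) a] ftor_ob[OF F(2) a] ftor_ob[OF F(3) a] ftor_ob[OF F(4) a] e'] by simp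
  qed
qed

lemma Vect_simps [simp]:
  "Obj Vect = {V. fdvs V}" "Mor Vect = Lin" "Idn Vect V = (\<lambda>x\<in>carrier V. x)"
  "Cmp Vect U V W g f = compose (carrier U) g f"
  by (simp_all add: Vect_def)

lemma Vect_linear_category: "linear_category (Vect :: ('k::field, ('k, 'u) module, 'u \<Rightarrow> 'u) lcat)"
  unfolding linear_category_def
proof (intro conjI ballI)
  fix U V W :: "('k, 'u) module" and f g
  assume o: "U \<in> Obj Vect" "V \<in> Obj Vect" "W \<in> Obj Vect"
  then have v: "vs U" "vs V" "vs W" by auto
  have cmp: "(\<lambda>x\<in>carrier U. g (f x)) \<in> lin U W" if "f \<in> lin U V" "g \<in> lin V W" for f g
    using lin_compose[OF that(1) lin_lhom[OF that(2)] v(1)] by (simp add: compose_def)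
  show "(\<lambda>g. Cmp Vect U V W g f) \<in> lhom (Mor Vect V W) (Mor Vect U W)" if "f \<in> carrier (Mor Vect U V)"
    by (rule lhomI) (use that v cmp in \<open>auto simp: compose_def lin_closed[of f U V] intro!: restrict_ext\<close>)
  show "(\<lambda>f. Cmp Vect U V W g f) \<in> lhom (Mor Vect U V) (Mor Vect U W)" if "g \<in> carrier (Mor Vect V W)"
    by (rule lhomI) (use that v cmp in \<open>auto simp: compose_def lin_closed[of _ U V] lin_simps[of g V W] intro!: restrict_ext\<close>)
next
  fix U V W X :: "('k, 'u) module" and f g h
  assume "f \<in> carrier (Mor Vect U V)"
  then have "f \<in> carrier U \<rightarrow> carrier V" by (auto simp: lin_closed)
  then show "Cmp Vect U W X h (Cmp Vect U V W g f) = Cmp Vect U V X (Cmp Vect V W X h g) f"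
    by (simp add: compose_assoc)
next
  fix U V :: "('k, 'u) module" and f assume "f \<in> carrier (Mor Vect U V)"
  then have f: "f \<in> carrier U \<rightarrow> carrier V" "f \<in> extensional (carrier U)" by (auto simp: lin_closed lin_ext)
  show "Cmp Vect U U V f (Idn Vect U) = f" "Cmp Vect U V V (Idn Vect V) f = f"
    using f by (auto simp: compose_Id Id_compose)
qed (auto intro!: lin_id)

section \<open>Isomorphisms and categories with duality\<close>

definition lc_iso :: "('k::field, 'o, 'm) lcat \<Rightarrow> 'o \<Rightarrow> 'o \<Rightarrow> 'm \<Rightarrow> bool" where
  "lc_iso C a b f \<longleftrightarrow> f \<in> carrier (Mor C a b) \<and>
     (\<exists>g\<in>carrier (Mor C b a). Cmp C a b a g f = Idn C a \<and> Cmp C b a b f g = Idn C b)"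

lemma lc_iso_left_bij:
  assumes C: "linear_category C" and o: "a \<in> Obj C" "b \<in> Obj C" "c \<in> Obj C" and f: "lc_iso C b c f"
  shows "bij_betw (\<lambda>g. Cmp C a b c f g) (carrier (Mor C a b)) (carrier (Mor C a c))"
proof -
  obtain h where h: "h \<in> carrier (Mor C c b)" "Cmp C b c b h f = Idn C b" "Cmp C c b c f h = Idn C c"
    and f: "f \<in> carrier (Mor C b c)" using f by (auto simp: lc_iso_def)
  show ?thesis
    by (rule bij_betw_byWitness[of _ "\<lambda>g. Cmp C a c b h g"])
      (use o h f in \<open>auto simp: lc_assoc[OF C, symmetric] lc_idl[OF C] lc_cmp[OF C]\<close>)
qed

lemma lc_iso_right_bij:
  assumes C: "linear_category C" and o: "a \<in> Obj C" "b \<in> Obj C" "c \<in> Obj C" and f: "lc_iso C a b f"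
  shows "bij_betw (\<lambda>g. Cmp C a b c g f) (carrier (Mor C b c)) (carrier (Mor C a c))"
proof -
  obtain h where h: "h \<in> carrier (Mor C b a)" "Cmp C a b a h f = Idn C a" "Cmp C b a b f h = Idn C b"
    and f: "f \<in> carrier (Mor C a b)" using f by (auto simp: lc_iso_def)
  show ?thesis
    by (rule bij_betw_byWitness[of _ "\<lambda>g. Cmp C b a c g h"])
      (use o h f in \<open>auto simp: lc_assoc[OF C] lc_idr[OF C] lc_cmp[OF C]\<close>)
qed

text \<open>A contravariant functor together with a natural isomorphism \<open>u\<close> from the
  identity to its square. These data force it to be bijective on morphisms.\<close>

locale duality =
  fixes C :: "('k::field, 'o, 'm) lcat" and dob :: "'o \<Rightarrow> 'o" and dmo :: "'o \<Rightarrow> 'o \<Rightarrow> 'm \<Rightarrow> 'm"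
    and u :: "'o \<Rightarrow> 'm"
  assumes C: "linear_category C"
    and dob [simp]: "a \<in> Obj C \<Longrightarrow> dob a \<in> Obj C"
    and dmo [simp]: "a \<in> Obj C \<Longrightarrow> b \<in> Obj C \<Longrightarrow> f \<in> carrier (Mor C a b) \<Longrightarrow>
      dmo a b f \<in> carrier (Mor C (dob b) (dob a))"
    and dmo_idn: "a \<in> Obj C \<Longrightarrow> dmo a a (Idn C a) = Idn C (dob a)"
    and dmo_cmp: "a \<in> Obj C \<Longrightarrow> b \<in> Obj C \<Longrightarrow> c \<in> Obj C \<Longrightarrow> f \<in> carrier (Mor C a b) \<Longrightarrow>
      g \<in> carrier (Mor C b c) \<Longrightarrow>
      dmo a c (Cmp C a b c g f) = Cmp C (dob c) (dob b) (dob a) (dmo a b f) (dmo b c g)"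
    and u_iso: "a \<in> Obj C \<Longrightarrow> lc_iso C a (dob (dob a)) (u a)"
    and u_natural: "a \<in> Obj C \<Longrightarrow> b \<in> Obj C \<Longrightarrow> f \<in> carrier (Mor C a b) \<Longrightarrow>
      Cmp C a (dob (dob a)) (dob (dob b)) (dmo (dob b) (dob a) (dmo a b f)) (u a) =
      Cmp C a b (dob (dob b)) (u b) f"
begin

lemma u_closed [simp]: "a \<in> Obj C \<Longrightarrow> u a \<in> carrier (Mor C a (dob (dob a)))"
  using u_iso by (simp add: lc_iso_def)

text \<open>By naturality of \<open>u\<close>, the dual of \<open>f\<close> determines
  \<open>u b\<close> composed with \<open>f\<close>, and the isomorphism \<open>u b\<close> can be
  cancelled.\<close>

lemma dmo_inj:
  assumes o: "a \<in> Obj C" "b \<in> Obj C"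
  shows "inj_on (dmo a b) (carrier (Mor C a b))"
proof (rule inj_onI)
  fix f g assume fg: "f \<in> carrier (Mor C a b)" "g \<in> carrier (Mor C a b)" "dmo a b f = dmo a b g"
  then have "Cmp C a b (dob (dob b)) (u b) f = Cmp C a b (dob (dob b)) (u b) g"
    using u_natural[OF o] by metis
  then show "f = g"
    using lc_iso_left_bij[OF C o dob[OF dob[OF o(2)]] u_iso[OF o(2)]] fg by (auto simp: bij_betw_def inj_on_def)
qed

text \<open>To reach \<open>w\<close>, conjugate its dual by the units: choose \<open>f\<close> such
  that \<open>u b\<close> after \<open>f\<close> equals the dual of \<open>w\<close> after
  \<open>u a\<close>. By naturality the double dual of \<open>f\<close> is then the dual of
  \<open>w\<close>, and \<open>dmo_inj\<close> for the dual objects removes one dual.\<close>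

lemma dmo_bij:
  assumes o: "a \<in> Obj C" "b \<in> Obj C"
  shows "bij_betw (dmo a b) (carrier (Mor C a b)) (carrier (Mor C (dob b) (dob a)))"
proof (rule bij_betw_imageI[OF dmo_inj[OF o]], safe)
  fix w assume w: "w \<in> carrier (Mor C (dob b) (dob a))"
  let ?w = "dmo (dob b) (dob a) w"
  note oo = dob[OF o(1)] dob[OF o(2)]
  note ooo = dob[OF oo(1)] dob[OF oo(2)]
  have wc: "?w \<in> carrier (Mor C (dob (dob a)) (dob (dob b)))" using w o by simp
  have "Cmp C a (dob (dob a)) (dob (dob b)) ?w (u a) \<in> carrier (Mor C a (dob (dob b)))"
    by (rule lc_cmp[OF C o(1) ooo u_closed[OF o(1)] wc])
  then obtain f where f: "f \<in> carrier (Mor C a b)"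
    "Cmp C a b (dob (dob b)) (u b) f = Cmp C a (dob (dob a)) (dob (dob b)) ?w (u a)"
    using bij_betw_imp_surj_on[OF lc_iso_left_bij[OF C o ooo(2) u_iso[OF o(2)]]] by (metis (no_types, lifting) imageE)
  have "Cmp C a (dob (dob a)) (dob (dob b)) (dmo (dob b) (dob a) (dmo a b f)) (u a) =
    Cmp C a (dob (dob a)) (dob (dob b)) ?w (u a)"
    using u_natural[OF o f(1)] f(2) by simp
  then have "dmo (dob b) (dob a) (dmo a b f) = ?w"
    using lc_iso_right_bij[OF C o(1) ooo u_iso[OF o(1)]] wc dmo[OF oo(2,1) dmo[OF o f(1)]]
    by (auto simp: bij_betw_def inj_on_def)
  then have "dmo a b f = w"
    using dmo_inj[OF oo(2,1)] w dmo[OF o f(1)] by (auto simp: inj_on_def)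
  then show "w \<in> dmo a b ` carrier (Mor C a b)" using f by blast
qed (use o in simp)

end

text \<open>Conjugating a right adjoint of \<open>L\<close> by dualities which commute with \<open>L\<close> gives a left adjoint of \<open>L\<close>.\<close>

lemma adjoint_by_duality:
  fixes A :: "('k::field, 'o, 'm) lcat" and P :: "('k, 'p, 'q) lcat"
  assumes A: "duality A da dam ua" and P: "duality P dp dpm up" and adj: "adjoint A P L R"
    and s: "\<And>f. f \<in> Obj A \<Longrightarrow> lc_iso P (ob L (da f)) (dp (ob L f)) (s f)"
    and sn: "\<And>f g v. f \<in> Obj A \<Longrightarrow> g \<in> Obj A \<Longrightarrow> v \<in> carrier (Mor A f g) \<Longrightarrow>
      Cmp P (ob L (da g)) (ob L (da f)) (dp (ob L f)) (s f) (mo L (da g) (da f) (dam f g v)) =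
      Cmp P (ob L (da g)) (dp (ob L g)) (dp (ob L f)) (dpm (ob L f) (ob L g) (mo L f g v)) (s g)"
  shows "adjoint P A \<lparr> ob = (\<lambda>F. da (ob R (dp F))),
     mo = (\<lambda>F G \<alpha>. dam (ob R (dp G)) (ob R (dp F)) (mo R (dp G) (dp F) (dpm F G \<alpha>))) \<rparr> L"
proof -
  interpret A: duality A da dam ua by fact
  interpret P: duality P dp dpm up by fact
  have L: "is_functor A P L" and R: "is_functor P A R" using adj by (auto simp: adjoint_def)
  obtain \<phi> where bij: "\<And>c d. c \<in> Obj A \<Longrightarrow> d \<in> Obj P \<Longrightarrow>
      bij_betw (\<phi> c d) (carrier (Mor P (ob L c) d)) (carrier (Mor A c (ob R d)))"
    and nat: "\<And>c c' d d' u v g. c \<in> Obj A \<Longrightarrow> c' \<in> Obj A \<Longrightarrow> d \<in> Obj P \<Longrightarrow> d' \<in> Obj P \<Longrightarrow>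
      u \<in> carrier (Mor A c' c) \<Longrightarrow> v \<in> carrier (Mor P d d') \<Longrightarrow> g \<in> carrier (Mor P (ob L c) d) \<Longrightarrow>
      \<phi> c' d' (Cmp P (ob L c') d d' v (Cmp P (ob L c') (ob L c) d g (mo L c' c u))) =
      Cmp A c' (ob R d) (ob R d') (mo R d d' v) (Cmp A c' c (ob R d) (\<phi> c d g) u)"
    using adj unfolding adjoint_def by metis
  note oL [simp] = ftor_ob[OF L] and oR [simp] = ftor_ob[OF R]
  note mL [simp] = ftor_mo[OF L] and mR [simp] = ftor_mo[OF R]
  note cA [simp] = lc_cmp[OF A.C] and cP [simp] = lc_cmp[OF P.C]
  have sc [simp]: "s f \<in> carrier (Mor P (ob L (da f)) (dp (ob L f)))" if "f \<in> Obj A" for f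
    using s[OF that] by (simp add: lc_iso_def)
  define K where "K F = ob R (dp F)" for F
  have oK [simp]: "K F \<in> Obj A" if "F \<in> Obj P" for F using that by (simp add: K_def)
  \<comment> \<open>Write D for both dualities. This is the chain Hom(F, L f) \<cong> Hom(D(L f), D
    F) \<cong> Hom(L(D f), D F) \<cong> Hom(D f, K F) \<cong> Hom(D f, D(D(K F))), given by duality,
    by \<open>s\<close>, by the adjunction and by the unit. The last space is also the dual form of
    Hom(D(K F), f), which is the Hom space wanted.\<close>
  define \<Psi> where "\<Psi> F f \<gamma> = Cmp A (da f) (K F) (da (da (K F))) (ua (K F))
    (\<phi> (da f) (dp F) (Cmp P (ob L (da f)) (dp (ob L f)) (dp F) (dpm F (ob L f) \<gamma>) (s f)))" for F f \<gamma>
  have \<Psi>: "bij_betw (\<Psi> F f) (carrier (Mor P F (ob L f))) (carrier (Mor A (da f) (da (da (K F)))))"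
    if o: "F \<in> Obj P" "f \<in> Obj A" for F f
  proof -
    have "bij_betw ((\<lambda>h. Cmp A (da f) (K F) (da (da (K F))) (ua (K F)) h) \<circ> \<phi> (da f) (dp F) \<circ>
        (\<lambda>h. Cmp P (ob L (da f)) (dp (ob L f)) (dp F) h (s f)) \<circ> dpm F (ob L f))
      (carrier (Mor P F (ob L f))) (carrier (Mor A (da f) (da (da (K F)))))"
    proof (intro bij_betw_trans)
      show "bij_betw (dpm F (ob L f)) (carrier (Mor P F (ob L f))) (carrier (Mor P (dp (ob L f)) (dp F)))"
        by (rule P.dmo_bij) (use o in auto)
      show "bij_betw (\<lambda>h. Cmp P (ob L (da f)) (dp (ob L f)) (dp F) h (s f))
          (carrier (Mor P (dp (ob L f)) (dp F))) (carrier (Mor P (ob L (da f)) (dp F)))"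
        by (rule lc_iso_right_bij[OF P.C]) (use o s in auto)
      show "bij_betw (\<phi> (da f) (dp F)) (carrier (Mor P (ob L (da f)) (dp F))) (carrier (Mor A (da f) (K F)))"
        unfolding K_def by (rule bij) (use o in auto)
      show "bij_betw (\<lambda>h. Cmp A (da f) (K F) (da (da (K F))) (ua (K F)) h)
          (carrier (Mor A (da f) (K F))) (carrier (Mor A (da f) (da (da (K F)))))"
        by (rule lc_iso_left_bij[OF A.C]) (use o A.u_iso in auto)
    qed
    then show ?thesis by (simp add: \<Psi>_def[abs_def] comp_def)
  qed
  define T where "T = \<lparr> ob = (\<lambda>F. da (ob R (dp F))),
     mo = (\<lambda>F G \<alpha>. dam (ob R (dp G)) (ob R (dp F)) (mo R (dp G) (dp F) (dpm F G \<alpha>))) \<rparr>"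
  have T: "ob T F = da (K F)" "mo T F G \<alpha> = dam (K G) (K F) (mo R (dp G) (dp F) (dpm F G \<alpha>))" for F G \<alpha>
    by (simp_all add: T_def K_def)
  have RD [simp]: "mo R (dp G) (dp F) (dpm F G \<alpha>) \<in> carrier (Mor A (K G) (K F))"
    if "F \<in> Obj P" "G \<in> Obj P" "\<alpha> \<in> carrier (Mor P F G)" for F G \<alpha>
    using that by (simp add: K_def)
  have "is_functor P A T"
    unfolding is_functor_def
  proof (intro conjI ballI)
    show "mo T F F (Idn P F) = Idn A (ob T F)" if "F \<in> Obj P" for F
      unfolding T K_def using that by (simp add: P.dmo_idn ftor_idn[OF R] A.dmo_idn)
    fix F G H \<alpha> \<beta> assume o: "F \<in> Obj P" "G \<in> Obj P" "H \<in> Obj P"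
      and m: "\<alpha> \<in> carrier (Mor P F G)" "\<beta> \<in> carrier (Mor P G H)"
    have "mo R (dp H) (dp F) (dpm F H (Cmp P F G H \<beta> \<alpha>)) =
      Cmp A (K H) (K G) (K F) (mo R (dp G) (dp F) (dpm F G \<alpha>)) (mo R (dp H) (dp G) (dpm G H \<beta>))"
      using o m by (simp add: P.dmo_cmp ftor_cmp[OF R] K_def)
    then show "mo T F H (Cmp P F G H \<beta> \<alpha>) = Cmp A (ob T F) (ob T G) (ob T H) (mo T G H \<beta>) (mo T F G \<alpha>)"
      using o m by (simp add: T A.dmo_cmp)
  qed (auto simp: T)
  moreover have "\<exists>\<phi>'. (\<forall>c\<in>Obj P. \<forall>d\<in>Obj A.
      bij_betw (\<phi>' c d) (carrier (Mor A (ob T c) d)) (carrier (Mor P c (ob L d)))) \<and>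
    (\<forall>c\<in>Obj P. \<forall>c'\<in>Obj P. \<forall>d\<in>Obj A. \<forall>d'\<in>Obj A.
      \<forall>u\<in>carrier (Mor P c' c). \<forall>v\<in>carrier (Mor A d d'). \<forall>g\<in>carrier (Mor A (ob T c) d).
        \<phi>' c' d' (Cmp A (ob T c') d d' v (Cmp A (ob T c') (ob T c) d g (mo T c' c u))) =
        Cmp P c' (ob L d) (ob L d') (mo L d d' v) (Cmp P c' c (ob L d) (\<phi>' c d g) u))"
  proof -
    \<comment> \<open>The definition of \<open>adjoint\<close> asks for a map out of Hom(T F, f). So
      \<open>\<beta>\<close> is dualized first and the chain \<open>\<Psi>\<close> is run
      backwards.\<close>
    define \<phi>' where "\<phi>' F f \<beta> = inv_into (carrier (Mor P F (ob L f))) (\<Psi> F f) (dam (da (K F)) f \<beta>)" for F f \<beta>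
    have bij': "bij_betw (\<phi>' F f) (carrier (Mor A (ob T F) f)) (carrier (Mor P F (ob L f)))"
      if o: "F \<in> Obj P" "f \<in> Obj A" for F f
    proof -
      have "bij_betw (inv_into (carrier (Mor P F (ob L f))) (\<Psi> F f) \<circ> dam (da (K F)) f)
          (carrier (Mor A (ob T F) f)) (carrier (Mor P F (ob L f)))"
        by (rule bij_betw_trans[OF _ bij_betw_inv_into[OF \<Psi>[OF o]]]) (use A.dmo_bij o in \<open>simp add: T\<close>)
      then show ?thesis by (simp add: \<phi>'_def[abs_def] comp_def)
    qed
    have \<Psi>\<phi>: "\<Psi> F f (\<phi>' F f \<beta>) = dam (da (K F)) f \<beta>"
      if "F \<in> Obj P" "f \<in> Obj A" "\<beta> \<in> carrier (Mor A (ob T F) f)" for F f \<beta>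
      using \<Psi>[OF that(1,2)] A.dmo_bij[of "da (K F)" f] that
      by (auto simp: \<phi>'_def T bij_betw_def intro!: f_inv_into_f)
    have nat': "\<phi>' F' f' (Cmp A (ob T F') f f' v (Cmp A (ob T F') (ob T F) f \<beta> (mo T F' F \<alpha>))) =
        Cmp P F' (ob L f) (ob L f') (mo L f f' v) (Cmp P F' F (ob L f) (\<phi>' F f \<beta>) \<alpha>)"
      if o [simp]: "F \<in> Obj P" "F' \<in> Obj P" "f \<in> Obj A" "f' \<in> Obj A"
        and m [simp]: "\<alpha> \<in> carrier (Mor P F' F)" "v \<in> carrier (Mor A f f')" "\<beta> \<in> carrier (Mor A (ob T F) f)"
      for F F' f f' \<alpha> v \<beta>
    proof -
      define \<gamma> where "\<gamma> = \<phi>' F f \<beta>"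
      have \<gamma> [simp]: "\<gamma> \<in> carrier (Mor P F (ob L f))"
        using bij'[OF o(1,3)] m(3) by (auto simp: \<gamma>_def bij_betw_def)
      have \<beta> [simp]: "\<beta> \<in> carrier (Mor A (da (K F)) f)" using m(3) by (simp add: T)
      let ?\<gamma> = "Cmp P F' (ob L f) (ob L f') (mo L f f' v) (Cmp P F' F (ob L f) \<gamma> \<alpha>)"
      let ?\<beta> = "Cmp A (ob T F') f f' v (Cmp A (ob T F') (ob T F) f \<beta> (mo T F' F \<alpha>))"
      let ?r = "mo R (dp F) (dp F') (dpm F' F \<alpha>)"
      let ?g = "Cmp P (ob L (da f)) (dp (ob L f)) (dp F) (dpm F (ob L f) \<gamma>) (s f)"
      have fg [simp]: "\<phi> (da f) (dp F) ?g \<in> carrier (Mor A (da f) (K F))"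
        using bij[of "da f" "dp F"] by (auto simp: K_def bij_betw_def)
      have \<beta>c: "?\<beta> \<in> carrier (Mor A (ob T F') f')" by (simp add: T)
      \<comment> \<open>Naturality is checked after applying \<open>\<Psi>\<close>, which is
        injective and has an explicit formula. The calculation combines naturality of
        \<open>s\<close> (assumption \<open>sn\<close>), of \<open>\<phi>\<close> and of the unit
        \<open>ua\<close>.\<close>
      have "\<Psi> F' f' ?\<gamma> = dam (da (K F')) f' ?\<beta>"
      proof -
        have 1: "Cmp P (ob L (da f')) (dp (ob L f')) (dp F') (dpm F' (ob L f') ?\<gamma>) (s f') =
          Cmp P (ob L (da f')) (dp F) (dp F') (dpm F' F \<alpha>) (Cmp P (ob L (da f')) (ob L (da f)) (dp F) ?g
            (mo L (da f') (da f) (dam f f' v)))"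
          by (simp add: P.dmo_cmp lc_assoc[OF P.C] sn)
        have "\<Psi> F' f' ?\<gamma> = Cmp A (da f') (K F') (da (da (K F'))) (ua (K F'))
           (Cmp A (da f') (K F) (K F') ?r (Cmp A (da f') (da f) (K F) (\<phi> (da f) (dp F) ?g) (dam f f' v)))"
          unfolding \<Psi>_def 1 by (subst nat[of "da f" "da f'" "dp F" "dp F'"]) (simp_all add: K_def)
        also have "\<dots> = Cmp A (da f') (K F) (da (da (K F'))) (Cmp A (K F) (K F') (da (da (K F'))) (ua (K F')) ?r)
           (Cmp A (da f') (da f) (K F) (\<phi> (da f) (dp F) ?g) (dam f f' v))"
          by (simp add: lc_assoc[OF A.C])
        also have "\<dots> = Cmp A (da f') (K F) (da (da (K F')))
           (Cmp A (K F) (da (da (K F))) (da (da (K F'))) (dam (da (K F')) (da (K F)) (dam (K F) (K F') ?r)) (ua (K F)))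
           (Cmp A (da f') (da f) (K F) (\<phi> (da f) (dp F) ?g) (dam f f' v))"
          by (subst A.u_natural) simp_all
        also have "\<dots> = Cmp A (da f') (da (da (K F))) (da (da (K F'))) (dam (da (K F')) (da (K F)) (mo T F' F \<alpha>))
           (Cmp A (da f') (da f) (da (da (K F))) (\<Psi> F f \<gamma>) (dam f f' v))"
          by (simp add: \<Psi>_def lc_assoc[OF A.C] T)
        also have "\<Psi> F f \<gamma> = dam (da (K F)) f \<beta>" unfolding \<gamma>_def by (rule \<Psi>\<phi>) simp_all
        also have "Cmp A (da f') (da (da (K F))) (da (da (K F'))) (dam (da (K F')) (da (K F)) (mo T F' F \<alpha>))
           (Cmp A (da f') (da f) (da (da (K F))) (dam (da (K F)) f \<beta>) (dam f f' v)) = dam (da (K F')) f' ?\<beta>"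
          by (simp add: T A.dmo_cmp lc_assoc[OF A.C])
        finally show ?thesis .
      qed
      then have "\<Psi> F' f' ?\<gamma> = \<Psi> F' f' (\<phi>' F' f' ?\<beta>)"
        by (simp only: \<Psi>\<phi>[OF o(2,4) \<beta>c])
      moreover have "\<phi>' F' f' ?\<beta> \<in> carrier (Mor P F' (ob L f'))"
        using bij'[OF o(2,4)] \<beta>c by (auto simp: bij_betw_def)
      ultimately have "?\<gamma> = \<phi>' F' f' ?\<beta>"
        using \<Psi>[OF o(2,4)] unfolding bij_betw_def by (metis \<gamma> cP inj_onD m(1) m(2) mL o oL)
      then show ?thesis by (simp add: \<gamma>_def)
    qed
    show ?thesis by (rule exI[of _ \<phi>']) (use bij' nat' in blast)
  qed
  ultimately have "adjoint P A T L"
    unfolding adjoint_def using A.C P.C L by blast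
  then show ?thesis by (simp only: T_def)
qed

section \<open>Linear functors with values in vector spaces\<close>

text \<open>The closure properties of a linear category. \<open>Gam n\<close> is treated through
  this predicate: the laws of a linear functor into \<open>Vect\<close> are equations between
  vectors, and functor categories take their associativity from \<open>Vect\<close>.\<close>

definition lc_pre :: "('k::field, 'o, 'm) lcat \<Rightarrow> bool" where
  "lc_pre C \<longleftrightarrow> (\<forall>a\<in>Obj C. \<forall>b\<in>Obj C. vs (Mor C a b)) \<and> (\<forall>a\<in>Obj C. Idn C a \<in> carrier (Mor C a a)) \<and>
     (\<forall>a\<in>Obj C. \<forall>b\<in>Obj C. \<forall>c\<in>Obj C. \<forall>f\<in>carrier (Mor C a b). \<forall>g\<in>carrier (Mor C b c).
        Cmp C a b c g f \<in> carrier (Mor C a c))"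

lemma linear_category_pre: "linear_category C \<Longrightarrow> lc_pre C"
  by (simp add: lc_pre_def lc_vs lc_idn lc_cmp)

lemma lc_preD:
  assumes "lc_pre C"
  shows "a \<in> Obj C \<Longrightarrow> b \<in> Obj C \<Longrightarrow> vs (Mor C a b)"
    "a \<in> Obj C \<Longrightarrow> Idn C a \<in> carrier (Mor C a a)"
    "a \<in> Obj C \<Longrightarrow> b \<in> Obj C \<Longrightarrow> c \<in> Obj C \<Longrightarrow> f \<in> carrier (Mor C a b) \<Longrightarrow> g \<in> carrier (Mor C b c) \<Longrightarrow>
      Cmp C a b c g f \<in> carrier (Mor C a c)"
  using assms by (simp_all add: lc_pre_def)

text \<open>The laws are asked for vector by vector; since the maps \<open>mo F a b f\<close> are
  extensional, this yields the equations between linear maps.\<close>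

lemma linear_functor_VectI:
  assumes C: "lc_pre C" and o: "\<And>a. a \<in> Obj C \<Longrightarrow> fdvs (ob F a)"
    and m: "\<And>a b f. a \<in> Obj C \<Longrightarrow> b \<in> Obj C \<Longrightarrow> f \<in> carrier (Mor C a b) \<Longrightarrow> mo F a b f \<in> lin (ob F a) (ob F b)"
    and i: "\<And>a x. a \<in> Obj C \<Longrightarrow> x \<in> carrier (ob F a) \<Longrightarrow> mo F a a (Idn C a) x = x"
    and c: "\<And>a b c f g x. a \<in> Obj C \<Longrightarrow> b \<in> Obj C \<Longrightarrow> c \<in> Obj C \<Longrightarrow> f \<in> carrier (Mor C a b) \<Longrightarrow>
      g \<in> carrier (Mor C b c) \<Longrightarrow> x \<in> carrier (ob F a) \<Longrightarrow>
      mo F a c (Cmp C a b c g f) x = mo F b c g (mo F a b f x)"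
    and a: "\<And>a b f g x. a \<in> Obj C \<Longrightarrow> b \<in> Obj C \<Longrightarrow> f \<in> carrier (Mor C a b) \<Longrightarrow> g \<in> carrier (Mor C a b) \<Longrightarrow>
      x \<in> carrier (ob F a) \<Longrightarrow> mo F a b (f \<oplus>\<^bsub>Mor C a b\<^esub> g) x = mo F a b f x \<oplus>\<^bsub>ob F b\<^esub> mo F a b g x"
    and s: "\<And>a b f r x. a \<in> Obj C \<Longrightarrow> b \<in> Obj C \<Longrightarrow> f \<in> carrier (Mor C a b) \<Longrightarrow>
      x \<in> carrier (ob F a) \<Longrightarrow> mo F a b (r \<odot>\<^bsub>Mor C a b\<^esub> f) x = r \<odot>\<^bsub>ob F b\<^esub> mo F a b f x"
  shows "linear_functor C Vect F"
proof -
  note P = lc_preD[OF C]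
  have e: "mo F a b f = (\<lambda>x\<in>carrier (ob F a). g x)"
    if "a \<in> Obj C" "b \<in> Obj C" "f \<in> carrier (Mor C a b)" "\<And>x. x \<in> carrier (ob F a) \<Longrightarrow> mo F a b f x = g x"
    for a b f g
    using that by (intro extensionalityI[OF lin_ext[OF m] restrict_extensional]) auto
  show ?thesis
    unfolding linear_functor_def is_functor_def Vect_simps
  proof (intro conjI ballI)
    fix a b assume ab: "a \<in> Obj C" "b \<in> Obj C"
    show "mo F a b \<in> lhom (Mor C a b) (Lin (ob F a) (ob F b))"
      by (rule lhomI) (use P ab m a s in \<open>auto intro!: e\<close>)
  qed (use o m P in \<open>auto intro!: e i c simp: compose_def\<close>)
qed

lemma LF:
  assumes F: "linear_functor C (Vect :: ('k::field, ('k, 'u) module, 'u \<Rightarrow> 'u) lcat) F"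
  shows LF_fdvs: "a \<in> Obj C \<Longrightarrow> fdvs (ob F a)"
    and LF_lin: "a \<in> Obj C \<Longrightarrow> b \<in> Obj C \<Longrightarrow> f \<in> carrier (Mor C a b) \<Longrightarrow> mo F a b f \<in> lin (ob F a) (ob F b)"
    and LF_closed: "a \<in> Obj C \<Longrightarrow> b \<in> Obj C \<Longrightarrow> f \<in> carrier (Mor C a b) \<Longrightarrow> x \<in> carrier (ob F a) \<Longrightarrow>
      mo F a b f x \<in> carrier (ob F b)"
    and LF_idn: "a \<in> Obj C \<Longrightarrow> x \<in> carrier (ob F a) \<Longrightarrow> mo F a a (Idn C a) x = x"
    and LF_cmp: "a \<in> Obj C \<Longrightarrow> b \<in> Obj C \<Longrightarrow> c \<in> Obj C \<Longrightarrow> f \<in> carrier (Mor C a b) \<Longrightarrow>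
      g \<in> carrier (Mor C b c) \<Longrightarrow> x \<in> carrier (ob F a) \<Longrightarrow>
      mo F a c (Cmp C a b c g f) x = mo F b c g (mo F a b f x)"
    and LF_cmp': "a \<in> Obj C \<Longrightarrow> b \<in> Obj C \<Longrightarrow> c \<in> Obj C \<Longrightarrow> f \<in> carrier (Mor C a b) \<Longrightarrow>
      g \<in> carrier (Mor C b c) \<Longrightarrow> mo F a c (Cmp C a b c g f) = compose (carrier (ob F a)) (mo F b c g) (mo F a b f)"
    and LF_lhom: "a \<in> Obj C \<Longrightarrow> b \<in> Obj C \<Longrightarrow> mo F a b \<in> lhom (Mor C a b) (Lin (ob F a) (ob F b))"
    and LF_add: "a \<in> Obj C \<Longrightarrow> b \<in> Obj C \<Longrightarrow> f \<in> carrier (Mor C a b) \<Longrightarrow> g \<in> carrier (Mor C a b) \<Longrightarrow>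
      x \<in> carrier (ob F a) \<Longrightarrow> mo F a b (f \<oplus>\<^bsub>Mor C a b\<^esub> g) x = mo F a b f x \<oplus>\<^bsub>ob F b\<^esub> mo F a b g x"
    and LF_smult: "a \<in> Obj C \<Longrightarrow> b \<in> Obj C \<Longrightarrow> f \<in> carrier (Mor C a b) \<Longrightarrow>
      x \<in> carrier (ob F a) \<Longrightarrow> mo F a b (r \<odot>\<^bsub>Mor C a b\<^esub> f) x = r \<odot>\<^bsub>ob F b\<^esub> mo F a b f x"
proof -
  note F1 = linear_functorD(1)[OF F] and F2 = linear_functorD(2)[OF F]
  show "a \<in> Obj C \<Longrightarrow> fdvs (ob F a)" using ftor_ob[OF F1] by simp
  show l: "a \<in> Obj C \<Longrightarrow> b \<in> Obj C \<Longrightarrow> f \<in> carrier (Mor C a b) \<Longrightarrow> mo F a b f \<in> lin (ob F a) (ob F b)" for a b f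
    using ftor_mo[OF F1] by simp
  show "a \<in> Obj C \<Longrightarrow> b \<in> Obj C \<Longrightarrow> f \<in> carrier (Mor C a b) \<Longrightarrow> x \<in> carrier (ob F a) \<Longrightarrow>
      mo F a b f x \<in> carrier (ob F b)" using lin_closed[OF l] .
  show "a \<in> Obj C \<Longrightarrow> x \<in> carrier (ob F a) \<Longrightarrow> mo F a a (Idn C a) x = x"
    using ftor_idn[OF F1] by simp
  show "a \<in> Obj C \<Longrightarrow> b \<in> Obj C \<Longrightarrow> c \<in> Obj C \<Longrightarrow> f \<in> carrier (Mor C a b) \<Longrightarrow>
      g \<in> carrier (Mor C b c) \<Longrightarrow> x \<in> carrier (ob F a) \<Longrightarrow>
      mo F a c (Cmp C a b c g f) x = mo F b c g (mo F a b f x)"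
    using ftor_cmp[OF F1] by (simp add: compose_def)
  show "a \<in> Obj C \<Longrightarrow> b \<in> Obj C \<Longrightarrow> c \<in> Obj C \<Longrightarrow> f \<in> carrier (Mor C a b) \<Longrightarrow>
      g \<in> carrier (Mor C b c) \<Longrightarrow> mo F a c (Cmp C a b c g f) = compose (carrier (ob F a)) (mo F b c g) (mo F a b f)"
    using ftor_cmp[OF F1] by simp
  show h: "a \<in> Obj C \<Longrightarrow> b \<in> Obj C \<Longrightarrow> mo F a b \<in> lhom (Mor C a b) (Lin (ob F a) (ob F b))"
    using F2 by simp
  show "a \<in> Obj C \<Longrightarrow> b \<in> Obj C \<Longrightarrow> f \<in> carrier (Mor C a b) \<Longrightarrow> g \<in> carrier (Mor C a b) \<Longrightarrow>
      x \<in> carrier (ob F a) \<Longrightarrow> mo F a b (f \<oplus>\<^bsub>Mor C a b\<^esub> g) x = mo F a b f x \<oplus>\<^bsub>ob F b\<^esub> mo F a b g x"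
    using lhom_add[OF h] by simp
  show "a \<in> Obj C \<Longrightarrow> b \<in> Obj C \<Longrightarrow> f \<in> carrier (Mor C a b) \<Longrightarrow>
      x \<in> carrier (ob F a) \<Longrightarrow> mo F a b (r \<odot>\<^bsub>Mor C a b\<^esub> f) x = r \<odot>\<^bsub>ob F b\<^esub> mo F a b f x"
    using lhom_smult[OF h] by simp
qed

lemma nt_lin: "\<eta> \<in> nat_trans C Vect F G \<Longrightarrow> a \<in> Obj C \<Longrightarrow> \<eta> a \<in> lin (ob F a) (ob G a)"
  using nt_closed[of \<eta> C Vect F G a] by simp

lemma nt_app_closed: "\<eta> \<in> nat_trans C Vect F G \<Longrightarrow> a \<in> Obj C \<Longrightarrow> x \<in> carrier (ob F a) \<Longrightarrow> \<eta> a x \<in> carrier (ob G a)"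
  using lin_closed[OF nt_lin, of \<eta> C F G a x] by simp

lemma nt_app_natural:
  "\<eta> \<in> nat_trans C Vect F G \<Longrightarrow> a \<in> Obj C \<Longrightarrow> b \<in> Obj C \<Longrightarrow> f \<in> carrier (Mor C a b) \<Longrightarrow>
    x \<in> carrier (ob F a) \<Longrightarrow> mo G a b f (\<eta> a x) = \<eta> b (mo F a b f x)"
  using fun_cong[OF nt_natural[of \<eta> C Vect F G a b f], of x] by (simp add: compose_def)

lemma nat_trans_VectI:
  assumes "\<eta> \<in> extensional (Obj C)" "\<And>a. a \<in> Obj C \<Longrightarrow> \<eta> a \<in> lin (ob F a) (ob G a)"
    "\<And>a b f x. a \<in> Obj C \<Longrightarrow> b \<in> Obj C \<Longrightarrow> f \<in> carrier (Mor C a b) \<Longrightarrow> x \<in> carrier (ob F a) \<Longrightarrow>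
      mo G a b f (\<eta> a x) = \<eta> b (mo F a b f x)"
  shows "\<eta> \<in> nat_trans C Vect F G"
  by (rule nat_transI) (use assms in \<open>auto simp: compose_def intro!: restrict_ext\<close>)

lemma nt_eqI:
  assumes "\<eta> \<in> nat_trans C Vect F G" "\<theta> \<in> nat_trans C Vect F H"
    "\<And>a x. a \<in> Obj C \<Longrightarrow> x \<in> carrier (ob F a) \<Longrightarrow> \<eta> a x = \<theta> a x"
  shows "\<eta> = \<theta>"
  by (rule extensionalityI[OF nt_ext[OF assms(1)] nt_ext[OF assms(2)]])
    (rule lin_eqI[OF nt_lin[OF assms(1)] nt_lin[OF assms(2)]]; use assms(3) in simp)

lemma Fun_Cmp_apply [simp]:
  "a \<in> Obj C \<Longrightarrow> x \<in> carrier (ob F a) \<Longrightarrow> Cmp (Fun C Vect) F G H \<theta> \<eta> a x = \<theta> a (\<eta> a x)"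
  by (simp add: compose_def)

lemma nt_cmp:
  "linear_functor C Vect F \<Longrightarrow> linear_functor C Vect G \<Longrightarrow> linear_functor C Vect H \<Longrightarrow>
    \<eta> \<in> nat_trans C Vect F G \<Longrightarrow> \<theta> \<in> nat_trans C Vect G H \<Longrightarrow>
    Cmp (Fun C Vect) F G H \<theta> \<eta> \<in> nat_trans C Vect F H"
  using lc_cmp[OF Fun_linear_category[OF Vect_linear_category, of C], of F G H \<eta> \<theta>] by simp

lemma lin_inv:
  assumes "f \<in> lin V W" "bij_betw f (carrier V) (carrier W)" "vs V" "vs W"
  defines "g \<equiv> restrict (inv_into (carrier V) f) (carrier W)"
  shows "g \<in> lin W V" "\<And>x. x \<in> carrier V \<Longrightarrow> g (f x) = x" "\<And>y. y \<in> carrier W \<Longrightarrow> f (g y) = y"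
  using lin_restrict[OF lhom_inv[OF lin_lhom[OF assms(1)] assms(2,3)] assms(4)] assms(1,2)
  by (auto simp: g_def bij_betw_def f_inv_into_f)

lemma nat_iso:
  assumes F: "linear_functor C Vect F" and G: "linear_functor C Vect G" and e: "\<eta> \<in> nat_trans C Vect F G"
    and bij: "\<And>a. a \<in> Obj C \<Longrightarrow> bij_betw (\<eta> a) (carrier (ob F a)) (carrier (ob G a))"
  shows "lc_iso (Fun C Vect) F G \<eta>"
proof -
  define \<theta> where "\<theta> = (\<lambda>a\<in>Obj C. restrict (inv_into (carrier (ob F a)) (\<eta> a)) (carrier (ob G a)))"
  have I: "\<theta> a \<in> lin (ob G a) (ob F a)" "\<And>x. x \<in> carrier (ob F a) \<Longrightarrow> \<theta> a (\<eta> a x) = x"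
    "\<And>y. y \<in> carrier (ob G a) \<Longrightarrow> \<eta> a (\<theta> a y) = y" if "a \<in> Obj C" for a
    using lin_inv[OF nt_lin[OF e that] bij[OF that]] LF_fdvs[OF F that] LF_fdvs[OF G that] that
    by (auto simp: \<theta>_def)
  have t: "\<theta> \<in> nat_trans C Vect G F"
  proof (rule nat_trans_VectI)
    fix a b f y assume A: "a \<in> Obj C" "b \<in> Obj C" "f \<in> carrier (Mor C a b)" "y \<in> carrier (ob G a)"
    have "\<theta> b (mo G a b f (\<eta> a (\<theta> a y))) = \<theta> b (\<eta> b (mo F a b f (\<theta> a y)))"
      using nt_app_natural[OF e A(1-3) lin_closed[OF I(1)[OF A(1)] A(4)]] by simp
    then show "mo F a b f (\<theta> a y) = \<theta> b (mo G a b f y)"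
      using A I LF_closed[OF F] lin_closed[OF I(1)[OF A(1)]] by simp
  qed (use I in \<open>auto simp: \<theta>_def\<close>)
  note L = Fun_linear_category[OF Vect_linear_category, of C]
  have "Cmp (Fun C Vect) F G F \<theta> \<eta> = Idn (Fun C Vect) F" "Cmp (Fun C Vect) G F G \<eta> \<theta> = Idn (Fun C Vect) G"
    by (rule nt_eqI[of _ C _ _ _ _]; use nt_cmp[OF F G F e t] nt_cmp[OF G F G t e] lc_idn[OF L, of F]
        lc_idn[OF L, of G] F G I in \<open>simp add: compose_def\<close>)+
  then show ?thesis
    unfolding lc_iso_def using e t by auto
qed

text \<open>A contravariant linear endofunctor \<open>d\<close> of the source category whose square
  is isomorphic to the identity by \<open>ev\<close>. Then sending F to the dual of F after
  \<open>d\<close> is a duality on the functor category. It is instantiated for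
  \<open>Rep n\<close>, giving \<open>DA\<close>, and for \<open>Gam n\<close>, giving
  \<open>DP\<close>.\<close>

locale cat_duality = univ \<iota>
  for \<iota> :: "'k::field list \<Rightarrow> 'u" +
  fixes C :: "('k, 'o, 'm) lcat" and d :: "('o, 'm, 'o, 'm) ftor" and ev :: "'o \<Rightarrow> 'm"
  assumes C: "lc_pre C"
    and dob [simp]: "a \<in> Obj C \<Longrightarrow> ob d a \<in> Obj C"
    and dmo: "a \<in> Obj C \<Longrightarrow> b \<in> Obj C \<Longrightarrow> mo d a b \<in> lhom (Mor C a b) (Mor C (ob d b) (ob d a))"
    and d_idn: "a \<in> Obj C \<Longrightarrow> mo d a a (Idn C a) = Idn C (ob d a)"
    and d_cmp: "a \<in> Obj C \<Longrightarrow> b \<in> Obj C \<Longrightarrow> c \<in> Obj C \<Longrightarrow> f \<in> carrier (Mor C a b) \<Longrightarrow>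
      g \<in> carrier (Mor C b c) \<Longrightarrow>
      mo d a c (Cmp C a b c g f) = Cmp C (ob d c) (ob d b) (ob d a) (mo d a b f) (mo d b c g)"
    and ev_iso: "a \<in> Obj C \<Longrightarrow> lc_iso C a (ob d (ob d a)) (ev a)"
    and ev_natural: "a \<in> Obj C \<Longrightarrow> b \<in> Obj C \<Longrightarrow> f \<in> carrier (Mor C a b) \<Longrightarrow>
      Cmp C a (ob d (ob d a)) (ob d (ob d b)) (mo d (ob d b) (ob d a) (mo d a b f)) (ev a) =
      Cmp C a b (ob d (ob d b)) (ev b) f"
begin

lemma dmo_closed [simp]:
  "a \<in> Obj C \<Longrightarrow> b \<in> Obj C \<Longrightarrow> f \<in> carrier (Mor C a b) \<Longrightarrow> mo d a b f \<in> carrier (Mor C (ob d b) (ob d a))"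
  by (rule lhom_closed[OF dmo])

lemma ev_closed [simp]: "a \<in> Obj C \<Longrightarrow> ev a \<in> carrier (Mor C a (ob d (ob d a)))"
  using ev_iso by (simp add: lc_iso_def)

lemma dual_ftor_simps [simp]:
  "ob (dual_ftor d F) a = vdual (ob F (ob d a))"
  "mo (dual_ftor d F) a b f = vdual_map (ob F (ob d b)) (ob F (ob d a)) (mo F (ob d b) (ob d a) (mo d a b f))"
  by (simp_all add: dual_ftor_def)

lemma dual_ftor_linear:
  fixes F :: "('o, 'm, ('k, 'u) module, 'u \<Rightarrow> 'u) ftor"
  assumes F: "linear_functor C Vect F"
  shows "linear_functor C Vect (dual_ftor d F)"
proof (rule linear_functor_VectI[OF C])
  note fd = LF_fdvs[OF F dob]
  fix a b assume o: "a \<in> Obj C" "b \<in> Obj C"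
  note o' = dob[OF o(1)] dob[OF o(2)]
  have l: "mo F (ob d b) (ob d a) (mo d a b f) \<in> lin (ob F (ob d b)) (ob F (ob d a))"
    if "f \<in> carrier (Mor C a b)" for f
    using LF_lin[OF F o'(2,1)] that o by simp
  have h: "(\<lambda>f. vdual_map (ob F (ob d b)) (ob F (ob d a)) (mo F (ob d b) (ob d a) (mo d a b f)))
    \<in> lhom (Mor C a b) (Lin (vdual (ob F (ob d a))) (vdual (ob F (ob d b))))"
    by (rule lhom_compose[OF lhom_compose[OF dmo[OF o] LF_lhom[OF F o'(2,1)]] vdual_map_lhom[OF fd[OF o(2)] fd[OF o(1)]]])
  show "fdvs (ob (dual_ftor d F) a)" using fd[OF o(1)] by simp
  show "mo (dual_ftor d F) a b f \<in> lin (ob (dual_ftor d F) a) (ob (dual_ftor d F) b)"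
    if "f \<in> carrier (Mor C a b)" for f
    using vdual_map_lin[OF fd[OF o(2)] fd[OF o(1)] l[OF that]] by simp
  show "mo (dual_ftor d F) a b (f \<oplus>\<^bsub>Mor C a b\<^esub> g) x =
      mo (dual_ftor d F) a b f x \<oplus>\<^bsub>ob (dual_ftor d F) b\<^esub> mo (dual_ftor d F) a b g x"
    if "f \<in> carrier (Mor C a b)" "g \<in> carrier (Mor C a b)" "x \<in> carrier (ob (dual_ftor d F) a)" for f g x
    using lhom_add[OF h that(1,2)] that(3) by simp
  show "mo (dual_ftor d F) a b (r \<odot>\<^bsub>Mor C a b\<^esub> f) x = r \<odot>\<^bsub>ob (dual_ftor d F) b\<^esub> mo (dual_ftor d F) a b f x"
    if "f \<in> carrier (Mor C a b)" "x \<in> carrier (ob (dual_ftor d F) a)" for f r x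
    using lhom_smult[OF h that(1)] that(2) by simp
  show "mo (dual_ftor d F) a a (Idn C a) x = x" if x: "x \<in> carrier (ob (dual_ftor d F) a)" for x
  proof -
    have "mo F (ob d a) (ob d a) (mo d a a (Idn C a)) = (\<lambda>x\<in>carrier (ob F (ob d a)). x)"
      using ftor_idn[OF linear_functorD(1)[OF F] o'(1)] d_idn[OF o(1)] by simp
    then show ?thesis using vdual_map_id[OF fd[OF o(1)]] x by simp
  qed
  fix c f g x assume c: "c \<in> Obj C" and f: "f \<in> carrier (Mor C a b)" and g: "g \<in> carrier (Mor C b c)"
    and x: "x \<in> carrier (ob (dual_ftor d F) a)"
  have "mo F (ob d c) (ob d a) (mo d a c (Cmp C a b c g f)) =
    compose (carrier (ob F (ob d c))) (mo F (ob d b) (ob d a) (mo d a b f)) (mo F (ob d c) (ob d b) (mo d b c g))"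
    using LF_cmp'[OF F dob[OF c] o'(2,1) dmo_closed[OF o(2) c g] dmo_closed[OF o f]] d_cmp[OF o c f g] by simp
  then show "mo (dual_ftor d F) a c (Cmp C a b c g f) x = mo (dual_ftor d F) b c g (mo (dual_ftor d F) a b f x)"
    using vdual_map_compose[OF fd[OF c] fd[OF o(2)] fd[OF o(1)] LF_lin[OF F dob[OF c] o'(2) dmo_closed[OF o(2) c g]] l[OF f]] x
    by simp
qed

lemma dual_nt_closed:
  fixes F G :: "('o, 'm, ('k, 'u) module, 'u \<Rightarrow> 'u) ftor"
  assumes F: "linear_functor C Vect F" and G: "linear_functor C Vect G" and e: "\<eta> \<in> nat_trans C Vect F G"
  shows "dual_nt C d F G \<eta> \<in> nat_trans C Vect (dual_ftor d G) (dual_ftor d F)"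
proof (rule nat_trans_VectI)
  note fF = LF_fdvs[OF F dob] and fG = LF_fdvs[OF G dob] and l = nt_lin[OF e dob]
  show "dual_nt C d F G \<eta> a \<in> lin (ob (dual_ftor d G) a) (ob (dual_ftor d F) a)" if "a \<in> Obj C" for a
    using vdual_map_lin[OF fF fG l] that by (simp add: dual_nt_def)
  fix a b f x assume o: "a \<in> Obj C" "b \<in> Obj C" and f: "f \<in> carrier (Mor C a b)"
    and x: "x \<in> carrier (ob (dual_ftor d G) a)"
  note o' = dob[OF o(1)] dob[OF o(2)]
  note df = dmo_closed[OF o f]
  note lF = LF_lin[OF F o'(2,1) df] and lG = LF_lin[OF G o'(2,1) df]
  have "compose (carrier (ob F (ob d b))) (mo G (ob d b) (ob d a) (mo d a b f)) (\<eta> (ob d b)) =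
    compose (carrier (ob F (ob d b))) (\<eta> (ob d a)) (mo F (ob d b) (ob d a) (mo d a b f))"
    using nt_natural[OF e o'(2,1) df] by simp
  then show "mo (dual_ftor d F) a b f (dual_nt C d F G \<eta> a x) = dual_nt C d F G \<eta> b (mo (dual_ftor d G) a b f x)"
    using vdual_map_compose[OF fF[OF o(2)] fG[OF o(2)] fG[OF o(1)] l[OF o(2)] lG, of x]
      vdual_map_compose[OF fF[OF o(2)] fF[OF o(1)] fG[OF o(1)] lF l[OF o(1)], of x] x o
    by (simp add: dual_nt_def)
qed (simp add: dual_nt_def)

text \<open>Two bidualities are composed: \<open>ev\<close>, which moves from \<open>a\<close> to
  its double dual inside \<open>C\<close>, and \<open>evd\<close>, which moves the value of F there
  into its double dual space.\<close>

definition unit :: "('o, 'm, ('k, 'u) module, 'u \<Rightarrow> 'u) ftor \<Rightarrow> 'o \<Rightarrow> 'u \<Rightarrow> 'u" where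
  "unit F = (\<lambda>a\<in>Obj C. \<lambda>x\<in>carrier (ob F a). evd (ob F (ob d (ob d a))) (mo F a (ob d (ob d a)) (ev a) x))"

lemma unit_apply [simp]:
  "a \<in> Obj C \<Longrightarrow> x \<in> carrier (ob F a) \<Longrightarrow> unit F a x = evd (ob F (ob d (ob d a))) (mo F a (ob d (ob d a)) (ev a) x)"
  by (simp add: unit_def)

lemma unit_closed:
  assumes F: "linear_functor C Vect F"
  shows "unit F \<in> nat_trans C Vect F (dual_ftor d (dual_ftor d F))"
proof (rule nat_trans_VectI)
  note fd = LF_fdvs[OF F]
  show "unit F a \<in> lin (ob F a) (ob (dual_ftor d (dual_ftor d F)) a)" if "a \<in> Obj C" for a
    using lin_restrict[OF lhom_compose[OF lin_lhom[OF LF_lin[OF F]] lin_lhom[OF evd_lin[OF fd]]]] that fd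
    by (simp add: unit_def)
  fix a b f x assume o: "a \<in> Obj C" "b \<in> Obj C" and f: "f \<in> carrier (Mor C a b)" and x: "x \<in> carrier (ob F a)"
  let ?f = "mo d (ob d b) (ob d a) (mo d a b f)"
  have ff: "?f \<in> carrier (Mor C (ob d (ob d a)) (ob d (ob d b)))" using o f by simp
  have "mo (dual_ftor d (dual_ftor d F)) a b f (unit F a x) =
    evd (ob F (ob d (ob d b))) (mo F (ob d (ob d a)) (ob d (ob d b)) ?f (mo F a (ob d (ob d a)) (ev a) x))"
    using o x fd LF_lin[OF F _ _ ff] LF_closed[OF F] by (simp add: evd_natural)
  also have "\<dots> = evd (ob F (ob d (ob d b))) (mo F b (ob d (ob d b)) (ev b) (mo F a b f x))"
    using LF_cmp[OF F o(1) _ _ ev_closed[OF o(1)] ff x] LF_cmp[OF F o _ f ev_closed[OF o(2)] x]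
      ev_natural[OF o f] o by simp
  also have "\<dots> = unit F b (mo F a b f x)"
    using o f x LF_closed[OF F] by simp
  finally show "mo (dual_ftor d (dual_ftor d F)) a b f (unit F a x) = unit F b (mo F a b f x)" .
qed (simp add: unit_def)

lemma LF_bij:
  assumes F: "linear_functor C (Vect :: ('k, ('k, 'u) module, 'u \<Rightarrow> 'u) lcat) F" and o: "a \<in> Obj C" "b \<in> Obj C" and f: "lc_iso C a b f"
  shows "bij_betw (mo F a b f) (carrier (ob F a)) (carrier (ob F b))"
proof -
  obtain g where g: "g\<in>carrier (Mor C b a)" "Cmp C a b a g f = Idn C a" "Cmp C b a b f g = Idn C b"
    and f: "f \<in> carrier (Mor C a b)"
    using f by (auto simp: lc_iso_def)
  show ?thesis
  proof (rule bij_betw_byWitness[of _ "mo F b a g"])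
    show "\<forall>x\<in>carrier (ob F a). mo F b a g (mo F a b f x) = x"
      using LF_cmp[OF F o o(1) f g(1)] LF_idn[OF F o(1)] g by simp
    show "\<forall>x\<in>carrier (ob F b). mo F a b f (mo F b a g x) = x"
      using LF_cmp[OF F o(2,1) o(2) g(1) f] LF_idn[OF F o(2)] g by simp
  qed (use LF_closed[OF F] o f g in auto)
qed

lemma unit_iso:
  assumes F: "linear_functor C Vect F"
  shows "lc_iso (Fun C Vect) F (dual_ftor d (dual_ftor d F)) (unit F)"
proof (rule nat_iso[OF F dual_ftor_linear[OF dual_ftor_linear[OF F]] unit_closed[OF F]])
  fix a assume o: "a \<in> Obj C"
  have "bij_betw (evd (ob F (ob d (ob d a))) \<circ> mo F a (ob d (ob d a)) (ev a)) (carrier (ob F a))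
      (carrier (ob (dual_ftor d (dual_ftor d F)) a))"
    using bij_betw_trans[OF LF_bij[OF F o _ ev_iso[OF o]] evd_bij] LF_fdvs[OF F] o by simp
  then show "bij_betw (unit F a) (carrier (ob F a)) (carrier (ob (dual_ftor d (dual_ftor d F)) a))"
    by (rule bij_betw_cong[THEN iffD1, rotated]) (simp add: o)
qed

sublocale duality "Fun C Vect" "dual_ftor d" "dual_nt C d" unit
proof
  show "linear_category (Fun C Vect)" by (rule Fun_linear_category[OF Vect_linear_category])
next
  fix F :: "('o, 'm, ('k, 'u) module, 'u \<Rightarrow> 'u) ftor" assume "F \<in> Obj (Fun C Vect)"
  then have F: "linear_functor C Vect F" by simp
  show "dual_ftor d F \<in> Obj (Fun C Vect)" using dual_ftor_linear[OF F] by simp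
  show "lc_iso (Fun C Vect) F (dual_ftor d (dual_ftor d F)) (unit F)" by (rule unit_iso[OF F])
  show "dual_nt C d F F (Idn (Fun C Vect) F) = Idn (Fun C Vect) (dual_ftor d F)"
    unfolding Fun_simps dual_nt_def
  proof (rule restrict_ext)
    fix a assume a: "a \<in> Obj C"
    show "vdual_map (ob F (ob d a)) (ob F (ob d a)) ((\<lambda>a\<in>Obj C. Idn Vect (ob F a)) (ob d a)) = Idn Vect (ob (dual_ftor d F) a)"
      by (rule lin_eqI[of _ "vdual (ob F (ob d a))" "vdual (ob F (ob d a))" _ "vdual (ob F (ob d a))"])
        (use a LF_fdvs[OF F] in \<open>simp_all add: lin_id[OF fdvs_vs] vdual_map_id vdual_map_lin\<close>)
  qed
next
  fix F G :: "('o, 'm, ('k, 'u) module, 'u \<Rightarrow> 'u) ftor" and \<eta> assume "F \<in> Obj (Fun C Vect)" "G \<in> Obj (Fun C Vect)" "\<eta> \<in> carrier (Mor (Fun C Vect) F G)"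
  then have F: "linear_functor C Vect F" "linear_functor C Vect G" and e: "\<eta> \<in> nat_trans C Vect F G" by auto
  note ed = dual_nt_closed[OF F e]
  note edd = dual_nt_closed[OF dual_ftor_linear[OF F(2)] dual_ftor_linear[OF F(1)] ed]
  note dd = dual_ftor_linear[OF dual_ftor_linear]
  show "dual_nt C d F G \<eta> \<in> carrier (Mor (Fun C Vect) (dual_ftor d G) (dual_ftor d F))"
    using ed by simp
  show "Cmp (Fun C Vect) F (dual_ftor d (dual_ftor d F)) (dual_ftor d (dual_ftor d G))
      (dual_nt C d (dual_ftor d G) (dual_ftor d F) (dual_nt C d F G \<eta>)) (unit F) =
    Cmp (Fun C Vect) F G (dual_ftor d (dual_ftor d G)) (unit G) \<eta>"
  proof (rule nt_eqI[OF nt_cmp[OF F(1) dd[OF F(1)] dd[OF F(2)] unit_closed[OF F(1)] edd]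
      nt_cmp[OF F dd[OF F(2)] e unit_closed[OF F(2)]]])
    fix a x assume a: "a \<in> Obj C" and x: "x \<in> carrier (ob F a)"
    show "Cmp (Fun C Vect) F (dual_ftor d (dual_ftor d F)) (dual_ftor d (dual_ftor d G))
        (dual_nt C d (dual_ftor d G) (dual_ftor d F) (dual_nt C d F G \<eta>)) (unit F) a x =
      Cmp (Fun C Vect) F G (dual_ftor d (dual_ftor d G)) (unit G) \<eta> a x"
      using a x LF_fdvs[OF F(1)] LF_fdvs[OF F(2)] nt_lin[OF e] LF_closed[OF F(1)]
        nt_app_natural[OF e a _ ev_closed[OF a] x] nt_app_closed[OF e a x]
      by (simp add: dual_nt_def evd_natural del: Fun_simps)
  qed
next
  fix F G H :: "('o, 'm, ('k, 'u) module, 'u \<Rightarrow> 'u) ftor" and \<eta> \<theta> assume "F \<in> Obj (Fun C Vect)" "G \<in> Obj (Fun C Vect)" "H \<in> Obj (Fun C Vect)"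
    "\<eta> \<in> carrier (Mor (Fun C Vect) F G)" "\<theta> \<in> carrier (Mor (Fun C Vect) G H)"
  then have F: "linear_functor C Vect F" "linear_functor C Vect G" "linear_functor C Vect H"
    and e: "\<eta> \<in> nat_trans C Vect F G" "\<theta> \<in> nat_trans C Vect G H" by auto
  note d = dual_ftor_linear
  show "dual_nt C d F H (Cmp (Fun C Vect) F G H \<theta> \<eta>) =
    Cmp (Fun C Vect) (dual_ftor d H) (dual_ftor d G) (dual_ftor d F) (dual_nt C d F G \<eta>) (dual_nt C d G H \<theta>)"
  proof (rule nt_eqI[OF dual_nt_closed[OF F(1,3) nt_cmp[OF F e]]
      nt_cmp[OF d[OF F(3)] d[OF F(2)] d[OF F(1)] dual_nt_closed[OF F(2,3) e(2)] dual_nt_closed[OF F(1,2) e(1)]]])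
    fix a x assume a: "a \<in> Obj C" and x: "x \<in> carrier (ob (dual_ftor d H) a)"
    show "dual_nt C d F H (Cmp (Fun C Vect) F G H \<theta> \<eta>) a x =
      Cmp (Fun C Vect) (dual_ftor d H) (dual_ftor d G) (dual_ftor d F) (dual_nt C d F G \<eta>) (dual_nt C d G H \<theta>) a x"
      using a x vdual_map_compose[OF LF_fdvs[OF F(1) dob[OF a]] LF_fdvs[OF F(2) dob[OF a]] LF_fdvs[OF F(3) dob[OF a]]
        nt_lin[OF e(1) dob[OF a]] nt_lin[OF e(2) dob[OF a]], of x]
      by (simp add: dual_nt_def compose_def)
  qed
qed

end

section \<open>Representations of the symmetric group\<close>

lemma sym_group_facts [simp]:
  "\<one>\<^bsub>sym_group n\<^esub> \<in> carrier (sym_group n)"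
  "s \<in> carrier (sym_group n) \<Longrightarrow> inv\<^bsub>sym_group n\<^esub> s \<in> carrier (sym_group n)"
  "s \<in> carrier (sym_group n) \<Longrightarrow> t \<in> carrier (sym_group n) \<Longrightarrow> s \<otimes>\<^bsub>sym_group n\<^esub> t \<in> carrier (sym_group n)"
  using group.inv_closed[OF sym_group_is_group] monoid.m_closed[OF group.is_monoid[OF sym_group_is_group]]
    monoid.one_closed[OF group.is_monoid[OF sym_group_is_group]] by blast+

text \<open>Keeps inverses in the group notation, to which the group laws apply.
  \<open>kap_equivariant\<close> unfolds them to inverse functions explicitly.\<close>

declare sym_group_inv_equality [simp del]

lemma is_repD:
  assumes "is_rep n M"
  shows rep_fdvs: "fdvs (rsp M)"
    and act_lin: "s \<in> carrier (sym_group n) \<Longrightarrow> act M s \<in> lin (rsp M) (rsp M)"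
    and act_closed: "s \<in> carrier (sym_group n) \<Longrightarrow> x \<in> carrier (rsp M) \<Longrightarrow> act M s x \<in> carrier (rsp M)"
    and act_one: "x \<in> carrier (rsp M) \<Longrightarrow> act M \<one>\<^bsub>sym_group n\<^esub> x = x"
    and act_mult: "s \<in> carrier (sym_group n) \<Longrightarrow> t \<in> carrier (sym_group n) \<Longrightarrow> x \<in> carrier (rsp M) \<Longrightarrow>
      act M (s \<otimes>\<^bsub>sym_group n\<^esub> t) x = act M s (act M t x)"
  using assms by (auto simp: is_rep_def compose_def lin_closed)

lemma act_inv:
  assumes "is_rep n M" "s \<in> carrier (sym_group n)" "x \<in> carrier (rsp M)"
  shows "act M (inv\<^bsub>sym_group n\<^esub> s) (act M s x) = x" "act M s (act M (inv\<^bsub>sym_group n\<^esub> s) x) = x"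
  using act_mult[OF assms(1) _ assms(2,3), of "inv\<^bsub>sym_group n\<^esub> s"] act_one[OF assms(1,3)]
    act_mult[OF assms(1,2) _ assms(3), of "inv\<^bsub>sym_group n\<^esub> s"] assms(2)
    group.l_inv[OF sym_group_is_group assms(2)] group.r_inv[OF sym_group_is_group assms(2)] by simp_all

lemma is_repI:
  assumes "fdvs (rsp M)" "\<And>s. s \<in> carrier (sym_group n) \<Longrightarrow> act M s \<in> lin (rsp M) (rsp M)"
    "\<And>x. x \<in> carrier (rsp M) \<Longrightarrow> act M \<one>\<^bsub>sym_group n\<^esub> x = x"
    "\<And>s t x. s \<in> carrier (sym_group n) \<Longrightarrow> t \<in> carrier (sym_group n) \<Longrightarrow> x \<in> carrier (rsp M) \<Longrightarrow>
      act M (s \<otimes>\<^bsub>sym_group n\<^esub> t) x = act M s (act M t x)"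
  shows "is_rep n M"
proof -
  have "act M \<one>\<^bsub>sym_group n\<^esub> = (\<lambda>x\<in>carrier (rsp M). x)"
    using assms(3) by (intro extensionalityI[OF lin_ext[OF assms(2)] restrict_extensional]) auto
  moreover have "act M (s \<otimes>\<^bsub>sym_group n\<^esub> t) = compose (carrier (rsp M)) (act M s) (act M t)"
    if "s \<in> carrier (sym_group n)" "t \<in> carrier (sym_group n)" for s t
    using assms(4) that by (intro extensionalityI[OF lin_ext[OF assms(2)]]) (auto simp: compose_def)
  ultimately show ?thesis using assms by (simp add: is_rep_def)
qed

lemma equivariantD:
  assumes "f \<in> equivariant n M N"
  shows "f \<in> lin (rsp M) (rsp N)"
    "s \<in> carrier (sym_group n) \<Longrightarrow> x \<in> carrier (rsp M) \<Longrightarrow> f (act M s x) = act N s (f x)"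
  using assms by (auto simp: equivariant_def)

lemma equivariantI:
  assumes "f \<in> lin (rsp M) (rsp N)"
    "\<And>s x. s \<in> carrier (sym_group n) \<Longrightarrow> x \<in> carrier (rsp M) \<Longrightarrow> f (act M s x) = act N s (f x)"
  shows "f \<in> equivariant n M N"
  using assms by (auto simp: equivariant_def)

lemma HomS_simps [simp]:
  "carrier (HomS n M N) = equivariant n M N" "\<zero>\<^bsub>HomS n M N\<^esub> = (\<lambda>x\<in>carrier (rsp M). \<zero>\<^bsub>rsp N\<^esub>)"
  "f \<oplus>\<^bsub>HomS n M N\<^esub> g = (\<lambda>x\<in>carrier (rsp M). f x \<oplus>\<^bsub>rsp N\<^esub> g x)"
  "c \<odot>\<^bsub>HomS n M N\<^esub> f = (\<lambda>x\<in>carrier (rsp M). c \<odot>\<^bsub>rsp N\<^esub> f x)"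
  by (simp_all add: HomS_def Lin_def)

lemma fdvs_HomS [simp]:
  assumes M: "is_rep n M" and N: "is_rep n N"
  shows "fdvs (HomS n M N)"
proof -
  note v = fdvs_vs[OF rep_fdvs[OF M]] fdvs_vs[OF rep_fdvs[OF N]]
  show ?thesis
    unfolding HomS_def
  proof (rule fdvs_sub[OF fdvs_Lin[OF rep_fdvs[OF M] rep_fdvs[OF N]]])
    show "equivariant n M N \<subseteq> carrier (Lin (rsp M) (rsp N))" by (auto simp: equivariant_def)
    show "\<zero>\<^bsub>Lin (rsp M) (rsp N)\<^esub> \<in> equivariant n M N"
      by (rule equivariantI)
        (use v act_closed[OF M] lin_zero[OF act_lin[OF N]] in \<open>auto intro!: lin_restrict lhom_const_zero\<close>)
    fix f g r assume f: "f \<in> equivariant n M N"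
    note f' = equivariantD[OF f]
    note sN = lin_simps[OF act_lin[OF N]]
    show "r \<odot>\<^bsub>Lin (rsp M) (rsp N)\<^esub> f \<in> equivariant n M N"
      by (rule equivariantI)
        (use v act_closed[OF M] f' sN in \<open>simp_all add: lin_closed lin_restrict lhom_scale lin_lhom\<close>)
    assume g: "g \<in> equivariant n M N"
    note g' = equivariantD[OF g]
    show "f \<oplus>\<^bsub>Lin (rsp M) (rsp N)\<^esub> g \<in> equivariant n M N"
      by (rule equivariantI)
        (use v act_closed[OF M] f' g' sN in \<open>simp_all add: lin_closed lin_restrict lhom_plus lin_lhom\<close>)
  qed
qed

lemma equivariant_compose:
  assumes "is_rep n L" "f \<in> equivariant n L M" "g \<in> equivariant n M N"
  shows "compose (carrier (rsp L)) g f \<in> equivariant n L N"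
proof (rule equivariantI)
  note f = equivariantD[OF assms(2)] and g = equivariantD[OF assms(3)]
  show "compose (carrier (rsp L)) g f \<in> lin (rsp L) (rsp N)"
    by (rule lin_compose[OF f(1) lin_lhom[OF g(1)] fdvs_vs[OF rep_fdvs[OF assms(1)]]])
  show "compose (carrier (rsp L)) g f (act L s x) = act N s (compose (carrier (rsp L)) g f x)"
    if "s \<in> carrier (sym_group n)" "x \<in> carrier (rsp L)" for s x
    using that act_closed[OF assms(1) that] f(2)[OF that] g(2)[OF that(1) lin_closed[OF f(1) that(2)]]
    by (simp add: compose_def)
qed

lemma Rep_simps [simp]:
  "Obj (Rep n) = {M. is_rep n M}" "Mor (Rep n) = HomS n" "Idn (Rep n) M = (\<lambda>x\<in>carrier (rsp M). x)"
  "Cmp (Rep n) L M N g f = compose (carrier (rsp L)) g f"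
  by (simp_all add: Rep_def)

lemma equivariant_id: "is_rep n M \<Longrightarrow> (\<lambda>x\<in>carrier (rsp M). x) \<in> equivariant n M M"
  by (rule equivariantI) (auto simp: rep_fdvs act_closed lin_id)

lemma Rep_linear_category: "linear_category (Rep n :: ('k::field, ('k, 'u) rep, 'u \<Rightarrow> 'u) lcat)"
  unfolding linear_category_def
proof (intro conjI ballI)
  fix M N :: "('k, 'u) rep" assume "M \<in> Obj (Rep n)" "N \<in> Obj (Rep n)"
  then show "vs (Mor (Rep n) M N)" by simp
next
  fix L M N :: "('k, 'u) rep" and f g
  assume "L \<in> Obj (Rep n)" "M \<in> Obj (Rep n)" "N \<in> Obj (Rep n)"
  then have o: "is_rep n L" "is_rep n M" "is_rep n N" by auto
  have v: "vs (rsp L)" "vs (rsp M)" "vs (rsp N)" using fdvs_vs[OF rep_fdvs[OF o(1)]] fdvs_vs[OF rep_fdvs[OF o(2)]] fdvs_vs[OF rep_fdvs[OF o(3)]] by auto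
  have cmp: "(\<lambda>x\<in>carrier (rsp L). g (f x)) \<in> equivariant n L N"
    if "f \<in> equivariant n L M" "g \<in> equivariant n M N" for f g
    using equivariant_compose[OF o(1) that] by (simp add: compose_def)
  show "(\<lambda>g. Cmp (Rep n) L M N g f) \<in> lhom (Mor (Rep n) M N) (Mor (Rep n) L N)" if "f \<in> carrier (Mor (Rep n) L M)"
    by (rule lhomI) (use that v cmp lin_closed[OF equivariantD(1)[of f n L M]] in \<open>auto simp: compose_def intro!: restrict_ext\<close>)
  show "(\<lambda>f. Cmp (Rep n) L M N g f) \<in> lhom (Mor (Rep n) L M) (Mor (Rep n) L N)" if "g \<in> carrier (Mor (Rep n) M N)"
    by (rule lhomI) (use that v cmp lin_closed[OF equivariantD(1)[of _ n L M]] lin_simps[OF equivariantD(1)[of g n M N]]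
      in \<open>auto simp: compose_def intro!: restrict_ext\<close>)
next
  fix U V W X :: "('k, 'u) rep" and f g h
  assume "f \<in> carrier (Mor (Rep n) U V)"
  then have "f \<in> carrier (rsp U) \<rightarrow> carrier (rsp V)" using lin_closed[OF equivariantD(1)[of f n U V]] by auto
  then show "Cmp (Rep n) U W X h (Cmp (Rep n) U V W g f) = Cmp (Rep n) U V X (Cmp (Rep n) V W X h g) f"
    by (simp add: compose_assoc)
next
  fix U V :: "('k, 'u) rep" and f assume "f \<in> carrier (Mor (Rep n) U V)"
  then have f: "f \<in> carrier (rsp U) \<rightarrow> carrier (rsp V)" "f \<in> extensional (carrier (rsp U))"
    using equivariantD(1)[of f n U V] by (auto simp: lin_closed lin_ext)
  show "Cmp (Rep n) U U V f (Idn (Rep n) U) = f" "Cmp (Rep n) U V V (Idn (Rep n) V) f = f"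
    using f by (auto simp: compose_Id Id_compose)
qed (auto intro!: equivariant_id)

lemma rep_iso:
  assumes M: "is_rep n M" and N: "is_rep n N" and f: "f \<in> equivariant n M N"
    and bij: "bij_betw f (carrier (rsp M)) (carrier (rsp N))"
  shows "lc_iso (Rep n) M N f"
proof -
  let ?g = "restrict (inv_into (carrier (rsp M)) f) (carrier (rsp N))"
  note f' = equivariantD[OF f]
  note I = lin_inv[OF f'(1) bij fdvs_vs[OF rep_fdvs[OF M]] fdvs_vs[OF rep_fdvs[OF N]]]
  have g: "?g \<in> equivariant n N M"
  proof (rule equivariantI[OF I(1)])
    fix s y assume s: "s \<in> carrier (sym_group n)" and y: "y \<in> carrier (rsp N)"
    have "?g (act N s (f (?g y))) = ?g (f (act M s (?g y)))"
      using f'(2)[OF s lin_closed[OF I(1) y]] by (simp only:)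
    then show "?g (act N s y) = act M s (?g y)"
      using I(2)[OF act_closed[OF M s lin_closed[OF I(1) y]]] I(3)[OF y] by (simp only:)
  qed
  show ?thesis
    unfolding lc_iso_def
    by (intro conjI bexI[of _ ?g]) (use f g I in \<open>auto simp: compose_def simp del: restrict_apply intro!: restrict_ext\<close>)
qed

context univ
begin

lemma dual_rep_simps [simp]:
  "rsp (dual_rep n M) = vdual (rsp M)"
  "act (dual_rep n M) s = vdual_map (rsp M) (rsp M) (act M (inv\<^bsub>sym_group n\<^esub> s))"
  by (simp_all add: dual_rep_def)

lemma dual_rep_is_rep:
  fixes M :: "('k, 'u) rep"
  assumes M: "is_rep n M"
  shows "is_rep n (dual_rep n M)"
proof (rule is_repI)
  note fd = rep_fdvs[OF M]
  have l: "act M (inv\<^bsub>sym_group n\<^esub> s) \<in> lin (rsp M) (rsp M)" if "s \<in> carrier (sym_group n)" for s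
    using act_lin[OF M] that by simp
  show "fdvs (rsp (dual_rep n M))" using fd by simp
  show "act (dual_rep n M) s \<in> lin (rsp (dual_rep n M)) (rsp (dual_rep n M))" if "s \<in> carrier (sym_group n)" for s
    using vdual_map_lin[OF fd fd l[OF that]] by simp
  show "act (dual_rep n M) \<one>\<^bsub>sym_group n\<^esub> x = x" if "x \<in> carrier (rsp (dual_rep n M))" for x
    by (rule app_ext[OF fd]) (use that fd act_one[OF M] act_lin[OF M] in
      \<open>simp_all add: vdual_map_closed monoid.inv_one[OF group.is_monoid[OF sym_group_is_group]]\<close>)
  show "act (dual_rep n M) (s \<otimes>\<^bsub>sym_group n\<^esub> t) x = act (dual_rep n M) s (act (dual_rep n M) t x)"
    if "s \<in> carrier (sym_group n)" "t \<in> carrier (sym_group n)" "x \<in> carrier (rsp (dual_rep n M))" for s t x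
    by (rule app_ext[OF fd]) (use that fd act_mult[OF M] act_lin[OF M] act_closed[OF M] in
      \<open>simp_all add: vdual_map_closed group.inv_mult_group[OF sym_group_is_group]\<close>)
qed

lemma vdual_map_equivariant:
  fixes M N :: "('k, 'u) rep"
  assumes M: "is_rep n M" and N: "is_rep n N" and f: "f \<in> equivariant n M N"
  shows "vdual_map (rsp M) (rsp N) f \<in> equivariant n (dual_rep n N) (dual_rep n M)"
proof (rule equivariantI)
  note fd = rep_fdvs[OF M] rep_fdvs[OF N] and f' = equivariantD[OF f]
  show "vdual_map (rsp M) (rsp N) f \<in> lin (rsp (dual_rep n N)) (rsp (dual_rep n M))"
    using vdual_map_lin[OF fd f'(1)] by simp
  show "vdual_map (rsp M) (rsp N) f (act (dual_rep n N) s x) = act (dual_rep n M) s (vdual_map (rsp M) (rsp N) f x)"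
    if "s \<in> carrier (sym_group n)" "x \<in> carrier (rsp (dual_rep n N))" for s x
    by (rule app_ext[OF fd(1)]) (use that fd f' act_lin[OF M] act_lin[OF N] act_closed[OF M] lin_closed[OF f'(1)]
      in \<open>simp_all add: vdual_map_closed\<close>)
qed

text \<open>The dual action uses the inverse permutation; in the double dual the two inversions
  cancel.\<close>

lemma evd_equivariant:
  fixes M :: "('k, 'u) rep"
  assumes M: "is_rep n M"
  shows "evd (rsp M) \<in> equivariant n M (dual_rep n (dual_rep n M))"
proof (rule equivariantI)
  note fd = rep_fdvs[OF M]
  show "evd (rsp M) \<in> lin (rsp M) (rsp (dual_rep n (dual_rep n M)))"
    using evd_lin[OF fd] by simp
  show "evd (rsp M) (act M s x) = act (dual_rep n (dual_rep n M)) s (evd (rsp M) x)"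
    if "s \<in> carrier (sym_group n)" "x \<in> carrier (rsp M)" for s x
    by (rule app_ext[of "vdual (rsp M)"]) (use that fd act_lin[OF M] act_closed[OF M]
      in \<open>simp_all add: vdual_map_closed vdual_map_lin evd_closed group.inv_inv[OF sym_group_is_group]\<close>)
qed

lemma Rep_cat_duality: "cat_duality \<iota> (Rep n) (Rep_dual n) (\<lambda>M. evd (rsp M))"
proof unfold_locales
  show "lc_pre (Rep n)" by (rule linear_category_pre[OF Rep_linear_category])
next
  fix M N :: "('k, 'u) rep" assume "M \<in> Obj (Rep n)" "N \<in> Obj (Rep n)"
  then have M: "is_rep n M" and N: "is_rep n N" by auto
  note fd = rep_fdvs[OF M] rep_fdvs[OF N]
  show "ob (Rep_dual n) M \<in> Obj (Rep n)" using dual_rep_is_rep[OF M] by (simp add: Rep_dual_def)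
  show "mo (Rep_dual n) M N \<in> lhom (Mor (Rep n) M N) (Mor (Rep n) (ob (Rep_dual n) N) (ob (Rep_dual n) M))"
    by (rule lhomI) (use vdual_map_equivariant[OF M N] lhom_add[OF vdual_map_lhom[OF fd]] lhom_smult[OF vdual_map_lhom[OF fd]]
      in \<open>auto simp: Rep_dual_def equivariant_def\<close>)
  show "mo (Rep_dual n) M M (Idn (Rep n) M) = Idn (Rep n) (ob (Rep_dual n) M)"
    by (rule lin_eqI[of _ "vdual (rsp M)" "vdual (rsp M)" _ "vdual (rsp M)"])
      (use fd in \<open>simp_all add: Rep_dual_def vdual_map_lin lin_id vdual_map_id\<close>)
  show "lc_iso (Rep n) M (ob (Rep_dual n) (ob (Rep_dual n) M)) (evd (rsp M))"
    using rep_iso[OF M dual_rep_is_rep[OF dual_rep_is_rep[OF M]] evd_equivariant[OF M]] evd_bij[OF fd(1)]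
    by (simp add: Rep_dual_def)
  fix f assume "f \<in> carrier (Mor (Rep n) M N)"
  then have f: "f \<in> lin (rsp M) (rsp N)" by (simp add: equivariantD)
  show "Cmp (Rep n) M (ob (Rep_dual n) (ob (Rep_dual n) M)) (ob (Rep_dual n) (ob (Rep_dual n) N))
      (mo (Rep_dual n) (ob (Rep_dual n) N) (ob (Rep_dual n) M) (mo (Rep_dual n) M N f)) (evd (rsp M)) =
    Cmp (Rep n) M N (ob (Rep_dual n) (ob (Rep_dual n) N)) (evd (rsp N)) f"
    using evd_natural[OF fd f] by (auto simp: Rep_dual_def compose_def intro!: restrict_ext)
  fix L :: "('k, 'u) rep" and g assume "L \<in> Obj (Rep n)" "g \<in> carrier (Mor (Rep n) N L)"
  then have L: "is_rep n L" and g: "g \<in> lin (rsp N) (rsp L)" by (auto simp: equivariantD)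
  show "mo (Rep_dual n) M L (Cmp (Rep n) M N L g f) =
    Cmp (Rep n) (ob (Rep_dual n) L) (ob (Rep_dual n) N) (ob (Rep_dual n) M) (mo (Rep_dual n) M N f) (mo (Rep_dual n) N L g)"
    by (rule lin_eqI[of _ "vdual (rsp L)" "vdual (rsp M)" _ "vdual (rsp M)"])
      (use fd rep_fdvs[OF L] f g in \<open>simp_all add: Rep_dual_def vdual_map_lin vdual_map_compose compose_eq
        lin_compose[OF vdual_map_lin[OF fd(2) rep_fdvs[OF L] g] lin_lhom[OF vdual_map_lin[OF fd f]]]
        lin_compose[OF f lin_lhom[OF g] fdvs_vs[OF fd(1)]]\<close>)
qed

end

section \<open>The category of divided powers\<close>

text \<open>Keeps the index set in the form \<open>{1..n}\<close>, in which tuples and the symmetric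
  group are stated.\<close>

declare One_nat_def [simp del]

context univ
begin

context
  fixes V :: "('k, 'a) module" and n :: nat
  assumes V: "fdvs V"
begin

lemma sym_tuples: "s \<in> carrier (sym_group n) \<Longrightarrow> v \<in> tuples n V \<Longrightarrow> v \<circ> s \<in> tuples n V"
  by (rule tuples_perm) (auto simp: sym_group_carrier)

lemma sym_multilinear: "s \<in> carrier (sym_group n) \<Longrightarrow>
    multilinear n V (tpow n V :: ('k, 'u) module) (\<lambda>v. pure n V (v \<circ> s))"
  by (rule multilinear_perm[OF pure_multilinear[OF V]]) (auto simp: sym_group_carrier)

lemma tpow_act_lin: "s \<in> carrier (sym_group n) \<Longrightarrow>
    (tpow_act n V s :: 'u \<Rightarrow> 'u) \<in> lin (tpow n V) (tpow n V)"
  unfolding tpow_act_def by (rule tlift_lin[OF V _ sym_multilinear]) (simp_all add: V)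

lemma tpow_act_closed [simp]: "s \<in> carrier (sym_group n) \<Longrightarrow> x \<in> carrier (tpow n V :: ('k, 'u) module) \<Longrightarrow>
    tpow_act n V s x \<in> carrier (tpow n V)"
  by (rule lin_closed[OF tpow_act_lin])

lemma tpow_act_pure [simp]: "s \<in> carrier (sym_group n) \<Longrightarrow> v \<in> tuples n V \<Longrightarrow>
    tpow_act n V s (pure n V v :: 'u) = pure n V (v \<circ> inv\<^bsub>sym_group n\<^esub> s)"
  unfolding tpow_act_def by (rule tlift_pure[OF V _ sym_multilinear]) (simp_all add: V)

lemma tpow_rep_simps [simp]:
  "rsp (tpow_rep n V :: ('k, 'u) rep) = tpow n V" "act (tpow_rep n V :: ('k, 'u) rep) = tpow_act n V"
  by (simp_all add: tpow_rep_def)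

lemma tpow_is_rep: "is_rep n (tpow_rep n V :: ('k, 'u) rep)"
proof (rule is_repI)
  let ?T = "tpow n V :: ('k, 'u) module"
  have T: "vs ?T" using V by simp
  show "act (tpow_rep n V :: ('k, 'u) rep) \<one>\<^bsub>sym_group n\<^esub> x = x"
    if "x \<in> carrier (rsp (tpow_rep n V :: ('k, 'u) rep))" for x
    unfolding tpow_rep_simps
    by (rule tpow_ext[OF V T lin_lhom[OF tpow_act_lin] lhom_id])
      (use that in \<open>simp_all add: monoid.inv_one[OF group.is_monoid[OF sym_group_is_group]]\<close>, simp add: sym_group_one)
  fix s t x assume s: "s \<in> carrier (sym_group n)" and t: "t \<in> carrier (sym_group n)"
    and x: "x \<in> carrier (rsp (tpow_rep n V :: ('k, 'u) rep))"
  show "act (tpow_rep n V :: ('k, 'u) rep) (s \<otimes>\<^bsub>sym_group n\<^esub> t) x =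
      act (tpow_rep n V :: ('k, 'u) rep) s (act (tpow_rep n V :: ('k, 'u) rep) t x)"
    unfolding tpow_rep_simps
    by (rule tpow_ext[OF V T lin_lhom[OF tpow_act_lin] lhom_compose[OF lin_lhom[OF tpow_act_lin] lin_lhom[OF tpow_act_lin]]])
      (use s t x in \<open>simp_all add: sym_tuples group.inv_mult_group[OF sym_group_is_group]\<close>,
        simp add: sym_group_mult comp_assoc)
qed (use V in \<open>simp_all add: tpow_act_lin\<close>)

end

lemma Vect_compose_lhom:
  fixes U V W :: "('k, 'u) module"
  assumes "fdvs U" "fdvs V" "fdvs W"
  shows "f \<in> lin U V \<Longrightarrow> (\<lambda>g. compose (carrier U) g f) \<in> lhom (Lin V W) (Lin U W)"
    "g \<in> lin V W \<Longrightarrow> (\<lambda>f. compose (carrier U) g f) \<in> lhom (Lin U V) (Lin U W)"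
  using lc_left[OF Vect_linear_category, of U V W f] lc_right[OF Vect_linear_category, of U V W g] assms
  by simp_all

lemma pure_map_multilinear:
  fixes V :: "('k, 'a) module" and W :: "('k, 'b) module"
  assumes "fdvs V" "fdvs W" "\<And>i. i \<in> {1..n} \<Longrightarrow> f i \<in> lhom V W"
  shows "multilinear n V (tpow n W :: ('k, 'u) module) (\<lambda>v. pure n W (\<lambda>i\<in>{1..n}. f i (v i)))"
  by (rule multilinear_map[OF pure_multilinear[OF assms(2)]]) (use assms in auto)

abbreviation T :: "nat \<Rightarrow> ('k, 'u) module \<Rightarrow> ('k, 'u) module \<Rightarrow> ('k, 'u) module" where
  "T n V W \<equiv> tpow n (Lin V W)"

abbreviation tp :: "nat \<Rightarrow> ('k, 'u) module \<Rightarrow> ('k, 'u) module" where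
  "tp n V \<equiv> tpow n V"

lemma tuples_Lin: "f \<in> tuples n (Lin V W) \<Longrightarrow> i \<in> {1..n} \<Longrightarrow> f i \<in> lin V W"
  using tuples_mem[of f n "Lin V W" i] by simp

lemma Gam_cmp_facts:
  fixes U V W :: "('k, 'u) module"
  assumes o: "fdvs U" "fdvs V" "fdvs W"
  shows Gam_cmp_lin: "Gam_cmp n U V W \<in> lin (T n V W) (Lin (T n U V) (T n U W))"
    and Gam_cmp_pure: "g \<in> tuples n (Lin V W) \<Longrightarrow> f \<in> tuples n (Lin U V) \<Longrightarrow>
      Gam_cmp n U V W (pure n (Lin V W) g) (pure n (Lin U V) f) =
      pure n (Lin U W) (\<lambda>i\<in>{1..n}. compose (carrier U) (g i) (f i))"
proof -
  have f: "fdvs (Lin U V)" "fdvs (Lin V W)" "fdvs (Lin U W)" using o by simp_all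
  have v: "vs (T n U W)" using f by simp
  have B: "multilinear n (Lin U V) (T n U W) (\<lambda>f. pure n (Lin U W) (\<lambda>i\<in>{1..n}. compose (carrier U) (g i) (f i)))"
    if "g \<in> tuples n (Lin V W)" for g
    by (rule pure_map_multilinear[OF f(1,3)]) (rule Vect_compose_lhom(2)[OF o tuples_Lin[OF that]])
  have B': "multilinear n (Lin V W) (T n U W) (\<lambda>g. pure n (Lin U W) (\<lambda>i\<in>{1..n}. compose (carrier U) (g i) (f i)))"
    if "f \<in> tuples n (Lin U V)" for f
    by (rule pure_map_multilinear[OF f(2,3), of n "\<lambda>i g. compose (carrier U) g (f i)"])
      (rule Vect_compose_lhom(1)[OF o tuples_Lin[OF that]])
  have eq: "Gam_cmp n U V W = tlift n (Lin V W) (Lin (T n U V) (T n U W))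
       (\<lambda>g. tlift n (Lin U V) (T n U W)
         (\<lambda>f. pure n (Lin U W) (\<lambda>i\<in>{1..n}. compose (carrier U) (g i) (f i))))"
    by (intro ext) (simp add: Gam_cmp_def)
  show "Gam_cmp n U V W \<in> lin (T n V W) (Lin (T n U V) (T n U W))"
    unfolding eq by (rule tlift2(1)[OF f(2,1) v B B'])
  show "g \<in> tuples n (Lin V W) \<Longrightarrow> f \<in> tuples n (Lin U V) \<Longrightarrow>
      Gam_cmp n U V W (pure n (Lin V W) g) (pure n (Lin U V) f) =
      pure n (Lin U W) (\<lambda>i\<in>{1..n}. compose (carrier U) (g i) (f i))"
    unfolding eq by (rule tlift2(2)[OF f(2,1) v B B'])
qed

lemma Gam_real_facts:
  fixes V W :: "('k, 'u) module"
  assumes o: "fdvs V" "fdvs W"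
  shows Gam_real_lin: "Gam_real n V W \<in> lin (T n V W) (Lin (tp n V) (tp n W))"
    and Gam_real_pure: "f \<in> tuples n (Lin V W) \<Longrightarrow> v \<in> tuples n V \<Longrightarrow>
      Gam_real n V W (pure n (Lin V W) f) (pure n V v) = pure n W (\<lambda>i\<in>{1..n}. f i (v i))"
proof -
  have f: "fdvs (Lin V W)" and v: "vs (tpow n W :: ('k, 'u) module)" using o by simp_all
  have B: "multilinear n V (tp n W) (\<lambda>v. pure n W (\<lambda>i\<in>{1..n}. f i (v i)))"
    if "f \<in> tuples n (Lin V W)" for f
    by (rule pure_map_multilinear[OF o]) (rule lin_lhom[OF tuples_Lin[OF that]])
  have B': "multilinear n (Lin V W) (tp n W) (\<lambda>f. pure n W (\<lambda>i\<in>{1..n}. f i (v i)))"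
    if "v \<in> tuples n V" for v
    by (rule pure_map_multilinear[OF f o(2), of n "\<lambda>i f. f (v i)"])
      (rule lhom_eval[OF fdvs_vs[OF o(1)] tuples_mem[OF that]])
  show "Gam_real n V W \<in> lin (T n V W) (Lin (tp n V) (tp n W))"
    unfolding Gam_real_def by (rule tlift2(1)[OF f o(1) v B B'])
  show "f \<in> tuples n (Lin V W) \<Longrightarrow> v \<in> tuples n V \<Longrightarrow>
      Gam_real n V W (pure n (Lin V W) f) (pure n V v) = pure n W (\<lambda>i\<in>{1..n}. f i (v i))"
    unfolding Gam_real_def by (rule tlift2(2)[OF f o(1) v B B'])
qed

lemma Lin_bilinear:
  assumes "\<beta> \<in> lin X (Lin Y Z)" and "vs Y"
  shows "x \<in> carrier X \<Longrightarrow> \<beta> x \<in> lin Y Z" "x \<in> carrier X \<Longrightarrow> \<beta> x \<in> lhom Y Z"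
    "y \<in> carrier Y \<Longrightarrow> (\<lambda>x. \<beta> x y) \<in> lhom X Z"
  using lin_closed[OF assms(1)] lhom_compose[OF lin_lhom[OF assms(1)] lhom_eval[OF assms(2)]]
  by (auto simp: lin_lhom)

context
  fixes U V W :: "('k, 'u) module" and n :: nat
  assumes o: "fdvs U" "fdvs V" "fdvs W"
begin

lemma gc_right: "y \<in> carrier (T n V W) \<Longrightarrow> Gam_cmp n U V W y \<in> lhom (T n U V) (T n U W)"
  and gc_left: "x \<in> carrier (T n U V) \<Longrightarrow> (\<lambda>y. Gam_cmp n U V W y x) \<in> lhom (T n V W) (T n U W)"
  using Lin_bilinear[OF Gam_cmp_lin[OF o]] o by simp_all

lemma gc_closed [simp]: "x \<in> carrier (T n U V) \<Longrightarrow> y \<in> carrier (T n V W) \<Longrightarrow> Gam_cmp n U V W y x \<in> carrier (T n U W)"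
  by (rule lhom_closed[OF gc_right])

lemma gr_lhom: "x \<in> carrier (T n U V) \<Longrightarrow> Gam_real n U V x \<in> lhom (tp n U) (tp n V)"
  and gr_lin: "x \<in> carrier (T n U V) \<Longrightarrow> Gam_real n U V x \<in> lin (tp n U) (tp n V)"
  and gr_left: "t \<in> carrier (tp n U) \<Longrightarrow> (\<lambda>x. Gam_real n U V x t) \<in> lhom (T n U V) (tp n V)"
  using Lin_bilinear[OF Gam_real_lin[OF o(1,2)]] o by simp_all

lemma gr_closed [simp]: "x \<in> carrier (T n U V) \<Longrightarrow> t \<in> carrier (tp n U) \<Longrightarrow> Gam_real n U V x t \<in> carrier (tp n V)"
  by (rule lhom_closed[OF gr_lhom])

end

lemma tuples_compose:
  fixes U V W :: "('k, 'u) module"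
  assumes "fdvs U" "g \<in> tuples n (Lin V W)" "f \<in> tuples n (Lin U V)"
  shows "(\<lambda>i\<in>{1..n}. compose (carrier U) (g i) (f i)) \<in> tuples n (Lin U W)"
  by (rule tuples_restrict) (use lin_compose[OF tuples_Lin[OF assms(3)] lin_lhom[OF tuples_Lin[OF assms(2)]]] assms(1) in simp)

lemma tuples_apply:
  assumes "f \<in> tuples n (Lin V W)" "v \<in> tuples n V"
  shows "(\<lambda>i\<in>{1..n}. f i (v i)) \<in> tuples n W"
  by (rule tuples_restrict) (rule lin_closed[OF tuples_Lin[OF assms(1)] tuples_mem[OF assms(2)]])

text \<open>The identity is proved on the full tensor powers of the Hom spaces, where pure tensors
  span, and later restricted to the invariant tensors. Invariants do not offer such a reduction:
  over a finite field they need not be spanned by the powers of single maps.\<close>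

lemma Gam_real_cmp:
  fixes U V W :: "('k, 'u) module"
  assumes o: "fdvs U" "fdvs V" "fdvs W" and x: "x \<in> carrier (T n U V)" and y: "y \<in> carrier (T n V W)"
    and t: "t \<in> carrier (tp n U)"
  shows "Gam_real n U W (Gam_cmp n U V W y x) t = Gam_real n V W y (Gam_real n U V x t)"
proof -
  have f: "fdvs (Lin U V)" "fdvs (Lin V W)" "fdvs (Lin U W)" using o by simp_all
  have vW: "vs (tpow n W :: ('k, 'u) module)" using o by simp
  note gr = gr_lhom[OF o(2,3,3)] gr_lhom[OF o(1,2,2)] gr_lhom[OF o(1,3,3)]
  have tt: "pure n U v \<in> carrier (tp n U)" if "v \<in> tuples n U" for v using o that by simp
  have gp: "Gam_real n U V x (pure n U v) \<in> carrier (tp n V)" if "x \<in> carrier (T n U V)" "v \<in> tuples n U" for x v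
    using o that by simp
  show ?thesis
  proof (rule tpow_ext[OF o(1) vW gr(3)[OF gc_closed[OF o x y]] lhom_compose[OF gr(2)[OF x] gr(1)[OF y]] _ t])
    fix v assume v: "v \<in> tuples n U"
    show "Gam_real n U W (Gam_cmp n U V W y x) (pure n U v) = Gam_real n V W y (Gam_real n U V x (pure n U v))"
    proof (rule tpow_ext2[OF f(2,1) vW _ _ _ _ _ y x])
      show "(\<lambda>x. Gam_real n U W (Gam_cmp n U V W y x) (pure n U v)) \<in> lhom (T n U V) (tp n W)"
        if "y \<in> carrier (T n V W)" for y
        by (rule lhom_compose[OF gc_right[OF o that] gr_left[OF o(1,3,3) tt[OF v]]])
      show "(\<lambda>y. Gam_real n U W (Gam_cmp n U V W y x) (pure n U v)) \<in> lhom (T n V W) (tp n W)"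
        if "x \<in> carrier (T n U V)" for x
        by (rule lhom_compose[OF gc_left[OF o that] gr_left[OF o(1,3,3) tt[OF v]]])
      show "(\<lambda>x. Gam_real n V W y (Gam_real n U V x (pure n U v))) \<in> lhom (T n U V) (tp n W)"
        if "y \<in> carrier (T n V W)" for y
        by (rule lhom_compose[OF gr_left[OF o(1,2,2) tt[OF v]] gr(1)[OF that]])
      show "(\<lambda>y. Gam_real n V W y (Gam_real n U V x (pure n U v))) \<in> lhom (T n V W) (tp n W)"
        if "x \<in> carrier (T n U V)" for x
        by (rule gr_left[OF o(2,3,3) gp[OF that v]])
      fix g h assume g: "g \<in> tuples n (Lin V W)" and h: "h \<in> tuples n (Lin U V)"
      show "Gam_real n U W (Gam_cmp n U V W (pure n (Lin V W) g) (pure n (Lin U V) h)) (pure n U v) =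
        Gam_real n V W (pure n (Lin V W) g) (Gam_real n U V (pure n (Lin U V) h) (pure n U v))"
        using o g h v tuples_mem[OF v]
        by (simp add: Gam_cmp_pure Gam_real_pure tuples_compose tuples_apply compose_eq cong: restrict_cong)
    qed
  qed
qed

lemma tuples_const: "f \<in> carrier V \<Longrightarrow> (\<lambda>i\<in>{1..n}. f) \<in> tuples n V"
  by (rule tuples_restrict)

lemma Gam_real_id:
  fixes V :: "('k, 'u) module"
  assumes o: "fdvs V" and t: "t \<in> carrier (tp n V)"
  shows "Gam_real n V V (pure n (Lin V V) (\<lambda>i\<in>{1..n}. \<lambda>x\<in>carrier V. x)) t = t"
proof -
  have i: "(\<lambda>i\<in>{1..n}. \<lambda>x\<in>carrier V. x) \<in> tuples n (Lin V V)"
    by (rule tuples_const) (simp add: o lin_id)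
  have vV: "vs (tpow n V :: ('k, 'u) module)" using o by simp
  show ?thesis
  proof (rule tpow_ext[OF o vV gr_lhom[OF o o o] lhom_id _ t])
    show "pure n (Lin V V) (\<lambda>i\<in>{1..n}. \<lambda>x\<in>carrier V. x) \<in> carrier (T n V V)" using o i by simp
    fix v assume v: "v \<in> tuples n V"
    have "(\<lambda>i\<in>{1..n}. (\<lambda>i\<in>{1..n}. \<lambda>x\<in>carrier V. x) i (v i)) = v"
      by (rule tuples_eqI[OF tuples_apply[OF i v] v]) (use tuples_mem[OF v] in simp)
    then show "Gam_real n V V (pure n (Lin V V) (\<lambda>i\<in>{1..n}. \<lambda>x\<in>carrier V. x)) (pure n V v) = pure n V v"
      using Gam_real_pure[OF o o i v] by simp
  qed
qed

lemma inv_sym_mem: "s \<in> carrier (sym_group n) \<Longrightarrow> i \<in> {1..n} \<Longrightarrow> (inv\<^bsub>sym_group n\<^esub> s) i \<in> {1..n}"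
  using permutes_in_image[of "inv\<^bsub>sym_group n\<^esub> s" "{1..n}" i] sym_group_facts(2)[of s n]
  by (simp add: sym_group_carrier)

lemma inv_sym_notin: "s \<in> carrier (sym_group n) \<Longrightarrow> i \<notin> {1..n} \<Longrightarrow> (inv\<^bsub>sym_group n\<^esub> s) i = i"
  using permutes_not_in[of "inv\<^bsub>sym_group n\<^esub> s" "{1..n}" i] sym_group_facts(2)[of s n]
  by (simp add: sym_group_carrier)

lemma restrict_sym:
  assumes "s \<in> carrier (sym_group n)"
  shows "(\<lambda>i\<in>{1..n}. F i) \<circ> inv\<^bsub>sym_group n\<^esub> s = (\<lambda>i\<in>{1..n}. F ((inv\<^bsub>sym_group n\<^esub> s) i))"
proof
  fix i show "((\<lambda>i\<in>{1..n}. F i) \<circ> inv\<^bsub>sym_group n\<^esub> s) i = (\<lambda>i\<in>{1..n}. F ((inv\<^bsub>sym_group n\<^esub> s) i)) i"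
    by (cases "i \<in> {1..n}") (use inv_sym_mem[OF assms, of i] inv_sym_notin[OF assms, of i] in auto)
qed

text \<open>Composition works position by position and so commutes with a simultaneous permutation
  of the positions. Consequently composites of invariant tensors are invariant.\<close>

lemma Gam_cmp_act:
  fixes U V W :: "('k, 'u) module"
  assumes o: "fdvs U" "fdvs V" "fdvs W" and s: "s \<in> carrier (sym_group n)"
    and x: "x \<in> carrier (T n U V)" and y: "y \<in> carrier (T n V W)"
  shows "tpow_act n (Lin U W) s (Gam_cmp n U V W y x) =
    Gam_cmp n U V W (tpow_act n (Lin V W) s y) (tpow_act n (Lin U V) s x)"
proof -
  have f: "fdvs (Lin U V)" "fdvs (Lin V W)" "fdvs (Lin U W)" using o by simp_all
  have vW: "vs (T n U W)" using f by simp
  note a = lin_lhom[OF tpow_act_lin[OF f(1) s]] lin_lhom[OF tpow_act_lin[OF f(2) s]] lin_lhom[OF tpow_act_lin[OF f(3) s]]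
  show ?thesis
  proof (rule tpow_ext2[OF f(2,1) vW _ _ _ _ _ y x])
    fix y assume y: "y \<in> carrier (T n V W)"
    show "(\<lambda>x. tpow_act n (Lin U W) s (Gam_cmp n U V W y x)) \<in> lhom (T n U V) (T n U W)"
      by (rule lhom_compose[OF gc_right[OF o y] a(3)])
    show "(\<lambda>x. Gam_cmp n U V W (tpow_act n (Lin V W) s y) (tpow_act n (Lin U V) s x)) \<in> lhom (T n U V) (T n U W)"
      by (rule lhom_compose[OF a(1) gc_right[OF o lhom_closed[OF a(2) y]]])
  next
    fix x assume x: "x \<in> carrier (T n U V)"
    show "(\<lambda>y. tpow_act n (Lin U W) s (Gam_cmp n U V W y x)) \<in> lhom (T n V W) (T n U W)"
      by (rule lhom_compose[OF gc_left[OF o x] a(3)])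
    show "(\<lambda>y. Gam_cmp n U V W (tpow_act n (Lin V W) s y) (tpow_act n (Lin U V) s x)) \<in> lhom (T n V W) (T n U W)"
      by (rule lhom_compose[OF a(2) gc_left[OF o lhom_closed[OF a(1) x]]])
  next
    fix g h assume g: "g \<in> tuples n (Lin V W)" and h: "h \<in> tuples n (Lin U V)"
    show "tpow_act n (Lin U W) s (Gam_cmp n U V W (pure n (Lin V W) g) (pure n (Lin U V) h)) =
      Gam_cmp n U V W (tpow_act n (Lin V W) s (pure n (Lin V W) g)) (tpow_act n (Lin U V) s (pure n (Lin U V) h))"
      using o f g h s
      by (simp add: restrict_sym[OF s] Gam_cmp_pure tuples_compose sym_tuples[OF f(1)] sym_tuples[OF f(2)])
  qed
qed

lemma Gam_real_act:
  fixes V W :: "('k, 'u) module"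
  assumes o: "fdvs V" "fdvs W" and s: "s \<in> carrier (sym_group n)"
    and x: "x \<in> carrier (T n V W)" and t: "t \<in> carrier (tp n V)"
  shows "tpow_act n W s (Gam_real n V W x t) = Gam_real n V W (tpow_act n (Lin V W) s x) (tpow_act n V s t)"
proof -
  have f: "fdvs (Lin V W)" and vW: "vs (tpow n W :: ('k, 'u) module)" using o by simp_all
  note a = lin_lhom[OF tpow_act_lin[OF f s]] lin_lhom[OF tpow_act_lin[OF o(1) s]] lin_lhom[OF tpow_act_lin[OF o(2) s]]
  show ?thesis
  proof (rule tpow_ext2[OF f o(1) vW _ _ _ _ _ x t])
    fix x assume x: "x \<in> carrier (T n V W)"
    show "(\<lambda>t. tpow_act n W s (Gam_real n V W x t)) \<in> lhom (tp n V) (tp n W)"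
      by (rule lhom_compose[OF gr_lhom[OF o o(2) x] a(3)])
    show "(\<lambda>t. Gam_real n V W (tpow_act n (Lin V W) s x) (tpow_act n V s t)) \<in> lhom (tp n V) (tp n W)"
      by (rule lhom_compose[OF a(2) gr_lhom[OF o o(2) lhom_closed[OF a(1) x]]])
  next
    fix t assume t: "t \<in> carrier (tp n V)"
    show "(\<lambda>x. tpow_act n W s (Gam_real n V W x t)) \<in> lhom (T n V W) (tp n W)"
      by (rule lhom_compose[OF gr_left[OF o o(2) t] a(3)])
    show "(\<lambda>x. Gam_real n V W (tpow_act n (Lin V W) s x) (tpow_act n V s t)) \<in> lhom (T n V W) (tp n W)"
      by (rule lhom_compose[OF a(1) gr_left[OF o o(2) lhom_closed[OF a(2) t]]])
  next
    fix g v assume g: "g \<in> tuples n (Lin V W)" and v: "v \<in> tuples n V"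
    show "tpow_act n W s (Gam_real n V W (pure n (Lin V W) g) (pure n V v)) =
      Gam_real n V W (tpow_act n (Lin V W) s (pure n (Lin V W) g)) (tpow_act n V s (pure n V v))"
      using o f g v s
      by (simp add: restrict_sym[OF s] Gam_real_pure tuples_apply sym_tuples[OF f] sym_tuples[OF o(1)])
  qed
qed

lemma Gam_mor_simps [simp]:
  "carrier (Gam_mor n V W) = {x \<in> carrier (T n V W). \<forall>s\<in>carrier (sym_group n). tpow_act n (Lin V W) s x = x}"
  "\<zero>\<^bsub>Gam_mor n V W\<^esub> = \<zero>\<^bsub>T n V W\<^esub>" "x \<oplus>\<^bsub>Gam_mor n V W\<^esub> y = x \<oplus>\<^bsub>T n V W\<^esub> y"
  "c \<odot>\<^bsub>Gam_mor n V W\<^esub> x = c \<odot>\<^bsub>T n V W\<^esub> x"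
  by (simp_all add: Gam_mor_def)

lemma Gam_simps [simp]:
  "Obj (Gam n) = {V. fdvs V}" "Mor (Gam n) = Gam_mor n"
  "Idn (Gam n) V = pure n (Lin V V) (\<lambda>i\<in>{1..n}. \<lambda>x\<in>carrier V. x)" "Cmp (Gam n) = Gam_cmp n"
  by (simp_all add: Gam_def)

text \<open>The n-th power of a single map, an invariant tensor. Identities, unit isomorphisms of
  the duality and the maps in the polarization identity have this form, and on them composition is
  ordinary composition of maps.\<close>

definition gam :: "nat \<Rightarrow> ('k, 'u) module \<Rightarrow> ('k, 'u) module \<Rightarrow> ('u \<Rightarrow> 'u) \<Rightarrow> 'u" where
  "gam n V W f = pure n (Lin V W) (\<lambda>i\<in>{1..n}. f)"

lemma gam_closed [simp]:
  fixes V W :: "('k, 'u) module"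
  assumes "fdvs V" "fdvs W" "f \<in> lin V W"
  shows "gam n V W f \<in> carrier (Gam_mor n V W)"
proof -
  have "(\<lambda>i\<in>{1..n}. f) \<in> tuples n (Lin V W)" by (rule tuples_const) (simp add: assms)
  then show ?thesis
    using assms by (simp add: gam_def restrict_sym)
qed

lemma gam_cmp:
  fixes U V W :: "('k, 'u) module"
  assumes "fdvs U" "fdvs V" "fdvs W" "f \<in> lin U V" "g \<in> lin V W"
  shows "Gam_cmp n U V W (gam n V W g) (gam n U V f) = gam n U W (compose (carrier U) g f)"
  unfolding gam_def using assms Gam_cmp_pure[OF assms(1-3) tuples_const tuples_const, of g f n]
  by (simp cong: restrict_cong)

lemma Gam_pre: "lc_pre (Gam n :: ('k, ('k, 'u) module, 'u) lcat)"
  unfolding lc_pre_def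
proof (intro conjI ballI)
  fix U V :: "('k, 'u) module" assume "U \<in> Obj (Gam n)" "V \<in> Obj (Gam n)"
  then have o: "fdvs U" "fdvs V" by auto
  have f: "fdvs (Lin U V)" using o by simp
  note a = tpow_act_lin[OF f]
  have v: "vs (T n U V)" using f by simp
  show "vs (Mor (Gam n) U V)"
    unfolding Gam_simps unfolding Gam_mor_def
    by (rule vs_sub[OF v]) (use v lin_zero[OF a v v] lin_simps[OF a] in auto)
next
  fix V :: "('k, 'u) module" assume "V \<in> Obj (Gam n)"
  then show "Idn (Gam n) V \<in> carrier (Mor (Gam n) V V)"
    using gam_closed[of V V "\<lambda>x\<in>carrier V. x" n] lin_id[of V] by (simp add: gam_def)
next
  fix U V W :: "('k, 'u) module" and x y
  assume "U \<in> Obj (Gam n)" "V \<in> Obj (Gam n)" "W \<in> Obj (Gam n)"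
    "x \<in> carrier (Mor (Gam n) U V)" "y \<in> carrier (Mor (Gam n) V W)"
  then show "Cmp (Gam n) U V W y x \<in> carrier (Mor (Gam n) U W)"
    by (simp add: Gam_cmp_act)
qed

lemma gam_iso:
  fixes V W :: "('k, 'u) module"
  assumes o: "fdvs V" "fdvs W" and f: "f \<in> lin V W" "bij_betw f (carrier V) (carrier W)"
  shows "lc_iso (Gam n) V W (gam n V W f)"
proof -
  let ?g = "restrict (inv_into (carrier V) f) (carrier W)"
  note I = lin_inv[OF f fdvs_vs[OF o(1)] fdvs_vs[OF o(2)]]
  have 1: "compose (carrier V) ?g f = (\<lambda>x\<in>carrier V. x)" "compose (carrier W) f ?g = (\<lambda>x\<in>carrier W. x)"
    using I by (auto simp: compose_def simp del: restrict_apply intro!: restrict_ext)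
  show ?thesis
    unfolding lc_iso_def
    by (intro conjI bexI[of _ "gam n W V ?g"]; unfold Gam_simps)
      (use o f(1) I(1) gam_cmp[OF o o(1) f(1) I(1), of n] gam_cmp[OF o(2,1,2) I(1) f(1), of n] 1
        gam_closed[OF o f(1), of n] gam_closed[OF o(2,1) I(1), of n] in \<open>simp_all only: gam_def\<close>)
qed

lemma Gam_real_equivariant:
  fixes V W :: "('k, 'u) module"
  assumes o: "fdvs V" "fdvs W" and x: "x \<in> carrier (Gam_mor n V W)"
  shows "Gam_real n V W x \<in> equivariant n (tpow_rep n V) (tpow_rep n W)"
  by (rule equivariantI) (use o x Gam_real_act[OF o, of _ n x] gr_lin[OF o o(2), of x n] in simp_all)

section \<open>Duality on the category of divided powers\<close>

lemma Gam_dual_facts: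
  fixes V W :: "('k, 'u) module"
  assumes o: "fdvs V" "fdvs W"
  shows gd_lin: "mo (Gam_dual n) V W \<in> lin (T n V W) (T n (vdual W) (vdual V))"
    and gd_pure: "f \<in> tuples n (Lin V W) \<Longrightarrow> mo (Gam_dual n) V W (pure n (Lin V W) f) =
      pure n (Lin (vdual W) (vdual V)) (\<lambda>i\<in>{1..n}. vdual_map V W (f i))"
proof -
  have f: "fdvs (Lin V W)" "fdvs (Lin (vdual W) (vdual V))" and v: "vs (T n (vdual W) (vdual V))"
    using o by simp_all
  have m: "multilinear n (Lin V W) (T n (vdual W) (vdual V))
      (\<lambda>f. pure n (Lin (vdual W) (vdual V)) (\<lambda>i\<in>{1..n}. vdual_map V W (f i)))"
    by (rule pure_map_multilinear[OF f, of n "\<lambda>i. vdual_map V W"]) (rule vdual_map_lhom[OF o])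
  show "mo (Gam_dual n) V W \<in> lin (T n V W) (T n (vdual W) (vdual V))"
    unfolding Gam_dual_def ftor.simps by (rule tlift_lin[OF f(1) v m])
  show "f \<in> tuples n (Lin V W) \<Longrightarrow> mo (Gam_dual n) V W (pure n (Lin V W) f) =
      pure n (Lin (vdual W) (vdual V)) (\<lambda>i\<in>{1..n}. vdual_map V W (f i))"
    unfolding Gam_dual_def ftor.simps by (rule tlift_pure[OF f(1) v m])
qed

lemma tuples_vdual_map:
  fixes V W :: "('k, 'u) module"
  assumes "fdvs V" "fdvs W" "f \<in> tuples n (Lin V W)"
  shows "(\<lambda>i\<in>{1..n}. vdual_map V W (f i)) \<in> tuples n (Lin (vdual W) (vdual V))"
  by (rule tuples_restrict) (use vdual_map_lin[OF assms(1,2) tuples_Lin[OF assms(3)]] in simp)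

lemma Gam_dual_act:
  fixes V W :: "('k, 'u) module"
  assumes o: "fdvs V" "fdvs W" and s: "s \<in> carrier (sym_group n)" and x: "x \<in> carrier (T n V W)"
  shows "mo (Gam_dual n) V W (tpow_act n (Lin V W) s x) =
    tpow_act n (Lin (vdual W) (vdual V)) s (mo (Gam_dual n) V W x)"
proof -
  have f: "fdvs (Lin V W)" "fdvs (Lin (vdual W) (vdual V))" and v: "vs (T n (vdual W) (vdual V))"
    using o by simp_all
  note a = lin_lhom[OF tpow_act_lin[OF f(1) s]] lin_lhom[OF tpow_act_lin[OF f(2) s]] and d = lin_lhom[OF gd_lin[OF o]]
  show ?thesis
    by (rule tpow_ext[OF f(1) v lhom_compose[OF a(1) d] lhom_compose[OF d a(2)] _ x])
      (use o f s in \<open>simp add: restrict_sym[OF s] gd_pure sym_tuples[OF f(1)] tuples_vdual_map\<close>)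
qed

lemma Gam_dual_cmp:
  fixes U V W :: "('k, 'u) module"
  assumes o: "fdvs U" "fdvs V" "fdvs W" and x: "x \<in> carrier (T n U V)" and y: "y \<in> carrier (T n V W)"
  shows "mo (Gam_dual n) U W (Gam_cmp n U V W y x) =
    Gam_cmp n (vdual W) (vdual V) (vdual U) (mo (Gam_dual n) U V x) (mo (Gam_dual n) V W y)"
proof -
  have f: "fdvs (Lin U V)" "fdvs (Lin V W)" "fdvs (Lin U W)" using o by simp_all
  have o': "fdvs (vdual U)" "fdvs (vdual V)" "fdvs (vdual W)" using o by simp_all
  have v: "vs (T n (vdual W) (vdual U))" using o' by simp
  note d = lin_lhom[OF gd_lin[OF o(1,2)]] lin_lhom[OF gd_lin[OF o(2,3)]] lin_lhom[OF gd_lin[OF o(1,3)]]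
  show ?thesis
  proof (rule tpow_ext2[OF f(2,1) v _ _ _ _ _ y x])
    fix y assume y: "y \<in> carrier (T n V W)"
    show "(\<lambda>x. mo (Gam_dual n) U W (Gam_cmp n U V W y x)) \<in> lhom (T n U V) (T n (vdual W) (vdual U))"
      by (rule lhom_compose[OF gc_right[OF o y] d(3)])
    show "(\<lambda>x. Gam_cmp n (vdual W) (vdual V) (vdual U) (mo (Gam_dual n) U V x) (mo (Gam_dual n) V W y)) \<in> lhom (T n U V) (T n (vdual W) (vdual U))"
      by (rule lhom_compose[OF d(1) gc_left[OF o'(3,2,1) lhom_closed[OF d(2) y]]])
  next
    fix x assume x: "x \<in> carrier (T n U V)"
    show "(\<lambda>y. mo (Gam_dual n) U W (Gam_cmp n U V W y x)) \<in> lhom (T n V W) (T n (vdual W) (vdual U))"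
      by (rule lhom_compose[OF gc_left[OF o x] d(3)])
    show "(\<lambda>y. Gam_cmp n (vdual W) (vdual V) (vdual U) (mo (Gam_dual n) U V x) (mo (Gam_dual n) V W y)) \<in> lhom (T n V W) (T n (vdual W) (vdual U))"
      by (rule lhom_compose[OF d(2) gc_right[OF o'(3,2,1) lhom_closed[OF d(1) x]]])
  next
    fix g h assume g: "g \<in> tuples n (Lin V W)" and h: "h \<in> tuples n (Lin U V)"
    have "vdual_map U W (compose (carrier U) (g i) (h i)) =
      compose (carrier (vdual W)) (vdual_map U V (h i)) (vdual_map V W (g i))" if i: "i \<in> {1..n}" for i
    proof -
      note gi = tuples_Lin[OF g i] and hi = tuples_Lin[OF h i]
      show ?thesis
        by (rule lin_eqI[OF vdual_map_lin[OF o(1,3) lin_compose[OF hi lin_lhom[OF gi] fdvs_vs[OF o(1)]]]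
            lin_compose[OF vdual_map_lin[OF o(2,3) gi] lin_lhom[OF vdual_map_lin[OF o(1,2) hi]] fdvs_vs[OF o'(3)]]])
          (use vdual_map_compose[OF o hi gi] in \<open>simp add: compose_eq\<close>)
    qed
    then show "mo (Gam_dual n) U W (Gam_cmp n U V W (pure n (Lin V W) g) (pure n (Lin U V) h)) =
      Gam_cmp n (vdual W) (vdual V) (vdual U) (mo (Gam_dual n) U V (pure n (Lin U V) h)) (mo (Gam_dual n) V W (pure n (Lin V W) g))"
      using o o' g h
      by (simp add: Gam_cmp_pure gd_pure tuples_compose tuples_vdual_map cong: restrict_cong)
  qed
qed

lemma Gam_dual_ob [simp]: "ob (Gam_dual n) = vdual"
  by (simp add: Gam_dual_def)

lemma gd_closed:
  fixes V W :: "('k, 'u) module"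
  assumes "fdvs V" "fdvs W" "x \<in> carrier (Gam_mor n V W)"
  shows "mo (Gam_dual n) V W x \<in> carrier (Gam_mor n (vdual W) (vdual V))"
  using assms Gam_dual_act[OF assms(1,2), of _ n x, symmetric] lin_closed[OF gd_lin[OF assms(1,2)]] by simp

lemma Gam_cat_duality: "cat_duality \<iota> (Gam n) (Gam_dual n) (\<lambda>V. gam n V (vdual (vdual V)) (evd V))"
proof unfold_locales
  show "lc_pre (Gam n :: ('k, ('k, 'u) module, 'u) lcat)" by (rule Gam_pre)
next
  fix V W :: "('k, 'u) module" assume "V \<in> Obj (Gam n)" "W \<in> Obj (Gam n)"
  then have o: "fdvs V" "fdvs W" by auto
  have dd: "fdvs (vdual (vdual V))" "fdvs (vdual (vdual W))" and d: "fdvs (vdual V)" "fdvs (vdual W)" using o by simp_all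
  show "ob (Gam_dual n) V \<in> Obj (Gam n)" using o by simp
  show "mo (Gam_dual n) V W \<in> lhom (Mor (Gam n) V W) (Mor (Gam n) (ob (Gam_dual n) W) (ob (Gam_dual n) V))"
    by (rule lhomI) (use gd_closed[OF o] lin_simps[OF gd_lin[OF o]] in simp_all)
  show "mo (Gam_dual n) V V (Idn (Gam n) V) = Idn (Gam n) (ob (Gam_dual n) V)"
  proof -
    have "vdual_map V V (\<lambda>x\<in>carrier V. x) = (\<lambda>x\<in>carrier (vdual V). x)"
      by (rule lin_eqI[OF vdual_map_lin lin_id]) (use o in \<open>simp_all add: lin_id vdual_map_id\<close>)
    then show ?thesis
      using gd_pure[OF o(1) o(1) tuples_const, of "\<lambda>x\<in>carrier V. x" n] o lin_id[of V] by (simp cong: restrict_cong)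
  qed
  show "lc_iso (Gam n) V (ob (Gam_dual n) (ob (Gam_dual n) V)) (gam n V (vdual (vdual V)) (evd V))"
    using gam_iso[OF o(1) dd(1) evd_lin[OF o(1)] evd_bij[OF o(1)]] by simp
  fix x assume "x \<in> carrier (Mor (Gam n) V W)"
  then have x: "x \<in> carrier (T n V W)" by simp
  let ?d = "mo (Gam_dual n)"
  have gx: "gam n V (vdual (vdual V)) (evd V) \<in> carrier (T n V (vdual (vdual V)))"
    "gam n W (vdual (vdual W)) (evd W) \<in> carrier (T n W (vdual (vdual W)))"
    using gam_closed[OF o(1) dd(1) evd_lin[OF o(1)], of n] gam_closed[OF o(2) dd(2) evd_lin[OF o(2)], of n] by simp_all
  \<comment> \<open>Both sides are linear in \<open>x\<close>, so pure tensors suffice; there the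
    equation is \<open>evd_natural\<close> in each factor.\<close>
  have "Gam_cmp n V (vdual (vdual V)) (vdual (vdual W)) (?d (vdual W) (vdual V) (?d V W x)) (gam n V (vdual (vdual V)) (evd V)) =
      Gam_cmp n V W (vdual (vdual W)) (gam n W (vdual (vdual W)) (evd W)) x"
  proof (rule tpow_ext[OF _ _ lhom_compose[OF lhom_compose[OF lin_lhom[OF gd_lin[OF o]] lin_lhom[OF gd_lin[OF d(2,1)]]] gc_left[OF o(1) dd gx(1)]]
        gc_right[OF o dd(2) gx(2)] _ x])
    fix f assume f: "f \<in> tuples n (Lin V W)"
    have "compose (carrier V) (vdual_map (vdual W) (vdual V) (vdual_map V W (f i))) (evd V) = compose (carrier V) (evd W) (f i)"
      if "i \<in> {1..n}" for i
      using evd_natural[OF o tuples_Lin[OF f that]] by (auto simp: compose_def intro!: restrict_ext)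
    then show "Gam_cmp n V (vdual (vdual V)) (vdual (vdual W)) (?d (vdual W) (vdual V) (?d V W (pure n (Lin V W) f))) (gam n V (vdual (vdual V)) (evd V)) =
      Gam_cmp n V W (vdual (vdual W)) (gam n W (vdual (vdual W)) (evd W)) (pure n (Lin V W) f)"
      using o d dd f tuples_const[of "evd V" "Lin V (vdual (vdual V))" n] tuples_const[of "evd W" "Lin W (vdual (vdual W))" n]
        evd_lin[OF o(1)] evd_lin[OF o(2)] tuples_vdual_map[OF d(2,1) tuples_vdual_map[OF o f]]
      by (simp add: gd_pure tuples_vdual_map Gam_cmp_pure gam_def cong: restrict_cong)
  qed (use o in simp_all)
  then show "Cmp (Gam n) V (ob (Gam_dual n) (ob (Gam_dual n) V)) (ob (Gam_dual n) (ob (Gam_dual n) W))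
      (?d (ob (Gam_dual n) W) (ob (Gam_dual n) V) (?d V W x)) (gam n V (vdual (vdual V)) (evd V)) =
    Cmp (Gam n) V W (ob (Gam_dual n) (ob (Gam_dual n) W)) (gam n W (vdual (vdual W)) (evd W)) x"
    by simp
  fix U :: "('k, 'u) module" and y assume "U \<in> Obj (Gam n)" "y \<in> carrier (Mor (Gam n) W U)"
  then show "?d V U (Cmp (Gam n) V W U y x) = Cmp (Gam n) (ob (Gam_dual n) U) (ob (Gam_dual n) W) (ob (Gam_dual n) V) (?d V W x) (?d W U y)"
    using Gam_dual_cmp[OF o _ x] by simp
qed

end

text \<open>Composites in functor categories stay folded from here on, so that associativity and
  \<open>Fun_Cmp_apply\<close> can be applied to them.\<close>

declare Fun_simps(7) [simp del]

context univ
begin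

subsection \<open>Duals of tensor powers\<close>

text \<open>The pairing between tensors of functionals and tensors of vectors, on pure tensors the
  product of the evaluations. \<open>kap\<close> is the canonical map from the tensor power of the
  dual to the dual of the tensor power, that is, this pairing with its values coded in
  \<open>vdual\<close>.\<close>

definition kap_form :: "nat \<Rightarrow> ('k, 'u) module \<Rightarrow> 'u \<Rightarrow> 'u \<Rightarrow> 'k" where
  "kap_form n V = tlift n (vdual V) (Lin (tp n V) scalars)
     (\<lambda>\<xi>. tlift n V scalars (\<lambda>v. \<Prod>i\<in>{1..n}. app V (\<xi> i) (v i)))"

definition kap :: "nat \<Rightarrow> ('k, 'u) module \<Rightarrow> 'u \<Rightarrow> 'u" where
  "kap n V = compose (carrier (tp n (vdual V))) (enc (dual_space (tp n V))) (kap_form n V)"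

context
  fixes V :: "('k, 'u) module" and n :: nat
  assumes V: "fdvs V"
begin

lemma kap_form_lin: "kap_form n V \<in> lin (tp n (vdual V)) (Lin (tp n V) scalars)"
  and kap_form_pure: "\<xi> \<in> tuples n (vdual V) \<Longrightarrow> v \<in> tuples n V \<Longrightarrow>
    kap_form n V (pure n (vdual V) \<xi>) (pure n V v) = (\<Prod>i\<in>{1..n}. app V (\<xi> i) (v i))"
proof -
  have B: "multilinear n V scalars (\<lambda>v. \<Prod>i\<in>{1..n}. app V (\<xi> i) (v i))" if "\<xi> \<in> tuples n (vdual V)" for \<xi>
    by (rule multilinear_prod) (rule app_lhom[OF V tuples_mem[OF that]])
  have B': "multilinear n (vdual V) scalars (\<lambda>\<xi>. \<Prod>i\<in>{1..n}. app V (\<xi> i) (v i))" if "v \<in> tuples n V" for v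
    by (rule multilinear_prod[of n "\<lambda>i \<xi>. app V \<xi> (v i)"]) (rule app_lhom_left[OF V tuples_mem[OF that]])
  show "kap_form n V \<in> lin (tp n (vdual V)) (Lin (tp n V) scalars)"
    unfolding kap_form_def by (rule tlift2(1)[OF fdvs_vdual[OF V] V vs_scalars B B'])
  show "\<xi> \<in> tuples n (vdual V) \<Longrightarrow> v \<in> tuples n V \<Longrightarrow>
    kap_form n V (pure n (vdual V) \<xi>) (pure n V v) = (\<Prod>i\<in>{1..n}. app V (\<xi> i) (v i))"
    unfolding kap_form_def by (rule tlift2(2)[OF fdvs_vdual[OF V] V vs_scalars B B'])
qed

lemma kap_lin: "kap n V \<in> lin (tp n (vdual V)) (vdual (tp n V))"
proof -
  have "(enc (dual_space (tp n V)) :: _ \<Rightarrow> 'u) \<in> lhom (Lin (tp n V) scalars) (vdual (tp n V))"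
    using enc_lhom[of "dual_space (tp n V)"] V by (simp add: vdual_def flip: dual_space_def)
  then show ?thesis
    unfolding kap_def by (rule lin_compose[OF kap_form_lin]) (simp add: V)
qed

lemma kap_closed [simp]: "y \<in> carrier (tp n (vdual V)) \<Longrightarrow> kap n V y \<in> carrier (vdual (tp n V))"
  by (rule lin_closed[OF kap_lin])

lemma app_kap: "y \<in> carrier (tp n (vdual V)) \<Longrightarrow> app (tp n V) (kap n V y) = kap_form n V y"
  using lin_closed[OF kap_form_lin, of y] by (simp add: kap_def app_def compose_eq V)

lemma app_kap_pure [simp]:
  "\<xi> \<in> tuples n (vdual V) \<Longrightarrow> v \<in> tuples n V \<Longrightarrow>
    app (tp n V) (kap n V (pure n (vdual V) \<xi>)) (pure n V v) = (\<Prod>i\<in>{1..n}. app V (\<xi> i) (v i))"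
  using kap_form_pure by (simp add: app_kap V)

lemma app_kap_right: "y \<in> carrier (tp n (vdual V)) \<Longrightarrow> (\<lambda>t. app (tp n V) (kap n V y) t) \<in> lhom (tp n V) scalars"
  using app_lhom[OF _ kap_closed] V by simp

lemma app_kap_left: "t \<in> carrier (tp n V) \<Longrightarrow> (\<lambda>y. app (tp n V) (kap n V y) t) \<in> lhom (tp n (vdual V)) scalars"
  using lhom_compose[OF lin_lhom[OF kap_lin] app_lhom_left[of "tp n V" t]] V by simp

lemma vdual_bas:
  assumes B: "bas V I b c"
  shows "bas (vdual V) I (\<lambda>i. mkd V (c i)) (\<lambda>i \<xi>. app V \<xi> (b i))"
proof -
  note B' = basD[OF B]
  have v: "vs (vdual V)" using V by simp
  have z: "app V \<zero>\<^bsub>vdual V\<^esub> x = 0" if "x \<in> carrier V" for x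
    using lhom_zero[OF app_lhom_left[OF V that] v] by simp
  show ?thesis
    unfolding bas_def
  proof (intro conjI ballI impI)
    fix \<xi> assume x: "\<xi> \<in> carrier (vdual V)" "\<forall>i\<in>I. app V \<xi> (b i) = 0"
    show "\<xi> = \<zero>\<^bsub>vdual V\<^esub>"
    proof (rule app_ext[OF V x(1) vs_zero[OF v]])
      fix y assume y: "y \<in> carrier V"
      have "app V \<xi> y = (\<lambda>x. \<zero>\<^bsub>scalars\<^esub>) y"
        by (rule bas_ext[OF B app_lhom[OF V x(1)] lhom_const_zero vs_scalars _ y]) (use x in auto)
      then show "app V \<xi> y = app V \<zero>\<^bsub>vdual V\<^esub> y" using z[OF y] by simp
    qed
  qed (use B' V v app_lhom_left in auto)
qed

lemma kap_bij: "bij_betw (kap n V) (carrier (tp n (vdual V))) (carrier (vdual (tp n V)))"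
proof (rule bij_betw_imageI)
  have dV: "fdvs (vdual V)" and tV: "fdvs (tp n V)" using V by simp_all
  have v: "vs (tp n (vdual V))" "vs (vdual (tp n V))" using dV tV by simp_all
  show "inj_on (kap n V) (carrier (tp n (vdual V)))"
    unfolding lhom_inj_iff[OF lin_lhom[OF kap_lin] v]
  proof (intro ballI impI)
    fix y assume y: "y \<in> carrier (tp n (vdual V))" "kap n V y = \<zero>\<^bsub>vdual (tp n V)\<^esub>"
    show "y = \<zero>\<^bsub>tp n (vdual V)\<^esub>"
    proof (rule tpow_separates[OF dV y(1)])
      fix f assume f: "f \<in> tuples n (dual_space (vdual V))"
      have fl: "f i \<in> lhom (vdual V) scalars" if "i \<in> {1..n}" for i
        using tuples_mem[OF f that] by (simp add: lin_lhom)
      \<comment> \<open>By reflexivity each factor of the test functional is evaluation at a vector.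
        The whole test functional is then the pairing with a pure tensor, which vanishes on
        \<open>y\<close> because \<open>kap n V y\<close> is zero.\<close>
      then have "\<exists>x\<in>carrier V. \<forall>\<xi>\<in>carrier (vdual V). f i \<xi> = app V \<xi> x" if "i \<in> {1..n}" for i
        using app_surj[OF V] that by blast
      then obtain x where x: "\<And>i. i \<in> {1..n} \<Longrightarrow> x i \<in> carrier V"
        "\<And>i \<xi>. i \<in> {1..n} \<Longrightarrow> \<xi> \<in> carrier (vdual V) \<Longrightarrow> f i \<xi> = app V \<xi> (x i)" by metis
      let ?x = "\<lambda>i\<in>{1..n}. x i"
      have xt: "?x \<in> tuples n V" by (rule tuples_restrict) (rule x)
      have pt: "pure n V ?x \<in> carrier (tp n V)" using V xt by simp
      have m: "multilinear n (vdual V) scalars (\<lambda>\<xi>. \<Prod>i\<in>{1..n}. f i (\<xi> i))"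
        by (rule multilinear_prod) (rule fl)
      have "tlift n (vdual V) scalars (\<lambda>\<xi>. \<Prod>i\<in>{1..n}. f i (\<xi> i)) y = app (tp n V) (kap n V y) (pure n V ?x)"
        by (rule tpow_ext[OF dV vs_scalars lin_lhom[OF tlift_lin[OF dV vs_scalars m]] app_kap_left[OF pt] _ y(1)])
          (use xt dV m x tuples_mem[of _ n "vdual V"] in \<open>auto intro!: prod.cong\<close>)
      also have "\<dots> = 0"
        using y(2) lhom_zero[OF app_lhom_left[OF tV pt] v(2)] by simp
      finally show "tlift n (vdual V) scalars (\<lambda>\<xi>. \<Prod>i\<in>{1..n}. f i (\<xi> i)) y = 0" .
    qed
  qed
  show "kap n V ` carrier (tp n (vdual V)) = carrier (vdual (tp n V))"
  proof safe
    fix l assume l: "l \<in> carrier (vdual (tp n V))"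
    obtain d b c where B: "bas V {..<d::nat} b c" using fdvs_bas[OF V] by blast
    let ?\<Phi> = "{1..n} \<rightarrow>\<^sub>E {..<d}"
    note D = vdual_bas[OF B]
    note BD = bas_tpow[OF dV D, of n] and BV = bas_tpow[OF V B, of n]
    let ?b = "\<lambda>\<phi>. \<lambda>i\<in>{1..n}. b (\<phi> i)"
    have bt: "?b \<phi> \<in> tuples n V" if "\<phi> \<in> ?\<Phi>" for \<phi>
      by (intro tuples_restrict basD(3)[OF B] PiE_mem[OF that])
    \<comment> \<open>In the basis of pure tensors of the dual basis, the coordinates of
      \<open>y\<close> are its pairings with the pure tensors of \<open>b\<close>. They are
      prescribed to be the values of \<open>l\<close> there.\<close>
    obtain y where y: "y \<in> carrier (tp n (vdual V))" "\<forall>\<phi>\<in>?\<Phi>.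
        tlift n (vdual V) scalars (\<lambda>\<xi>. \<Prod>i\<in>{1..n}. app V (\<xi> i) (b (\<phi> i))) y = app (tp n V) l (pure n V (?b \<phi>))"
      using bas_vec[OF BD, of "\<lambda>\<phi>. app (tp n V) l (pure n V (?b \<phi>))"] by blast
    have "kap n V y = l"
    proof (rule app_ext[OF tV kap_closed[OF y(1)] l])
      fix t assume t: "t \<in> carrier (tp n V)"
      show "app (tp n V) (kap n V y) t = app (tp n V) l t"
      proof (rule bas_ext[OF BV app_kap_right[OF y(1)] app_lhom[OF tV l] vs_scalars _ t])
        fix \<phi> assume \<phi>: "\<phi> \<in> ?\<Phi>"
        have m: "multilinear n (vdual V) scalars (\<lambda>\<xi>. \<Prod>i\<in>{1..n}. app V (\<xi> i) (b (\<phi> i)))"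
          by (rule multilinear_prod[of n "\<lambda>i \<xi>. app V \<xi> (b (\<phi> i))"])
            (rule app_lhom_left[OF V basD(3)[OF B PiE_mem[OF \<phi>]]])
        have pt: "pure n V (?b \<phi>) \<in> carrier (tp n V)" using V bt[OF \<phi>] by simp
        have "tlift n (vdual V) scalars (\<lambda>\<xi>. \<Prod>i\<in>{1..n}. app V (\<xi> i) (b (\<phi> i))) y = app (tp n V) (kap n V y) (pure n V (?b \<phi>))"
          by (rule tpow_ext[OF dV vs_scalars lin_lhom[OF tlift_lin[OF dV vs_scalars m]] app_kap_left[OF pt] _ y(1)])
            (use bt[OF \<phi>] dV m in simp)
        then show "app (tp n V) (kap n V y) (pure n V (?b \<phi>)) = app (tp n V) l (pure n V (?b \<phi>))"
          using y(2) \<phi> by simp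
      qed
    qed
    then show "l \<in> kap n V ` carrier (tp n (vdual V))" using y by blast
  qed (rule kap_closed)
qed

lemma kap_equivariant: "kap n V \<in> equivariant n (tpow_rep n (vdual V)) (dual_rep n (tpow_rep n V))"
proof (rule equivariantI)
  have dV: "fdvs (vdual V)" and tV: "fdvs (tp n V)" using V by simp_all
  show "kap n V \<in> lin (rsp (tpow_rep n (vdual V))) (rsp (dual_rep n (tpow_rep n V)))"
    using kap_lin V by simp
  fix s and y :: 'u assume s: "s \<in> carrier (sym_group n)" and "y \<in> carrier (rsp (tpow_rep n (vdual V)))"
  then have y: "y \<in> carrier (tp n (vdual V))" using V by simp
  let ?s = "inv\<^bsub>sym_group n\<^esub> s"
  have s': "?s \<in> carrier (sym_group n)" using s by simp
  note a = lin_lhom[OF tpow_act_lin[OF V s']] lin_lhom[OF tpow_act_lin[OF dV s]]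
  have "kap n V (tpow_act n (vdual V) s y) = vdual_map (tp n V) (tp n V) (tpow_act n V ?s) (kap n V y)"
  proof (rule app_ext[OF tV])
    fix t assume t: "t \<in> carrier (tp n V)"
    have "app (tp n V) (kap n V (tpow_act n (vdual V) s y)) t = app (tp n V) (kap n V y) (tpow_act n V ?s t)"
    proof (rule tpow_ext2[OF dV V vs_scalars _ _ _ _ _ y t])
      fix y assume y: "y \<in> carrier (tp n (vdual V))"
      show "(\<lambda>t. app (tp n V) (kap n V (tpow_act n (vdual V) s y)) t) \<in> lhom (tp n V) scalars"
        by (rule app_kap_right[OF lhom_closed[OF a(2) y]])
      show "(\<lambda>t. app (tp n V) (kap n V y) (tpow_act n V ?s t)) \<in> lhom (tp n V) scalars"
        by (rule lhom_compose[OF a(1) app_kap_right[OF y]])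
    next
      fix t assume t: "t \<in> carrier (tp n V)"
      show "(\<lambda>y. app (tp n V) (kap n V (tpow_act n (vdual V) s y)) t) \<in> lhom (tp n (vdual V)) scalars"
        by (rule lhom_compose[OF a(2) app_kap_left[OF t]])
      show "(\<lambda>y. app (tp n V) (kap n V y) (tpow_act n V ?s t)) \<in> lhom (tp n (vdual V)) scalars"
        by (rule app_kap_left[OF lhom_closed[OF a(1) t]])
    next
      fix \<xi> v assume x: "\<xi> \<in> tuples n (vdual V)" and v: "v \<in> tuples n V"
      have p: "s permutes {1..n}" "?s = inv' s" using s by (simp_all add: sym_group_carrier sym_group_inv_equality)
      \<comment> \<open>Reindexing the product by \<open>s\<close> moves the permutation from the
        functionals to the vectors, where it appears inverted, as the dual action requires.\<close>
      have "(\<Prod>i\<in>{1..n}. app V (\<xi> (inv' s i)) (v i)) = (\<Prod>i\<in>{1..n}. app V (\<xi> (inv' s (s i))) (v (s i)))"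
        by (rule prod.permute[OF p(1), unfolded comp_def])
      also have "\<dots> = (\<Prod>i\<in>{1..n}. app V (\<xi> i) (v (s i)))"
        using permutes_inverses(2)[OF p(1)] by simp
      finally have eq: "(\<Prod>i\<in>{1..n}. app V (\<xi> (?s i)) (v i)) = (\<Prod>i\<in>{1..n}. app V (\<xi> i) (v (s i)))"
        unfolding p(2) .
      show "app (tp n V) (kap n V (tpow_act n (vdual V) s (pure n (vdual V) \<xi>))) (pure n V v) =
          app (tp n V) (kap n V (pure n (vdual V) \<xi>)) (tpow_act n V ?s (pure n V v))"
        using x v s s' dV V sym_tuples[OF dV s' x] sym_tuples[OF V s v] eq
        by (simp add: group.inv_inv[OF sym_group_is_group])
    qed
    then show "app (tp n V) (kap n V (tpow_act n (vdual V) s y)) t =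
        app (tp n V) (vdual_map (tp n V) (tp n V) (tpow_act n V ?s) (kap n V y)) t"
      using tV t y tpow_act_lin[OF V s'] by simp
  qed (use V dV tV s y tpow_act_lin[OF V s'] in \<open>simp_all add: vdual_map_closed\<close>)
  then show "kap n V (act (tpow_rep n (vdual V)) s y) = act (dual_rep n (tpow_rep n V)) s (kap n V y)"
    using V by simp
qed

end

text \<open>The duality of \<open>Gam n\<close>, realized on tensor powers, becomes ordinary
  transposition under \<open>kap\<close>. This is what makes j^* compatible with the two dualities
  and identifies the functor of coinvariants.\<close>

lemma kap_natural:
  fixes V W :: "('k, 'u) module"
  assumes o: "fdvs V" "fdvs W" and x: "x \<in> carrier (T n V W)" and y: "y \<in> carrier (tp n (vdual W))"
  shows "kap n V (Gam_real n (vdual W) (vdual V) (mo (Gam_dual n) V W x) y) =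
    vdual_map (tp n V) (tp n W) (Gam_real n V W x) (kap n W y)"
proof (rule app_ext[of "tp n V"])
  have d: "fdvs (vdual V)" "fdvs (vdual W)" and t: "fdvs (tp n V)" "fdvs (tp n W)" and f: "fdvs (Lin V W)"
    using o by simp_all
  note D = gd_lin[OF o, of n]
  have Dx: "mo (Gam_dual n) V W x \<in> carrier (T n (vdual W) (vdual V))" if "x \<in> carrier (T n V W)" for x
    by (rule lin_closed[OF D that])
  have rl: "Gam_real n V W x \<in> lin (tp n V) (tp n W)" by (rule gr_lin[OF o o(2) x])
  show "fdvs (tp n V)" by (rule t)
  show "kap n V (Gam_real n (vdual W) (vdual V) (mo (Gam_dual n) V W x) y) \<in> carrier (vdual (tp n V))"
    using Dx[OF x] o d x y by simp
  show "vdual_map (tp n V) (tp n W) (Gam_real n V W x) (kap n W y) \<in> carrier (vdual (tp n V))"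
    by (rule vdual_map_closed[OF t rl kap_closed[OF o(2) y]])
  fix s assume s: "s \<in> carrier (tp n V)"
  note gr = gr_lhom[OF d(2,1,1)] gr_left[OF d(2,1,1)] gr_lhom[OF o o(2)] gr_left[OF o o(2)]
  have "app (tp n V) (kap n V (Gam_real n (vdual W) (vdual V) (mo (Gam_dual n) V W x) y)) s =
    app (tp n W) (kap n W y) (Gam_real n V W x s)"
  proof (rule tpow_ext[OF o(1) vs_scalars app_kap_right[OF o(1)] lhom_compose[OF gr(3)[OF x] app_kap_right[OF o(2) y]] _ s])
    show "Gam_real n (vdual W) (vdual V) (mo (Gam_dual n) V W x) y \<in> carrier (tp n (vdual V))"
      using Dx[OF x] d y by simp
    fix v assume v: "v \<in> tuples n V"
    have pv: "pure n V v \<in> carrier (tp n V)" using o v by simp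
    show "app (tp n V) (kap n V (Gam_real n (vdual W) (vdual V) (mo (Gam_dual n) V W x) y)) (pure n V v) =
      app (tp n W) (kap n W y) (Gam_real n V W x (pure n V v))"
    proof (rule tpow_ext2[OF f d(2) vs_scalars _ _ _ _ _ x y])
      fix x assume x: "x \<in> carrier (T n V W)"
      show "(\<lambda>y. app (tp n V) (kap n V (Gam_real n (vdual W) (vdual V) (mo (Gam_dual n) V W x) y)) (pure n V v)) \<in> lhom (tp n (vdual W)) scalars"
        by (rule lhom_compose[OF gr(1)[OF Dx[OF x]] app_kap_left[OF o(1) pv]])
      show "(\<lambda>y. app (tp n W) (kap n W y) (Gam_real n V W x (pure n V v))) \<in> lhom (tp n (vdual W)) scalars"
        by (rule app_kap_left[OF o(2) lhom_closed[OF gr(3)[OF x] pv]])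
    next
      fix y assume y: "y \<in> carrier (tp n (vdual W))"
      show "(\<lambda>x. app (tp n V) (kap n V (Gam_real n (vdual W) (vdual V) (mo (Gam_dual n) V W x) y)) (pure n V v)) \<in> lhom (T n V W) scalars"
        by (rule lhom_compose[OF lhom_compose[OF lin_lhom[OF D] gr(2)[OF y]] app_kap_left[OF o(1) pv]])
      show "(\<lambda>x. app (tp n W) (kap n W y) (Gam_real n V W x (pure n V v))) \<in> lhom (T n V W) scalars"
        by (rule lhom_compose[OF gr(4)[OF pv] app_kap_right[OF o(2) y]])
    next
      fix g \<xi> assume g: "g \<in> tuples n (Lin V W)" and \<xi>: "\<xi> \<in> tuples n (vdual W)"
      have "app V (vdual_map V W (g i) (\<xi> i)) (v i) = app W (\<xi> i) (g i (v i))" if "i \<in> {1..n}" for i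
        using o tuples_Lin[OF g that] tuples_mem[OF \<xi> that] tuples_mem[OF v that] by simp
      then show "app (tp n V) (kap n V (Gam_real n (vdual W) (vdual V) (mo (Gam_dual n) V W (pure n (Lin V W) g)) (pure n (vdual W) \<xi>))) (pure n V v) =
        app (tp n W) (kap n W (pure n (vdual W) \<xi>)) (Gam_real n V W (pure n (Lin V W) g) (pure n V v))"
        using o d g \<xi> v tuples_apply[OF tuples_vdual_map[OF o g] \<xi>]
        by (simp add: gd_pure Gam_real_pure tuples_vdual_map tuples_apply cong: restrict_cong)
    qed
  qed
  then show "app (tp n V) (kap n V (Gam_real n (vdual W) (vdual V) (mo (Gam_dual n) V W x) y)) s =
      app (tp n V) (vdual_map (tp n V) (tp n W) (Gam_real n V W x) (kap n W y)) s"
    using t rl s y o by simp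
qed

end

subsection \<open>Polarization and finite-dimensionality\<close>

text \<open>The subsets of \<open>S\<close> are grouped into pairs \<open>A\<close> and
  \<open>insert j A\<close>, which carry opposite signs.\<close>

lemma alternating_sum_zero:
  fixes f :: "'a set \<Rightarrow> 'k::comm_ring_1"
  assumes "finite S" "j \<in> S"
  shows "(\<Sum>A\<in>Pow S. (-1) ^ card A * f A) = (\<Sum>A\<in>Pow (S - {j}). (-1) ^ card A * (f A - f (insert j A)))"
proof -
  let ?S = "S - {j}"
  have fin: "finite (Pow ?S)" using assms by simp
  have P: "Pow S = Pow ?S \<union> insert j ` Pow ?S" using assms by (metis Pow_insert insert_Diff)
  have inj: "inj_on (insert j) (Pow ?S)" by (rule inj_onI) blast
  have "(\<Sum>A\<in>Pow S. (-1) ^ card A * f A) = (\<Sum>A\<in>Pow ?S. (-1) ^ card A * f A) + (\<Sum>A\<in>insert j ` Pow ?S. (-1) ^ card A * f A)"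
    unfolding P by (rule sum.union_disjoint) (use fin in auto)
  also have "(\<Sum>A\<in>insert j ` Pow ?S. (-1) ^ card A * f A) = (\<Sum>A\<in>Pow ?S. (-1) ^ card (insert j A) * f (insert j A))"
    by (simp add: sum.reindex[OF inj])
  also have "\<dots> = (\<Sum>A\<in>Pow ?S. - ((-1) ^ card A * f (insert j A)))"
  proof (rule sum.cong[OF refl])
    fix A assume "A \<in> Pow ?S"
    then have "finite A" "j \<notin> A" using assms finite_subset[of A ?S] by auto
    then show "(-1) ^ card (insert j A) * f (insert j A) = - ((-1) ^ card A * f (insert j A))" by simp
  qed
  finally show ?thesis by (simp add: sum.distrib[symmetric] algebra_simps)
qed

text \<open>A product of \<open>card I\<close> additive functions of the subset has degree at most
  \<open>card I\<close>, so more than \<open>card I\<close> successive differences annihilate it.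
  The induction expands the factor of \<open>i\<close>. The part with \<open>c i\<close> vanishes by
  hypothesis; in the part with \<open>a i j\<close> only the sets containing \<open>j\<close>
  remain, and removing \<open>j\<close> from them shrinks \<open>S\<close> by one while the terms
  \<open>a k j\<close> are absorbed into the constants. This is why the statement carries the
  constants \<open>c\<close>, general in the induction.\<close>

lemma alternating_prod_sum:
  fixes a :: "'i \<Rightarrow> 'a \<Rightarrow> 'k::comm_ring_1"
  assumes "finite I" "finite S" "card I < card S"
  shows "(\<Sum>A\<in>Pow S. (-1) ^ card A * (\<Prod>i\<in>I. c i + (\<Sum>j\<in>A. a i j))) = 0"
  using assms
proof (induction I arbitrary: S c rule: finite_induct)
  case empty
  then obtain j where "j \<in> S" by fastforce
  then show ?case using alternating_sum_zero[OF empty(1), of j "\<lambda>_. 1"] by simp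
next
  case (insert i I)
  let ?f = "\<lambda>A. \<Prod>k\<in>I. c k + (\<Sum>j\<in>A. a k j)"
  have "(\<Sum>A\<in>Pow S. (-1) ^ card A * (\<Prod>k\<in>insert i I. c k + (\<Sum>j\<in>A. a k j))) =
    (\<Sum>A\<in>Pow S. c i * ((-1) ^ card A * ?f A) + (\<Sum>j\<in>A. a i j * ((-1) ^ card A * ?f A)))"
    using insert.hyps by (intro sum.cong) (auto simp: algebra_simps sum_distrib_left sum_distrib_right)
  also have "\<dots> = c i * (\<Sum>A\<in>Pow S. (-1) ^ card A * ?f A) + (\<Sum>A\<in>Pow S. \<Sum>j\<in>A. a i j * ((-1) ^ card A * ?f A))"
    by (simp add: sum.distrib sum_distrib_left)
  also have "(\<Sum>A\<in>Pow S. (-1) ^ card A * ?f A) = 0"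
    by (rule insert.IH) (use insert in auto)
  also have "(\<Sum>A\<in>Pow S. \<Sum>j\<in>A. a i j * ((-1) ^ card A * ?f A)) =
      (\<Sum>A\<in>Pow S. \<Sum>j\<in>{j\<in>S. j \<in> A}. a i j * ((-1) ^ card A * ?f A))"
    by (intro sum.cong) auto
  also have "\<dots> = (\<Sum>j\<in>S. \<Sum>A\<in>{A\<in>Pow S. j \<in> A}. a i j * ((-1) ^ card A * ?f A))"
    by (rule sum.swap_restrict) (use insert in auto)
  also have "\<dots> = (\<Sum>j\<in>S. a i j * (\<Sum>A\<in>{A\<in>Pow S. j \<in> A}. (-1) ^ card A * ?f A))"
    by (simp add: sum_distrib_left)
  also have "\<dots> = 0"
  proof (rule sum.neutral, intro ballI)
    fix j assume j: "j \<in> S"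
    have eq: "{A\<in>Pow S. j \<in> A} = insert j ` Pow (S - {j})"
    proof safe
      fix A assume "A \<subseteq> S" "j \<in> A"
      then show "A \<in> insert j ` Pow (S - {j})" by (intro image_eqI[of _ _ "A - {j}"]) auto
    qed (use j in auto)
    have inj: "inj_on (insert j) (Pow (S - {j}))" by (rule inj_onI) blast
    have "(\<Sum>A\<in>{A\<in>Pow S. j \<in> A}. (-1) ^ card A * ?f A) =
      (\<Sum>A\<in>Pow (S - {j}). (-1) ^ card (insert j A) * ?f (insert j A))"
      unfolding eq by (simp add: sum.reindex[OF inj])
    also have "\<dots> = (\<Sum>A\<in>Pow (S - {j}). - ((-1) ^ card A * (\<Prod>k\<in>I. (c k + a k j) + (\<Sum>j\<in>A. a k j))))"
    proof (rule sum.cong[OF refl])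
      fix A assume "A \<in> Pow (S - {j})"
      then have "finite A" "j \<notin> A" using insert.prems finite_subset[of A "S - {j}"] by auto
      then show "(-1) ^ card (insert j A) * ?f (insert j A) = - ((-1) ^ card A * (\<Prod>k\<in>I. (c k + a k j) + (\<Sum>j\<in>A. a k j)))"
        by (simp add: add.assoc)
    qed
    also have "\<dots> = - (\<Sum>A\<in>Pow (S - {j}). (-1) ^ card A * (\<Prod>k\<in>I. (c k + a k j) + (\<Sum>j\<in>A. a k j)))"
      by (rule sum_negf)
    also have "\<dots> = 0"
      by (subst insert.IH) (use insert j in auto)
    finally show "a i j * (\<Sum>A\<in>{A\<in>Pow S. j \<in> A}. (-1) ^ card A * ?f A) = 0" by simp
  qed
  finally show ?case by simp
qed

text \<open>The linear combination is described by its value under every functional; finite sums are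
  thus taken among scalars instead of in \<open>X\<close>.\<close>

lemma linear_combination_in:
  assumes X: "vs X" and N: "N \<subseteq> carrier X" "\<zero>\<^bsub>X\<^esub> \<in> N"
    and c: "\<And>x y. x \<in> N \<Longrightarrow> y \<in> N \<Longrightarrow> x \<oplus>\<^bsub>X\<^esub> y \<in> N" "\<And>r x. x \<in> N \<Longrightarrow> r \<odot>\<^bsub>X\<^esub> x \<in> N"
    and A: "finite A" "\<And>a. a \<in> A \<Longrightarrow> z a \<in> N"
  shows "\<exists>s\<in>N. \<forall>f\<in>lhom X scalars. f s = (\<Sum>a\<in>A. r a * f (z a))"
  using A
proof (induction A)
  case empty
  show ?case using lhom_zero[OF _ X vs_scalars] N by (intro bexI[of _ "\<zero>\<^bsub>X\<^esub>"]) auto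
next
  case (insert a A)
  then obtain s where s: "s \<in> N" "\<forall>f\<in>lhom X scalars. f s = (\<Sum>a\<in>A. r a * f (z a))" by auto
  have za: "z a \<in> N" using insert by simp
  have "f (s \<oplus>\<^bsub>X\<^esub> r a \<odot>\<^bsub>X\<^esub> z a) = (\<Sum>a\<in>insert a A. r a * f (z a))" if "f \<in> lhom X scalars" for f
  proof -
    have m: "s \<in> carrier X" "z a \<in> carrier X" "r a \<odot>\<^bsub>X\<^esub> z a \<in> carrier X" using s(1) za c N by auto
    show ?thesis using s insert that by (simp add: lhom_add[OF that m(1,3)] lhom_smult[OF that m(2)])
  qed
  then show ?case using s za c by (intro bexI[of _ "s \<oplus>\<^bsub>X\<^esub> r a \<odot>\<^bsub>X\<^esub> z a"]) auto
qed

context univ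
begin

text \<open>Supplies, for \<open>m\<close> equal to n, the one space inside the universe on which
  transformations in the category of polynomial functors are tested.\<close>

lemma model_space_exists: "\<exists>E b c. bas (E :: ('k, 'u) module) {..<m::nat} b c"
proof -
  let ?X = "prod_space {..<m} (\<lambda>_. scalars :: ('k, 'k) module)"
  have B: "bas ?X {..<m} (\<lambda>i. \<lambda>j\<in>{..<m}. if i = j then 1 else 0) (\<lambda>i f. f i)"
    by (rule bas_prod_space) simp
  note fX = bas_fdvs[OF B] and B' = basD[OF B]
  let ?E = "small ?X :: ('k, 'u) module"
  have "bas ?E {..<m} (\<lambda>i. enc ?X (\<lambda>j\<in>{..<m}. if i = j then 1 else 0)) (\<lambda>i u. dec ?X u i)"
    unfolding bas_def
  proof (intro conjI ballI impI)
    show "u = \<zero>\<^bsub>?E\<^esub>" if u: "u \<in> carrier ?E" "\<forall>i\<in>{..<m}. dec ?X u i = 0" for u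
    proof -
      have "dec ?X u = \<zero>\<^bsub>?X\<^esub>" by (rule B'(6)) (use u fX in auto)
      then show ?thesis using lhom_zero[OF enc_lhom[OF fX] fdvs_vs[OF fX] fdvs_vs[OF fdvs_small[OF fX]]] enc_dec[OF fX u(1)] by simp
    qed
  qed (use fX lhom_compose[OF dec_lhom[OF fX] B'(4)] dec_enc[OF fX B'(3)] enc_closed[OF fX B'(3)] in auto)
  then show ?thesis by blast
qed

text \<open>
  The polarization identity expresses \<open>id\<^sup>\<otimes>\<^sup>n\<close> on \<open>V\<close> through the endomorphisms \<open>e\<^sup>\<otimes>\<^sup>n\<close> with \<open>e\<close> a coordinate
  projection of rank at most \<open>n\<close>; these factor through \<open>E\<close>.
\<close>

lemma gam_id_generated:
  fixes V E :: "('k, 'u) module"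
  assumes V: "fdvs V" and E: "bas E {..<n} bE cE"
    and N: "N \<subseteq> carrier (T n V V)" "\<zero>\<^bsub>T n V V\<^esub> \<in> N"
    and c: "\<And>x y. x \<in> N \<Longrightarrow> y \<in> N \<Longrightarrow> x \<oplus>\<^bsub>T n V V\<^esub> y \<in> N" "\<And>r x. x \<in> N \<Longrightarrow> r \<odot>\<^bsub>T n V V\<^esub> x \<in> N"
    and fac: "\<And>f g. f \<in> lin V E \<Longrightarrow> g \<in> lin E V \<Longrightarrow> gam n V V (compose (carrier V) g f) \<in> N"
  shows "gam n V V (\<lambda>x\<in>carrier V. x) \<in> N"
proof -
  obtain d b cc where B: "bas V {..<d::nat} b cc" using fdvs_bas[OF V] by blast
  note B' = basD[OF B] and E' = basD[OF E]
  have fL: "fdvs (Lin V V)" using V by simp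
  have vT: "vs (T n V V)" using fL by simp
  \<comment> \<open>\<open>e A\<close> is the coordinate projection onto the span of the basis
    vectors with index in \<open>A\<close>. It is additive on disjoint unions, and
    \<open>e {..<d}\<close> is the identity.\<close>
  have "\<exists>e\<in>lin V V. \<forall>i\<in>{..<d}. e (b i) = (if i \<in> A then b i else \<zero>\<^bsub>V\<^esub>)" for A
    by (rule bas_lin_ex[OF B B'(2)]) (use B'(2,3) in auto)
  then obtain e where e: "\<And>A. e A \<in> lin V V"
    and e': "\<And>A. \<forall>i\<in>{..<d}. e A (b i) = (if i \<in> A then b i else \<zero>\<^bsub>V\<^esub>)"
    by metis
  have "e A (b i) = (if i \<in> A then b i else \<zero>\<^bsub>V\<^esub>)" if "i < d" for A i
    using e'[of A] that by blast
  note e = e this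
  have gt: "gam n V V (e A) \<in> carrier (T n V V)" for A
    using gam_closed[OF V V e(1), of n A] by simp
  have e_empty: "e {} = \<zero>\<^bsub>Lin V V\<^esub>"
  proof (rule lin_eqI[OF e(1)])
    show "\<zero>\<^bsub>Lin V V\<^esub> \<in> lin V V" using vs_zero[of "Lin V V"] fL by simp
    show "e {} x = \<zero>\<^bsub>Lin V V\<^esub> x" if "x \<in> carrier V" for x
      using bas_ext[OF B lin_lhom[OF e(1)] lhom_const_zero[OF B'(2)] B'(2), of "{}" x] e(2) that by simp
  qed
  have e_insert: "e (insert j A) = e A \<oplus>\<^bsub>Lin V V\<^esub> e {j}" if "j \<notin> A" for j A
  proof (rule lin_eqI[OF e(1)])
    have a: "e A \<oplus>\<^bsub>Lin V V\<^esub> e {j} \<in> lin V V" using vs_add[of "Lin V V" "e A" "e {j}"] fL e(1) by simp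
    then show "e A \<oplus>\<^bsub>Lin V V\<^esub> e {j} \<in> lin V V" .
    show "e (insert j A) x = (e A \<oplus>\<^bsub>Lin V V\<^esub> e {j}) x" if "x \<in> carrier V" for x
      by (rule bas_ext[OF B lin_lhom[OF e(1)] lin_lhom[OF a] B'(2) _ that]) (use e(2) \<open>j \<notin> A\<close> B'(2,3) in auto)
  qed
  \<comment> \<open>The decomposition of \<open>e A\<close> into the rank one projections
    \<open>e {j}\<close>, recorded under a functional so that the sum is one of scalars.\<close>
  have sum_e: "f (e A) = (\<Sum>j\<in>A. f (e {j}))" if f: "f \<in> lhom (Lin V V) scalars" and "finite A" for f A
    using \<open>finite A\<close>
  proof (induction A)
    case empty
    show ?case
      using lhom_zero[OF f fdvs_vs[OF fL] vs_scalars] by (simp only: e_empty scalars_simps sum.empty)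
  next
    case (insert j A)
    then show ?case using lhom_add[OF f, of "e A" "e {j}"] e(1) by (simp add: e_insert[OF insert.hyps(2)] add.commute del: Lin_simps(3))
  qed
  \<comment> \<open>If \<open>A\<close> has at most n elements, it is injected by \<open>h\<close>
    into the index set of the basis of \<open>E\<close>. Sending \<open>b i\<close> to
    \<open>bE (h i)\<close> and back factors \<open>e A\<close> through \<open>E\<close>.\<close>
  have small: "gam n V V (e A) \<in> N" if A: "A \<subseteq> {..<d}" "card A \<le> n" for A
  proof -
    have fin: "finite A" using A finite_subset by blast
    obtain h where h: "inj_on h A" "h ` A \<subseteq> {..<n}"
      using card_le_inj[OF fin, of "{..<n}"] A by auto
    have "\<exists>f\<in>lin V E. \<forall>i\<in>{..<d}. f (b i) = (if i \<in> A then bE (h i) else \<zero>\<^bsub>E\<^esub>)"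
    proof (rule bas_lin_ex[OF B E'(2)])
      show "(if i \<in> A then bE (h i) else \<zero>\<^bsub>E\<^esub>) \<in> carrier E" for i
        using E'(2) E'(3)[of "h i"] h(2) by auto
    qed
    then obtain f where f: "f \<in> lin V E" "\<forall>i\<in>{..<d}. f (b i) = (if i \<in> A then bE (h i) else \<zero>\<^bsub>E\<^esub>)"
      by blast
    have "\<exists>g\<in>lin E V. \<forall>k\<in>{..<n}. g (bE k) = (if k \<in> h ` A then b (inv_into A h k) else \<zero>\<^bsub>V\<^esub>)"
    proof (rule bas_lin_ex[OF E B'(2)])
      show "(if k \<in> h ` A then b (inv_into A h k) else \<zero>\<^bsub>V\<^esub>) \<in> carrier V" for k
        using B'(2) B'(3)[of "inv_into A h k"] A(1) inv_into_into[of k h A] by auto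
    qed
    then obtain g where g: "g \<in> lin E V" "\<forall>k\<in>{..<n}. g (bE k) = (if k \<in> h ` A then b (inv_into A h k) else \<zero>\<^bsub>V\<^esub>)"
      by blast
    have "compose (carrier V) g f = e A"
    proof (rule lin_eqI[OF lin_compose[OF f(1) lin_lhom[OF g(1)] B'(2)] e(1)])
      show "compose (carrier V) g f x = e A x" if "x \<in> carrier V" for x
      proof (rule bas_ext[OF B lin_lhom[OF lin_compose[OF f(1) lin_lhom[OF g(1)] B'(2)]] lin_lhom[OF e(1)] B'(2) _ that])
        fix i assume i: "i \<in> {..<d}"
        show "compose (carrier V) g f (b i) = e A (b i)"
          using i f(2) g(2) e(2)[of i A] h B'(3)[OF i] lin_zero[OF g(1) E'(2) B'(2)]
          by (cases "i \<in> A") (auto simp: compose_eq)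
      qed
    qed
    then show ?thesis using fac[OF f(1) g(1)] by simp
  qed
  \<comment> \<open>Induction on the size of \<open>A\<close>. Beyond n elements, the alternating
    sum of the n-th powers of \<open>e A'\<close> over all subsets \<open>A'\<close> of
    \<open>A\<close> vanishes, so the term of \<open>A\<close> itself is a combination of terms of
    proper subsets.\<close>
  have all: "gam n V V (e A) \<in> N" if "A \<subseteq> {..<d}" for A
    using that
  proof (induction "card A" arbitrary: A rule: less_induct)
    case less
    show ?case
    proof (cases "card A \<le> n")
      case False
      have fin: "finite A" using less finite_subset by blast
      have sub: "gam n V V (e A') \<in> N" if "A' \<in> Pow A - {A}" for A'
        using that less psubset_card_mono[OF fin, of A'] by auto
      \<comment> \<open>These coefficients solve the vanishing alternating sum for the term of
        \<open>A\<close>: that term has the sign \<open>(-1) ^ card A\<close>, which is its own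
        inverse.\<close>
      obtain s where s: "s \<in> N" "\<forall>f\<in>lhom (T n V V) scalars. f s =
          (\<Sum>A'\<in>Pow A - {A}. (- ((-1) ^ card A) * (-1) ^ card A') * f (gam n V V (e A')))"
        using linear_combination_in[OF vT N c, of "Pow A - {A}" "\<lambda>A'. gam n V V (e A')"
            "\<lambda>A'. - ((-1) ^ card A) * (-1) ^ card A'"] sub fin by auto
      have sT: "s \<in> carrier (T n V V)" using s N by auto
      have "gam n V V (e A) \<oplus>\<^bsub>T n V V\<^esub> (-1) \<odot>\<^bsub>T n V V\<^esub> s = \<zero>\<^bsub>T n V V\<^esub>"
      proof (rule tpow_separates[OF fL])
        show "gam n V V (e A) \<oplus>\<^bsub>T n V V\<^esub> (-1) \<odot>\<^bsub>T n V V\<^esub> s \<in> carrier (T n V V)"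
          using vT gt sT by simp
        fix f assume f: "f \<in> tuples n (dual_space (Lin V V))"
        have fl: "f i \<in> lhom (Lin V V) scalars" if "i \<in> {1..n}" for i
          using tuples_mem[OF f that] by (simp add: lin_lhom)
        have m: "multilinear n (Lin V V) scalars (\<lambda>v. \<Prod>i\<in>{1..n}. f i (v i))"
          by (rule multilinear_prod) (rule fl)
        let ?F = "tlift n (Lin V V) scalars (\<lambda>v. \<Prod>i\<in>{1..n}. f i (v i)) :: 'u \<Rightarrow> 'k"
        have F: "?F \<in> lhom (T n V V) scalars" by (rule lin_lhom[OF tlift_lin[OF fL vs_scalars m]])
        have Fg: "?F (gam n V V (e A')) = (\<Prod>i\<in>{1..n}. \<Sum>j\<in>A'. f i (e {j}))" if "finite A'" for A'
        proof -
          have "?F (gam n V V (e A')) = (\<Prod>i\<in>{1..n}. f i (e A'))"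
            unfolding gam_def using fL m tuples_const[of "e A'" "Lin V V" n] e(1) by simp
          also have "\<dots> = (\<Prod>i\<in>{1..n}. \<Sum>j\<in>A'. f i (e {j}))"
            by (rule prod.cong[OF refl]) (rule sum_e[OF fl that])
          finally show ?thesis .
        qed
        \<comment> \<open>The product has n factors and \<open>A\<close> more than n elements,
          exactly the bound of \<open>alternating_prod_sum\<close>, here used with constants
          zero.\<close>
        have "(\<Sum>A'\<in>Pow A. (-1) ^ card A' * (\<Prod>i\<in>{1..n}. 0 + (\<Sum>j\<in>A'. f i (e {j})))) = 0"
          by (rule alternating_prod_sum) (use fin False in auto)
        moreover have "(\<Sum>A'\<in>Pow A. (-1) ^ card A' * ?F (gam n V V (e A'))) =
            (\<Sum>A'\<in>Pow A. (-1) ^ card A' * (\<Prod>i\<in>{1..n}. 0 + (\<Sum>j\<in>A'. f i (e {j}))))"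
          by (intro sum.cong) (use Fg finite_subset[OF _ fin] in auto)
        ultimately have "(\<Sum>A'\<in>Pow A. (-1) ^ card A' * ?F (gam n V V (e A'))) = 0" by simp
        then have z: "(-1) ^ card A * ?F (gam n V V (e A)) + (\<Sum>A'\<in>Pow A - {A}. (-1) ^ card A' * ?F (gam n V V (e A'))) = 0"
          using fin by (subst (asm) sum.remove[of _ A]) auto
        have z': "(\<Sum>A'\<in>Pow A - {A}. (-1) ^ card A' * ?F (gam n V V (e A'))) = - ((-1) ^ card A * ?F (gam n V V (e A)))"
          using z by (simp only: eq_neg_iff_add_eq_0 add.commute)
        have "?F s = - ((-1) ^ card A) * (\<Sum>A'\<in>Pow A - {A}. (-1) ^ card A' * ?F (gam n V V (e A')))"
          using s(2) F by (simp add: sum_distrib_left mult.assoc)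
        also have "\<dots> = (-1) ^ card A * ((-1) ^ card A * ?F (gam n V V (e A)))"
          unfolding z' by simp
        also have "\<dots> = ?F (gam n V V (e A))" by (simp flip: mult.assoc power_mult_distrib)
        finally show "?F (gam n V V (e A) \<oplus>\<^bsub>T n V V\<^esub> (-1) \<odot>\<^bsub>T n V V\<^esub> s) = 0"
          using vT gt sT by (simp add: lhom_add[OF F] lhom_smult[OF F])
      qed
      then have "gam n V V (e A) = s" using vs_eq_iff[OF vT gt[of A] sT] by blast
      then show ?thesis using s(1) by blast
    qed (use small less in auto)
  qed
  have "e {..<d} = (\<lambda>x\<in>carrier V. x)"
  proof (rule lin_eqI[OF e(1) lin_id[OF B'(2)]])
    show "e {..<d} x = (\<lambda>x\<in>carrier V. x) x" if "x \<in> carrier V" for x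
      using bas_ext[OF B lin_lhom[OF e(1)] lhom_id B'(2) _ that, of "{..<d}"] e(2) that by simp
  qed
  then show ?thesis using all[of "{..<d}"] by simp
qed

text \<open>Evaluation at a space \<open>E\<close> of dimension n is injective on transformations.
  Suppose the component at \<open>E\<close> is zero. For \<open>x\<close> in the value of G at
  \<open>V\<close>, the morphisms \<open>z\<close> of \<open>V\<close> whose image under F kills
  \<open>\<eta> V x\<close> form a subspace \<open>N\<close>. By naturality it contains every n-th
  power of a map factoring through \<open>E\<close>, hence by \<open>gam_id_generated\<close> the
  identity, so \<open>\<eta> V x\<close> is zero.\<close>

lemma fdvs_nat_trans:
  fixes F G :: "('k, 'u) pftor"
  assumes G: "linear_functor (Gam n) Vect G" and F: "linear_functor (Gam n) Vect F"
  shows "fdvs (Mor (Fun (Gam n) Vect) G F)"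
proof -
  obtain E :: "('k, 'u) module" and bE cE where E: "bas E {..<n} bE cE" using model_space_exists by blast
  have oE: "E \<in> Obj (Gam n)" using bas_fdvs[OF E] by simp
  have vM: "vs (Mor (Fun (Gam n) Vect) G F)" by (rule vs_Fun[OF Vect_linear_category G F])
  have ev: "(\<lambda>\<eta>. \<eta> E) \<in> lhom (Mor (Fun (Gam n) Vect) G F) (Lin (ob G E) (ob F E))"
    by (rule lhomI) (use oE in \<open>auto simp: nt_lin\<close>)
  have fL: "fdvs (Lin (ob G E) (ob F E))" using LF_fdvs[OF G oE] LF_fdvs[OF F oE] by simp
  have "\<eta> = \<zero>\<^bsub>Mor (Fun (Gam n) Vect) G F\<^esub>"
    if e: "\<eta> \<in> carrier (Mor (Fun (Gam n) Vect) G F)" and z: "\<eta> E = \<zero>\<^bsub>Lin (ob G E) (ob F E)\<^esub>" for \<eta>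
  proof -
    have e: "\<eta> \<in> nat_trans (Gam n) Vect G F" using e by simp
    have "\<eta> V x = \<zero>\<^bsub>ob F V\<^esub>" if V: "V \<in> Obj (Gam n)" and x: "x \<in> carrier (ob G V)" for V x
    proof -
      have fV: "fdvs V" using V by simp
      have fFV: "vs (ob F V)" using LF_fdvs[OF F V] by simp
      note y = nt_app_closed[OF e V x]
      define N where "N = {z \<in> carrier (Gam_mor n V V). mo F V V z (\<eta> V x) = \<zero>\<^bsub>ob F V\<^esub>}"
      have vG: "vs (Gam_mor n V V)" using lc_preD(1)[OF Gam_pre V V] by simp
      note vs0 = vs_zero[OF vG] and vsa = vs_add[OF vG] and vss = vs_smult[OF vG]
      have h: "(\<lambda>z. mo F V V z (\<eta> V x)) \<in> lhom (Gam_mor n V V) (ob F V)"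
        using lhom_compose[OF LF_lhom[OF F V V] lhom_eval[OF fFV y]] by simp
      note hs = lhom_simps(2,3)[OF h]
      have "gam n V V (\<lambda>x\<in>carrier V. x) \<in> N"
      proof (rule gam_id_generated[OF fV E])
        show "N \<subseteq> carrier (T n V V)" by (auto simp: N_def)
        show "\<zero>\<^bsub>T n V V\<^esub> \<in> N" using vs0 lhom_zero[OF h vG fFV] unfolding N_def by simp
        show "a \<oplus>\<^bsub>T n V V\<^esub> b \<in> N" if "a \<in> N" "b \<in> N" for a b
          using that vsa[of a b] hs(1)[of a b] fFV unfolding N_def by simp
        show "r \<odot>\<^bsub>T n V V\<^esub> a \<in> N" if "a \<in> N" for a r
          using that vss[of a r] hs(2)[of a r] fFV unfolding N_def by simp
        fix f g assume f: "f \<in> lin V E" and g: "g \<in> lin E V"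
        have gm: "gam n V E f \<in> carrier (Mor (Gam n) V E)" "gam n E V g \<in> carrier (Mor (Gam n) E V)"
          using gam_closed[OF fV _ f, of n] gam_closed[OF _ fV g, of n] oE by auto
        have "mo F V V (gam n V V (compose (carrier V) g f)) (\<eta> V x) = mo F E V (gam n E V g) (mo F V E (gam n V E f) (\<eta> V x))"
          using LF_cmp[OF F V oE V gm y] gam_cmp[of V E V f g n] f g fV oE by simp
        also have "mo F V E (gam n V E f) (\<eta> V x) = \<eta> E (mo G V E (gam n V E f) x)"
          by (rule nt_app_natural[OF e V oE gm(1) x])
        also have "\<dots> = \<zero>\<^bsub>ob F E\<^esub>" using z LF_closed[OF G V oE gm(1) x] by simp
        also have "mo F E V (gam n E V g) \<zero>\<^bsub>ob F E\<^esub> = \<zero>\<^bsub>ob F V\<^esub>"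
          using lin_zero[OF LF_lin[OF F oE V gm(2)]] LF_fdvs[OF F oE] fFV by simp
        finally show "gam n V V (compose (carrier V) g f) \<in> N"
          using gam_closed[OF fV fV lin_compose[OF f lin_lhom[OF g] fdvs_vs[OF fV]], of n] by (simp add: N_def)
      qed
      then show "\<eta> V x = \<zero>\<^bsub>ob F V\<^esub>"
        using LF_idn[OF F V y] by (simp add: N_def gam_def)
    qed
    then show ?thesis
      by (intro nt_eqI[OF e]) (use vs_zero[OF vM] in auto)
  qed
  then have "inj_on (\<lambda>\<eta>. \<eta> E) (carrier (Mor (Fun (Gam n) Vect) G F))"
    using lhom_inj_iff[OF ev vM fdvs_vs[OF fL]] by blast
  then show ?thesis by (rule fdvs_inj[OF fL vM ev])
qed

end

section \<open>The right adjoint\<close>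

context univ
begin

abbreviation PC :: "nat \<Rightarrow> ('k, 'u) pcat" where "PC n \<equiv> Fun (Gam n) Vect"
abbreviation AC :: "nat \<Rightarrow> ('k, 'u) acat" where "AC n \<equiv> Fun (Rep n) Vect"
abbreviation TR :: "nat \<Rightarrow> ('k, 'u) module \<Rightarrow> ('k, 'u) rep" where "TR n V \<equiv> tpow_rep n V"
abbreviation J :: "nat \<Rightarrow> ('k, 'u) rep \<Rightarrow> ('k, 'u) pftor" where "J n M \<equiv> jstar_ob n (h_ftor n M)"
abbreviation jh :: "nat \<Rightarrow> ('k, 'u) rep \<Rightarrow> ('k, 'u) rep \<Rightarrow> ('u \<Rightarrow> 'u) \<Rightarrow> ('k, 'u) module \<Rightarrow> 'u \<Rightarrow> 'u" where
  "jh n M N \<phi> \<equiv> jstar_nt n (h_nt n M N \<phi>)"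

lemma PC_linear_category: "linear_category (PC n)"
  and AC_linear_category: "linear_category (AC n)"
  by (rule Fun_linear_category[OF Vect_linear_category])+

section \<open>The functor j^*\<close>

lemma Gam_real_hom:
  assumes o: "fdvs (V :: ('k, 'u) module)" "fdvs W"
  shows "Gam_real n V W \<in> lhom (Gam_mor n V W) (HomS n (TR n V) (TR n W))"
  by (rule lhomI) (use Gam_real_equivariant[OF o] lin_simps[OF Gam_real_lin[OF o]] o in simp_all)

lemma Gam_real_compose:
  assumes o: "fdvs (U :: ('k, 'u) module)" "fdvs V" "fdvs W"
    and "x \<in> carrier (Gam_mor n U V)" "y \<in> carrier (Gam_mor n V W)"
  shows "Gam_real n U W (Gam_cmp n U V W y x) = compose (carrier (tp n U)) (Gam_real n V W y) (Gam_real n U V x)"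
  by (rule lin_eqI[OF gr_lin[OF o(1,3,3)] lin_compose[OF gr_lin[OF o(1,2,2)] gr_lhom[OF o(2,3,3)]]])
    (use assms Gam_real_cmp[OF o] in \<open>simp_all add: compose_eq\<close>)

lemma Gam_real_idn:
  assumes o: "fdvs (V :: ('k, 'u) module)"
  shows "Gam_real n V V (Idn (Gam n) V) = (\<lambda>x\<in>carrier (tp n V). x)"
proof (rule lin_eqI[OF gr_lin[OF o o o] lin_id])
  show "Idn (Gam n) V \<in> carrier (T n V V)" using lc_preD(2)[OF Gam_pre, of V n] o by simp
qed (use Gam_real_id[OF o] o in simp_all)

lemma jstar_ob_simps [simp]:
  "ob (jstar_ob n f) V = ob f (TR n V)"
  "mo (jstar_ob n f) V W x = mo f (TR n V) (TR n W) (Gam_real n V W x)"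
  by (simp_all add: jstar_ob_def)

lemma jstar_nt_apply [simp]: "fdvs V \<Longrightarrow> jstar_nt n \<eta> V = \<eta> (TR n V)"
  by (simp add: jstar_nt_def)

lemma TR_rep [simp]: "fdvs V \<Longrightarrow> is_rep n (TR n V)"
  by (rule tpow_is_rep)

lemma TR_obj [simp]: "fdvs V \<Longrightarrow> TR n V \<in> Obj (Rep n)"
  by simp

lemma jstar_ob_linear:
  fixes f :: "('k, 'u) aftor"
  assumes f: "linear_functor (Rep n) Vect f"
  shows "linear_functor (Gam n) Vect (jstar_ob n f)"
proof (rule linear_functor_VectI[OF Gam_pre])
  fix V W :: "('k, 'u) module" assume o: "V \<in> Obj (Gam n)" "W \<in> Obj (Gam n)"
  then have fd: "fdvs V" "fdvs W" by auto
  note r = TR_obj[OF fd(1), of n] TR_obj[OF fd(2), of n]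
  have e: "Gam_real n V W x \<in> carrier (Mor (Rep n) (TR n V) (TR n W))" if "x \<in> carrier (Mor (Gam n) V W)" for x
    using lhom_closed[OF Gam_real_hom[OF fd]] that by simp
  have h: "(\<lambda>x. mo f (TR n V) (TR n W) (Gam_real n V W x)) \<in> lhom (Gam_mor n V W) (Lin (ob f (TR n V)) (ob f (TR n W)))"
    using lhom_compose[OF Gam_real_hom[OF fd] LF_lhom[OF f r, unfolded Rep_simps]] .
  show "fdvs (ob (jstar_ob n f) V)" using LF_fdvs[OF f r(1)] by simp
  show "mo (jstar_ob n f) V W x \<in> lin (ob (jstar_ob n f) V) (ob (jstar_ob n f) W)" if "x \<in> carrier (Mor (Gam n) V W)" for x
    using LF_lin[OF f r e[OF that]] by simp
  show "mo (jstar_ob n f) V V (Idn (Gam n) V) x = x" if "x \<in> carrier (ob (jstar_ob n f) V)" for x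
    unfolding jstar_ob_simps Gam_real_idn[OF fd(1)] using LF_idn[OF f r(1)] that fd by simp
  show "mo (jstar_ob n f) V W (x \<oplus>\<^bsub>Mor (Gam n) V W\<^esub> y) z = mo (jstar_ob n f) V W x z \<oplus>\<^bsub>ob (jstar_ob n f) W\<^esub> mo (jstar_ob n f) V W y z"
    if "x \<in> carrier (Mor (Gam n) V W)" "y \<in> carrier (Mor (Gam n) V W)" "z \<in> carrier (ob (jstar_ob n f) V)" for x y z
    using lhom_add[OF h, of x y] that by simp
  show "mo (jstar_ob n f) V W (s \<odot>\<^bsub>Mor (Gam n) V W\<^esub> x) z = s \<odot>\<^bsub>ob (jstar_ob n f) W\<^esub> mo (jstar_ob n f) V W x z"
    if "x \<in> carrier (Mor (Gam n) V W)" "z \<in> carrier (ob (jstar_ob n f) V)" for x s z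
    using lhom_smult[OF h, of x s] that by simp
  fix U :: "('k, 'u) module" and x y z assume u: "U \<in> Obj (Gam n)" and x: "x \<in> carrier (Mor (Gam n) V W)" and y: "y \<in> carrier (Mor (Gam n) W U)"
    and z: "z \<in> carrier (ob (jstar_ob n f) V)"
  have fU: "fdvs U" using u by simp
  have e': "Gam_real n W U y \<in> carrier (Mor (Rep n) (TR n W) (TR n U))"
    using lhom_closed[OF Gam_real_hom[OF fd(2) fU]] y by simp
  show "mo (jstar_ob n f) V U (Cmp (Gam n) V W U y x) z = mo (jstar_ob n f) W U y (mo (jstar_ob n f) V W x z)"
    using LF_cmp[OF f r TR_obj[OF fU] e[OF x] e', of z] Gam_real_compose[OF fd fU, of x n y] x y z fd by simp
qed

lemma jstar_nt_closed:
  fixes f g :: "('k, 'u) aftor"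
  assumes e: "\<eta> \<in> nat_trans (Rep n) Vect f g"
  shows "jstar_nt n \<eta> \<in> nat_trans (Gam n) Vect (jstar_ob n f) (jstar_ob n g)"
proof (rule nat_trans_VectI)
  show "jstar_nt n \<eta> V \<in> lin (ob (jstar_ob n f) V) (ob (jstar_ob n g) V)" if "V \<in> Obj (Gam n)" for V
    using nt_lin[OF e TR_obj[of V n]] that by simp
  fix V W :: "('k, 'u) module" and x z assume o: "V \<in> Obj (Gam n)" "W \<in> Obj (Gam n)" and x: "x \<in> carrier (Mor (Gam n) V W)"
    and z: "z \<in> carrier (ob (jstar_ob n f) V)"
  then have fd: "fdvs V" "fdvs W" by auto
  have "Gam_real n V W x \<in> carrier (Mor (Rep n) (TR n V) (TR n W))"
    using lhom_closed[OF Gam_real_hom[OF fd]] x by simp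
  from nt_app_natural[OF e TR_obj[OF fd(1)] TR_obj[OF fd(2)] this, of z]
  show "mo (jstar_ob n g) V W x (jstar_nt n \<eta> V z) = jstar_nt n \<eta> W (mo (jstar_ob n f) V W x z)"
    using z fd by simp
qed (simp add: jstar_nt_def)

lemma jstar_nt_Cmp:
  "jstar_nt n (Cmp (AC n) f g h \<theta> \<eta>) = Cmp (PC n) (jstar_ob n f) (jstar_ob n g) (jstar_ob n h) (jstar_nt n \<theta>) (jstar_nt n \<eta>)"
  unfolding jstar_nt_def Fun_simps(7) by (rule restrict_ext) simp

lemma jstar_functor: "is_functor (AC n) (PC n) (jstar n)"
  unfolding is_functor_def jstar_def
proof (intro conjI ballI)
  fix f :: "('k, 'u) aftor" assume "f \<in> Obj (AC n)"
  show "mo \<lparr>ob = jstar_ob n, mo = \<lambda>f g. jstar_nt n\<rparr> f f (Idn (AC n) f) = Idn (PC n) (ob \<lparr>ob = jstar_ob n, mo = \<lambda>f g. jstar_nt n\<rparr> f)"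
    unfolding jstar_nt_def Fun_simps ftor.simps by (rule restrict_ext) simp
qed (auto simp: jstar_ob_linear jstar_nt_closed jstar_nt_Cmp)

section \<open>Represented functors and Yoneda transformations\<close>

context
  fixes M :: "('k, 'u) rep" and n :: nat
  assumes M: "is_rep n M"
begin

lemma Rep_compose_lhom:
  fixes N L :: "('k, 'u) rep"
  assumes "is_rep n N" "is_rep n L"
  shows "f \<in> equivariant n N L \<Longrightarrow> (\<lambda>\<psi>. compose (carrier (rsp M)) f \<psi>) \<in> lhom (HomS n M N) (HomS n M L)"
    "g \<in> equivariant n M N \<Longrightarrow> (\<lambda>\<psi>. compose (carrier (rsp M)) \<psi> g) \<in> lhom (HomS n N L) (HomS n M L)"
  using lc_left[OF Rep_linear_category, of M n N L g] lc_right[OF Rep_linear_category, of M n N L f] M assms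
  by simp_all

lemma h_ftor_ob [simp]: "ob (h_ftor n M) N = small (HomS n M N)"
  by (simp add: h_ftor_def)

lemma h_ftor_apply [simp]:
  fixes N L :: "('k, 'u) rep"
  assumes "is_rep n N" "u \<in> carrier (small (HomS n M N))"
  shows "mo (h_ftor n M) N L f u = enc (HomS n M L) (compose (carrier (rsp M)) f (dec (HomS n M N) u))"
  using assms small_map_apply[OF fdvs_HomS[OF M assms(1)]] by (simp add: h_ftor_def)

lemma h_ftor_linear: "linear_functor (Rep n) Vect (h_ftor n M)"
proof (rule linear_functor_VectI[OF linear_category_pre[OF Rep_linear_category]])
  fix N L :: "('k, 'u) rep" assume "N \<in> Obj (Rep n)" "L \<in> Obj (Rep n)"
  then have o: "is_rep n N" "is_rep n L" by auto
  note fd = fdvs_HomS[OF M o(1)] fdvs_HomS[OF M o(2)]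
  note dc = dec_closed[OF fd(1)]
  show "fdvs (ob (h_ftor n M) N)" using fd by simp
  show "mo (h_ftor n M) N L f \<in> lin (ob (h_ftor n M) N) (ob (h_ftor n M) L)" if "f \<in> carrier (Mor (Rep n) N L)" for f
    using small_map_lin[OF fd Rep_compose_lhom(1)[OF o]] that by (simp add: h_ftor_def)
  show "mo (h_ftor n M) N N (Idn (Rep n) N) u = u" if "u \<in> carrier (ob (h_ftor n M) N)" for u
  proof -
    have u: "u \<in> carrier (small (HomS n M N))" using that by simp
    have d: "dec (HomS n M N) u \<in> equivariant n M N" using dc[OF u] by simp
    have "compose (carrier (rsp M)) (\<lambda>x\<in>carrier (rsp N). x) (dec (HomS n M N) u) = dec (HomS n M N) u"
      using lin_closed[OF equivariantD(1)[OF d]] lin_ext[OF equivariantD(1)[OF d]] by (intro Id_compose) auto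
    then show ?thesis using u o fd by simp
  qed
  fix f u assume f: "f \<in> carrier (Mor (Rep n) N L)" and "u \<in> carrier (ob (h_ftor n M) N)"
  then have f': "f \<in> equivariant n N L" and u: "u \<in> carrier (small (HomS n M N))" by simp_all
  have d: "dec (HomS n M N) u \<in> equivariant n M N" using dc[OF u] by simp
  note h = lhom_compose[OF Rep_compose_lhom(2)[OF o d] enc_lhom[OF fd(2)]]
  show "mo (h_ftor n M) N L (f \<oplus>\<^bsub>Mor (Rep n) N L\<^esub> g) u = mo (h_ftor n M) N L f u \<oplus>\<^bsub>ob (h_ftor n M) L\<^esub> mo (h_ftor n M) N L g u"
    if "g \<in> carrier (Mor (Rep n) N L)" for g
    using lhom_add[OF h, of f g] f' that u o by simp
  show "mo (h_ftor n M) N L (r \<odot>\<^bsub>Mor (Rep n) N L\<^esub> f) u = r \<odot>\<^bsub>ob (h_ftor n M) L\<^esub> mo (h_ftor n M) N L f u" for r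
    using lhom_smult[OF h, of f r] f' u o by simp
  fix K :: "('k, 'u) rep" and g assume "K \<in> Obj (Rep n)" "g \<in> carrier (Mor (Rep n) L K)"
  then have K: "is_rep n K" and g: "g \<in> equivariant n L K" by simp_all
  have c: "compose (carrier (rsp M)) f (dec (HomS n M N) u) \<in> carrier (HomS n M L)"
    by (rule lhom_closed[OF Rep_compose_lhom(1)[OF o f'] dc[OF u]])
  have "compose (carrier (rsp M)) (compose (carrier (rsp N)) g f) (dec (HomS n M N) u) =
    compose (carrier (rsp M)) g (compose (carrier (rsp M)) f (dec (HomS n M N) u))"
    using lin_closed[OF equivariantD(1)[OF d]] by (intro compose_assoc[symmetric]) auto
  then show "mo (h_ftor n M) N K (Cmp (Rep n) N L K g f) u = mo (h_ftor n M) L K g (mo (h_ftor n M) N L f u)"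
    using u o fd c by simp
qed

lemma J_linear: "linear_functor (Gam n) Vect (J n M)"
  by (rule jstar_ob_linear[OF h_ftor_linear])

definition yo :: "('k, 'u) aftor \<Rightarrow> 'u \<Rightarrow> ('k, 'u) rep \<Rightarrow> 'u \<Rightarrow> 'u" where
  "yo f x = (\<lambda>N\<in>Obj (Rep n). \<lambda>u\<in>carrier (small (HomS n M N)). mo f M N (dec (HomS n M N) u) x)"

lemma yo_apply: "is_rep n N \<Longrightarrow> u \<in> carrier (small (HomS n M N)) \<Longrightarrow> yo f x N u = mo f M N (dec (HomS n M N) u) x"
  by (simp add: yo_def)

lemma yo_nt:
  assumes f: "linear_functor (Rep n) Vect f" and x: "x \<in> carrier (ob f M)"
  shows "yo f x \<in> nat_trans (Rep n) Vect (h_ftor n M) f"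
proof (rule nat_trans_VectI)
  have oM: "M \<in> Obj (Rep n)" using M by simp
  fix N :: "('k, 'u) rep" assume oN: "N \<in> Obj (Rep n)"
  then have N: "is_rep n N" by simp
  note fd = fdvs_HomS[OF M N]
  have "(\<lambda>u :: 'u. mo f M N (dec (HomS n M N) u) x) \<in> lhom (small (HomS n M N)) (ob f N)"
    using lhom_compose[OF lhom_compose[OF dec_lhom[OF fd] LF_lhom[OF f oM oN, unfolded Rep_simps]]
      lhom_eval[OF fdvs_vs[OF LF_fdvs[OF f oM]] x]] .
  from lin_restrict[OF this] show "yo f x N \<in> lin (ob (h_ftor n M) N) (ob f N)"
    using N fd by (simp add: yo_def)
  fix L :: "('k, 'u) rep" and g u assume oL: "L \<in> Obj (Rep n)" and g: "g \<in> carrier (Mor (Rep n) N L)" and u: "u \<in> carrier (ob (h_ftor n M) N)"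
  then have L: "is_rep n L" by simp
  have d: "dec (HomS n M N) u \<in> carrier (Mor (Rep n) M N)" using dec_closed[OF fd] u by simp
  have c: "compose (carrier (rsp M)) g (dec (HomS n M N) u) \<in> carrier (HomS n M L)"
    using lhom_closed[OF Rep_compose_lhom(1)[OF N L]] g d by simp
  show "mo f N L g (yo f x N u) = yo f x L (mo (h_ftor n M) N L g u)"
    using LF_cmp[OF f oM oN oL d g x] u N L c fdvs_HomS[OF M L] by (simp add: yo_apply)
qed (simp add: yo_def)

text \<open>The Yoneda transformation restricted to tensor powers. As \<open>x\<close> varies, this
  is the component at \<open>M\<close> of the unit from f to j_* j^* f, before coding.\<close>

definition Y :: "('k, 'u) aftor \<Rightarrow> 'u \<Rightarrow> ('k, 'u) module \<Rightarrow> 'u \<Rightarrow> 'u" where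
  "Y f x = jstar_nt n (yo f x)"

lemma Y_nt:
  assumes "linear_functor (Rep n) Vect f" "x \<in> carrier (ob f M)"
  shows "Y f x \<in> nat_trans (Gam n) Vect (J n M) (jstar_ob n f)"
  unfolding Y_def by (rule jstar_nt_closed[OF yo_nt[OF assms]])

lemma Y_apply: "fdvs V \<Longrightarrow> u \<in> carrier (small (HomS n M (TR n V))) \<Longrightarrow>
    Y f x V u = mo f M (TR n V) (dec (HomS n M (TR n V)) u) x"
  by (simp add: Y_def yo_apply)

lemma Y_lhom:
  assumes f: "linear_functor (Rep n) Vect f"
  shows "Y f \<in> lhom (ob f M) (Mor (PC n) (J n M) (jstar_ob n f))"
proof -
  have oM: "M \<in> Obj (Rep n)" using M by simp
  note vM = fdvs_vs[OF LF_fdvs[OF f oM]]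
  note vP = vs_Fun[OF Vect_linear_category J_linear jstar_ob_linear[OF f]]
  have d: "dec (HomS n M (TR n V)) u \<in> carrier (Mor (Rep n) M (TR n V))"
    if "fdvs V" "u \<in> carrier (small (HomS n M (TR n V)))" for V and u :: 'u
    using dec_closed[OF fdvs_HomS[OF M TR_rep[OF that(1)]] that(2)] by simp
  note l = lin_simps(2,3)[OF LF_lin[OF f oM TR_obj d]]
  show ?thesis
  proof (rule lhomI)
    fix x y r assume x: "x \<in> carrier (ob f M)"
    show Yx: "Y f x \<in> carrier (Mor (PC n) (J n M) (jstar_ob n f))" using Y_nt[OF f x] by simp
    show "Y f (r \<odot>\<^bsub>ob f M\<^esub> x) = r \<odot>\<^bsub>Mor (PC n) (J n M) (jstar_ob n f)\<^esub> Y f x"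
    proof (rule nt_eqI[OF Y_nt[OF f]])
      show "r \<odot>\<^bsub>Mor (PC n) (J n M) (jstar_ob n f)\<^esub> Y f x \<in> nat_trans (Gam n) Vect (J n M) (jstar_ob n f)"
        using vs_smult[OF vP Yx, of r] by simp
    qed (use x vM l in \<open>simp_all add: Y_apply\<close>)
    assume y: "y \<in> carrier (ob f M)"
    have Yy: "Y f y \<in> carrier (Mor (PC n) (J n M) (jstar_ob n f))" using Y_nt[OF f y] by simp
    show "Y f (x \<oplus>\<^bsub>ob f M\<^esub> y) = Y f x \<oplus>\<^bsub>Mor (PC n) (J n M) (jstar_ob n f)\<^esub> Y f y"
    proof (rule nt_eqI[OF Y_nt[OF f]])
      show "Y f x \<oplus>\<^bsub>Mor (PC n) (J n M) (jstar_ob n f)\<^esub> Y f y \<in> nat_trans (Gam n) Vect (J n M) (jstar_ob n f)"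
        using vs_add[OF vP Yx Yy] by simp
    qed (use x y vM l in \<open>simp_all add: Y_apply\<close>)
  qed
qed

end

text \<open>Precomposition with \<open>\<phi>\<close> is the Yoneda transformation belonging to
  \<open>\<phi>\<close> itself, viewed as an element of the represented functor of \<open>M\<close>
  at \<open>N\<close>. Naturality and linearity of \<open>jh\<close> thereby follow from the
  corresponding facts for \<open>Y\<close>.\<close>

lemma jh_eq_Y:
  assumes M: "is_rep n M" and N: "is_rep n N" and \<phi>: "\<phi> \<in> equivariant n M N"
  shows "jh n M N \<phi> = Y N n (h_ftor n M) (enc (HomS n M N) \<phi>)"
proof -
  have "h_nt n M N \<phi> L = yo N n (h_ftor n M) (enc (HomS n M N) \<phi>) L" if L: "is_rep n L" for L
    unfolding h_nt_def yo_def[OF N] small_map_def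
    using L M N \<phi> fdvs_HomS[OF M N] by (simp cong: restrict_cong)
  then show ?thesis
    unfolding Y_def[OF N] jstar_nt_def by (intro restrict_ext) simp
qed

text \<open>Naturality of the Yoneda correspondence in the representation: both sides send a coded
  map from \<open>N\<close> to the action of its composite with \<open>\<phi>\<close> on
  \<open>x\<close>.\<close>

lemma Y_precompose:
  assumes M: "is_rep n M" and N: "is_rep n N" and \<phi>: "\<phi> \<in> equivariant n M N"
    and f: "linear_functor (Rep n) Vect f" and x: "x \<in> carrier (ob f M)"
  shows "Cmp (PC n) (J n N) (J n M) (jstar_ob n f) (Y M n f x) (jh n M N \<phi>) = Y N n f (mo f M N \<phi> x)"
proof -
  have o: "M \<in> Obj (Rep n)" "N \<in> Obj (Rep n)" using M N by auto
  have e: "enc (HomS n M N) \<phi> \<in> carrier (ob (h_ftor n M) N)" using fdvs_HomS[OF M N] M \<phi> by simp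
  have fx: "mo f M N \<phi> x \<in> carrier (ob f N)" using LF_closed[OF f o _ x] \<phi> by simp
  have jn: "jh n M N \<phi> \<in> nat_trans (Gam n) Vect (J n N) (J n M)"
    unfolding jh_eq_Y[OF M N \<phi>] by (rule Y_nt[OF N h_ftor_linear[OF M] e])
  show ?thesis
  proof (rule nt_eqI[OF nt_cmp[OF J_linear[OF N] J_linear[OF M] jstar_ob_linear[OF f] jn Y_nt[OF M f x]] Y_nt[OF N f fx]])
    fix V :: "('k, 'u) module" and u assume V: "V \<in> Obj (Gam n)" and u: "u \<in> carrier (ob (J n N) V)"
    then have fV: "fdvs V" and u': "u \<in> carrier (small (HomS n N (TR n V)))" using N by simp_all
    have d: "dec (HomS n N (TR n V)) u \<in> equivariant n N (TR n V)"
      using dec_closed[OF fdvs_HomS[OF N TR_rep[OF fV]] u'] by simp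
    have c: "compose (carrier (rsp M)) (dec (HomS n N (TR n V)) u) \<phi> \<in> carrier (HomS n M (TR n V))"
      using equivariant_compose[OF M \<phi> d] by simp
    have "jh n M N \<phi> V u = enc (HomS n M (TR n V)) (compose (carrier (rsp M)) (dec (HomS n N (TR n V)) u) \<phi>)"
      unfolding jh_eq_Y[OF M N \<phi>] using Y_apply[OF N fV u'] M N \<phi> d e fdvs_HomS[OF M N] by simp
    moreover have "mo f M (TR n V) (compose (carrier (rsp M)) (dec (HomS n N (TR n V)) u) \<phi>) x =
        mo f N (TR n V) (dec (HomS n N (TR n V)) u) (mo f M N \<phi> x)"
      using LF_cmp[OF f o TR_obj[OF fV], of \<phi> "dec (HomS n N (TR n V)) u" x] \<phi> d x by simp
    ultimately show "Cmp (PC n) (J n N) (J n M) (jstar_ob n f) (Y M n f x) (jh n M N \<phi>) V u = Y N n f (mo f M N \<phi> x) V u"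
      using V u fV u' c fdvs_HomS[OF M TR_rep[OF fV]] by (simp add: Y_apply[OF M] Y_apply[OF N])
  qed
qed

context
  fixes n :: nat
begin

lemma jh_nt:
  assumes M: "is_rep n M" and N: "is_rep n N" and \<phi>: "\<phi> \<in> equivariant n M N"
  shows "jh n M N \<phi> \<in> nat_trans (Gam n) Vect (J n N) (J n M)"
proof -
  have "enc (HomS n M N) \<phi> \<in> carrier (ob (h_ftor n M) N)" using fdvs_HomS[OF M N] M \<phi> by simp
  then show ?thesis unfolding jh_eq_Y[OF M N \<phi>] by (rule Y_nt[OF N h_ftor_linear[OF M]])
qed

lemma jh_apply:
  assumes M: "is_rep n M" and N: "is_rep n N" and V: "fdvs V" and u: "u \<in> carrier (small (HomS n N (TR n V)))"
  shows "jh n M N \<phi> V u = enc (HomS n M (TR n V)) (compose (carrier (rsp M)) (dec (HomS n N (TR n V)) u) \<phi>)"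
  using assms small_map_apply[OF fdvs_HomS[OF N TR_rep[OF V]] u] by (simp add: h_nt_def)

lemma jh_lhom:
  assumes M: "is_rep n M" and N: "is_rep n N"
  shows "jh n M N \<in> lhom (HomS n M N) (Mor (PC n) (J n N) (J n M))"
proof (rule lhom_cong)
  show "(\<lambda>\<phi>. Y N n (h_ftor n M) (enc (HomS n M N) \<phi>)) \<in> lhom (HomS n M N) (Mor (PC n) (J n N) (J n M))"
    by (rule lhom_compose[OF enc_lhom[OF fdvs_HomS[OF M N], folded h_ftor_ob[OF M]] Y_lhom[OF N h_ftor_linear[OF M]]])
qed (use jh_eq_Y[OF M N] fdvs_HomS[OF M N] in simp_all)

lemma jh_id:
  assumes M: "is_rep n M"
  shows "jh n M M (\<lambda>x\<in>carrier (rsp M). x) = Idn (PC n) (J n M)"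
proof (rule nt_eqI[OF jh_nt[OF M M equivariant_id[OF M]]])
  show "Idn (PC n) (J n M) \<in> nat_trans (Gam n) Vect (J n M) (J n M)"
    using lc_idn[OF PC_linear_category, of "J n M"] J_linear[OF M] by simp
  fix V :: "('k, 'u) module" and u assume V: "V \<in> Obj (Gam n)" and u: "u \<in> carrier (ob (J n M) V)"
  then have fV: "fdvs V" and u': "u \<in> carrier (small (HomS n M (TR n V)))" using M by simp_all
  note fd = fdvs_HomS[OF M TR_rep[OF fV]]
  have d: "dec (HomS n M (TR n V)) u \<in> equivariant n M (TR n V)" using dec_closed[OF fd u'] by simp
  have "compose (carrier (rsp M)) (dec (HomS n M (TR n V)) u) (\<lambda>x\<in>carrier (rsp M). x) = dec (HomS n M (TR n V)) u"
    using lin_closed[OF equivariantD(1)[OF d]] lin_ext[OF equivariantD(1)[OF d]] by (intro compose_Id) auto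
  then show "jh n M M (\<lambda>x\<in>carrier (rsp M). x) V u = Idn (PC n) (J n M) V u"
    unfolding jh_apply[OF M M fV u'] using V u u' fd M by simp
qed

lemma jh_compose:
  assumes L: "is_rep n L" and M: "is_rep n M" and N: "is_rep n N" and p: "\<psi> \<in> equivariant n L M" "\<phi> \<in> equivariant n M N"
  shows "jh n L N (compose (carrier (rsp L)) \<phi> \<psi>) = Cmp (PC n) (J n N) (J n M) (J n L) (jh n L M \<psi>) (jh n M N \<phi>)"
proof -
  have e: "enc (HomS n L M) \<psi> \<in> carrier (ob (h_ftor n L) M)" using fdvs_HomS[OF L M] L p by simp
  show ?thesis
    \<comment> \<open>Functoriality of \<open>jh\<close> is the case of \<open>Y_precompose\<close>
      in which \<open>f\<close> is represented by \<open>L\<close> and the element is the code of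
      \<open>\<psi>\<close>.\<close>
    using Y_precompose[OF M N p(2) h_ftor_linear[OF L] e] e p fdvs_HomS[OF L M] M
    by (simp add: jh_eq_Y[OF L M p(1)] jh_eq_Y[OF L N equivariant_compose[OF L p]] h_ftor_apply[OF L] L)
qed

section \<open>The functor j_*\<close>

lemma jlow_space_eq: "jlow_space n F M = Mor (PC n) (J n M) F"
  by (simp add: jlow_space_def P_cat_def)

lemma jlow_space_carrier [simp]: "carrier (jlow_space n F M) = nat_trans (Gam n) Vect (J n M) F"
  by (simp add: jlow_space_eq)

text \<open>This is where polarization enters the construction: it guarantees that
  \<open>small\<close> chooses an actual copy of the space of transformations.\<close>

lemma fdvs_jlow_space [simp]:
  fixes M :: "('k, 'u) rep"
  assumes "linear_functor (Gam n) Vect F" "is_rep n M"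
  shows "fdvs (jlow_space n F M)"
  unfolding jlow_space_eq by (rule fdvs_nat_trans[OF J_linear[OF assms(2)] assms(1)])

lemma jlow_ob_ob [simp]: "ob (jlow_ob n F) M = small (jlow_space n F M)"
  by (simp add: jlow_ob_def)

context
  fixes F :: "('k, 'u) pftor"
  assumes F: "linear_functor (Gam n) Vect F"
begin

lemma precompose_lhom:
  assumes M: "is_rep n M" and N: "is_rep n N" and \<phi>: "\<phi> \<in> equivariant n M N"
  shows "(\<lambda>\<eta>. Cmp (PC n) (J n N) (J n M) F \<eta> (jh n M N \<phi>)) \<in> lhom (jlow_space n F M) (jlow_space n F N)"
  unfolding jlow_space_eq
  by (rule lc_left[OF PC_linear_category]) (use J_linear[OF M] J_linear[OF N] F jh_nt[OF M N \<phi>] in auto)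

lemma jlow_ob_apply [simp]:
  fixes M :: "('k, 'u) rep"
  assumes M: "is_rep n M" and u: "u \<in> carrier (small (jlow_space n F M))"
  shows "mo (jlow_ob n F) M N \<phi> u =
    enc (jlow_space n F N) (Cmp (PC n) (J n N) (J n M) F (dec (jlow_space n F M) u) (jh n M N \<phi>))"
  using small_map_apply[OF fdvs_jlow_space[OF F M] u] by (simp add: jlow_ob_def P_cat_def)

lemma jlow_ob_linear: "linear_functor (Rep n) Vect (jlow_ob n F)"
proof (rule linear_functor_VectI[OF linear_category_pre[OF Rep_linear_category]])
  fix M N :: "('k, 'u) rep" assume "M \<in> Obj (Rep n)" "N \<in> Obj (Rep n)"
  then have o: "is_rep n M" "is_rep n N" by auto
  note fd = fdvs_jlow_space[OF F o(1)] fdvs_jlow_space[OF F o(2)]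
  have oJ: "J n M \<in> Obj (PC n)" "J n N \<in> Obj (PC n)" "F \<in> Obj (PC n)" using J_linear o F by auto
  show "fdvs (ob (jlow_ob n F) M)" using fd by simp
  show "mo (jlow_ob n F) M N \<phi> \<in> lin (ob (jlow_ob n F) M) (ob (jlow_ob n F) N)" if "\<phi> \<in> carrier (Mor (Rep n) M N)" for \<phi>
    using small_map_lin[OF fd precompose_lhom[OF o]] that by (simp add: jlow_ob_def P_cat_def)
  show "mo (jlow_ob n F) M M (Idn (Rep n) M) u = u" if "u \<in> carrier (ob (jlow_ob n F) M)" for u
  proof -
    have u: "u \<in> carrier (small (jlow_space n F M))" using that by simp
    have "Cmp (PC n) (J n M) (J n M) F (dec (jlow_space n F M) u) (Idn (PC n) (J n M)) = dec (jlow_space n F M) u"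
      by (rule lc_idr[OF PC_linear_category oJ(1,3)]) (use dec_closed[OF fd(1) u] in simp)
    then show ?thesis using u o fd jh_id[OF o(1)] by (simp del: Fun_simps)
  qed
  fix \<phi> u assume p: "\<phi> \<in> carrier (Mor (Rep n) M N)" and "u \<in> carrier (ob (jlow_ob n F) M)"
  then have p': "\<phi> \<in> equivariant n M N" and u: "u \<in> carrier (small (jlow_space n F M))" by simp_all
  have d: "dec (jlow_space n F M) u \<in> carrier (Mor (PC n) (J n M) F)" using dec_closed[OF fd(1) u] by simp
  have h: "(\<lambda>\<phi>. enc (jlow_space n F N) (Cmp (PC n) (J n N) (J n M) F (dec (jlow_space n F M) u) (jh n M N \<phi>)) :: 'u)
      \<in> lhom (HomS n M N) (small (jlow_space n F N))"
    by (rule lhom_compose[OF lhom_compose[OF jh_lhom[OF o] lc_right[OF PC_linear_category oJ(2,1,3) d], folded jlow_space_eq]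
        enc_lhom[OF fd(2)]])
  show "mo (jlow_ob n F) M N (\<phi> \<oplus>\<^bsub>Mor (Rep n) M N\<^esub> \<phi>') u = mo (jlow_ob n F) M N \<phi> u \<oplus>\<^bsub>ob (jlow_ob n F) N\<^esub> mo (jlow_ob n F) M N \<phi>' u"
    if "\<phi>' \<in> carrier (Mor (Rep n) M N)" for \<phi>'
    using lhom_add[OF h, of \<phi> \<phi>'] p' that u o by simp
  show "mo (jlow_ob n F) M N (r \<odot>\<^bsub>Mor (Rep n) M N\<^esub> \<phi>) u = r \<odot>\<^bsub>ob (jlow_ob n F) N\<^esub> mo (jlow_ob n F) M N \<phi> u" for r
    using lhom_smult[OF h, of \<phi> r] p' u o by simp
  fix K :: "('k, 'u) rep" and \<psi> assume "K \<in> Obj (Rep n)" "\<psi> \<in> carrier (Mor (Rep n) N K)"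
  then have K: "is_rep n K" and q: "\<psi> \<in> equivariant n N K" by simp_all
  have oK: "J n K \<in> Obj (PC n)" using J_linear[OF K] by simp
  have c: "Cmp (PC n) (J n N) (J n M) F (dec (jlow_space n F M) u) (jh n M N \<phi>) \<in> carrier (jlow_space n F N)"
    by (rule lhom_closed[OF precompose_lhom[OF o p'] dec_closed[OF fd(1) u]])
  have "Cmp (PC n) (J n K) (J n M) F (dec (jlow_space n F M) u) (jh n M K (compose (carrier (rsp M)) \<psi> \<phi>)) =
    Cmp (PC n) (J n K) (J n N) F (Cmp (PC n) (J n N) (J n M) F (dec (jlow_space n F M) u) (jh n M N \<phi>)) (jh n N K \<psi>)"
    unfolding jh_compose[OF o(1) o(2) K p' q]
    using lc_assoc[OF PC_linear_category oK oJ(2,1,3) _ _ d, of "jh n N K \<psi>" "jh n M N \<phi>"] jh_nt[OF o p'] jh_nt[OF o(2) K q] by simp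
  then show "mo (jlow_ob n F) M K (Cmp (Rep n) M N K \<psi> \<phi>) u = mo (jlow_ob n F) N K \<psi> (mo (jlow_ob n F) M N \<phi> u)"
    using u o fd c enc_closed[OF fd(2) c] by (simp del: jlow_space_carrier)
qed

end

lemma postcompose_lhom:
  assumes F: "linear_functor (Gam n) Vect F" and G: "linear_functor (Gam n) Vect G"
    and a: "\<alpha> \<in> nat_trans (Gam n) Vect F G" and M: "is_rep n M"
  shows "(\<lambda>\<eta>. Cmp (PC n) (J n M) F G \<alpha> \<eta>) \<in> lhom (jlow_space n F M) (jlow_space n G M)"
  unfolding jlow_space_eq
  by (rule lc_right[OF PC_linear_category]) (use J_linear[OF M] F G a in auto)

lemma jlow_nt_apply:
  fixes M :: "('k, 'u) rep" and F G :: "('k, 'u) pftor"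
  assumes F: "linear_functor (Gam n) Vect F" and M: "is_rep n M" and u: "u \<in> carrier (small (jlow_space n F M))"
  shows "jlow_nt n F G \<alpha> M u = enc (jlow_space n G M) (Cmp (PC n) (J n M) F G \<alpha> (dec (jlow_space n F M) u))"
  using small_map_apply[OF fdvs_jlow_space[OF F M] u] M by (simp add: jlow_nt_def P_cat_def)

lemma jlow_nt_closed:
  fixes F G :: "('k, 'u) pftor"
  assumes F: "linear_functor (Gam n) Vect F" and G: "linear_functor (Gam n) Vect G"
    and a: "\<alpha> \<in> nat_trans (Gam n) Vect F G"
  shows "jlow_nt n F G \<alpha> \<in> nat_trans (Rep n) Vect (jlow_ob n F) (jlow_ob n G)"
proof (rule nat_trans_VectI)
  fix M :: "('k, 'u) rep" assume "M \<in> Obj (Rep n)"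
  then have M: "is_rep n M" by simp
  note fd = fdvs_jlow_space[OF F M] fdvs_jlow_space[OF G M]
  show "jlow_nt n F G \<alpha> M \<in> lin (ob (jlow_ob n F) M) (ob (jlow_ob n G) M)"
    using small_map_lin[OF fd postcompose_lhom[OF F G a M]] M by (simp add: jlow_nt_def P_cat_def)
  fix N :: "('k, 'u) rep" and \<phi> u assume "N \<in> Obj (Rep n)" "\<phi> \<in> carrier (Mor (Rep n) M N)" "u \<in> carrier (ob (jlow_ob n F) M)"
  then have N: "is_rep n N" and p: "\<phi> \<in> equivariant n M N" and u: "u \<in> carrier (small (jlow_space n F M))" by simp_all
  note d = dec_closed[OF fd(1) u]
  note c1 = lhom_closed[OF precompose_lhom[OF F M N p] d] and c2 = lhom_closed[OF postcompose_lhom[OF F G a M] d]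
  have "Cmp (PC n) (J n N) (J n M) G (Cmp (PC n) (J n M) F G \<alpha> (dec (jlow_space n F M) u)) (jh n M N \<phi>) =
    Cmp (PC n) (J n N) F G \<alpha> (Cmp (PC n) (J n N) (J n M) F (dec (jlow_space n F M) u) (jh n M N \<phi>))"
    by (rule lc_assoc[OF PC_linear_category])
      (use J_linear[OF M] J_linear[OF N] F G a d jh_nt[OF M N p] in auto)
  then show "mo (jlow_ob n G) M N \<phi> (jlow_nt n F G \<alpha> M u) = jlow_nt n F G \<alpha> N (mo (jlow_ob n F) M N \<phi> u)"
    using u M N F G c1 c2 fd fdvs_jlow_space[OF F N]
      enc_closed[OF fd(2) c2] enc_closed[OF fdvs_jlow_space[OF F N] c1]
    by (simp add: jlow_nt_apply del: jlow_space_carrier)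
qed (simp add: jlow_nt_def)

lemma jlow_functor: "is_functor (PC n) (AC n) (jlow n)"
  unfolding is_functor_def
proof (intro conjI ballI)
  fix F :: "('k, 'u) pftor" assume "F \<in> Obj (PC n)"
  then have F: "linear_functor (Gam n) Vect F" by simp
  show "ob (jlow n) F \<in> Obj (AC n)" using jlow_ob_linear[OF F] by (simp add: jlow_def)
  have i: "Idn (PC n) F \<in> nat_trans (Gam n) Vect F F" using lc_idn[OF PC_linear_category, of F] F by simp
  have "jlow_nt n F F (Idn (PC n) F) = Idn (AC n) (jlow_ob n F)"
  proof (rule nt_eqI[OF jlow_nt_closed[OF F F i]])
    show "Idn (AC n) (jlow_ob n F) \<in> nat_trans (Rep n) Vect (jlow_ob n F) (jlow_ob n F)"
      using lc_idn[OF AC_linear_category, of "jlow_ob n F"] jlow_ob_linear[OF F] by simp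
    fix M :: "('k, 'u) rep" and u assume "M \<in> Obj (Rep n)" "u \<in> carrier (ob (jlow_ob n F) M)"
    then have M: "is_rep n M" and u: "u \<in> carrier (small (jlow_space n F M))" by simp_all
    note fd = fdvs_jlow_space[OF F M]
    have "Cmp (PC n) (J n M) F F (Idn (PC n) F) (dec (jlow_space n F M) u) = dec (jlow_space n F M) u"
      by (rule lc_idl[OF PC_linear_category]) (use J_linear[OF M] F dec_closed[OF fd u] in auto)
    then have "jlow_nt n F F (Idn (PC n) F) M u = u"
      using u fd by (simp only: jlow_nt_apply[OF F M u] enc_dec[OF fd u])
    then show "jlow_nt n F F (Idn (PC n) F) M u = Idn (AC n) (jlow_ob n F) M u" using M u by simp
  qed
  then show "mo (jlow n) F F (Idn (PC n) F) = Idn (AC n) (ob (jlow n) F)" by (simp add: jlow_def)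
next
  fix F G :: "('k, 'u) pftor" and \<alpha> assume "F \<in> Obj (PC n)" "G \<in> Obj (PC n)" "\<alpha> \<in> carrier (Mor (PC n) F G)"
  then show "mo (jlow n) F G \<alpha> \<in> carrier (Mor (AC n) (ob (jlow n) F) (ob (jlow n) G))"
    using jlow_nt_closed by (simp add: jlow_def)
next
  fix F G H :: "('k, 'u) pftor" and \<alpha> \<beta> assume "F \<in> Obj (PC n)" "G \<in> Obj (PC n)" "H \<in> Obj (PC n)"
    "\<alpha> \<in> carrier (Mor (PC n) F G)" "\<beta> \<in> carrier (Mor (PC n) G H)"
  then have F: "linear_functor (Gam n) Vect F" "linear_functor (Gam n) Vect G" "linear_functor (Gam n) Vect H"
    and a: "\<alpha> \<in> nat_trans (Gam n) Vect F G" "\<beta> \<in> nat_trans (Gam n) Vect G H" by auto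
  note l = jlow_ob_linear[OF F(1)] jlow_ob_linear[OF F(2)] jlow_ob_linear[OF F(3)]
  have "jlow_nt n F H (Cmp (PC n) F G H \<beta> \<alpha>) =
    Cmp (AC n) (jlow_ob n F) (jlow_ob n G) (jlow_ob n H) (jlow_nt n G H \<beta>) (jlow_nt n F G \<alpha>)"
  proof (rule nt_eqI[OF jlow_nt_closed[OF F(1,3) nt_cmp[OF F a]] nt_cmp[OF l jlow_nt_closed[OF F(1,2) a(1)] jlow_nt_closed[OF F(2,3) a(2)]]])
    fix M :: "('k, 'u) rep" and u assume "M \<in> Obj (Rep n)" "u \<in> carrier (ob (jlow_ob n F) M)"
    then have M: "is_rep n M" and u: "u \<in> carrier (small (jlow_space n F M))" by simp_all
    note fd = fdvs_jlow_space[OF F(1) M] fdvs_jlow_space[OF F(2) M]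
    note d = dec_closed[OF fd(1) u]
    note c = lhom_closed[OF postcompose_lhom[OF F(1,2) a(1) M] d]
    have "Cmp (PC n) (J n M) F H (Cmp (PC n) F G H \<beta> \<alpha>) (dec (jlow_space n F M) u) =
      Cmp (PC n) (J n M) G H \<beta> (Cmp (PC n) (J n M) F G \<alpha> (dec (jlow_space n F M) u))"
      by (rule lc_assoc[OF PC_linear_category]) (use J_linear[OF M] F a d in auto)
    then show "jlow_nt n F H (Cmp (PC n) F G H \<beta> \<alpha>) M u =
        Cmp (AC n) (jlow_ob n F) (jlow_ob n G) (jlow_ob n H) (jlow_nt n G H \<beta>) (jlow_nt n F G \<alpha>) M u"
      using u M F c fd enc_closed[OF fd(2) c] by (simp add: jlow_nt_apply del: jlow_space_carrier)
  qed
  then show "mo (jlow n) F H (Cmp (PC n) F G H \<beta> \<alpha>) =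
      Cmp (AC n) (ob (jlow n) F) (ob (jlow n) G) (ob (jlow n) H) (mo (jlow n) G H \<beta>) (mo (jlow n) F G \<alpha>)"
    by (simp add: jlow_def)
qed

text \<open>The unit, given by \<open>Y\<close>, followed by \<open>\<alpha>\<close>: an element of
  f at \<open>M\<close> becomes a transformation out of the restricted represented functor.\<close>

definition adj_to :: "('k, 'u) aftor \<Rightarrow> ('k, 'u) pftor \<Rightarrow> (('k, 'u) module \<Rightarrow> 'u \<Rightarrow> 'u) \<Rightarrow> ('k, 'u) rep \<Rightarrow> 'u \<Rightarrow> 'u" where
  "adj_to f F \<alpha> = (\<lambda>M\<in>Obj (Rep n). \<lambda>x\<in>carrier (ob f M).
     enc (jlow_space n F M) (Cmp (PC n) (J n M) (jstar_ob n f) F \<alpha> (Y M n f x)))"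

text \<open>The code of the identity of the tensor power of \<open>V\<close>, an element of the
  value at \<open>V\<close> of the restricted functor represented by that tensor power. Evaluation
  at this universal element is the inverse of the Yoneda step.\<close>

definition adj_unit :: "('k, 'u) module \<Rightarrow> 'u" where
  "adj_unit V = enc (HomS n (TR n V) (TR n V)) (\<lambda>x\<in>carrier (tp n V). x)"

definition adj_from :: "('k, 'u) aftor \<Rightarrow> ('k, 'u) pftor \<Rightarrow> (('k, 'u) rep \<Rightarrow> 'u \<Rightarrow> 'u) \<Rightarrow> ('k, 'u) module \<Rightarrow> 'u \<Rightarrow> 'u" where
  "adj_from f F \<beta> = (\<lambda>V\<in>Obj (Gam n). \<lambda>x\<in>carrier (ob f (TR n V)).
     dec (jlow_space n F (TR n V)) (\<beta> (TR n V) x) V (adj_unit V))"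

context
  fixes f :: "('k, 'u) aftor" and F :: "('k, 'u) pftor"
  assumes f: "linear_functor (Rep n) Vect f" and F: "linear_functor (Gam n) Vect F"
begin

lemma adj_to_lhom:
  assumes a: "\<alpha> \<in> nat_trans (Gam n) Vect (jstar_ob n f) F" and M: "is_rep n M"
  shows "(\<lambda>x. Cmp (PC n) (J n M) (jstar_ob n f) F \<alpha> (Y M n f x)) \<in> lhom (ob f M) (jlow_space n F M)"
  unfolding jlow_space_eq
  by (rule lhom_compose[OF Y_lhom[OF M f] lc_right[OF PC_linear_category]])
    (use J_linear[OF M] jstar_ob_linear[OF f] F a in auto)

lemma adj_to_closed:
  assumes a: "\<alpha> \<in> nat_trans (Gam n) Vect (jstar_ob n f) F"
  shows "adj_to f F \<alpha> \<in> nat_trans (Rep n) Vect f (jlow_ob n F)"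
proof (rule nat_trans_VectI)
  fix M :: "('k, 'u) rep" assume oM: "M \<in> Obj (Rep n)"
  then have M: "is_rep n M" by simp
  note fd = fdvs_jlow_space[OF F M]
  show "adj_to f F \<alpha> M \<in> lin (ob f M) (ob (jlow_ob n F) M)"
    using lin_restrict[OF lhom_compose[OF adj_to_lhom[OF a M] enc_lhom[OF fd]]] LF_fdvs[OF f oM] M by (simp add: adj_to_def)
  fix N :: "('k, 'u) rep" and \<phi> x assume oN: "N \<in> Obj (Rep n)" and p: "\<phi> \<in> carrier (Mor (Rep n) M N)" and x: "x \<in> carrier (ob f M)"
  then have N: "is_rep n N" and p': "\<phi> \<in> equivariant n M N" by simp_all
  note c = lhom_closed[OF adj_to_lhom[OF a M] x]
  have "Cmp (PC n) (J n N) (J n M) F (Cmp (PC n) (J n M) (jstar_ob n f) F \<alpha> (Y M n f x)) (jh n M N \<phi>) =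
    Cmp (PC n) (J n N) (jstar_ob n f) F \<alpha> (Cmp (PC n) (J n N) (J n M) (jstar_ob n f) (Y M n f x) (jh n M N \<phi>))"
    by (rule lc_assoc[OF PC_linear_category])
      (use J_linear[OF M] J_linear[OF N] jstar_ob_linear[OF f] F a Y_nt[OF M f x] jh_nt[OF M N p'] in auto)
  also have "\<dots> = Cmp (PC n) (J n N) (jstar_ob n f) F \<alpha> (Y N n f (mo f M N \<phi> x))"
    by (simp only: Y_precompose[OF M N p' f x])
  finally show "mo (jlow_ob n F) M N \<phi> (adj_to f F \<alpha> M x) = adj_to f F \<alpha> N (mo f M N \<phi> x)"
    using M N F x c fd enc_closed[OF fd c] LF_closed[OF f oM oN p x] by (simp add: adj_to_def del: jlow_space_carrier)
qed (simp add: adj_to_def)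

lemma adj_unit_closed:
  assumes "fdvs V"
  shows "adj_unit V \<in> carrier (small (HomS n (TR n V) (TR n V)))"
    "dec (HomS n (TR n V) (TR n V)) (adj_unit V) = (\<lambda>x\<in>carrier (tp n V). x)"
proof -
  have "(\<lambda>x\<in>carrier (tp n V). x) \<in> carrier (HomS n (TR n V) (TR n V))"
    using equivariant_id[OF TR_rep[OF assms, of n]] assms by simp
  then show "adj_unit V \<in> carrier (small (HomS n (TR n V) (TR n V)))"
    "dec (HomS n (TR n V) (TR n V)) (adj_unit V) = (\<lambda>x\<in>carrier (tp n V). x)"
    using fdvs_HomS[OF TR_rep[OF assms] TR_rep[OF assms]] by (simp_all add: adj_unit_def del: HomS_simps)
qed

lemma jh_unit:
  assumes M: "is_rep n M" and V: "fdvs V" and p: "\<phi> \<in> equivariant n M (TR n V)"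
  shows "jh n M (TR n V) \<phi> V (adj_unit V) = enc (HomS n M (TR n V)) \<phi>"
proof -
  have "compose (carrier (rsp M)) (\<lambda>x\<in>carrier (tp n V). x) \<phi> = \<phi>"
    using lin_closed[OF equivariantD(1)[OF p]] lin_ext[OF equivariantD(1)[OF p]] V by (intro Id_compose) auto
  then show ?thesis using jh_apply[OF M TR_rep[OF V] V adj_unit_closed(1)[OF V]] adj_unit_closed(2)[OF V] by simp
qed

text \<open>The key formula. Naturality of \<open>\<beta>\<close> along \<open>\<phi>\<close> and
  the fact that \<open>jh\<close> of \<open>\<phi>\<close> carries the universal element to the code
  of \<open>\<phi>\<close> show how \<open>adj_from\<close> at \<open>V\<close> recovers every value
  of the transformation attached to an arbitrary \<open>M\<close>. It yields both the naturality of
  \<open>adj_from\<close> and the identity \<open>adj_to_from\<close>.\<close>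

lemma adj_from_apply:
  assumes b: "\<beta> \<in> nat_trans (Rep n) Vect f (jlow_ob n F)" and M: "is_rep n M" and V: "fdvs V"
    and p: "\<phi> \<in> equivariant n M (TR n V)" and x: "x \<in> carrier (ob f M)"
  shows "adj_from f F \<beta> V (mo f M (TR n V) \<phi> x) = dec (jlow_space n F M) (\<beta> M x) V (enc (HomS n M (TR n V)) \<phi>)"
proof -
  have o: "M \<in> Obj (Rep n)" "TR n V \<in> Obj (Rep n)" and p': "\<phi> \<in> carrier (Mor (Rep n) M (TR n V))" using M V p by simp_all
  have fx: "mo f M (TR n V) \<phi> x \<in> carrier (ob f (TR n V))" by (rule LF_closed[OF f o p' x])
  have bx: "\<beta> M x \<in> carrier (small (jlow_space n F M))" using nt_app_closed[OF b o(1) x] by simp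
  note fd = fdvs_jlow_space[OF F M] fdvs_jlow_space[OF F TR_rep[OF V]]
  note d = dec_closed[OF fd(1) bx]
  note c = lhom_closed[OF precompose_lhom[OF F M TR_rep[OF V] p] d]
  have "\<beta> (TR n V) (mo f M (TR n V) \<phi> x) = mo (jlow_ob n F) M (TR n V) \<phi> (\<beta> M x)"
    by (rule nt_app_natural[OF b o p' x, symmetric])
  also have "\<dots> = enc (jlow_space n F (TR n V)) (Cmp (PC n) (J n (TR n V)) (J n M) F (dec (jlow_space n F M) (\<beta> M x)) (jh n M (TR n V) \<phi>))"
    by (rule jlow_ob_apply[OF F M bx])
  finally have "dec (jlow_space n F (TR n V)) (\<beta> (TR n V) (mo f M (TR n V) \<phi> x)) =
      Cmp (PC n) (J n (TR n V)) (J n M) F (dec (jlow_space n F M) (\<beta> M x)) (jh n M (TR n V) \<phi>)"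
    by (simp only: dec_enc[OF fd(2) c])
  then show ?thesis
    using V fx adj_unit_closed(1)[OF V] jh_unit[OF M V p] by (simp add: adj_from_def)
qed

lemma adj_from_unit:
  assumes "\<beta> \<in> nat_trans (Rep n) Vect f (jlow_ob n F)" and V: "fdvs V" and x: "x \<in> carrier (ob f (TR n V))"
  shows "adj_from f F \<beta> V x = dec (jlow_space n F (TR n V)) (\<beta> (TR n V) x) V (adj_unit V)"
  using V x by (simp add: adj_from_def)

lemma adj_from_closed:
  assumes b: "\<beta> \<in> nat_trans (Rep n) Vect f (jlow_ob n F)"
  shows "adj_from f F \<beta> \<in> nat_trans (Gam n) Vect (jstar_ob n f) F"
proof (rule nat_trans_VectI)
  fix V :: "('k, 'u) module" assume oV: "V \<in> Obj (Gam n)"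
  then have V: "fdvs V" by simp
  note fd = fdvs_jlow_space[OF F TR_rep[OF V]] and u = adj_unit_closed[OF V]
  have u': "adj_unit V \<in> carrier (ob (J n (TR n V)) V)" using u V by simp
  have ev: "(\<lambda>\<zeta>. \<zeta> V (adj_unit V)) \<in> lhom (jlow_space n F (TR n V)) (ob F V)"
    unfolding jlow_space_eq
    by (rule lhomI) (use u' oV in \<open>auto simp del: jstar_ob_simps simp: nt_app_closed\<close>)
  have "(\<lambda>x. dec (jlow_space n F (TR n V)) (\<beta> (TR n V) x) V (adj_unit V)) \<in> lhom (ob f (TR n V)) (ob F V)"
    using lhom_compose[OF lhom_compose[OF lin_lhom[OF nt_lin[OF b TR_obj[OF V]], unfolded jlow_ob_ob] dec_lhom[OF fd]] ev] .
  from lin_restrict[OF this] show "adj_from f F \<beta> V \<in> lin (ob (jstar_ob n f) V) (ob F V)"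
    using V LF_fdvs[OF f TR_obj[OF V]] by (simp add: adj_from_def)
  fix W :: "('k, 'u) module" and y x assume oW: "W \<in> Obj (Gam n)" and y: "y \<in> carrier (Mor (Gam n) V W)" and x: "x \<in> carrier (ob (jstar_ob n f) V)"
  then have W: "fdvs W" and x': "x \<in> carrier (ob f (TR n V))" by simp_all
  let ?r = "Gam_real n V W y"
  have r: "?r \<in> equivariant n (TR n V) (TR n W)" using Gam_real_equivariant[OF V W] y by simp
  have z: "dec (jlow_space n F (TR n V)) (\<beta> (TR n V) x) \<in> nat_trans (Gam n) Vect (J n (TR n V)) F"
    using dec_closed[OF fd, of "\<beta> (TR n V) x"] nt_app_closed[OF b TR_obj[OF V] x'] by simp
  have "compose (carrier (tp n V)) ?r (\<lambda>x\<in>carrier (tp n V). x) = ?r"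
    using lin_closed[OF equivariantD(1)[OF r]] lin_ext[OF equivariantD(1)[OF r]] V by (intro compose_Id) auto
  \<comment> \<open>A morphism \<open>y\<close> of \<open>Gam n\<close> carries the universal
    element at \<open>V\<close> to the code of its realization. Naturality in \<open>V\<close> is
    therefore the case of \<open>adj_from_apply\<close> with that realization as
    \<open>\<phi>\<close>.\<close>
  then have Ju: "mo (J n (TR n V)) V W y (adj_unit V) = enc (HomS n (TR n V) (TR n W)) ?r"
    using V u by simp
  have "mo F V W y (adj_from f F \<beta> V x) = dec (jlow_space n F (TR n V)) (\<beta> (TR n V) x) W (mo (J n (TR n V)) V W y (adj_unit V))"
    using nt_app_natural[OF z oV oW y u'] adj_from_unit[OF b V x'] by simp
  also have "\<dots> = adj_from f F \<beta> W (mo f (TR n V) (TR n W) ?r x)"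
    unfolding Ju by (rule adj_from_apply[OF b TR_rep[OF V] W r x', symmetric])
  finally show "mo F V W y (adj_from f F \<beta> V x) = adj_from f F \<beta> W (mo (jstar_ob n f) V W y x)" by simp
qed (simp add: adj_from_def)

lemma adj_from_to:
  assumes a: "\<alpha> \<in> nat_trans (Gam n) Vect (jstar_ob n f) F"
  shows "adj_from f F (adj_to f F \<alpha>) = \<alpha>"
proof (rule nt_eqI[OF adj_from_closed[OF adj_to_closed[OF a]] a])
  fix V :: "('k, 'u) module" and x assume oV: "V \<in> Obj (Gam n)" and "x \<in> carrier (ob (jstar_ob n f) V)"
  then have V: "fdvs V" and x: "x \<in> carrier (ob f (TR n V))" by simp_all
  note u = adj_unit_closed[OF V]
  note c = lhom_closed[OF adj_to_lhom[OF a TR_rep[OF V]] x]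
  have "adj_from f F (adj_to f F \<alpha>) V x = Cmp (PC n) (J n (TR n V)) (jstar_ob n f) F \<alpha> (Y (TR n V) n f x) V (adj_unit V)"
    using adj_from_unit[OF adj_to_closed[OF a] V x] V x dec_enc[OF fdvs_jlow_space[OF F TR_rep[OF V]] c] by (simp add: adj_to_def)
  also have "\<dots> = \<alpha> V (Y (TR n V) n f x V (adj_unit V))" using oV V u by simp
  also have "Y (TR n V) n f x V (adj_unit V) = x"
    using Y_apply[OF TR_rep[OF V] V u(1)] u(2) LF_idn[OF f TR_obj[OF V] x] V by simp
  finally show "adj_from f F (adj_to f F \<alpha>) V x = \<alpha> V x" .
qed

lemma adj_to_from:
  assumes b: "\<beta> \<in> nat_trans (Rep n) Vect f (jlow_ob n F)"
  shows "adj_to f F (adj_from f F \<beta>) = \<beta>"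
proof (rule nt_eqI[OF adj_to_closed[OF adj_from_closed[OF b]] b])
  note a = adj_from_closed[OF b]
  fix M :: "('k, 'u) rep" and x assume oM: "M \<in> Obj (Rep n)" and x: "x \<in> carrier (ob f M)"
  then have M: "is_rep n M" by simp
  note fd = fdvs_jlow_space[OF F M]
  have bx: "\<beta> M x \<in> carrier (small (jlow_space n F M))" using nt_app_closed[OF b oM x] by simp
  have d: "dec (jlow_space n F M) (\<beta> M x) \<in> nat_trans (Gam n) Vect (J n M) F" using dec_closed[OF fd bx] by simp
  have "Cmp (PC n) (J n M) (jstar_ob n f) F (adj_from f F \<beta>) (Y M n f x) = dec (jlow_space n F M) (\<beta> M x)"
  proof (rule nt_eqI[OF nt_cmp[OF J_linear[OF M] jstar_ob_linear[OF f] F Y_nt[OF M f x] a] d])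
    fix V :: "('k, 'u) module" and u assume oV: "V \<in> Obj (Gam n)" and uJ: "u \<in> carrier (ob (J n M) V)"
    then have V: "fdvs V" and u: "u \<in> carrier (small (HomS n M (TR n V)))" using M by simp_all
    note fh = fdvs_HomS[OF M TR_rep[OF V]]
    have du: "dec (HomS n M (TR n V)) u \<in> equivariant n M (TR n V)" using dec_closed[OF fh u] by simp
    have "Cmp (PC n) (J n M) (jstar_ob n f) F (adj_from f F \<beta>) (Y M n f x) V u = adj_from f F \<beta> V (Y M n f x V u)"
      by (rule Fun_Cmp_apply[OF oV uJ])
    also have "\<dots> = adj_from f F \<beta> V (mo f M (TR n V) (dec (HomS n M (TR n V)) u) x)"
      by (simp only: Y_apply[OF M V u])
    also have "\<dots> = dec (jlow_space n F M) (\<beta> M x) V u"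
      unfolding adj_from_apply[OF b M V du x] enc_dec[OF fh u] ..
    finally show "Cmp (PC n) (J n M) (jstar_ob n f) F (adj_from f F \<beta>) (Y M n f x) V u = dec (jlow_space n F M) (\<beta> M x) V u" .
  qed
  then show "adj_to f F (adj_from f F \<beta>) M x = \<beta> M x" using M x enc_dec[OF fd bx] by (simp add: adj_to_def)
qed

lemma adj_to_bij:
  "bij_betw (adj_to f F) (nat_trans (Gam n) Vect (jstar_ob n f) F) (nat_trans (Rep n) Vect f (jlow_ob n F))"
  by (rule bij_betw_byWitness[of _ "adj_from f F"])
    (use adj_from_to adj_to_from adj_to_closed adj_from_closed in auto)

end

lemma Y_natural:
  assumes f: "linear_functor (Rep n) Vect f" and g: "linear_functor (Rep n) Vect g"
    and e: "\<eta> \<in> nat_trans (Rep n) Vect f g" and M: "is_rep n M" and x: "x \<in> carrier (ob f M)"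
  shows "Cmp (PC n) (J n M) (jstar_ob n f) (jstar_ob n g) (jstar_nt n \<eta>) (Y M n f x) = Y M n g (\<eta> M x)"
proof -
  have oM: "M \<in> Obj (Rep n)" using M by simp
  show ?thesis
  proof (rule nt_eqI[OF nt_cmp[OF J_linear[OF M] jstar_ob_linear[OF f] jstar_ob_linear[OF g] Y_nt[OF M f x] jstar_nt_closed[OF e]]
      Y_nt[OF M g nt_app_closed[OF e oM x]]])
    fix V :: "('k, 'u) module" and u assume oV: "V \<in> Obj (Gam n)" and uJ: "u \<in> carrier (ob (J n M) V)"
    then have V: "fdvs V" and u: "u \<in> carrier (small (HomS n M (TR n V)))" using M by simp_all
    have du: "dec (HomS n M (TR n V)) u \<in> carrier (Mor (Rep n) M (TR n V))"
      using dec_closed[OF fdvs_HomS[OF M TR_rep[OF V]] u] by simp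
    have "Cmp (PC n) (J n M) (jstar_ob n f) (jstar_ob n g) (jstar_nt n \<eta>) (Y M n f x) V u = jstar_nt n \<eta> V (Y M n f x V u)"
      by (rule Fun_Cmp_apply[OF oV uJ])
    then show "Cmp (PC n) (J n M) (jstar_ob n f) (jstar_ob n g) (jstar_nt n \<eta>) (Y M n f x) V u = Y M n g (\<eta> M x) V u"
      using V nt_app_natural[OF e oM TR_obj[OF V] du x] by (simp add: Y_apply[OF M V u])
  qed
qed

text \<open>Naturality in f is \<open>Y_natural\<close>; naturality in F is associativity of
  composition of transformations, since both \<open>adj_to\<close> and j_* act on F by composing on
  the left.\<close>

lemma jstar_jlow_adjoint: "adjoint (AC n) (PC n) (jstar n) (jlow n)"
  unfolding adjoint_def
proof (intro conjI exI[of _ adj_to] ballI)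
  fix f :: "('k, 'u) aftor" and F :: "('k, 'u) pftor" assume "f \<in> Obj (AC n)" "F \<in> Obj (PC n)"
  then show "bij_betw (adj_to f F) (carrier (Mor (PC n) (ob (jstar n) f) F)) (carrier (Mor (AC n) f (ob (jlow n) F)))"
    using adj_to_bij by (simp add: jstar_def jlow_def)
next
  fix f f' :: "('k, 'u) aftor" and \<eta> \<nu> \<alpha> and F F' :: "('k, 'u) pftor"
  assume "f \<in> Obj (AC n)" "f' \<in> Obj (AC n)" "F \<in> Obj (PC n)" "F' \<in> Obj (PC n)"
    "\<eta> \<in> carrier (Mor (AC n) f' f)" "\<nu> \<in> carrier (Mor (PC n) F F')" "\<alpha> \<in> carrier (Mor (PC n) (ob (jstar n) f) F)"
  then have f: "linear_functor (Rep n) Vect f" "linear_functor (Rep n) Vect f'"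
    and F: "linear_functor (Gam n) Vect F" "linear_functor (Gam n) Vect F'"
    and e: "\<eta> \<in> nat_trans (Rep n) Vect f' f" and v: "\<nu> \<in> nat_trans (Gam n) Vect F F'"
    and a: "\<alpha> \<in> nat_trans (Gam n) Vect (jstar_ob n f) F" by (auto simp: jstar_def)
  note lj = jstar_ob_linear[OF f(1)] jstar_ob_linear[OF f(2)] and je = jstar_nt_closed[OF e]
  note lw = jlow_ob_linear[OF F(1)] jlow_ob_linear[OF F(2)]
  let ?\<alpha> = "Cmp (PC n) (jstar_ob n f') (jstar_ob n f) F \<alpha> (jstar_nt n \<eta>)"
  note ca = nt_cmp[OF lj(2,1) F(1) je a]
  note cva = nt_cmp[OF lj(2) F(1,2) ca v]
  have "adj_to f' F' (Cmp (PC n) (jstar_ob n f') F F' \<nu> ?\<alpha>) =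
    Cmp (AC n) f' (jlow_ob n F) (jlow_ob n F') (jlow_nt n F F' \<nu>) (Cmp (AC n) f' f (jlow_ob n F) (adj_to f F \<alpha>) \<eta>)"
  proof (rule nt_eqI[OF adj_to_closed[OF f(2) F(2) cva]
      nt_cmp[OF f(2) lw nt_cmp[OF f(2,1) lw(1) e adj_to_closed[OF f(1) F(1) a]] jlow_nt_closed[OF F v]]])
    fix M :: "('k, 'u) rep" and x assume oM: "M \<in> Obj (Rep n)" and x: "x \<in> carrier (ob f' M)"
    then have M: "is_rep n M" by simp
    have ex: "\<eta> M x \<in> carrier (ob f M)" by (rule nt_app_closed[OF e oM x])
    note c = lhom_closed[OF adj_to_lhom[OF f(1) F(1) a M] ex]
    have oJ: "J n M \<in> Obj (PC n)" "jstar_ob n f \<in> Obj (PC n)" "jstar_ob n f' \<in> Obj (PC n)" "F \<in> Obj (PC n)" "F' \<in> Obj (PC n)"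
      using J_linear[OF M] lj F by auto
    have m: "Y M n f' x \<in> carrier (Mor (PC n) (J n M) (jstar_ob n f'))" "?\<alpha> \<in> carrier (Mor (PC n) (jstar_ob n f') F)"
      "\<nu> \<in> carrier (Mor (PC n) F F')" "jstar_nt n \<eta> \<in> carrier (Mor (PC n) (jstar_ob n f') (jstar_ob n f))"
      "\<alpha> \<in> carrier (Mor (PC n) (jstar_ob n f) F)"
      using Y_nt[OF M f(2) x] ca v je a by simp_all
    have "Cmp (PC n) (J n M) (jstar_ob n f') F' (Cmp (PC n) (jstar_ob n f') F F' \<nu> ?\<alpha>) (Y M n f' x) =
      Cmp (PC n) (J n M) F F' \<nu> (Cmp (PC n) (J n M) (jstar_ob n f') F ?\<alpha> (Y M n f' x))"
      by (rule lc_assoc[OF PC_linear_category oJ(1,3,4,5) m(1,2,3)])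
    also have "Cmp (PC n) (J n M) (jstar_ob n f') F ?\<alpha> (Y M n f' x) = Cmp (PC n) (J n M) (jstar_ob n f) F \<alpha>
        (Cmp (PC n) (J n M) (jstar_ob n f') (jstar_ob n f) (jstar_nt n \<eta>) (Y M n f' x))"
      by (rule lc_assoc[OF PC_linear_category oJ(1,3,2,4) m(1,4,5)])
    also have "Cmp (PC n) (J n M) (jstar_ob n f') (jstar_ob n f) (jstar_nt n \<eta>) (Y M n f' x) = Y M n f (\<eta> M x)"
      by (rule Y_natural[OF f(2,1) e M x])
    finally have eq: "Cmp (PC n) (J n M) (jstar_ob n f') F' (Cmp (PC n) (jstar_ob n f') F F' \<nu> ?\<alpha>) (Y M n f' x) =
      Cmp (PC n) (J n M) F F' \<nu> (Cmp (PC n) (J n M) (jstar_ob n f) F \<alpha> (Y M n f (\<eta> M x)))" .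
    have "adj_to f' F' (Cmp (PC n) (jstar_ob n f') F F' \<nu> ?\<alpha>) M x =
      enc (jlow_space n F' M) (Cmp (PC n) (J n M) F F' \<nu> (Cmp (PC n) (J n M) (jstar_ob n f) F \<alpha> (Y M n f (\<eta> M x))))"
      using M x by (simp add: adj_to_def eq)
    also have "\<dots> = jlow_nt n F F' \<nu> M (adj_to f F \<alpha> M (\<eta> M x))"
      using M ex enc_closed[OF fdvs_jlow_space[OF F(1) M] c] dec_enc[OF fdvs_jlow_space[OF F(1) M] c]
      by (simp add: adj_to_def jlow_nt_apply[OF F(1) M])
    finally show "adj_to f' F' (Cmp (PC n) (jstar_ob n f') F F' \<nu> ?\<alpha>) M x =
      Cmp (AC n) f' (jlow_ob n F) (jlow_ob n F') (jlow_nt n F F' \<nu>) (Cmp (AC n) f' f (jlow_ob n F) (adj_to f F \<alpha>) \<eta>) M x"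
      using oM x by simp
  qed
  then show "adj_to f' F' (Cmp (PC n) (ob (jstar n) f') F F' \<nu> (Cmp (PC n) (ob (jstar n) f') (ob (jstar n) f) F \<alpha> (mo (jstar n) f' f \<eta>))) =
    Cmp (AC n) f' (ob (jlow n) F) (ob (jlow n) F') (mo (jlow n) F F' \<nu>) (Cmp (AC n) f' f (ob (jlow n) F) (adj_to f F \<alpha>) \<eta>)"
    by (simp add: jstar_def jlow_def)
qed (rule AC_linear_category PC_linear_category jstar_functor jlow_functor)+

end

end

section \<open>The left adjoint\<close>

context univ
begin

context
  fixes n :: nat
begin

text \<open>At \<open>V\<close>, j^* of the dual of f is the dual of f at the dual of the tensor
  power, while the dual of j^* f is the dual of f at the tensor power of the dual. The transpose of
  f applied to \<open>kap\<close> goes from the first to the second.\<close>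

definition dual_comparison :: "('k, 'u) aftor \<Rightarrow> ('k, 'u) module \<Rightarrow> 'u \<Rightarrow> 'u" where
  "dual_comparison f = (\<lambda>V\<in>Obj (Gam n). vdual_map (ob f (TR n (vdual V))) (ob f (dual_rep n (TR n V)))
     (mo f (TR n (vdual V)) (dual_rep n (TR n V)) (kap n V)))"

lemma kap_mor [simp]:
  fixes V :: "('k, 'u) module"
  assumes V: "fdvs V"
  shows "kap n V \<in> carrier (Mor (Rep n) (TR n (vdual V)) (dual_rep n (TR n V)))"
  using kap_equivariant[OF V, of n] by simp

lemma kap_iso:
  fixes V :: "('k, 'u) module"
  assumes V: "fdvs V"
  shows "lc_iso (Rep n) (TR n (vdual V)) (dual_rep n (TR n V)) (kap n V)"
  by (rule rep_iso[OF TR_rep dual_rep_is_rep[OF TR_rep] kap_equivariant]) (use V kap_bij[OF V, of n] in simp_all)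

interpretation RD: cat_duality \<iota> "Rep n" "Rep_dual n" "\<lambda>M. evd (rsp M)"
  by (rule Rep_cat_duality)

interpretation GD: cat_duality \<iota> "Gam n" "Gam_dual n" "\<lambda>V. gam n V (vdual (vdual V)) (evd V)"
  by (rule Gam_cat_duality)

lemma DA_linear: "linear_functor (Rep n) Vect f \<Longrightarrow> linear_functor (Rep n) Vect (DA n (f :: ('k, 'u) aftor))"
  unfolding DA_def by (rule RD.dual_ftor_linear)

lemma DP_linear: "linear_functor (Gam n) Vect F \<Longrightarrow> linear_functor (Gam n) Vect (DP n (F :: ('k, 'u) pftor))"
  unfolding DP_def by (rule GD.dual_ftor_linear)

lemma Rep_dual_simps:
  "ob (Rep_dual n) M = dual_rep n (M :: ('k, 'u) rep)"
  "mo (Rep_dual n) M N \<phi> = vdual_map (rsp M) (rsp N) \<phi>"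
  by (simp_all add: Rep_dual_def)

lemma DA_simps:
  fixes f :: "('k, 'u) aftor"
  shows "ob (DA n f) M = vdual (ob f (dual_rep n M))"
    "mo (DA n f) M N \<phi> = vdual_map (ob f (dual_rep n N)) (ob f (dual_rep n M))
      (mo f (dual_rep n N) (dual_rep n M) (vdual_map (rsp M) (rsp N) \<phi>))"
    "M \<in> Obj (Rep n) \<Longrightarrow> DA_map n f g \<alpha> M = vdual_map (ob f (dual_rep n M)) (ob g (dual_rep n M)) (\<alpha> (dual_rep n M))"
  by (simp_all add: DA_def DA_map_def dual_nt_def Rep_dual_simps)

lemma DP_simps:
  fixes F :: "('k, 'u) pftor"
  shows "ob (DP n F) V = vdual (ob F (vdual V))"
    "mo (DP n F) V W x = vdual_map (ob F (vdual W)) (ob F (vdual V)) (mo F (vdual W) (vdual V) (mo (Gam_dual n) V W x))"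
    "V \<in> Obj (Gam n) \<Longrightarrow> DP_map n F G \<alpha> V = vdual_map (ob F (vdual V)) (ob G (vdual V)) (\<alpha> (vdual V))"
  by (simp_all add: DP_def DP_map_def dual_nt_def)

lemma DP_map_closed:
  "linear_functor (Gam n) Vect F \<Longrightarrow> linear_functor (Gam n) Vect G \<Longrightarrow> \<alpha> \<in> nat_trans (Gam n) Vect F G \<Longrightarrow>
    DP_map n F G \<alpha> \<in> nat_trans (Gam n) Vect (DP n (G :: ('k, 'u) pftor)) (DP n F)"
  unfolding DP_def DP_map_def by (rule GD.dual_nt_closed)

text \<open>The unit is hidden behind an existential quantifier: later arguments use it through the
  axioms of \<open>duality\<close>.\<close>

lemma DP_duality: "\<exists>u. duality (PC n) (DP n) (DP_map n) u"
  using GD.duality_axioms unfolding DP_def[abs_def] DP_map_def[abs_def] by blast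

lemma DA_duality: "\<exists>u. duality (AC n) (DA n) (DA_map n) u"
  using RD.duality_axioms unfolding DA_def[abs_def] DA_map_def[abs_def] by blast

context
  fixes f :: "('k, 'u) aftor"
  assumes f: "linear_functor (Rep n) Vect f"
begin

lemma f_kap:
  fixes V :: "('k, 'u) module"
  assumes V: "fdvs V"
  shows "mo f (TR n (vdual V)) (dual_rep n (TR n V)) (kap n V) \<in> lin (ob f (TR n (vdual V))) (ob f (dual_rep n (TR n V)))"
    "fdvs (ob f (TR n (vdual V)))" "fdvs (ob f (dual_rep n (TR n V)))"
proof -
  have o: "TR n (vdual V) \<in> Obj (Rep n)" "dual_rep n (TR n V) \<in> Obj (Rep n)"
    using V dual_rep_is_rep[OF TR_rep[OF V]] by simp_all
  show "mo f (TR n (vdual V)) (dual_rep n (TR n V)) (kap n V) \<in> lin (ob f (TR n (vdual V))) (ob f (dual_rep n (TR n V)))"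
    by (rule LF_lin[OF f o kap_mor[OF V]])
  show "fdvs (ob f (TR n (vdual V)))" "fdvs (ob f (dual_rep n (TR n V)))"
    using LF_fdvs[OF f] o by auto
qed

lemma dual_comparison_closed:
  "dual_comparison f \<in> nat_trans (Gam n) Vect (jstar_ob n (DA n f)) (DP n (jstar_ob n f))"
proof (rule nat_trans_VectI)
  fix V :: "('k, 'u) module" assume "V \<in> Obj (Gam n)"
  then have V: "fdvs V" by simp
  note dR = dual_rep_is_rep[OF TR_rep[OF V, of n]]
  show "dual_comparison f V \<in> lin (ob (jstar_ob n (DA n f)) V) (ob (DP n (jstar_ob n f)) V)"
    using vdual_map_lin[OF f_kap(2,3,1)[OF V]] V by (simp add: dual_comparison_def DA_simps DP_simps)
  fix W :: "('k, 'u) module" and x \<xi> assume "W \<in> Obj (Gam n)" and "x \<in> carrier (Mor (Gam n) V W)"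
    and "\<xi> \<in> carrier (ob (jstar_ob n (DA n f)) V)"
  then have W: "fdvs W" and x: "x \<in> carrier (Gam_mor n V W)" and \<xi>: "\<xi> \<in> carrier (vdual (ob f (dual_rep n (TR n V))))"
    by (simp_all add: DA_simps)
  have d: "fdvs (vdual V)" "fdvs (vdual W)" using V W by simp_all
  let ?V = "TR n (vdual V)" and ?W = "TR n (vdual W)" and ?V' = "dual_rep n (TR n V)" and ?W' = "dual_rep n (TR n W)"
  let ?x = "mo (Gam_dual n) V W x" and ?r = "vdual_map (tp n V) (tp n W) (Gam_real n V W x)"
  have o: "?V \<in> Obj (Rep n)" "?W \<in> Obj (Rep n)" "?V' \<in> Obj (Rep n)" "?W' \<in> Obj (Rep n)"
    using d dR dual_rep_is_rep[OF TR_rep[OF W, of n]] by simp_all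
  have r: "Gam_real n (vdual W) (vdual V) ?x \<in> carrier (Mor (Rep n) ?W ?V)"
    using Gam_real_equivariant[OF d(2,1) gd_closed[OF V W x]] by simp
  have r': "?r \<in> carrier (Mor (Rep n) ?W' ?V')"
    using vdual_map_equivariant[OF TR_rep[OF V] TR_rep[OF W] Gam_real_equivariant[OF V W x]] V W by simp
  \<comment> \<open>\<open>kap_natural\<close> as an equation of composites of equivariant maps.
    Applying f and then transposing gives the naturality square.\<close>
  have "compose (carrier (tp n (vdual W))) (kap n V) (Gam_real n (vdual W) (vdual V) ?x) =
    compose (carrier (tp n (vdual W))) ?r (kap n W)"
    using kap_natural[OF V W, of x n] x by (auto simp: compose_def intro!: restrict_ext)
  then have eq: "Cmp (Rep n) ?W ?V ?V' (kap n V) (Gam_real n (vdual W) (vdual V) ?x) = Cmp (Rep n) ?W ?W' ?V' ?r (kap n W)"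
    using d by simp
  note fr = LF_lin[OF f o(2,1) r] and fr' = LF_lin[OF f o(4,3) r']
  have e: "compose (carrier (ob f ?W)) (mo f ?V ?V' (kap n V)) (mo f ?W ?V (Gam_real n (vdual W) (vdual V) ?x)) =
      compose (carrier (ob f ?W)) (mo f ?W' ?V' ?r) (mo f ?W ?W' (kap n W))"
    using LF_cmp'[OF f o(2,1,3) r kap_mor[OF V]] LF_cmp'[OF f o(2,4,3) kap_mor[OF W] r'] eq by simp
  show "mo (DP n (jstar_ob n f)) V W x (dual_comparison f V \<xi>) = dual_comparison f W (mo (jstar_ob n (DA n f)) V W x \<xi>)"
    using vdual_map_compose[OF f_kap(2)[OF W] f_kap(2,3)[OF V] fr f_kap(1)[OF V] \<xi>]
      vdual_map_compose[OF f_kap(2,3)[OF W] f_kap(3)[OF V] f_kap(1)[OF W] fr' \<xi>] e V W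
    by (simp add: dual_comparison_def DA_simps DP_simps)
qed (simp add: dual_comparison_def)

lemma dual_comparison_iso:
  "lc_iso (PC n) (jstar_ob n (DA n f)) (DP n (jstar_ob n f)) (dual_comparison f)"
proof (rule nat_iso[OF jstar_ob_linear[OF DA_linear[OF f]] DP_linear[OF jstar_ob_linear[OF f]] dual_comparison_closed])
  fix V :: "('k, 'u) module" assume "V \<in> Obj (Gam n)"
  then have V: "fdvs V" by simp
  have "bij_betw (mo f (TR n (vdual V)) (dual_rep n (TR n V)) (kap n V)) (carrier (ob f (TR n (vdual V)))) (carrier (ob f (dual_rep n (TR n V))))"
    by (rule RD.LF_bij[OF f _ _ kap_iso[OF V]]) (use V dual_rep_is_rep[OF TR_rep[OF V, of n]] in simp_all)
  from vdual_map_bij[OF f_kap(2,3,1)[OF V] this]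
  show "bij_betw (dual_comparison f V) (carrier (ob (jstar_ob n (DA n f)) V)) (carrier (ob (DP n (jstar_ob n f)) V))"
    using V by (simp add: dual_comparison_def DA_simps DP_simps)
qed

end

lemma dual_comparison_natural:
  fixes f g :: "('k, 'u) aftor"
  assumes f: "linear_functor (Rep n) Vect f" and g: "linear_functor (Rep n) Vect g" and e: "\<eta> \<in> nat_trans (Rep n) Vect f g"
  shows "Cmp (PC n) (jstar_ob n (DA n g)) (jstar_ob n (DA n f)) (DP n (jstar_ob n f)) (dual_comparison f) (jstar_nt n (DA_map n f g \<eta>)) =
    Cmp (PC n) (jstar_ob n (DA n g)) (DP n (jstar_ob n g)) (DP n (jstar_ob n f))
      (DP_map n (jstar_ob n f) (jstar_ob n g) (jstar_nt n \<eta>)) (dual_comparison g)"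
proof -
  note L = jstar_ob_linear[OF DA_linear[OF f]] jstar_ob_linear[OF DA_linear[OF g]]
    DP_linear[OF jstar_ob_linear[OF f]] DP_linear[OF jstar_ob_linear[OF g]]
  have De: "DA_map n f g \<eta> \<in> nat_trans (Rep n) Vect (DA n g) (DA n f)"
    unfolding DA_def DA_map_def by (rule RD.dual_nt_closed[OF f g e])
  note Pe = DP_map_closed[OF jstar_ob_linear[OF f] jstar_ob_linear[OF g] jstar_nt_closed[OF e]]
  show ?thesis
  proof (rule nt_eqI[OF nt_cmp[OF L(2,1,3) jstar_nt_closed[OF De] dual_comparison_closed[OF f]]
      nt_cmp[OF L(2,4,3) dual_comparison_closed[OF g] Pe]])
    fix V :: "('k, 'u) module" and \<xi> assume oV: "V \<in> Obj (Gam n)" and x: "\<xi> \<in> carrier (ob (jstar_ob n (DA n g)) V)"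
    then have V: "fdvs V" and \<xi>: "\<xi> \<in> carrier (vdual (ob g (dual_rep n (TR n V))))" by (simp_all add: DA_simps)
    let ?V = "TR n (vdual V)" and ?V' = "dual_rep n (TR n V)"
    have o: "?V \<in> Obj (Rep n)" "?V' \<in> Obj (Rep n)" using V dual_rep_is_rep[OF TR_rep[OF V, of n]] by simp_all
    note kf = f_kap[OF f V] and kg = f_kap[OF g V]
    have eq: "compose (carrier (ob f ?V)) (\<eta> ?V') (mo f ?V ?V' (kap n V)) = compose (carrier (ob f ?V)) (mo g ?V ?V' (kap n V)) (\<eta> ?V)"
      using nt_natural[OF e o kap_mor[OF V]] by simp
    show "Cmp (PC n) (jstar_ob n (DA n g)) (jstar_ob n (DA n f)) (DP n (jstar_ob n f)) (dual_comparison f) (jstar_nt n (DA_map n f g \<eta>)) V \<xi> =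
      Cmp (PC n) (jstar_ob n (DA n g)) (DP n (jstar_ob n g)) (DP n (jstar_ob n f))
        (DP_map n (jstar_ob n f) (jstar_ob n g) (jstar_nt n \<eta>)) (dual_comparison g) V \<xi>"
      using oV x V eq vdual_map_compose[OF kf(2,3) kg(3) kf(1) nt_lin[OF e o(2)] \<xi>]
        vdual_map_compose[OF kf(2) kg(2,3) nt_lin[OF e o(1)] kg(1) \<xi>]
      by (simp add: dual_comparison_def DA_simps DP_simps)
  qed
qed

lemma jshriek_jstar_adjoint: "adjoint (PC n) (AC n) (jshriek n) (jstar n)"
proof -
  obtain up where P: "duality (PC n) (DP n) (DP_map n) up" using DP_duality by blast
  obtain ua where A: "duality (AC n) (DA n) (DA_map n) ua" using DA_duality by blast
  have "adjoint (PC n) (AC n) \<lparr> ob = (\<lambda>F. DA n (ob (jlow n) (DP n F))),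
     mo = (\<lambda>F G \<alpha>. DA_map n (ob (jlow n) (DP n G)) (ob (jlow n) (DP n F)) (mo (jlow n) (DP n G) (DP n F) (DP_map n F G \<alpha>))) \<rparr> (jstar n)"
    by (rule adjoint_by_duality[OF A P jstar_jlow_adjoint, of dual_comparison])
      (simp_all add: jstar_def dual_comparison_iso dual_comparison_natural)
  then show ?thesis by (simp add: jshriek_def)
qed

end

end

section \<open>Tensor products and coinvariants\<close>

lemma bilinearD:
  assumes "bilinear X Y W b"
  shows "x \<in> carrier X \<Longrightarrow> b x \<in> lhom Y W" "y \<in> carrier Y \<Longrightarrow> (\<lambda>x. b x y) \<in> lhom X W"
  using assms by (auto simp: bilinear_def)

lemma bilinear_compose: "bilinear X Y W b \<Longrightarrow> f \<in> lhom W Z \<Longrightarrow> bilinear X Y Z (\<lambda>x y. f (b x y))"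
  unfolding bilinear_def by (auto intro: lhom_compose)

lemma bilinear_ext:
  assumes X: "bas X I b c" and Y: "bas Y K b' c'" and W: "vs W" and m: "bilinear X Y W m" "bilinear X Y W m'"
    and eq: "\<And>i k. i \<in> I \<Longrightarrow> k \<in> K \<Longrightarrow> m (b i) (b' k) = m' (b i) (b' k)" and x: "x \<in> carrier X" and y: "y \<in> carrier Y"
  shows "m x y = m' x y"
proof (rule bas_ext[OF X bilinearD(2)[OF m(1) y] bilinearD(2)[OF m(2) y] W _ x])
  fix i assume i: "i \<in> I"
  note bi = basD(3)[OF X i]
  show "m (b i) y = m' (b i) y"
    by (rule bas_ext[OF Y bilinearD(1)[OF m(1) bi] bilinearD(1)[OF m(2) bi] W eq[OF i] y])
qed

lemma tensor_product_universal:
  assumes X: "bas X I b c" and Y: "bas Y K b' c'" and t: "bilinear X Y T t"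
    and T: "bas T (I \<times> K) (\<lambda>(i, k). t (b i) (b' k)) C" and W: "vs W" and m: "bilinear X Y W m"
  shows "\<exists>!f. f \<in> lin T W \<and> (\<forall>x\<in>carrier X. \<forall>y\<in>carrier Y. f (t x y) = m x y)"
proof -
  have bX: "i \<in> I \<Longrightarrow> b i \<in> carrier X" and bY: "k \<in> K \<Longrightarrow> b' k \<in> carrier Y" for i k
    using basD(3)[OF X] basD(3)[OF Y] by auto
  have "\<exists>f\<in>lin T W. \<forall>ik\<in>I \<times> K. f ((\<lambda>(i, k). t (b i) (b' k)) ik) = (\<lambda>(i, k). m (b i) (b' k)) ik"
    by (rule bas_lin_ex[OF T W]) (use bX bY lhom_closed[OF bilinearD(1)[OF m]] in auto)
  then obtain f where f: "f \<in> lin T W" "\<And>i k. i \<in> I \<Longrightarrow> k \<in> K \<Longrightarrow> f (t (b i) (b' k)) = m (b i) (b' k)" by auto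
  show ?thesis
  proof (rule ex1I[of _ f], intro conjI ballI)
    show "f (t x y) = m x y" if "x \<in> carrier X" "y \<in> carrier Y" for x y
      by (rule bilinear_ext[OF X Y W bilinear_compose[OF t lin_lhom[OF f(1)]] m f(2) that])
    show "g = f" if g: "g \<in> lin T W \<and> (\<forall>x\<in>carrier X. \<forall>y\<in>carrier Y. g (t x y) = m x y)" for g
    proof (rule lin_eqI[of _ T W _ W])
      show "g x = f x" if "x \<in> carrier T" for x
        by (rule bas_ext[OF T, of _ W]) (use g f W bX bY that in \<open>auto simp: lin_lhom\<close>)
    qed (use f g in auto)
  qed (rule f)
qed

lemma tensor_product_model:
  fixes X Y :: "('k::field, 'a) module"
  assumes X: "bas X I b c" and Y: "bas Y K b' c'"
  defines "T \<equiv> prod_space (I \<times> K) (\<lambda>_. scalars :: ('k, 'k) module)"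
  defines "t \<equiv> \<lambda>x y. \<lambda>(i, k)\<in>I \<times> K. c i x * c' k y"
  shows "bilinear X Y T t" "bas T (I \<times> K) (\<lambda>(i, k). t (b i) (b' k)) (\<lambda>ik f. f ik)"
proof -
  note BX = basD[OF X] and BY = basD[OF Y]
  have fin: "finite (I \<times> K)" using BX BY by simp
  note sX = lhom_simps[OF BX(4)] and sY = lhom_simps[OF BY(4)]
  show "bilinear X Y T t"
    unfolding bilinear_def
  proof (intro conjI ballI)
    fix x show "x \<in> carrier X \<Longrightarrow> t x \<in> lhom Y T"
      by (rule lhomI) (auto simp: T_def t_def prod_space_def sY algebra_simps intro!: restrict_ext)
  next
    fix y show "y \<in> carrier Y \<Longrightarrow> (\<lambda>x. t x y) \<in> lhom X T"
      by (rule lhomI) (auto simp: T_def t_def prod_space_def sX algebra_simps intro!: restrict_ext)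
  qed
  have "(\<lambda>(i, k). t (b i) (b' k)) ik = (\<lambda>j\<in>I \<times> K. if ik = j then 1 else 0)" if "ik \<in> I \<times> K" for ik
    unfolding t_def using that BX(5) BY(5) by (auto intro!: restrict_ext)
  then show "bas T (I \<times> K) (\<lambda>(i, k). t (b i) (b' k)) (\<lambda>ik f. f ik)"
    using bas_prod_space[OF fin] unfolding T_def bas_def by simp
qed

lemma bas_iso:
  assumes B: "bas X I b c" and g: "g \<in> lhom X T" "bij_betw g (carrier X) (carrier T)" and T: "vs T"
  shows "\<exists>C. bas T I (\<lambda>i. g (b i)) C"
proof -
  note B' = basD[OF B]
  let ?h = "inv_into (carrier X) g"
  have h: "?h \<in> lhom T X" by (rule lhom_inv[OF g B'(2)])
  have hg: "?h (g x) = x" if "x \<in> carrier X" for x using g(2) that by (auto simp: bij_betw_def)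
  have gh: "g (?h y) = y" if "y \<in> carrier T" for y using g(2) that by (auto simp: bij_betw_def f_inv_into_f)
  have "bas T I (\<lambda>i. g (b i)) (\<lambda>i y. c i (?h y))"
    unfolding bas_def
  proof (intro conjI ballI impI T B'(1))
    fix y assume y: "y \<in> carrier T" "\<forall>i\<in>I. c i (?h y) = 0"
    have "?h y = \<zero>\<^bsub>X\<^esub>" by (rule B'(6)) (use y lhom_closed[OF h] in auto)
    then show "y = \<zero>\<^bsub>T\<^esub>" using gh[OF y(1)] lhom_zero[OF g(1) B'(2) T] by simp
  qed (use B' hg lhom_closed[OF g(1)] in \<open>auto intro: lhom_compose[OF h]\<close>)
  then show ?thesis by blast
qed

context univ
begin

lemma tensor_product_exists:
  fixes X Y :: "('k, 'u) module"
  assumes X: "fdvs X" and Y: "fdvs Y"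
  shows "\<exists>(S :: ('k, 'u) module) t. is_tensor_product X Y S t"
proof -
  obtain d b c d' b' c' where B: "bas X {..<d::nat} b c" "bas Y {..<d'::nat} b' c'"
    using fdvs_bas[OF X] fdvs_bas[OF Y] by blast
  note M = tensor_product_model[OF B]
  let ?I = "{..<d} \<times> {..<d'}"
  let ?T = "prod_space ?I (\<lambda>_. scalars :: ('k, 'k) module)"
  let ?t = "\<lambda>x y. \<lambda>(i, k)\<in>?I. c i x * c' k y"
  have fd: "fdvs ?T" using bas_fdvs[OF M(2)] .
  let ?S = "small ?T :: ('k, 'u) module"
  have mS: "bilinear X Y ?S (\<lambda>x y. enc ?T (?t x y))" by (rule bilinear_compose[OF M(1) enc_lhom[OF fd]])
  obtain C where "bas ?S ?I (\<lambda>ik. enc ?T ((\<lambda>(i, k). ?t (b i) (b' k)) ik)) C"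
    using bas_iso[OF M(2) enc_lhom[OF fd] enc_bij[OF fd] fdvs_vs[OF fdvs_small[OF fd]]] by blast
  moreover have "(\<lambda>ik. enc ?T ((\<lambda>(i, k). ?t (b i) (b' k)) ik) :: 'u) = (\<lambda>(i, k). enc ?T (?t (b i) (b' k)))"
    by (rule ext) (simp add: split_beta)
  ultimately have bS: "bas ?S ?I (\<lambda>(i, k). enc ?T (?t (b i) (b' k))) C" by simp
  have "is_tensor_product X Y ?S (\<lambda>x y. enc ?T (?t x y))"
    unfolding is_tensor_product_def
    by (intro conjI allI impI fdvs_small[OF fd] mS tensor_product_universal[OF B mS bS]) auto
  then show ?thesis by blast
qed

context
  fixes X Y :: "('k, 'u) module"
  assumes X: "fdvs X" and Y: "fdvs Y"
begin

lemma tens_is_tensor_product: "is_tensor_product X Y (tens X Y) (tens_elem X Y)"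
proof -
  have "\<exists>p. case p of (S :: ('k, 'u) module, t) \<Rightarrow> is_tensor_product X Y S t"
    using tensor_product_exists[OF X Y] by auto
  from someI_ex[OF this] show ?thesis
    by (simp add: tens_def tens_elem_def tensor_product_def case_prod_unfold)
qed

lemma fdvs_tens [simp]: "fdvs (tens X Y)"
  and tens_bilinear: "bilinear X Y (tens X Y) (tens_elem X Y)"
  using tens_is_tensor_product by (auto simp: is_tensor_product_def)

lemma tens_elem_closed [simp]: "x \<in> carrier X \<Longrightarrow> y \<in> carrier Y \<Longrightarrow> tens_elem X Y x y \<in> carrier (tens X Y)"
  by (rule lhom_closed[OF bilinearD(1)[OF tens_bilinear]])

text \<open>As for tensor powers, the defining universal property concerns targets inside the
  universe. The chosen product is compared with the space of functions on pairs of indices by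
  \<open>g\<close> and \<open>k\<close>, and maps to an arbitrary target are transported along this
  comparison.\<close>

lemma tens_ex1:
  fixes W :: "('k, 'c) module"
  assumes W: "vs W" and m: "bilinear X Y W m"
  shows "\<exists>!f. f \<in> lin (tens X Y) W \<and> (\<forall>x\<in>carrier X. \<forall>y\<in>carrier Y. f (tens_elem X Y x y) = m x y)"
proof -
  obtain d b c d' b' c' where B: "bas X {..<d::nat} b c" "bas Y {..<d'::nat} b' c'"
    using fdvs_bas[OF X] fdvs_bas[OF Y] by blast
  note M = tensor_product_model[OF B]
  let ?I = "{..<d} \<times> {..<d'}"
  let ?T = "prod_space ?I (\<lambda>_. scalars :: ('k, 'k) module)"
  let ?t = "\<lambda>x y. \<lambda>(i, k)\<in>?I. c i x * c' k y"
  have fd: "fdvs ?T" using bas_fdvs[OF M(2)] .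
  have mt: "bilinear X Y (tens X Y) (tens_elem X Y)" and ft: "fdvs (tens X Y)"
    and uT: "\<And>(W :: ('k, 'u) module) m. vs W \<Longrightarrow> bilinear X Y W m \<Longrightarrow>
      \<exists>!f. f \<in> lin (tens X Y) W \<and> (\<forall>x\<in>carrier X. \<forall>y\<in>carrier Y. f (tens_elem X Y x y) = m x y)"
    using tens_is_tensor_product by (auto simp: is_tensor_product_def)
  obtain h where h: "h \<in> lin (tens X Y) (small ?T :: ('k, 'u) module)"
    "\<forall>x\<in>carrier X. \<forall>y\<in>carrier Y. h (tens_elem X Y x y) = enc ?T (?t x y)"
    using ex1_implies_ex[OF uT[OF fdvs_vs[OF fdvs_small[OF fd]] bilinear_compose[OF M(1) enc_lhom[OF fd]]]] by blast
  obtain k where k: "k \<in> lin ?T (tens X Y)" "\<forall>x\<in>carrier X. \<forall>y\<in>carrier Y. k (?t x y) = tens_elem X Y x y"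
    using ex1_implies_ex[OF tensor_product_universal[OF B M fdvs_vs[OF ft] mt]] by blast
  define g where "g x = dec ?T (h x)" for x
  have g: "g \<in> lhom (tens X Y) ?T" unfolding g_def by (rule lhom_compose[OF lin_lhom[OF h(1)] dec_lhom[OF fd]])
  have tT: "?t x y \<in> carrier ?T" if "x \<in> carrier X" "y \<in> carrier Y" for x y
    using lhom_closed[OF bilinearD(1)[OF M(1) that(1)] that(2)] by simp
  have gt: "g (tens_elem X Y x y) = ?t x y" if "x \<in> carrier X" "y \<in> carrier Y" for x y
    using h(2) that dec_enc[OF fd tT[OF that]] by (simp add: g_def)
  have kg: "k (g z) = z" if z: "z \<in> carrier (tens X Y)" for z
  proof -
    have 1: "(\<lambda>z\<in>carrier (tens X Y). k (g z)) \<in> lin (tens X Y) (tens X Y)" "(\<lambda>z\<in>carrier (tens X Y). z) \<in> lin (tens X Y) (tens X Y)"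
      using lin_restrict[OF lhom_compose[OF g lin_lhom[OF k(1)]] fdvs_vs[OF ft]] lin_id[OF fdvs_vs[OF ft]] by auto
    have 2: "\<forall>x\<in>carrier X. \<forall>y\<in>carrier Y. (\<lambda>z\<in>carrier (tens X Y). k (g z)) (tens_elem X Y x y) = tens_elem X Y x y"
      "\<forall>x\<in>carrier X. \<forall>y\<in>carrier Y. (\<lambda>z\<in>carrier (tens X Y). z) (tens_elem X Y x y) = tens_elem X Y x y"
      using gt k(2) by simp_all
    have "(\<lambda>z\<in>carrier (tens X Y). k (g z)) = (\<lambda>z\<in>carrier (tens X Y). z)"
      using uT[OF fdvs_vs[OF ft] mt] 1 2 by blast
    then show ?thesis using z by (metis restrict_apply')
  qed
  obtain f where f: "f \<in> lin ?T W" "\<forall>x\<in>carrier X. \<forall>y\<in>carrier Y. f (?t x y) = m x y"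
    and fu: "\<And>f'. f' \<in> lin ?T W \<and> (\<forall>x\<in>carrier X. \<forall>y\<in>carrier Y. f' (?t x y) = m x y) \<Longrightarrow> f' = f"
    using tensor_product_universal[OF B M W m] by blast
  show ?thesis
  proof (rule ex1I[of _ "\<lambda>z\<in>carrier (tens X Y). f (g z)"])
    show "(\<lambda>z\<in>carrier (tens X Y). f (g z)) \<in> lin (tens X Y) W \<and>
      (\<forall>x\<in>carrier X. \<forall>y\<in>carrier Y. (\<lambda>z\<in>carrier (tens X Y). f (g z)) (tens_elem X Y x y) = m x y)"
      using lin_restrict[OF lhom_compose[OF g lin_lhom[OF f(1)]] fdvs_vs[OF ft]] gt f(2) by simp
    fix f' assume f': "f' \<in> lin (tens X Y) W \<and> (\<forall>x\<in>carrier X. \<forall>y\<in>carrier Y. f' (tens_elem X Y x y) = m x y)"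
    have eqf: "(\<lambda>w\<in>carrier ?T. f' (k w)) = f"
    proof (rule fu, intro conjI ballI)
      show "(\<lambda>w\<in>carrier ?T. f' (k w)) \<in> lin ?T W"
        by (rule lin_restrict[OF lhom_compose[OF lin_lhom[OF k(1)] lin_lhom]]) (use f' fd in auto)
      show "(\<lambda>w\<in>carrier ?T. f' (k w)) (?t x y) = m x y" if "x \<in> carrier X" "y \<in> carrier Y" for x y
        using that f' k(2) tT[OF that] by simp
    qed
    have "f (g z) = f' (k (g z))" if "z \<in> carrier (tens X Y)" for z
      using fun_cong[OF eqf, of "g z"] lhom_closed[OF g that] by simp
    then show "f' = (\<lambda>z\<in>carrier (tens X Y). f (g z))"
      using kg f' by (intro lin_eqI[of f' "tens X Y" W _ W]) (auto intro!: lin_restrict[OF lhom_compose[OF g lin_lhom[OF f(1)]] fdvs_vs[OF ft]])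
  qed
qed

lemma tens_ext:
  fixes W :: "('k, 'c) module"
  assumes W: "vs W" and f: "f \<in> lhom (tens X Y) W" and g: "g \<in> lhom (tens X Y) W"
    and eq: "\<And>x y. x \<in> carrier X \<Longrightarrow> y \<in> carrier Y \<Longrightarrow> f (tens_elem X Y x y) = g (tens_elem X Y x y)" and z: "z \<in> carrier (tens X Y)"
  shows "f z = g z"
proof -
  have vt: "vs (tens X Y)" by simp
  have 1: "restrict f (carrier (tens X Y)) \<in> lin (tens X Y) W" "restrict g (carrier (tens X Y)) \<in> lin (tens X Y) W"
    using lin_restrict[OF f vt] lin_restrict[OF g vt] by auto
  have 2: "\<forall>x\<in>carrier X. \<forall>y\<in>carrier Y. restrict f (carrier (tens X Y)) (tens_elem X Y x y) = f (tens_elem X Y x y)"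
    "\<forall>x\<in>carrier X. \<forall>y\<in>carrier Y. restrict g (carrier (tens X Y)) (tens_elem X Y x y) = f (tens_elem X Y x y)"
    using eq by simp_all
  have "restrict f (carrier (tens X Y)) = restrict g (carrier (tens X Y))"
    using tens_ex1[OF W bilinear_compose[OF tens_bilinear f]] 1 2 by blast
  then show ?thesis using z by (metis restrict_apply')
qed

end

lemma tens_map_facts:
  fixes X Y X' Y' :: "('k, 'u) module"
  assumes o: "fdvs X" "fdvs Y" "fdvs X'" "fdvs Y'" and f: "f \<in> lhom X X'" and g: "g \<in> lhom Y Y'"
  shows tens_map_lin: "tens_map X Y X' Y' f g \<in> lin (tens X Y) (tens X' Y')"
    and tens_map_elem: "x \<in> carrier X \<Longrightarrow> y \<in> carrier Y \<Longrightarrow>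
      tens_map X Y X' Y' f g (tens_elem X Y x y) = tens_elem X' Y' (f x) (g y)"
proof -
  have "bilinear X Y (tens X' Y') (\<lambda>x y. tens_elem X' Y' (f x) (g y))"
    unfolding bilinear_def
    using lhom_compose[OF g bilinearD(1)[OF tens_bilinear[OF o(3,4)] lhom_closed[OF f]]]
      lhom_compose[OF f bilinearD(2)[OF tens_bilinear[OF o(3,4)] lhom_closed[OF g]]] by simp
  from theI'[OF tens_ex1[OF o(1,2) _ this]] o
  show "tens_map X Y X' Y' f g \<in> lin (tens X Y) (tens X' Y')"
    "x \<in> carrier X \<Longrightarrow> y \<in> carrier Y \<Longrightarrow> tens_map X Y X' Y' f g (tens_elem X Y x y) = tens_elem X' Y' (f x) (g y)"
    by (simp_all add: tens_map_def)
qed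

end

section \<open>Quotient spaces\<close>

lemma coset_iff:
  assumes "vs V" "D \<subseteq> carrier V"
  shows "D +>\<^bsub>V\<^esub> x = {d \<oplus>\<^bsub>V\<^esub> x | d. d \<in> D}"
  by (auto simp: a_r_coset_def r_coset_def)

lemma set_add_iff: "set_add V A B = {a \<oplus>\<^bsub>V\<^esub> b | a b. a \<in> A \<and> b \<in> B}"
  by (auto simp: set_add_def set_mult_def)

locale subsp =
  fixes V :: "('k::field, 'a) module" and D
  assumes V: "vs V" and sub: "D \<subseteq> carrier V" and zero: "\<zero>\<^bsub>V\<^esub> \<in> D"
    and add: "x \<in> D \<Longrightarrow> y \<in> D \<Longrightarrow> x \<oplus>\<^bsub>V\<^esub> y \<in> D" and smult: "x \<in> D \<Longrightarrow> r \<odot>\<^bsub>V\<^esub> x \<in> D"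
begin

abbreviation \<pi> :: "'a \<Rightarrow> 'a set" where "\<pi> x \<equiv> D +>\<^bsub>V\<^esub> x"

lemma coset_eq: "\<pi> x = {d \<oplus>\<^bsub>V\<^esub> x | d. d \<in> D}"
  by (rule coset_iff[OF V sub])

lemma coset_self: "x \<in> carrier V \<Longrightarrow> x \<in> \<pi> x"
  unfolding coset_eq using zero V by (auto intro!: exI[of _ "\<zero>\<^bsub>V\<^esub>"])

text \<open>The set-theoretic formula, the subspace added to the image of a coset, computes the
  induced map on cosets. Besides the maps in \<open>tensS_map\<close> it covers scalar
  multiplication in \<open>quotient_space\<close>, with multiplication by a scalar as
  \<open>h\<close>.\<close>

lemma coset_map:
  assumes V': "subsp V' D'" and h: "h \<in> lhom V V'" "\<And>d. d \<in> D \<Longrightarrow> h d \<in> D'" and x: "x \<in> carrier V"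
  shows "set_add V' D' (h ` \<pi> x) = D' +>\<^bsub>V'\<^esub> h x"
proof -
  interpret S: subsp V' D' by (rule V')
  have hx: "h x \<in> carrier V'" by (rule lhom_closed[OF h(1) x])
  have 1: "d' \<oplus>\<^bsub>V'\<^esub> h (d \<oplus>\<^bsub>V\<^esub> x) = (d' \<oplus>\<^bsub>V'\<^esub> h d) \<oplus>\<^bsub>V'\<^esub> h x" if "d \<in> D" "d' \<in> D'" for d d'
  proof -
    have D: "d \<in> carrier V" "d' \<in> carrier V'" using sub S.sub that by auto
    show ?thesis using D x hx S.V lhom_closed[OF h(1) D(1)] by (simp add: lhom_add[OF h(1)] vs_assoc)
  qed
  show ?thesis
  proof (intro equalityI subsetI)
    fix z assume "z \<in> set_add V' D' (h ` \<pi> x)"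
    then obtain d d' where d: "d \<in> D" "d' \<in> D'" "z = d' \<oplus>\<^bsub>V'\<^esub> h (d \<oplus>\<^bsub>V\<^esub> x)" unfolding set_add_iff coset_eq by blast
    then show "z \<in> D' +>\<^bsub>V'\<^esub> h x" unfolding S.coset_eq using 1[OF d(1,2)] S.add[OF d(2) h(2)[OF d(1)]] by blast
  next
    fix z assume "z \<in> D' +>\<^bsub>V'\<^esub> h x"
    then obtain d' where d: "d' \<in> D'" "z = d' \<oplus>\<^bsub>V'\<^esub> h x" unfolding S.coset_eq by blast
    moreover have "h x \<in> h ` \<pi> x" by (rule imageI[OF coset_self[OF x]])
    ultimately show "z \<in> set_add V' D' (h ` \<pi> x)" unfolding set_add_iff by blast
  qed
qed

lemma coset_add:
  assumes x: "x \<in> carrier V" and y: "y \<in> carrier V"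
  shows "set_add V (\<pi> x) (\<pi> y) = \<pi> (x \<oplus>\<^bsub>V\<^esub> y)"
proof -
  have 1: "(d \<oplus>\<^bsub>V\<^esub> x) \<oplus>\<^bsub>V\<^esub> (d' \<oplus>\<^bsub>V\<^esub> y) = (d \<oplus>\<^bsub>V\<^esub> d') \<oplus>\<^bsub>V\<^esub> (x \<oplus>\<^bsub>V\<^esub> y)" if "d \<in> D" "d' \<in> D" for d d'
  proof -
    have D: "d \<in> carrier V" "d' \<in> carrier V" using sub that by auto
    show ?thesis using D x y V by (simp add: vs_ac)
  qed
  show ?thesis
  proof (intro equalityI subsetI)
    fix z assume "z \<in> set_add V (\<pi> x) (\<pi> y)"
    then obtain d d' where d: "d \<in> D" "d' \<in> D" "z = (d \<oplus>\<^bsub>V\<^esub> x) \<oplus>\<^bsub>V\<^esub> (d' \<oplus>\<^bsub>V\<^esub> y)" unfolding set_add_iff coset_eq by blast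
    then show "z \<in> \<pi> (x \<oplus>\<^bsub>V\<^esub> y)" unfolding coset_eq using 1[OF d(1,2)] add[OF d(1,2)] by blast
  next
    fix z assume "z \<in> \<pi> (x \<oplus>\<^bsub>V\<^esub> y)"
    then obtain d where d: "d \<in> D" "z = d \<oplus>\<^bsub>V\<^esub> (x \<oplus>\<^bsub>V\<^esub> y)" unfolding coset_eq by blast
    moreover have "d \<oplus>\<^bsub>V\<^esub> (x \<oplus>\<^bsub>V\<^esub> y) = (d \<oplus>\<^bsub>V\<^esub> x) \<oplus>\<^bsub>V\<^esub> y" using d(1) sub x y V by (auto simp: vs_assoc subset_iff)
    moreover have "d \<oplus>\<^bsub>V\<^esub> x \<in> \<pi> x" using d(1) unfolding coset_eq by blast
    ultimately show "z \<in> set_add V (\<pi> x) (\<pi> y)" unfolding set_add_iff using coset_self[OF y] by blast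
  qed
qed

lemma quotient_simps [simp]:
  "carrier (quotient_space V D) = \<pi> ` carrier V"
  "\<zero>\<^bsub>quotient_space V D\<^esub> = D"
  "A \<oplus>\<^bsub>quotient_space V D\<^esub> B = set_add V A B"
  "c \<odot>\<^bsub>quotient_space V D\<^esub> A = set_add V D ((\<lambda>x. c \<odot>\<^bsub>V\<^esub> x) ` A)"
  by (auto simp: quotient_space_def A_RCOSETS_def')

lemma self: "subsp V D" by unfold_locales

lemma coset_smult:
  assumes "x \<in> carrier V"
  shows "set_add V D ((\<lambda>x. c \<odot>\<^bsub>V\<^esub> x) ` \<pi> x) = \<pi> (c \<odot>\<^bsub>V\<^esub> x)"
  by (rule coset_map[OF self lhom_scale[OF lhom_id V V, of c]]) (use assms smult in auto)

lemma coset_zero: "\<pi> \<zero>\<^bsub>V\<^esub> = D"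
  unfolding coset_eq using V sub by (auto simp: subset_iff) (metis vs_add0)

lemma coset_eq_iff:
  assumes x: "x \<in> carrier V" and y: "y \<in> carrier V"
  shows "\<pi> x = \<pi> y \<longleftrightarrow> x \<oplus>\<^bsub>V\<^esub> (-1) \<odot>\<^bsub>V\<^esub> y \<in> D"
proof
  assume "\<pi> x = \<pi> y"
  moreover have "x \<in> \<pi> x" by (rule coset_self[OF x])
  ultimately obtain d where d: "d \<in> D" "x = d \<oplus>\<^bsub>V\<^esub> y" unfolding coset_eq by blast
  then show "x \<oplus>\<^bsub>V\<^esub> (-1) \<odot>\<^bsub>V\<^esub> y \<in> D" using sub x y V by (auto simp: vs_assoc vs_cancel subset_iff)
next
  assume m: "x \<oplus>\<^bsub>V\<^esub> (-1) \<odot>\<^bsub>V\<^esub> y \<in> D"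
  have "\<pi> x = \<pi> ((x \<oplus>\<^bsub>V\<^esub> (-1) \<odot>\<^bsub>V\<^esub> y) \<oplus>\<^bsub>V\<^esub> y)"
    using x y V vs_cancel[OF V y] by (simp add: vs_assoc vs_comm[of V _ y])
  also have "\<dots> = set_add V (\<pi> (x \<oplus>\<^bsub>V\<^esub> (-1) \<odot>\<^bsub>V\<^esub> y)) (\<pi> y)" by (rule coset_add[symmetric]) (use x y V in auto)
  also have "\<pi> (x \<oplus>\<^bsub>V\<^esub> (-1) \<odot>\<^bsub>V\<^esub> y) = \<pi> \<zero>\<^bsub>V\<^esub>"
  proof -
    have D: "d \<in> carrier V" if "d \<in> D" for d using sub that by auto
    have "d = (d \<oplus>\<^bsub>V\<^esub> (-1) \<odot>\<^bsub>V\<^esub> (x \<oplus>\<^bsub>V\<^esub> (-1) \<odot>\<^bsub>V\<^esub> y)) \<oplus>\<^bsub>V\<^esub> (x \<oplus>\<^bsub>V\<^esub> (-1) \<odot>\<^bsub>V\<^esub> y)" if "d \<in> D" for d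
      using D[OF that] D[OF m] V vs_cancel[OF V D[OF m]] by (simp add: vs_assoc vs_comm[of V "(-1) \<odot>\<^bsub>V\<^esub> _"])
    then show ?thesis unfolding coset_zero unfolding coset_eq using m add smult by blast
  qed
  also have "set_add V (\<pi> \<zero>\<^bsub>V\<^esub>) (\<pi> y) = \<pi> y" using coset_add[of "\<zero>\<^bsub>V\<^esub>" y] y V by simp
  finally show "\<pi> x = \<pi> y" .
qed

lemma vs_quotient: "vs (quotient_space V D)"
proof (rule vsI, unfold quotient_simps)
  have z: "\<zero>\<^bsub>V\<^esub> \<in> carrier V" using V by simp
  show "D \<in> \<pi> ` carrier V" using imageI[OF z, of \<pi>] coset_zero by simp
  fix A assume "A \<in> \<pi> ` carrier V"
  then obtain x where x: "x \<in> carrier V" "A = \<pi> x" by blast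
  show "set_add V A D = A" using coset_add[OF x(1) z] x V by (simp add: coset_zero)
  show "set_add V D ((\<lambda>x. c \<odot>\<^bsub>V\<^esub> x) ` A) \<in> \<pi> ` carrier V" for c
    using x V by (simp add: coset_smult)
  show "set_add V D ((\<lambda>x. 0 \<odot>\<^bsub>V\<^esub> x) ` A) = D" "set_add V D ((\<lambda>x. 1 \<odot>\<^bsub>V\<^esub> x) ` A) = A"
    unfolding x(2) coset_smult[OF x(1)] using x V by (simp_all add: coset_zero)
  have s: "c \<odot>\<^bsub>V\<^esub> x \<in> carrier V" for c using x V by simp
  show "set_add V D ((\<lambda>x. (r + s) \<odot>\<^bsub>V\<^esub> x) ` A) =
      set_add V (set_add V D ((\<lambda>x. r \<odot>\<^bsub>V\<^esub> x) ` A)) (set_add V D ((\<lambda>x. s \<odot>\<^bsub>V\<^esub> x) ` A))" for r s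
    unfolding x(2) coset_smult[OF x(1)] coset_add[OF s s] using x V by (simp add: vs_distl)
  show "set_add V D ((\<lambda>x. (r * s) \<odot>\<^bsub>V\<^esub> x) ` A) =
      set_add V D ((\<lambda>x. r \<odot>\<^bsub>V\<^esub> x) ` set_add V D ((\<lambda>x. s \<odot>\<^bsub>V\<^esub> x) ` A))" for r s
    unfolding x(2) coset_smult[OF x(1)] coset_smult[OF s] using x V by (simp add: vs_smult_smult)
  fix B assume "B \<in> \<pi> ` carrier V"
  then obtain y where y: "y \<in> carrier V" "B = \<pi> y" by blast
  have xy: "x \<oplus>\<^bsub>V\<^esub> y \<in> carrier V" using x y V by simp
  show "set_add V A B \<in> \<pi> ` carrier V" "set_add V A B = set_add V B A"
    unfolding x(2) y(2) coset_add[OF x(1) y(1)] coset_add[OF y(1) x(1)] using xy x y V by (simp_all add: vs_comm)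
  have s': "c \<odot>\<^bsub>V\<^esub> y \<in> carrier V" for c using y V by simp
  show "set_add V D ((\<lambda>x. r \<odot>\<^bsub>V\<^esub> x) ` set_add V A B) =
      set_add V (set_add V D ((\<lambda>x. r \<odot>\<^bsub>V\<^esub> x) ` A)) (set_add V D ((\<lambda>x. r \<odot>\<^bsub>V\<^esub> x) ` B))" for r
    unfolding x(2) y(2) coset_add[OF x(1) y(1)] coset_smult[OF xy] coset_smult[OF x(1)] coset_smult[OF y(1)] coset_add[OF s s']
    using x y V by (simp add: vs_distr)
  fix C assume "C \<in> \<pi> ` carrier V"
  then obtain z where z: "z \<in> carrier V" "C = \<pi> z" by blast
  have yz: "y \<oplus>\<^bsub>V\<^esub> z \<in> carrier V" using y z V by simp
  show "set_add V (set_add V A B) C = set_add V A (set_add V B C)"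
    unfolding x(2) y(2) z(2) coset_add[OF x(1) y(1)] coset_add[OF y(1) z(1)] coset_add[OF xy z(1)] coset_add[OF x(1) yz]
    using x y z V by (simp add: vs_assoc)
qed

lemma proj_lhom: "\<pi> \<in> lhom V (quotient_space V D)"
  by (rule lhomI) (simp_all add: coset_add coset_smult)

lemma fdvs_quotient: "fdvs V \<Longrightarrow> fdvs (quotient_space V D)"
  by (rule fdvs_surj[OF _ vs_quotient proj_lhom]) auto

text \<open>The lift is the value of \<open>f\<close> at a chosen representative; two
  representatives differ by an element of \<open>D\<close>, which \<open>f\<close> kills.\<close>

lemma quotient_lift:
  assumes f: "f \<in> lhom V W" and W: "vs W" and D: "\<And>d. d \<in> D \<Longrightarrow> f d = \<zero>\<^bsub>W\<^esub>"
  shows "\<exists>g\<in>lhom (quotient_space V D) W. \<forall>x\<in>carrier V. g (\<pi> x) = f x"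
proof -
  define g where "g A = f (SOME x. x \<in> carrier V \<and> \<pi> x = A)" for A
  have g: "g (\<pi> x) = f x" if x: "x \<in> carrier V" for x
  proof -
    define y where "y = (SOME y. y \<in> carrier V \<and> \<pi> y = \<pi> x)"
    have y: "y \<in> carrier V" "\<pi> y = \<pi> x" using someI[of "\<lambda>y. y \<in> carrier V \<and> \<pi> y = \<pi> x" x] x by (auto simp: y_def)
    then have "f (y \<oplus>\<^bsub>V\<^esub> (-1) \<odot>\<^bsub>V\<^esub> x) = \<zero>\<^bsub>W\<^esub>" using coset_eq_iff[OF y(1) x] D by simp
    then have "f y = f x" using vs_eq_iff[OF W lhom_closed[OF f y(1)] lhom_closed[OF f x]] x y V by (simp add: lhom_simps[OF f])
    then show ?thesis by (simp add: g_def y_def)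
  qed
  have "g \<in> lhom (quotient_space V D) W"
    by (rule lhomI) (use g V in \<open>auto simp: coset_add coset_smult lhom_simps[OF f]\<close>)
  then show ?thesis using g by blast
qed

lemma coset_map_lhom:
  assumes V': "subsp V' D'" and h: "h \<in> lhom V V'" "\<And>d. d \<in> D \<Longrightarrow> h d \<in> D'"
  shows "(\<lambda>A. set_add V' D' (h ` A)) \<in> lhom (quotient_space V D) (quotient_space V' D')"
proof -
  interpret S: subsp V' D' by (rule V')
  have m: "set_add V' D' (h ` \<pi> x) = D' +>\<^bsub>V'\<^esub> h x" if "x \<in> carrier V" for x
    by (rule coset_map[OF V' h that])
  show ?thesis
  proof (rule lhomI)
    fix A assume "A \<in> carrier (quotient_space V D)"
    then obtain x where x: "x \<in> carrier V" "A = \<pi> x" by auto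
    have hx: "h x \<in> carrier V'" by (rule lhom_closed[OF h(1) x(1)])
    show "set_add V' D' (h ` A) \<in> carrier (quotient_space V' D')" using m[OF x(1)] hx x by simp
    show "set_add V' D' (h ` (r \<odot>\<^bsub>quotient_space V D\<^esub> A)) = r \<odot>\<^bsub>quotient_space V' D'\<^esub> set_add V' D' (h ` A)" for r
      unfolding quotient_simps S.quotient_simps x(2) coset_smult[OF x(1)] m[OF vs_smult[OF V x(1)]] m[OF x(1)] S.coset_smult[OF hx]
      by (simp add: lhom_smult[OF h(1) x(1)])
    fix B assume "B \<in> carrier (quotient_space V D)"
    then obtain y where y: "y \<in> carrier V" "B = \<pi> y" by auto
    have hy: "h y \<in> carrier V'" by (rule lhom_closed[OF h(1) y(1)])
    show "set_add V' D' (h ` (A \<oplus>\<^bsub>quotient_space V D\<^esub> B)) = set_add V' D' (h ` A) \<oplus>\<^bsub>quotient_space V' D'\<^esub> set_add V' D' (h ` B)"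
      unfolding quotient_simps S.quotient_simps x(2) y(2) coset_add[OF x(1) y(1)] m[OF vs_add[OF V x(1) y(1)]] m[OF x(1)] m[OF y(1)] S.coset_add[OF hx hy]
      by (simp add: lhom_add[OF h(1) x(1) y(1)])
  qed
qed

end

lemma subsp_submodule: "subsp V E \<Longrightarrow> LinearCombinations.submodule class_ring E V"
  by (rule LinearCombinations.submodule.intro)
    (simp_all add: vs_module subsp.V subsp.sub subsp.add subsp.zero subsp.smult)

lemma submodule_subsp:
  assumes V: "vs V" and E: "LinearCombinations.submodule class_ring E V"
  shows "subsp V E"
  by (rule subsp.intro) (use V LinearCombinations.submodule.subset[OF E] LinearCombinations.submodule.zero_closed[OF E]
    LinearCombinations.submodule.m_closed[OF E] LinearCombinations.submodule.smult_closed[OF E] in \<open>auto\<close>)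

lemma subsp_zero: "vs V \<Longrightarrow> subsp V {\<zero>\<^bsub>V\<^esub>}"
  by (rule subsp.intro) auto

lemma subsp_vimage:
  assumes E: "subsp W E" and h: "h \<in> lhom V W" and V: "vs V"
  shows "subsp V {x \<in> carrier V. h x \<in> E}"
  by (rule subsp.intro)
    (use V h subsp.add[OF E] subsp.smult[OF E] subsp.zero[OF E] lhom_zero[OF h V subsp.V[OF E]] in \<open>auto simp: lhom_simps[OF h]\<close>)

section \<open>Coinvariants of the diagonal action\<close>

context
  fixes n :: nat and M :: "('k::field, 'u) rep"
  assumes M: "is_rep n M"
begin

lemma coinv_kernel_eq: "coinv_kernel n M = LinearCombinations.module.span class_ring (rsp M)
     {act M s x \<oplus>\<^bsub>rsp M\<^esub> (-1) \<odot>\<^bsub>rsp M\<^esub> x | s x. s \<in> carrier (sym_group n) \<and> x \<in> carrier (rsp M)}"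
proof -
  have "{act M s x \<ominus>\<^bsub>rsp M\<^esub> x | s x. s \<in> carrier (sym_group n) \<and> x \<in> carrier (rsp M)} =
    {act M s x \<oplus>\<^bsub>rsp M\<^esub> (-1) \<odot>\<^bsub>rsp M\<^esub> x | s x. s \<in> carrier (sym_group n) \<and> x \<in> carrier (rsp M)}"
    by (intro Collect_cong ex_cong1) (auto simp: vs_minus[OF fdvs_vs[OF rep_fdvs[OF M]] act_closed[OF M]])
  then show ?thesis by (simp add: coinv_kernel_def)
qed

lemma coinv_kernel_generators:
  "{act M s x \<oplus>\<^bsub>rsp M\<^esub> (-1) \<odot>\<^bsub>rsp M\<^esub> x | s x. s \<in> carrier (sym_group n) \<and> x \<in> carrier (rsp M)} \<subseteq> carrier (rsp M)"
  using fdvs_vs[OF rep_fdvs[OF M]] act_closed[OF M] by auto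

lemma coinv_kernel_subsp: "subsp (rsp M) (coinv_kernel n M)"
  unfolding coinv_kernel_eq
  by (rule submodule_subsp[OF fdvs_vs[OF rep_fdvs[OF M]]
    LinearCombinations.module.span_is_submodule[OF vs_module[OF fdvs_vs[OF rep_fdvs[OF M]]] coinv_kernel_generators]])

lemma coinv_kernel_act:
  assumes "s \<in> carrier (sym_group n)" "x \<in> carrier (rsp M)"
  shows "act M s x \<oplus>\<^bsub>rsp M\<^esub> (-1) \<odot>\<^bsub>rsp M\<^esub> x \<in> coinv_kernel n M"
  unfolding coinv_kernel_eq
  using LinearCombinations.module.in_own_span[OF vs_module[OF fdvs_vs[OF rep_fdvs[OF M]]] coinv_kernel_generators] assms by blast

text \<open>The preimage of \<open>E\<close> is a subspace containing the generators, hence their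
  span. It is applied with \<open>E\<close> zero, for maps out of the coinvariants, and with
  \<open>E\<close> another such kernel, for maps between coinvariants.\<close>

lemma coinv_kernel_hom:
  assumes E: "subsp W E" and h: "h \<in> lhom (rsp M) W"
    and g: "\<And>s x. s \<in> carrier (sym_group n) \<Longrightarrow> x \<in> carrier (rsp M) \<Longrightarrow> h (act M s x) \<oplus>\<^bsub>W\<^esub> (-1) \<odot>\<^bsub>W\<^esub> h x \<in> E"
    and d: "d \<in> coinv_kernel n M"
  shows "h d \<in> E"
proof -
  note v = fdvs_vs[OF rep_fdvs[OF M]]
  have s: "{act M s x \<oplus>\<^bsub>rsp M\<^esub> (-1) \<odot>\<^bsub>rsp M\<^esub> x | s x. s \<in> carrier (sym_group n) \<and> x \<in> carrier (rsp M)} \<subseteq> {x \<in> carrier (rsp M). h x \<in> E}"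
    using v act_closed[OF M] g by (auto simp: lhom_simps[OF h])
  from LinearCombinations.module.span_is_subset[OF vs_module[OF v] s subsp_submodule[OF subsp_vimage[OF E h v]]] d
  show ?thesis by (auto simp: coinv_kernel_eq)
qed

end

context univ
begin

lemma tens_rep_simps [simp]:
  "rsp (tens_rep M N) = tens (rsp M) (rsp N)"
  "act (tens_rep M N) s = tens_map (rsp M) (rsp N) (rsp M) (rsp N) (act M s) (act N s)"
  by (simp_all add: tens_rep_def)

text \<open>The projection of the tensor product onto its coinvariants, with the class coded in the
  universe; \<open>tensS_elem\<close> is its value on a pure tensor.\<close>

definition tensS_class :: "nat \<Rightarrow> ('k, 'u) rep \<Rightarrow> ('k, 'u) rep \<Rightarrow> 'u \<Rightarrow> 'u" where
  "tensS_class n M N z = enc (coinvariants n (tens_rep M N)) (coinv_kernel n (tens_rep M N) +>\<^bsub>rsp (tens_rep M N)\<^esub> z)"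

definition tensS_elem :: "nat \<Rightarrow> ('k, 'u) rep \<Rightarrow> ('k, 'u) rep \<Rightarrow> 'u \<Rightarrow> 'u \<Rightarrow> 'u" where
  "tensS_elem n M N x y = tensS_class n M N (tens_elem (rsp M) (rsp N) x y)"

context
  fixes n :: nat and M N :: "('k, 'u) rep"
  assumes M: "is_rep n M" and N: "is_rep n N"
begin

lemmas MN = rep_fdvs[OF M] rep_fdvs[OF N]
lemmas act_lhom' = lin_lhom[OF act_lin[OF M]] lin_lhom[OF act_lin[OF N]]

lemma tens_act:
  "s \<in> carrier (sym_group n) \<Longrightarrow> x \<in> carrier (rsp M) \<Longrightarrow> y \<in> carrier (rsp N) \<Longrightarrow>
    act (tens_rep M N) s (tens_elem (rsp M) (rsp N) x y) = tens_elem (rsp M) (rsp N) (act M s x) (act N s y)"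
  using tens_map_elem[OF MN MN act_lhom'] by simp

lemma tens_rep_is_rep: "is_rep n (tens_rep M N)"
proof (rule is_repI)
  show "fdvs (rsp (tens_rep M N))" using fdvs_tens[OF MN] by simp
  show l: "act (tens_rep M N) s \<in> lin (rsp (tens_rep M N)) (rsp (tens_rep M N))" if "s \<in> carrier (sym_group n)" for s
    using tens_map_lin[OF MN MN lin_lhom[OF act_lin[OF M that]] lin_lhom[OF act_lin[OF N that]]] by simp
  have v: "vs (tens (rsp M) (rsp N))" using fdvs_tens[OF MN] by simp
  show "act (tens_rep M N) \<one>\<^bsub>sym_group n\<^esub> x = x" if x: "x \<in> carrier (rsp (tens_rep M N))" for x
  proof (rule tens_ext[OF MN v, of "act (tens_rep M N) \<one>\<^bsub>sym_group n\<^esub>" "\<lambda>x. x"])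
    show "act (tens_rep M N) \<one>\<^bsub>sym_group n\<^esub> (tens_elem (rsp M) (rsp N) a b) = tens_elem (rsp M) (rsp N) a b"
      if "a \<in> carrier (rsp M)" "b \<in> carrier (rsp N)" for a b
      using that by (simp add: tens_act act_one[OF M] act_one[OF N] del: tens_rep_simps)
  qed (use x lin_lhom[OF l[of "\<one>\<^bsub>sym_group n\<^esub>"]] lhom_id in simp_all)
  show "act (tens_rep M N) (s \<otimes>\<^bsub>sym_group n\<^esub> t) x = act (tens_rep M N) s (act (tens_rep M N) t x)"
    if s: "s \<in> carrier (sym_group n)" and t: "t \<in> carrier (sym_group n)" and x: "x \<in> carrier (rsp (tens_rep M N))" for s t x
  proof (rule tens_ext[OF MN v, of "act (tens_rep M N) (s \<otimes>\<^bsub>sym_group n\<^esub> t)" "\<lambda>x. act (tens_rep M N) s (act (tens_rep M N) t x)"])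
    show "act (tens_rep M N) (s \<otimes>\<^bsub>sym_group n\<^esub> t) \<in> lhom (tens (rsp M) (rsp N)) (tens (rsp M) (rsp N))"
      using lin_lhom[OF l[of "s \<otimes>\<^bsub>sym_group n\<^esub> t"]] s t by simp
    show "(\<lambda>x. act (tens_rep M N) s (act (tens_rep M N) t x)) \<in> lhom (tens (rsp M) (rsp N)) (tens (rsp M) (rsp N))"
      using lhom_compose[OF lin_lhom[OF l[OF t]] lin_lhom[OF l[OF s]]] by simp
    show "x \<in> carrier (tens (rsp M) (rsp N))" using x by simp
    show "act (tens_rep M N) (s \<otimes>\<^bsub>sym_group n\<^esub> t) (tens_elem (rsp M) (rsp N) a b) =
      act (tens_rep M N) s (act (tens_rep M N) t (tens_elem (rsp M) (rsp N) a b))"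
      if "a \<in> carrier (rsp M)" "b \<in> carrier (rsp N)" for a b
      using s t that act_closed[OF M t that(1)] act_closed[OF N t that(2)]
      by (simp add: tens_act act_mult[OF M] act_mult[OF N] del: tens_rep_simps)
  qed
qed

interpretation S: subsp "tens (rsp M) (rsp N)" "coinv_kernel n (tens_rep M N)"
  using coinv_kernel_subsp[OF tens_rep_is_rep] by simp

lemma fdvs_coinvariants [simp]: "fdvs (coinvariants n (tens_rep M N))"
  unfolding coinvariants_def using S.fdvs_quotient fdvs_tens[OF MN] by simp

lemma fdvs_tensS [simp]: "fdvs (tensS n M N)"
  by (simp add: tensS_def fdvs_small)

lemma tensS_class_lhom: "tensS_class n M N \<in> lhom (tens (rsp M) (rsp N)) (tensS n M N)"
  using lhom_compose[OF S.proj_lhom enc_lhom[of "coinvariants n (tens_rep M N)", unfolded coinvariants_def tens_rep_simps]]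
    fdvs_coinvariants
  by (simp add: tensS_class_def[abs_def] tensS_def coinvariants_def)

lemma tensS_class_surj:
  assumes w: "w \<in> carrier (tensS n M N)"
  shows "\<exists>z\<in>carrier (tens (rsp M) (rsp N)). w = tensS_class n M N z"
proof -
  let ?C = "coinvariants n (tens_rep M N)"
  have "dec ?C w \<in> carrier ?C" and e: "enc ?C (dec ?C w) = w" using w by (simp_all add: tensS_def)
  then obtain z where "z \<in> carrier (tens (rsp M) (rsp N))" "dec ?C w = coinv_kernel n (tens_rep M N) +>\<^bsub>tens (rsp M) (rsp N)\<^esub> z"
    by (auto simp: coinvariants_def)
  then show ?thesis using e by (auto simp: tensS_class_def)
qed

lemma tensS_elem_bilinear: "bilinear (rsp M) (rsp N) (tensS n M N) (tensS_elem n M N)"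
  unfolding tensS_elem_def[abs_def] by (rule bilinear_compose[OF tens_bilinear[OF MN] tensS_class_lhom])

lemma tensS_elem_closed [simp]: "x \<in> carrier (rsp M) \<Longrightarrow> y \<in> carrier (rsp N) \<Longrightarrow> tensS_elem n M N x y \<in> carrier (tensS n M N)"
  by (rule lhom_closed[OF bilinearD(1)[OF tensS_elem_bilinear]])

lemma tensS_ext:
  assumes W: "vs W" and f: "f \<in> lhom (tensS n M N) W" and g: "g \<in> lhom (tensS n M N) W"
    and eq: "\<And>x y. x \<in> carrier (rsp M) \<Longrightarrow> y \<in> carrier (rsp N) \<Longrightarrow> f (tensS_elem n M N x y) = g (tensS_elem n M N x y)"
    and w: "w \<in> carrier (tensS n M N)"
  shows "f w = g w"
proof -
  obtain z where z: "z \<in> carrier (tens (rsp M) (rsp N))" "w = tensS_class n M N z" using tensS_class_surj[OF w] by blast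
  show ?thesis
    unfolding z(2)
    by (rule tens_ext[OF MN W lhom_compose[OF tensS_class_lhom f] lhom_compose[OF tensS_class_lhom g] _ z(1)]) (use eq in \<open>simp add: tensS_elem_def\<close>)
qed

text \<open>The linear map on the tensor product is invariant because it is so on pure tensors. It
  therefore kills the kernel of the coinvariants and descends to the quotient.\<close>

lemma tensS_lift:
  assumes W: "vs W" and b: "bilinear (rsp M) (rsp N) W b"
    and inv: "\<And>s x y. s \<in> carrier (sym_group n) \<Longrightarrow> x \<in> carrier (rsp M) \<Longrightarrow> y \<in> carrier (rsp N) \<Longrightarrow> b (act M s x) (act N s y) = b x y"
  shows "\<exists>f\<in>lin (tensS n M N) W. \<forall>x\<in>carrier (rsp M). \<forall>y\<in>carrier (rsp N). f (tensS_elem n M N x y) = b x y"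
proof -
  let ?T = "tens (rsp M) (rsp N)" and ?C = "coinvariants n (tens_rep M N)"
  obtain h where h: "h \<in> lin ?T W" "\<And>x y. x \<in> carrier (rsp M) \<Longrightarrow> y \<in> carrier (rsp N) \<Longrightarrow> h (tens_elem (rsp M) (rsp N) x y) = b x y"
    using tens_ex1[OF MN W b] by blast
  note hl = lin_lhom[OF h(1)] and tr = tens_rep_is_rep
  have hi: "h (act (tens_rep M N) s z) = h z" if s: "s \<in> carrier (sym_group n)" and z: "z \<in> carrier ?T" for s z
  proof (rule tens_ext[OF MN W _ hl _ z])
    show "(\<lambda>z. h (act (tens_rep M N) s z)) \<in> lhom ?T W"
      using lhom_compose[OF lin_lhom[OF act_lin[OF tr s]], of h W] hl by simp
    show "h (act (tens_rep M N) s (tens_elem (rsp M) (rsp N) x y)) = h (tens_elem (rsp M) (rsp N) x y)"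
      if "x \<in> carrier (rsp M)" "y \<in> carrier (rsp N)" for x y
      using that act_closed[OF M s that(1)] act_closed[OF N s that(2)]
      by (simp add: tens_act s h(2) inv del: tens_rep_simps)
  qed
  have "h d = \<zero>\<^bsub>W\<^esub>" if d: "d \<in> coinv_kernel n (tens_rep M N)" for d
    using coinv_kernel_hom[OF tr subsp_zero[OF W] _ _ d, of h] hl hi vs_cancel[OF W lhom_closed[OF hl]] by (simp del: tens_rep_simps(2))
  then have "\<exists>g\<in>lhom (quotient_space ?T (coinv_kernel n (tens_rep M N))) W.
      \<forall>z\<in>carrier ?T. g (coinv_kernel n (tens_rep M N) +>\<^bsub>?T\<^esub> z) = h z"
    by (rule S.quotient_lift[OF hl W])
  then obtain g where g: "g \<in> lhom ?C W"
    "\<And>z. z \<in> carrier ?T \<Longrightarrow> g (coinv_kernel n (tens_rep M N) +>\<^bsub>?T\<^esub> z) = h z"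
    by (auto simp: coinvariants_def)
  let ?f = "\<lambda>w\<in>carrier (tensS n M N). g (dec ?C w)"
  have "?f \<in> lin (tensS n M N) W"
    using lin_restrict[OF lhom_compose[OF dec_lhom g(1)]] fdvs_tensS by (simp add: tensS_def)
  moreover have "?f (tensS_elem n M N x y) = b x y" if x: "x \<in> carrier (rsp M)" and y: "y \<in> carrier (rsp N)" for x y
  proof -
    have t: "tens_elem (rsp M) (rsp N) x y \<in> carrier ?T" using x y MN by simp
    have "coinv_kernel n (tens_rep M N) +>\<^bsub>?T\<^esub> tens_elem (rsp M) (rsp N) x y \<in> carrier ?C"
      using t by (simp add: coinvariants_def)
    then have "dec ?C (tensS_elem n M N x y) = coinv_kernel n (tens_rep M N) +>\<^bsub>?T\<^esub> tens_elem (rsp M) (rsp N) x y"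
      by (simp add: tensS_elem_def tensS_class_def)
    then show ?thesis using x y g(2)[OF t] h(2) by simp
  qed
  ultimately show ?thesis by blast
qed

end

context
  fixes n :: nat and M N M' N' :: "('k, 'u) rep" and f g
  assumes M: "is_rep n M" and N: "is_rep n N" and M': "is_rep n M'" and N': "is_rep n N'"
    and f: "f \<in> equivariant n M M'" and g: "g \<in> equivariant n N N'"
begin

text \<open>The coset formula in \<open>tensS_map\<close> is well-behaved since the tensor product
  of equivariant maps is equivariant and so maps one coinvariant kernel into the other.\<close>

lemma tensS_map_facts:
  shows tensS_map_lin: "tensS_map n M N M' N' f g \<in> lin (tensS n M N) (tensS n M' N')"
    and tensS_map_te: "x \<in> carrier (rsp M) \<Longrightarrow> y \<in> carrier (rsp N) \<Longrightarrow>
      tensS_map n M N M' N' f g (tensS_elem n M N x y) = tensS_elem n M' N' (f x) (g y)"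
proof -
  note MN = rep_fdvs[OF M] rep_fdvs[OF N] and MN' = rep_fdvs[OF M'] rep_fdvs[OF N']
  note tr = tens_rep_is_rep[OF M N] and tr' = tens_rep_is_rep[OF M' N']
  note fl = lin_lhom[OF equivariantD(1)[OF f]] and gl = lin_lhom[OF equivariantD(1)[OF g]]
  let ?T = "tens (rsp M) (rsp N)" and ?T' = "tens (rsp M') (rsp N')"
  let ?D = "coinv_kernel n (tens_rep M N)" and ?D' = "coinv_kernel n (tens_rep M' N')"
  let ?h = "tens_map (rsp M) (rsp N) (rsp M') (rsp N') f g"
  interpret S: subsp ?T ?D using coinv_kernel_subsp[OF tr] by simp
  have S': "subsp ?T' ?D'" using coinv_kernel_subsp[OF tr'] by simp
  note h = tens_map_lin[OF MN MN' fl gl] and he = tens_map_elem[OF MN MN' fl gl]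
  note hl = lin_lhom[OF h]
  have v': "vs ?T'" using fdvs_tens[OF MN'] by simp
  have eq: "?h (act (tens_rep M N) s z) = act (tens_rep M' N') s (?h z)"
    if s: "s \<in> carrier (sym_group n)" and z: "z \<in> carrier ?T" for s z
  proof (rule tens_ext[OF MN v' _ _ _ z])
    show "(\<lambda>z. ?h (act (tens_rep M N) s z)) \<in> lhom ?T ?T'"
      using lhom_compose[OF lin_lhom[OF act_lin[OF tr s]], of ?h ?T'] hl by simp
    show "(\<lambda>z. act (tens_rep M' N') s (?h z)) \<in> lhom ?T ?T'"
      using lhom_compose[OF hl, of "act (tens_rep M' N') s" ?T'] lin_lhom[OF act_lin[OF tr' s]] by simp
    show "?h (act (tens_rep M N) s (tens_elem (rsp M) (rsp N) x y)) = act (tens_rep M' N') s (?h (tens_elem (rsp M) (rsp N) x y))"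
      if "x \<in> carrier (rsp M)" "y \<in> carrier (rsp N)" for x y
      using that s act_closed[OF M s that(1)] act_closed[OF N s that(2)] lhom_closed[OF fl that(1)] lhom_closed[OF gl that(2)]
        equivariantD(2)[OF f s that(1)] equivariantD(2)[OF g s that(2)]
      by (simp add: tens_act[OF M N] tens_act[OF M' N'] he del: tens_rep_simps)
  qed
  have D: "?h d \<in> ?D'" if d: "d \<in> ?D" for d
  proof (rule coinv_kernel_hom[OF tr S' _ _ d])
    show "?h \<in> lhom (rsp (tens_rep M N)) ?T'" using hl by simp
    show "?h (act (tens_rep M N) s x) \<oplus>\<^bsub>?T'\<^esub> (-1) \<odot>\<^bsub>?T'\<^esub> ?h x \<in> ?D'"
      if s: "s \<in> carrier (sym_group n)" and x: "x \<in> carrier (rsp (tens_rep M N))" for s x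
      using coinv_kernel_act[OF tr' s, of "?h x"] x eq[OF s, of x] lhom_closed[OF hl, of x]
      by (simp del: tens_rep_simps(2))
  qed
  let ?C = "coinvariants n (tens_rep M N)" and ?C' = "coinvariants n (tens_rep M' N')"
  let ?F = "\<lambda>A. set_add ?T' ?D' (?h ` A)"
  have "?F \<in> lhom (quotient_space ?T ?D) (quotient_space ?T' ?D')" by (rule S.coset_map_lhom[OF S' hl D])
  then have F: "?F \<in> lhom ?C ?C'" by (simp add: coinvariants_def)
  have m: "tensS_map n M N M' N' f g = small_map ?C ?C' ?F" by (simp add: tensS_map_def)
  show "tensS_map n M N M' N' f g \<in> lin (tensS n M N) (tensS n M' N')"
    unfolding m tensS_def by (rule small_map_lin[OF fdvs_coinvariants[OF M N] fdvs_coinvariants[OF M' N'] F])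
  assume x: "x \<in> carrier (rsp M)" and y: "y \<in> carrier (rsp N)"
  have t: "tens_elem (rsp M) (rsp N) x y \<in> carrier ?T" using x y MN by simp
  have "?D +>\<^bsub>?T\<^esub> tens_elem (rsp M) (rsp N) x y \<in> carrier ?C" using t by (simp add: coinvariants_def)
  then have "dec ?C (tensS_elem n M N x y) = ?D +>\<^bsub>?T\<^esub> tens_elem (rsp M) (rsp N) x y"
    by (simp add: tensS_elem_def tensS_class_def fdvs_coinvariants[OF M N])
  moreover have "?F (?D +>\<^bsub>?T\<^esub> tens_elem (rsp M) (rsp N) x y) = ?D' +>\<^bsub>?T'\<^esub> ?h (tens_elem (rsp M) (rsp N) x y)"
    by (rule S.coset_map[OF S' hl D t])
  ultimately show "tensS_map n M N M' N' f g (tensS_elem n M N x y) = tensS_elem n M' N' (f x) (g y)"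
    using small_map_apply[OF fdvs_coinvariants[OF M N] tensS_elem_closed[OF M N x y, unfolded tensS_def], of ?C' ?F]
      he[OF x y] by (simp add: m tensS_elem_def tensS_class_def)
qed

end

end

section \<open>Coinvariants as the dual of a Hom functor\<close>

text \<open>Each functor law for \<open>F\<close> is an equation between two vectors. It holds after
  applying the injective natural family \<open>q\<close>, where it is a law of \<open>G\<close>. The
  functor of coinvariants obtains its laws in this way from the dual of a restricted Hom
  functor.\<close>

lemma linear_functor_transport:
  fixes F G :: "('o, 'm, ('k::field, 'u) module, 'u \<Rightarrow> 'u) ftor"
  assumes C: "lc_pre C" and G: "linear_functor C Vect G" and o: "\<And>a. a \<in> Obj C \<Longrightarrow> fdvs (ob F a)"
    and m: "\<And>a b f. a \<in> Obj C \<Longrightarrow> b \<in> Obj C \<Longrightarrow> f \<in> carrier (Mor C a b) \<Longrightarrow> mo F a b f \<in> lin (ob F a) (ob F b)"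
    and q: "\<And>a. a \<in> Obj C \<Longrightarrow> q a \<in> lin (ob F a) (ob G a)" "\<And>a. a \<in> Obj C \<Longrightarrow> inj_on (q a) (carrier (ob F a))"
    and nat: "\<And>a b f x. a \<in> Obj C \<Longrightarrow> b \<in> Obj C \<Longrightarrow> f \<in> carrier (Mor C a b) \<Longrightarrow> x \<in> carrier (ob F a) \<Longrightarrow>
      q b (mo F a b f x) = mo G a b f (q a x)"
  shows "linear_functor C Vect F"
proof (rule linear_functor_VectI[OF C o m])
  note P = lc_preD[OF C] and mc = lin_closed[OF m] and qc = lin_closed[OF q(1)]
  note ql = lhom_simps[OF lin_lhom[OF q(1)]]
  fix a f x assume a: "a \<in> Obj C" and x: "x \<in> carrier (ob F a)"
  note qx = qc[OF a x]
  show "mo F a a (Idn C a) x = x"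
    by (rule inj_onD[OF q(2)[OF a]]) (use a x P(2)[OF a] mc[OF a a P(2)[OF a] x] nat[OF a a P(2)[OF a] x] LF_idn[OF G a qx] in simp_all)
  fix b assume b: "b \<in> Obj C" and f: "f \<in> carrier (Mor C a b)"
  note v = fdvs_vs[OF o[OF b]] and vM = P(1)[OF a b]
  note fx = mc[OF a b f x] and nf = nat[OF a b f x]
  {
    fix c g assume c: "c \<in> Obj C" and g: "g \<in> carrier (Mor C b c)"
    note gf = P(3)[OF a b c f g]
    show "mo F a c (Cmp C a b c g f) x = mo F b c g (mo F a b f x)"
      by (rule inj_onD[OF q(2)[OF c]])
        (use nat[OF a c gf x] nat[OF b c g fx] nf LF_cmp[OF G a b c f g qx] mc[OF a c gf x] mc[OF b c g fx] in simp_all)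
  next
    fix g assume g: "g \<in> carrier (Mor C a b)"
    note fg = vs_add[OF vM f g] and gx = mc[OF a b g x]
    show "mo F a b (f \<oplus>\<^bsub>Mor C a b\<^esub> g) x = mo F a b f x \<oplus>\<^bsub>ob F b\<^esub> mo F a b g x"
      by (rule inj_onD[OF q(2)[OF b]])
        (use nat[OF a b fg x] nf nat[OF a b g x] LF_add[OF G a b f g qx] ql(2)[OF b fx gx] mc[OF a b fg x] vs_add[OF v fx gx] in simp_all)
  next
    fix r
    note rf = vs_smult[OF vM f, of r]
    show "mo F a b (r \<odot>\<^bsub>Mor C a b\<^esub> f) x = r \<odot>\<^bsub>ob F b\<^esub> mo F a b f x"
      by (rule inj_onD[OF q(2)[OF b]])
        (use nat[OF a b rf x] nf LF_smult[OF G a b f qx] ql(3)[OF b fx] mc[OF a b rf x] vs_smult[OF v fx] in simp_all)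
  }
qed

context univ
begin

lemma tensS_elem_act:
  assumes M: "is_rep n M" and N: "is_rep n N" and s: "s \<in> carrier (sym_group n)"
    and x: "x \<in> carrier (rsp M)" and y: "y \<in> carrier (rsp N)"
  shows "tensS_elem n M N (act M s x) (act N s y) = tensS_elem n M N x y"
proof -
  note tr = tens_rep_is_rep[OF M N]
  have t: "tens_elem (rsp M) (rsp N) x y \<in> carrier (rsp (tens_rep M N))"
    "tens_elem (rsp M) (rsp N) (act M s x) (act N s y) \<in> carrier (rsp (tens_rep M N))"
    using x y act_closed[OF M s x] act_closed[OF N s y] rep_fdvs[OF M] rep_fdvs[OF N] by simp_all
  have "coinv_kernel n (tens_rep M N) +>\<^bsub>rsp (tens_rep M N)\<^esub> tens_elem (rsp M) (rsp N) (act M s x) (act N s y) =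
      coinv_kernel n (tens_rep M N) +>\<^bsub>rsp (tens_rep M N)\<^esub> tens_elem (rsp M) (rsp N) x y"
    unfolding subsp.coset_eq_iff[OF coinv_kernel_subsp[OF tr] t(2,1)]
    using coinv_kernel_act[OF tr s t(1)] tens_act[OF M N s x y] by (simp del: tens_rep_simps)
  then show ?thesis by (simp add: tensS_elem_def tensS_class_def)
qed

lemma mkd_lhom:
  fixes H :: "('k, 'u) module"
  assumes H: "fdvs H" and A: "vs A" and b: "\<And>a. a \<in> carrier A \<Longrightarrow> b a \<in> lhom H scalars"
    and b': "\<And>u. u \<in> carrier H \<Longrightarrow> (\<lambda>a. b a u) \<in> lhom A scalars"
  shows "(\<lambda>a. mkd H (b a)) \<in> lhom A (vdual H)"
proof (rule lhomI)
  have v: "vs (vdual H)" using H by simp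
  note al = lhom_simps[OF app_lhom_left[OF H]]
  fix x r assume x: "x \<in> carrier A"
  show mx: "mkd H (b x) \<in> carrier (vdual H)" using mkd_closed[OF H b[OF x]] .
  show "mkd H (b (r \<odot>\<^bsub>A\<^esub> x)) = r \<odot>\<^bsub>vdual H\<^esub> mkd H (b x)"
    by (rule app_ext[OF H]) (use H b A x v mx in \<open>simp_all add: al lhom_smult[OF b'] vs_smult[OF v mx]\<close>)
  fix y assume y: "y \<in> carrier A"
  have my: "mkd H (b y) \<in> carrier (vdual H)" using mkd_closed[OF H b[OF y]] .
  show "mkd H (b (x \<oplus>\<^bsub>A\<^esub> y)) = mkd H (b x) \<oplus>\<^bsub>vdual H\<^esub> mkd H (b y)"
    by (rule app_ext[OF H]) (use H b A x y v mx my in \<open>simp_all add: al lhom_add[OF b'] vs_add[OF v mx my]\<close>)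
qed

text \<open>The two hypotheses say that the pairing identifies \<open>H\<close> with the dual of
  \<open>A\<close>. Surjectivity of that identification makes \<open>g\<close> injective, since
  functionals separate points; and a functional on \<open>H\<close>, transported to the dual of
  \<open>A\<close>, is evaluation at a point of \<open>A\<close> by reflexivity.\<close>

lemma perfect_pairing_bij:
  fixes A H :: "('k, 'u) module"
  assumes A: "fdvs A" and H: "fdvs H" and g: "g \<in> lhom A (vdual H)"
    and inj: "\<And>u v. u \<in> carrier H \<Longrightarrow> v \<in> carrier H \<Longrightarrow> (\<And>z. z \<in> carrier A \<Longrightarrow> app H (g z) u = app H (g z) v) \<Longrightarrow> u = v"
    and surj: "\<And>f. f \<in> lin A scalars \<Longrightarrow> \<exists>u\<in>carrier H. \<forall>z\<in>carrier A. app H (g z) u = f z"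
  shows "bij_betw g (carrier A) (carrier (vdual H))"
proof (rule bij_betw_imageI)
  note gc = lhom_closed[OF g]
  show "inj_on g (carrier A)"
  proof (rule inj_onI)
    fix x y assume xy: "x \<in> carrier A" "y \<in> carrier A" "g x = g y"
    show "x = y"
    proof (rule functional_ext[OF A xy(1,2)])
      fix f assume "f \<in> lin A scalars"
      from surj[OF this] show "f x = f y" using xy by metis
    qed
  qed
  let ?P = "\<lambda>u. \<lambda>z\<in>carrier A. app H (g z) u"
  have Pl: "?P u \<in> lin A scalars" if "u \<in> carrier H" for u
    by (rule lin_restrict[OF lhom_compose[OF g app_lhom_left[OF H that]] fdvs_vs[OF A]])
  have P: "?P \<in> lhom H (dual_space A)"
    by (rule lhomI) (use Pl gc in \<open>auto simp: lhom_simps[OF app_lhom[OF H]] intro!: restrict_ext\<close>)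
  have bP: "bij_betw ?P (carrier H) (carrier (dual_space A))"
  proof (rule bij_betw_imageI)
    show "inj_on ?P (carrier H)"
    proof (rule inj_onI)
      fix u v assume uv: "u \<in> carrier H" "v \<in> carrier H" "?P u = ?P v"
      show "u = v"
      proof (rule inj[OF uv(1,2)])
        show "app H (g z) u = app H (g z) v" if "z \<in> carrier A" for z
          using fun_cong[OF uv(3), of z] that by simp
      qed
    qed
    show "?P ` carrier H = carrier (dual_space A)"
    proof (intro equalityI subsetI)
      fix f assume "f \<in> carrier (dual_space A)"
      then have f: "f \<in> lin A scalars" by simp
      from surj[OF f] obtain u where u: "u \<in> carrier H" "\<And>z. z \<in> carrier A \<Longrightarrow> app H (g z) u = f z" by blast
      have "f = ?P u" by (rule lin_eqI[OF f Pl[OF u(1)]]) (simp add: u(2))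
      then show "f \<in> ?P ` carrier H" using u(1) by blast
    qed (use Pl in auto)
  qed
  show "g ` carrier A = carrier (vdual H)"
  proof (intro equalityI subsetI)
    fix \<zeta> assume z: "\<zeta> \<in> carrier (vdual H)"
    have "(\<lambda>f. app H \<zeta> (inv_into (carrier H) ?P f)) \<in> lhom (dual_space A) scalars"
      by (rule lhom_compose[OF lhom_inv[OF P bP fdvs_vs[OF H]] app_lhom[OF H z]])
    from double_dual_surj[OF A this] obtain x where x: "x \<in> carrier A"
      "\<And>f. f \<in> lin A scalars \<Longrightarrow> app H \<zeta> (inv_into (carrier H) ?P f) = f x" by blast
    have "\<zeta> = g x"
    proof (rule app_ext[OF H z gc[OF x(1)]])
      fix u assume u: "u \<in> carrier H"
      have "inv_into (carrier H) ?P (?P u) = u" using inv_into_f_f[OF bij_betw_imp_inj_on[OF bP] u] .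
      then show "app H \<zeta> u = app H (g x) u" using x(2)[OF Pl[OF u]] x(1) by simp
    qed
    then show "\<zeta> \<in> g ` carrier A" using x(1) by blast
  qed (use gc in auto)
qed

lemma coinv_ftor_simps [simp]:
  "ob (coinv_ftor n N) V = tensS n (TR n V) N"
  "mo (coinv_ftor n N) V W x = tensS_map n (TR n V) N (TR n W) N (Gam_real n V W x) (\<lambda>y\<in>carrier (rsp N). y)"
  by (simp_all add: coinv_ftor_def)

lemma coinv_mo:
  fixes V W :: "('k, 'u) module"
  assumes N: "is_rep n N" and V: "fdvs V" and W: "fdvs W" and x: "x \<in> carrier (Gam_mor n V W)"
  shows coinv_mo_lin: "mo (coinv_ftor n N) V W x \<in> lin (tensS n (TR n V) N) (tensS n (TR n W) N)"
    and coinv_mo_te: "a \<in> carrier (tp n V) \<Longrightarrow> b \<in> carrier (rsp N) \<Longrightarrow>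
      mo (coinv_ftor n N) V W x (tensS_elem n (TR n V) N a b) = tensS_elem n (TR n W) N (Gam_real n V W x a) b"
  using tensS_map_lin[OF TR_rep[OF V] N TR_rep[OF W] N Gam_real_equivariant[OF V W x] equivariant_id[OF N]]
    tensS_map_te[OF TR_rep[OF V] N TR_rep[OF W] N Gam_real_equivariant[OF V W x] equivariant_id[OF N], of a b] V
  by simp_all

lemma coinv_nt_facts:
  fixes V :: "('k, 'u) module"
  assumes N: "is_rep n N" and N': "is_rep n N'" and p: "\<psi> \<in> equivariant n N N'" and V: "fdvs V"
  shows coinv_nt_lin: "coinv_nt n N N' \<psi> V \<in> lin (tensS n (TR n V) N) (tensS n (TR n V) N')"
    and coinv_nt_te: "a \<in> carrier (tp n V) \<Longrightarrow> b \<in> carrier (rsp N) \<Longrightarrow>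
      coinv_nt n N N' \<psi> V (tensS_elem n (TR n V) N a b) = tensS_elem n (TR n V) N' a (\<psi> b)"
  using tensS_map_lin[OF TR_rep[OF V] N TR_rep[OF V] N' equivariant_id[OF TR_rep[OF V]] p]
    tensS_map_te[OF TR_rep[OF V] N TR_rep[OF V] N' equivariant_id[OF TR_rep[OF V]] p, of a b] V
  by (simp_all add: coinv_nt_def)

lemma coinv_nt_closed:
  fixes N N' :: "('k, 'u) rep"
  assumes N: "is_rep n N" and N': "is_rep n N'" and p: "\<psi> \<in> equivariant n N N'"
  shows "coinv_nt n N N' \<psi> \<in> nat_trans (Gam n) Vect (coinv_ftor n N) (coinv_ftor n N')"
proof (rule nat_trans_VectI)
  fix V :: "('k, 'u) module" assume "V \<in> Obj (Gam n)"
  then have V: "fdvs V" by simp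
  show "coinv_nt n N N' \<psi> V \<in> lin (ob (coinv_ftor n N) V) (ob (coinv_ftor n N') V)"
    using coinv_nt_lin[OF N N' p V] by simp
  fix W :: "('k, 'u) module" and x w assume "W \<in> Obj (Gam n)" and "x \<in> carrier (Mor (Gam n) V W)"
    and w: "w \<in> carrier (ob (coinv_ftor n N) V)"
  then have W: "fdvs W" and x: "x \<in> carrier (Gam_mor n V W)" by simp_all
  show "mo (coinv_ftor n N') V W x (coinv_nt n N N' \<psi> V w) = coinv_nt n N N' \<psi> W (mo (coinv_ftor n N) V W x w)"
  proof (rule tensS_ext[OF TR_rep[OF V] N, of "tensS n (TR n W) N'" "\<lambda>w. mo (coinv_ftor n N') V W x (coinv_nt n N N' \<psi> V w)"
      "\<lambda>w. coinv_nt n N N' \<psi> W (mo (coinv_ftor n N) V W x w)"])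
    show "vs (tensS n (TR n W) N')" using fdvs_tensS[OF TR_rep[OF W] N'] by simp
    show "(\<lambda>w. mo (coinv_ftor n N') V W x (coinv_nt n N N' \<psi> V w)) \<in> lhom (tensS n (TR n V) N) (tensS n (TR n W) N')"
      by (rule lhom_compose[OF lin_lhom[OF coinv_nt_lin[OF N N' p V]] lin_lhom[OF coinv_mo_lin[OF N' V W x]]])
    show "(\<lambda>w. coinv_nt n N N' \<psi> W (mo (coinv_ftor n N) V W x w)) \<in> lhom (tensS n (TR n V) N) (tensS n (TR n W) N')"
      by (rule lhom_compose[OF lin_lhom[OF coinv_mo_lin[OF N V W x]] lin_lhom[OF coinv_nt_lin[OF N N' p W]]])
    show "w \<in> carrier (tensS n (TR n V) N)" using w by simp
    fix a b assume "a \<in> carrier (rsp (TR n V))" and b: "b \<in> carrier (rsp N)"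
    then have a: "a \<in> carrier (tp n V)" using V by simp
    have xa: "Gam_real n V W x a \<in> carrier (tp n W)" using gr_closed[OF V W W] x a by simp
    note pb = lin_closed[OF equivariantD(1)[OF p] b]
    show "mo (coinv_ftor n N') V W x (coinv_nt n N N' \<psi> V (tensS_elem n (TR n V) N a b)) =
      coinv_nt n N N' \<psi> W (mo (coinv_ftor n N) V W x (tensS_elem n (TR n V) N a b))"
      unfolding coinv_nt_te[OF N N' p V a b] coinv_mo_te[OF N V W x a b] coinv_mo_te[OF N' V W x a pb]
        coinv_nt_te[OF N N' p W xa b] ..
  qed
qed (simp add: coinv_nt_def)

text \<open>Here \<open>u\<close> codes an equivariant map from \<open>N\<close> to the tensor power
  of the dual of \<open>V\<close>. It is applied to \<open>b\<close>, and the resulting tensor of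
  functionals is evaluated at \<open>a\<close> through \<open>kap\<close>.\<close>

definition coinv_pairing :: "nat \<Rightarrow> ('k, 'u) rep \<Rightarrow> ('k, 'u) module \<Rightarrow> 'u \<Rightarrow> 'u \<Rightarrow> 'u \<Rightarrow> 'k" where
  "coinv_pairing n N V a b = (\<lambda>u. app (tp n V) (kap n V (dec (HomS n N (TR n (vdual V))) u b)) a)"

text \<open>
  The map \<open>V\<^sup>\<otimes>\<^sup>n \<otimes>\<^sub>S\<^sub>n N \<rightarrow> Hom\<^sub>S\<^sub>n(N, (V\<^sup>\<or>)\<^sup>\<otimes>\<^sup>n)\<^sup>\<or>\<close> adjoint to the pairing; the target is \<open>DP n (J n N)\<close> at \<open>V\<close>.
\<close>

definition coinv_cmp :: "nat \<Rightarrow> ('k, 'u) rep \<Rightarrow> ('k, 'u) module \<Rightarrow> 'u \<Rightarrow> 'u" where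
  "coinv_cmp n N = (\<lambda>V\<in>Obj (Gam n). SOME f. f \<in> lin (tensS n (TR n V) N) (vdual (small (HomS n N (TR n (vdual V))))) \<and>
     (\<forall>a\<in>carrier (tp n V). \<forall>b\<in>carrier (rsp N).
        f (tensS_elem n (TR n V) N a b) = mkd (small (HomS n N (TR n (vdual V)))) (coinv_pairing n N V a b)))"

context
  fixes n :: nat and N :: "('k, 'u) rep"
  assumes N: "is_rep n N"
begin

context
  fixes V :: "('k, 'u) module"
  assumes V: "fdvs V"
begin

abbreviation (input) "HH \<equiv> HomS n N (TR n (vdual V))"
abbreviation (input) "H \<equiv> (small (HomS n N (TR n (vdual V))) :: ('k, 'u) module)"

lemma fdvs_HH: "fdvs HH" "fdvs H"
  using N V by (simp_all add: fdvs_small)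

lemma dec_HH: "u \<in> carrier H \<Longrightarrow> dec HH u \<in> equivariant n N (TR n (vdual V))"
  using dec_closed[OF fdvs_HH(1), of u] by simp

lemma dec_HH_closed: "u \<in> carrier H \<Longrightarrow> b \<in> carrier (rsp N) \<Longrightarrow> dec HH u b \<in> carrier (tp n (vdual V))"
  using lin_closed[OF equivariantD(1)[OF dec_HH]] V by simp

lemma coinv_pairing_lhom:
  assumes a: "a \<in> carrier (tp n V)" and b: "b \<in> carrier (rsp N)" and u: "u \<in> carrier H"
  shows "coinv_pairing n N V a b \<in> lhom H scalars" "(\<lambda>a. coinv_pairing n N V a b u) \<in> lhom (tp n V) scalars"
    "(\<lambda>b. coinv_pairing n N V a b u) \<in> lhom (rsp N) scalars"
proof -
  have e: "(\<lambda>\<psi>. \<psi> b) \<in> lhom HH (tp n (vdual V))"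
    by (rule lhomI) (use b V in \<open>auto simp: lin_closed[OF equivariantD(1)] dest!: lin_closed[OF equivariantD(1)]\<close>)
  show "coinv_pairing n N V a b \<in> lhom H scalars"
    unfolding coinv_pairing_def
    by (rule lhom_compose[OF dec_lhom[OF fdvs_HH(1)] lhom_compose[OF e app_kap_left[OF V a]]])
  show "(\<lambda>a. coinv_pairing n N V a b u) \<in> lhom (tp n V) scalars"
    unfolding coinv_pairing_def by (rule app_kap_right[OF V dec_HH_closed[OF u b]])
  have "dec HH u \<in> lhom (rsp N) (tp n (vdual V))" using lin_lhom[OF equivariantD(1)[OF dec_HH[OF u]]] V by simp
  from lhom_compose[OF this app_kap_left[OF V a]] show "(\<lambda>b. coinv_pairing n N V a b u) \<in> lhom (rsp N) scalars"
    unfolding coinv_pairing_def .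
qed

text \<open>The coded map and \<open>kap\<close> are equivariant, so acting on \<open>b\<close>
  becomes acting on a functional on the tensor power. The inverse in the dual action cancels against
  the action on \<open>a\<close>, and the pairing descends to coinvariants.\<close>

lemma coinv_pairing_act:
  assumes a: "a \<in> carrier (tp n V)" and b: "b \<in> carrier (rsp N)" and u: "u \<in> carrier H" and s: "s \<in> carrier (sym_group n)"
  shows "coinv_pairing n N V (act (TR n V) s a) (act N s b) u = coinv_pairing n N V a b u"
proof -
  let ?i = "inv\<^bsub>sym_group n\<^esub> s"
  have a': "a \<in> carrier (rsp (TR n V))" using a V by simp
  note d = dec_HH_closed[OF u b]
  have d': "dec HH u b \<in> carrier (rsp (TR n (vdual V)))" using d V by simp
  have t: "fdvs (tp n V)" using V by simp
  have l: "act (TR n V) ?i \<in> lin (tp n V) (tp n V)" using act_lin[OF TR_rep[OF V], of ?i n] s V by simp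
  have sa: "act (TR n V) s a \<in> carrier (tp n V)" using act_closed[OF TR_rep[OF V] s a'] V by simp
  have "kap n V (dec HH u (act N s b)) = vdual_map (tp n V) (tp n V) (act (TR n V) ?i) (kap n V (dec HH u b))"
    using equivariantD(2)[OF dec_HH[OF u] s b] equivariantD(2)[OF kap_equivariant[OF V] s d'] V by (simp del: tpow_rep_simps(2))
  then show ?thesis
    using app_vdual_map[OF t t l kap_closed[OF V d] sa] act_inv(1)[OF TR_rep[OF V] s a'] by (simp add: coinv_pairing_def)
qed

lemma coinv_cmp_facts:
  shows coinv_cmp_lin: "coinv_cmp n N V \<in> lin (tensS n (TR n V) N) (vdual H)"
    and coinv_cmp_te: "a \<in> carrier (tp n V) \<Longrightarrow> b \<in> carrier (rsp N) \<Longrightarrow> u \<in> carrier H \<Longrightarrow>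
      app H (coinv_cmp n N V (tensS_elem n (TR n V) N a b)) u = coinv_pairing n N V a b u"
proof -
  have r: "rsp (TR n V) = tp n V" using V by simp
  have vt: "vs (tp n V)" "vs (vdual H)" using V fdvs_HH(2) by simp_all
  have zH: "\<zero>\<^bsub>H\<^esub> \<in> carrier H" using fdvs_HH(2) by simp
  have cH: "coinv_pairing n N V a b \<in> lhom H scalars" if "a \<in> carrier (tp n V)" "b \<in> carrier (rsp N)" for a b
    by (rule coinv_pairing_lhom(1)[OF that zH])
  have bl: "bilinear (rsp (TR n V)) (rsp N) (vdual H) (\<lambda>a b. mkd H (coinv_pairing n N V a b))"
    unfolding bilinear_def r
  proof (intro conjI ballI)
    show "(\<lambda>b. mkd H (coinv_pairing n N V a b)) \<in> lhom (rsp N) (vdual H)" if a: "a \<in> carrier (tp n V)" for a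
      by (rule mkd_lhom[OF fdvs_HH(2) fdvs_vs[OF rep_fdvs[OF N]]]) (use cH coinv_pairing_lhom(3) vs_zero[OF fdvs_vs[OF rep_fdvs[OF N]]] a in auto)
    show "(\<lambda>a. mkd H (coinv_pairing n N V a b)) \<in> lhom (tp n V) (vdual H)" if b: "b \<in> carrier (rsp N)" for b
      by (rule mkd_lhom[OF fdvs_HH(2) vt(1)]) (use cH coinv_pairing_lhom(2) vs_zero[OF vt(1)] b in auto)
  qed
  have "\<exists>f\<in>lin (tensS n (TR n V) N) (vdual H). \<forall>a\<in>carrier (rsp (TR n V)). \<forall>b\<in>carrier (rsp N).
      f (tensS_elem n (TR n V) N a b) = mkd H (coinv_pairing n N V a b)"
  proof (rule tensS_lift[OF TR_rep[OF V] N vt(2) bl])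
    fix s a b assume s: "s \<in> carrier (sym_group n)" and "a \<in> carrier (rsp (TR n V))" and b: "b \<in> carrier (rsp N)"
    then have a: "a \<in> carrier (tp n V)" using r by simp
    have sa: "act (TR n V) s a \<in> carrier (tp n V)" using act_closed[OF TR_rep[OF V] s, of a] a V by simp
    note sb = act_closed[OF N s b]
    show "mkd H (coinv_pairing n N V (act (TR n V) s a) (act N s b)) = mkd H (coinv_pairing n N V a b)"
      by (rule app_ext[OF fdvs_HH(2) mkd_closed[OF fdvs_HH(2) cH[OF sa sb]] mkd_closed[OF fdvs_HH(2) cH[OF a b]]])
        (simp add: app_mkd[OF fdvs_HH(2) cH[OF sa sb]] app_mkd[OF fdvs_HH(2) cH[OF a b]] coinv_pairing_act[OF a b _ s])
  qed
  then have "\<exists>f. f \<in> lin (tensS n (TR n V) N) (vdual H) \<and> (\<forall>a\<in>carrier (tp n V). \<forall>b\<in>carrier (rsp N).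
      f (tensS_elem n (TR n V) N a b) = mkd H (coinv_pairing n N V a b))" unfolding r by blast
  from someI_ex[OF this] have "coinv_cmp n N V \<in> lin (tensS n (TR n V) N) (vdual H) \<and> (\<forall>a\<in>carrier (tp n V). \<forall>b\<in>carrier (rsp N).
      coinv_cmp n N V (tensS_elem n (TR n V) N a b) = mkd H (coinv_pairing n N V a b))" using V by (simp add: coinv_cmp_def)
  then show "coinv_cmp n N V \<in> lin (tensS n (TR n V) N) (vdual H)"
    "a \<in> carrier (tp n V) \<Longrightarrow> b \<in> carrier (rsp N) \<Longrightarrow> u \<in> carrier H \<Longrightarrow>
      app H (coinv_cmp n N V (tensS_elem n (TR n V) N a b)) u = coinv_pairing n N V a b u"
    using app_mkd[OF fdvs_HH(2) cH] by simp_all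
qed

text \<open>Tensor-Hom duality: a functional on the coinvariants is an invariant bilinear form on
  the tensor power of \<open>V\<close> and \<open>N\<close>, equivalently an equivariant map from
  \<open>N\<close> to the dual of that tensor power. Through \<open>kap\<close> this is an element
  of the Hom space, so the pairing is perfect on both sides.\<close>

lemma coinv_cmp_bij: "bij_betw (coinv_cmp n N V) (carrier (tensS n (TR n V) N)) (carrier (vdual H))"
proof (rule perfect_pairing_bij[OF fdvs_tensS[OF TR_rep[OF V] N] fdvs_HH(2) lin_lhom[OF coinv_cmp_lin]])
  have r: "rsp (TR n V) = tp n V" "rsp (TR n (vdual V)) = tp n (vdual V)" using V by simp_all
  have t: "fdvs (tp n V)" and v: "vs (tp n (vdual V))" "vs (vdual (tp n V))" "vs (rsp N)"
    using V fdvs_vs[OF rep_fdvs[OF N]] by simp_all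
  have tensS_elem: "tensS_elem n (TR n V) N a b \<in> carrier (tensS n (TR n V) N)" if "a \<in> carrier (tp n V)" "b \<in> carrier (rsp N)" for a b
    using tensS_elem_closed[OF TR_rep[OF V] N] that r by simp
  note kinj = bij_betw_imp_inj_on[OF kap_bij[OF V]]
  {
    fix u u' assume u: "u \<in> carrier H" "u' \<in> carrier H"
      and eq: "\<And>z. z \<in> carrier (tensS n (TR n V) N) \<Longrightarrow> app H (coinv_cmp n N V z) u = app H (coinv_cmp n N V z) u'"
    have "dec HH u = dec HH u'"
    proof (rule lin_eqI[OF equivariantD(1)[OF dec_HH[OF u(1)]] equivariantD(1)[OF dec_HH[OF u(2)]]])
      fix b assume b: "b \<in> carrier (rsp N)"
      note d = dec_HH_closed[OF u(1) b] dec_HH_closed[OF u(2) b]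
      have "kap n V (dec HH u b) = kap n V (dec HH u' b)"
      proof (rule app_ext[OF t kap_closed[OF V d(1)] kap_closed[OF V d(2)]])
        fix a assume a: "a \<in> carrier (tp n V)"
        show "app (tp n V) (kap n V (dec HH u b)) a = app (tp n V) (kap n V (dec HH u' b)) a"
          using eq[OF tensS_elem[OF a b]] coinv_cmp_te[OF a b u(1)] coinv_cmp_te[OF a b u(2)] by (simp add: coinv_pairing_def)
      qed
      then show "dec HH u b = dec HH u' b" using inj_onD[OF kinj] d by blast
    qed
    then have "enc HH (dec HH u) = (enc HH (dec HH u') :: 'u)" by (simp only:)
    then show "u = u'" by (simp only: enc_dec[OF fdvs_HH(1) u(1)] enc_dec[OF fdvs_HH(1) u(2)])
  next
    fix f assume f: "f \<in> lin (tensS n (TR n V) N) scalars"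
    note fl = lin_lhom[OF f] and bl = tensS_elem_bilinear[OF TR_rep[OF V] N]
    have f1: "(\<lambda>a. f (tensS_elem n (TR n V) N a b)) \<in> lhom (tp n V) scalars" if "b \<in> carrier (rsp N)" for b
      using lhom_compose[OF bilinearD(2)[OF bl that] fl] r by simp
    have f2: "(\<lambda>b. f (tensS_elem n (TR n V) N a b)) \<in> lhom (rsp N) scalars" if "a \<in> carrier (tp n V)" for a
      using lhom_compose[OF bilinearD(1)[OF bl] fl] that r by simp
    let ?k = "restrict (inv_into (carrier (tp n (vdual V))) (kap n V)) (carrier (vdual (tp n V)))"
    note K = lin_inv[OF kap_lin[OF V] kap_bij[OF V] v(1,2)]
    let ?m = "\<lambda>b. mkd (tp n V) (\<lambda>a. f (tensS_elem n (TR n V) N a b))"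
    have m: "?m \<in> lhom (rsp N) (vdual (tp n V))"
      by (rule mkd_lhom[OF t v(3)]) (use f1 f2 in auto)
    \<comment> \<open>The map sending \<open>b\<close> to the functional given by pairing
      \<open>b\<close> under \<open>f\<close>, pulled back along the inverse of
      \<open>kap\<close>.\<close>
    define \<psi> where "\<psi> = (\<lambda>b\<in>carrier (rsp N). ?k (?m b))"
    have \<psi>: "\<psi> \<in> lin (rsp N) (tp n (vdual V))"
      unfolding \<psi>_def by (rule lin_restrict[OF lhom_compose[OF m lin_lhom[OF K(1)]] v(3)])
    have k\<psi>: "kap n V (\<psi> b) = ?m b" if "b \<in> carrier (rsp N)" for b
      unfolding \<psi>_def using that K(3)[OF lhom_closed[OF m that]] by simp
    have ak: "app (tp n V) (kap n V (\<psi> b)) a = f (tensS_elem n (TR n V) N a b)" if "a \<in> carrier (tp n V)" "b \<in> carrier (rsp N)" for a b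
      using k\<psi>[OF that(2)] app_mkd[OF t f1[OF that(2)] that(1)] by simp
    \<comment> \<open>Equivariance is tested under the injective \<open>kap\<close>. It comes from
      the fact that \<open>f\<close> sees classes of coinvariants: acting by the inverse on the
      first entry is the same as acting on the second.\<close>
    have e: "\<psi> \<in> equivariant n N (TR n (vdual V))"
    proof (rule equivariantI)
      show "\<psi> \<in> lin (rsp N) (rsp (TR n (vdual V)))" using \<psi> r by simp
      fix s b assume s: "s \<in> carrier (sym_group n)" and b: "b \<in> carrier (rsp N)"
      let ?i = "inv\<^bsub>sym_group n\<^esub> s"
      note sb = act_closed[OF N s b] and pb = lin_closed[OF \<psi> b]
      have pb': "\<psi> b \<in> carrier (rsp (TR n (vdual V)))" using pb r by simp
      have dV: "fdvs (vdual V)" using V by simp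
      have sp: "act (TR n (vdual V)) s (\<psi> b) \<in> carrier (tp n (vdual V))" using act_closed[OF TR_rep[OF dV] s pb'] r by simp
      have l: "act (TR n V) ?i \<in> lin (tp n V) (tp n V)" using act_lin[OF TR_rep[OF V], of ?i n] s r by simp
      have "kap n V (\<psi> (act N s b)) = kap n V (act (TR n (vdual V)) s (\<psi> b))"
      proof (rule app_ext[OF t kap_closed[OF V lin_closed[OF \<psi> sb]] kap_closed[OF V sp]])
        fix a assume a: "a \<in> carrier (tp n V)"
        then have a': "a \<in> carrier (rsp (TR n V))" using r by simp
        have ia: "act (TR n V) ?i a \<in> carrier (rsp (TR n V))" using act_closed[OF TR_rep[OF V], of ?i n a] s a' by simp
        have k: "kap n V (act (TR n (vdual V)) s (\<psi> b)) = vdual_map (tp n V) (tp n V) (act (TR n V) ?i) (kap n V (\<psi> b))"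
          using equivariantD(2)[OF kap_equivariant[OF V] s pb'] r by (simp del: tpow_rep_simps(2))
        have "app (tp n V) (kap n V (act (TR n (vdual V)) s (\<psi> b))) a = f (tensS_elem n (TR n V) N (act (TR n V) ?i a) b)"
          unfolding k using app_vdual_map[OF t t l kap_closed[OF V pb] a] ak[of "act (TR n V) ?i a" b] ia b r
          by (simp del: tpow_rep_simps(2))
        also have "\<dots> = f (tensS_elem n (TR n V) N a (act N s b))"
          using tensS_elem_act[OF TR_rep[OF V] N s ia b] act_inv(2)[OF TR_rep[OF V] s a'] by (simp del: tpow_rep_simps(2))
        also have "\<dots> = app (tp n V) (kap n V (\<psi> (act N s b))) a" using ak[OF a sb] by simp
        finally show "app (tp n V) (kap n V (\<psi> (act N s b))) a = app (tp n V) (kap n V (act (TR n (vdual V)) s (\<psi> b))) a" by simp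
      qed
      then show "\<psi> (act N s b) = act (TR n (vdual V)) s (\<psi> b)" using inj_onD[OF kinj] lin_closed[OF \<psi> sb] sp by blast
    qed
    let ?u = "enc HH \<psi> :: 'u"
    have u: "?u \<in> carrier H" "dec HH ?u = \<psi>" using e fdvs_HH(1) by simp_all
    have "app H (coinv_cmp n N V z) ?u = f z" if z: "z \<in> carrier (tensS n (TR n V) N)" for z
    proof (rule tensS_ext[OF TR_rep[OF V] N vs_scalars lhom_compose[OF lin_lhom[OF coinv_cmp_lin] app_lhom_left[OF fdvs_HH(2) u(1)]] fl _ z])
      show "app H (coinv_cmp n N V (tensS_elem n (TR n V) N a b)) ?u = f (tensS_elem n (TR n V) N a b)"
        if "a \<in> carrier (rsp (TR n V))" "b \<in> carrier (rsp N)" for a b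
        using that coinv_cmp_te[of a b ?u] u ak[of a b] r by (simp add: coinv_pairing_def)
    qed
    then show "\<exists>u\<in>carrier H. \<forall>z\<in>carrier (tensS n (TR n V) N). app H (coinv_cmp n N V z) u = f z" using u(1) by blast
  }
qed

end

text \<open>On pure classes, evaluated at a coded map, the claim reduces to
  \<open>kap_natural\<close>.\<close>

lemma coinv_cmp_natural:
  fixes V W :: "('k, 'u) module"
  assumes V: "fdvs V" and W: "fdvs W" and x: "x \<in> carrier (Gam_mor n V W)" and z: "z \<in> carrier (tensS n (TR n V) N)"
  shows "mo (DP n (J n N)) V W x (coinv_cmp n N V z) = coinv_cmp n N W (mo (coinv_ftor n N) V W x z)"
proof -
  let ?H = "\<lambda>V. small (HomS n N (TR n (vdual V))) :: ('k, 'u) module" and ?HH = "\<lambda>V. HomS n N (TR n (vdual V))"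
  let ?g = "mo (Gam_dual n) V W x" and ?m = "mo (J n N) (vdual W) (vdual V) (mo (Gam_dual n) V W x)"
  have d: "fdvs (vdual V)" "fdvs (vdual W)" using V W by simp_all
  note hV = fdvs_HH[OF V] and hW = fdvs_HH[OF W]
  note g = gd_closed[OF V W x]
  have m: "?m \<in> lin (?H W) (?H V)" using LF_lin[OF J_linear[OF N], of "vdual W" "vdual V" ?g] d g N by simp
  have mo: "mo (DP n (J n N)) V W x = vdual_map (?H W) (?H V) ?m" using N by (simp add: DP_simps)
  note ml = vdual_map_lin[OF hW(2) hV(2) m]
  show ?thesis
    unfolding mo
  proof (rule tensS_ext[OF TR_rep[OF V] N, of "vdual (?H W)" "\<lambda>z. vdual_map (?H W) (?H V) ?m (coinv_cmp n N V z)" "\<lambda>z. coinv_cmp n N W (mo (coinv_ftor n N) V W x z)"])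
    show "vs (vdual (?H W))" using hW(2) by simp
    show "(\<lambda>z. vdual_map (?H W) (?H V) ?m (coinv_cmp n N V z)) \<in> lhom (tensS n (TR n V) N) (vdual (?H W))"
      by (rule lhom_compose[OF lin_lhom[OF coinv_cmp_lin[OF V]] lin_lhom[OF ml]])
    show "(\<lambda>z. coinv_cmp n N W (mo (coinv_ftor n N) V W x z)) \<in> lhom (tensS n (TR n V) N) (vdual (?H W))"
      by (rule lhom_compose[OF lin_lhom[OF coinv_mo_lin[OF N V W x]] lin_lhom[OF coinv_cmp_lin[OF W]]])
    show "z \<in> carrier (tensS n (TR n V) N)" by (rule z)
    fix a b assume "a \<in> carrier (rsp (TR n V))" and b: "b \<in> carrier (rsp N)"
    then have a: "a \<in> carrier (tp n V)" using V by simp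
    have xT: "x \<in> carrier (T n V W)" using x by simp
    have xa: "Gam_real n V W x a \<in> carrier (tp n W)" using gr_closed[OF V W W xT a] .
    have tensS_elem: "tensS_elem n (TR n V) N a b \<in> carrier (tensS n (TR n V) N)" "tensS_elem n (TR n W) N (Gam_real n V W x a) b \<in> carrier (tensS n (TR n W) N)"
      using tensS_elem_closed[OF TR_rep[OF V] N _ b, of a] tensS_elem_closed[OF TR_rep[OF W] N _ b, of "Gam_real n V W x a"] a xa V W by simp_all
    note q1 = lin_closed[OF coinv_cmp_lin[OF V] tensS_elem(1)] and q2 = lin_closed[OF coinv_cmp_lin[OF W] tensS_elem(2)]
    show "vdual_map (?H W) (?H V) ?m (coinv_cmp n N V (tensS_elem n (TR n V) N a b)) =
      coinv_cmp n N W (mo (coinv_ftor n N) V W x (tensS_elem n (TR n V) N a b))"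
      unfolding coinv_mo_te[OF N V W x a b]
    proof (rule app_ext[OF hW(2) lin_closed[OF ml q1] q2])
      fix u assume u: "u \<in> carrier (?H W)"
      note mu = lin_closed[OF m u] and db = dec_HH_closed[OF W u b]
      have c: "compose (carrier (rsp N)) (Gam_real n (vdual W) (vdual V) ?g) (dec (?HH W) u) \<in> equivariant n N (TR n (vdual V))"
        by (rule equivariant_compose[OF N dec_HH[OF W u] Gam_real_equivariant[OF d(2,1) g]])
      have mue: "?m u = enc (?HH V) (compose (carrier (rsp N)) (Gam_real n (vdual W) (vdual V) ?g) (dec (?HH W) u))"
        using h_ftor_apply[OF N TR_rep[OF d(2)] u] by simp
      have du: "dec (?HH V) (?m u) b = Gam_real n (vdual W) (vdual V) ?g (dec (?HH W) u b)"
        unfolding mue using dec_enc[OF hV(1)] c b by (simp add: compose_eq)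
      have t: "fdvs (tp n V)" "fdvs (tp n W)" using V W by simp_all
      have "coinv_pairing n N V a b (?m u) = app (tp n V) (vdual_map (tp n V) (tp n W) (Gam_real n V W x) (kap n W (dec (?HH W) u b))) a"
        unfolding coinv_pairing_def du kap_natural[OF V W xT db] ..
      also have "\<dots> = coinv_pairing n N W (Gam_real n V W x a) b u"
        unfolding coinv_pairing_def using app_vdual_map[OF t gr_lin[OF V W W xT] kap_closed[OF W db] a] by simp
      finally show "app (?H W) (vdual_map (?H W) (?H V) ?m (coinv_cmp n N V (tensS_elem n (TR n V) N a b))) u =
        app (?H W) (coinv_cmp n N W (tensS_elem n (TR n W) N (Gam_real n V W x a) b)) u"
        using app_vdual_map[OF hW(2) hV(2) m q1 u] coinv_cmp_te[OF V a b mu] coinv_cmp_te[OF W xa b u] by simp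
    qed
  qed
qed

lemma coinv_ftor_linear: "linear_functor (Gam n) Vect (coinv_ftor n N)"
proof (rule linear_functor_transport[OF Gam_pre DP_linear[OF J_linear[OF N]], of _ "coinv_cmp n N"])
  fix V :: "('k, 'u) module" assume "V \<in> Obj (Gam n)"
  then have V: "fdvs V" by simp
  show "fdvs (ob (coinv_ftor n N) V)" using fdvs_tensS[OF TR_rep[OF V] N] by simp
  show "coinv_cmp n N V \<in> lin (ob (coinv_ftor n N) V) (ob (DP n (J n N)) V)" using coinv_cmp_lin[OF V] N by (simp add: DP_simps)
  show "inj_on (coinv_cmp n N V) (carrier (ob (coinv_ftor n N) V))" using bij_betw_imp_inj_on[OF coinv_cmp_bij[OF V]] by simp
next
  fix V W :: "('k, 'u) module" and x assume "V \<in> Obj (Gam n)" "W \<in> Obj (Gam n)" and "x \<in> carrier (Mor (Gam n) V W)"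
  then have V: "fdvs V" and W: "fdvs W" and x: "x \<in> carrier (Gam_mor n V W)" by simp_all
  show "mo (coinv_ftor n N) V W x \<in> lin (ob (coinv_ftor n N) V) (ob (coinv_ftor n N) W)"
    using coinv_mo_lin[OF N V W x] by simp
  show "coinv_cmp n N W (mo (coinv_ftor n N) V W x z) = mo (DP n (J n N)) V W x (coinv_cmp n N V z)" if "z \<in> carrier (ob (coinv_ftor n N) V)" for z
    using coinv_cmp_natural[OF V W x, of z] that by simp
qed

lemma coinv_cmp_closed: "coinv_cmp n N \<in> nat_trans (Gam n) Vect (coinv_ftor n N) (DP n (J n N))"
proof (rule nat_trans_VectI)
  show "coinv_cmp n N V \<in> lin (ob (coinv_ftor n N) V) (ob (DP n (J n N)) V)" if "V \<in> Obj (Gam n)" for V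
    using coinv_cmp_lin[of V] N that by (simp add: DP_simps)
  show "mo (DP n (J n N)) V W x (coinv_cmp n N V z) = coinv_cmp n N W (mo (coinv_ftor n N) V W x z)"
    if "V \<in> Obj (Gam n)" "W \<in> Obj (Gam n)" "x \<in> carrier (Mor (Gam n) V W)" "z \<in> carrier (ob (coinv_ftor n N) V)" for V W x z
    using coinv_cmp_natural[of V W x z] that by simp
qed (simp add: coinv_cmp_def)

lemma coinv_cmp_iso: "lc_iso (PC n) (coinv_ftor n N) (DP n (J n N)) (coinv_cmp n N)"
  by (rule nat_iso[OF coinv_ftor_linear DP_linear[OF J_linear[OF N]] coinv_cmp_closed])
    (use coinv_cmp_bij N in \<open>simp add: DP_simps\<close>)

end

text \<open>Both sides pair a class of \<open>a\<close> and \<open>b\<close> with a coded map on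
  \<open>N'\<close> by evaluating that map at the image of \<open>b\<close>.\<close>

lemma coinv_cmp_natural_rep:
  fixes N N' :: "('k, 'u) rep"
  assumes N: "is_rep n N" and N': "is_rep n N'" and p: "\<psi> \<in> equivariant n N N'"
  shows "Cmp (PC n) (coinv_ftor n N) (DP n (J n N)) (DP n (J n N')) (DP_map n (J n N') (J n N) (jh n N N' \<psi>)) (coinv_cmp n N) =
    Cmp (PC n) (coinv_ftor n N) (coinv_ftor n N') (DP n (J n N')) (coinv_cmp n N') (coinv_nt n N N' \<psi>)"
proof -
  note L = coinv_ftor_linear[OF N] coinv_ftor_linear[OF N'] DP_linear[OF J_linear[OF N]] DP_linear[OF J_linear[OF N']]
  have Dj: "DP_map n (J n N') (J n N) (jh n N N' \<psi>) \<in> nat_trans (Gam n) Vect (DP n (J n N)) (DP n (J n N'))"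
    by (rule DP_map_closed[OF J_linear[OF N'] J_linear[OF N] jh_nt[OF N N' p]])
  show ?thesis
  proof (rule nt_eqI[OF nt_cmp[OF L(1,3,4) coinv_cmp_closed[OF N] Dj] nt_cmp[OF L(1,2,4) coinv_nt_closed[OF N N' p] coinv_cmp_closed[OF N']]])
    fix V :: "('k, 'u) module" and z assume oV: "V \<in> Obj (Gam n)" and zc: "z \<in> carrier (ob (coinv_ftor n N) V)"
    then have V: "fdvs V" and z: "z \<in> carrier (tensS n (TR n V) N)" by simp_all
    have dV: "fdvs (vdual V)" using V by simp
    let ?H = "small (HomS n N (TR n (vdual V))) :: ('k, 'u) module" and ?H' = "small (HomS n N' (TR n (vdual V))) :: ('k, 'u) module"
    let ?j = "jh n N N' \<psi> (vdual V)"
    note h = fdvs_HH[OF N V] and h' = fdvs_HH[OF N' V]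
    have j: "?j \<in> lin ?H' ?H" using nt_lin[OF jh_nt[OF N N' p], of "vdual V"] dV N N' by simp
    note ml = vdual_map_lin[OF h'(2) h(2) j]
    have "vdual_map ?H' ?H ?j (coinv_cmp n N V z) = coinv_cmp n N' V (coinv_nt n N N' \<psi> V z)"
    proof (rule tensS_ext[OF TR_rep[OF V] N, of "vdual ?H'" "\<lambda>z. vdual_map ?H' ?H ?j (coinv_cmp n N V z)" "\<lambda>z. coinv_cmp n N' V (coinv_nt n N N' \<psi> V z)"])
      show "vs (vdual ?H')" using h'(2) by simp
      show "(\<lambda>z. vdual_map ?H' ?H ?j (coinv_cmp n N V z)) \<in> lhom (tensS n (TR n V) N) (vdual ?H')"
        by (rule lhom_compose[OF lin_lhom[OF coinv_cmp_lin[OF N V]] lin_lhom[OF ml]])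
      show "(\<lambda>z. coinv_cmp n N' V (coinv_nt n N N' \<psi> V z)) \<in> lhom (tensS n (TR n V) N) (vdual ?H')"
        by (rule lhom_compose[OF lin_lhom[OF coinv_nt_lin[OF N N' p V]] lin_lhom[OF coinv_cmp_lin[OF N' V]]])
      show "z \<in> carrier (tensS n (TR n V) N)" by (rule z)
      fix a b assume "a \<in> carrier (rsp (TR n V))" and b: "b \<in> carrier (rsp N)"
      then have a: "a \<in> carrier (tp n V)" using V by simp
      note pb = lin_closed[OF equivariantD(1)[OF p] b]
      have tensS_elem: "tensS_elem n (TR n V) N a b \<in> carrier (tensS n (TR n V) N)" "tensS_elem n (TR n V) N' a (\<psi> b) \<in> carrier (tensS n (TR n V) N')"
        using tensS_elem_closed[OF TR_rep[OF V] N _ b, of a] tensS_elem_closed[OF TR_rep[OF V] N' _ pb, of a] a V by simp_all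
      note q1 = lin_closed[OF coinv_cmp_lin[OF N V] tensS_elem(1)] and q2 = lin_closed[OF coinv_cmp_lin[OF N' V] tensS_elem(2)]
      show "vdual_map ?H' ?H ?j (coinv_cmp n N V (tensS_elem n (TR n V) N a b)) = coinv_cmp n N' V (coinv_nt n N N' \<psi> V (tensS_elem n (TR n V) N a b))"
        unfolding coinv_nt_te[OF N N' p V a b]
      proof (rule app_ext[OF h'(2) lin_closed[OF ml q1] q2])
        fix u assume u: "u \<in> carrier ?H'"
        note ju = lin_closed[OF j u]
        have c: "compose (carrier (rsp N)) (dec (HomS n N' (TR n (vdual V))) u) \<psi> \<in> equivariant n N (TR n (vdual V))"
          by (rule equivariant_compose[OF N p dec_HH[OF N' V u]])
        have du: "dec (HomS n N (TR n (vdual V))) (?j u) b = dec (HomS n N' (TR n (vdual V))) u (\<psi> b)"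
          unfolding jh_apply[OF N N' dV u] using dec_enc[OF h(1)] c b by (simp add: compose_eq)
        have "coinv_pairing n N V a b (?j u) = coinv_pairing n N' V a (\<psi> b) u" unfolding coinv_pairing_def du ..
        then show "app ?H' (vdual_map ?H' ?H ?j (coinv_cmp n N V (tensS_elem n (TR n V) N a b))) u = app ?H' (coinv_cmp n N' V (tensS_elem n (TR n V) N' a (\<psi> b))) u"
          using app_vdual_map[OF h'(2) h(2) j q1 u] coinv_cmp_te[OF N V a b ju] coinv_cmp_te[OF N' V a pb u] by simp
      qed
    qed
    then show "Cmp (PC n) (coinv_ftor n N) (DP n (J n N)) (DP n (J n N')) (DP_map n (J n N') (J n N) (jh n N N' \<psi>)) (coinv_cmp n N) V z =
      Cmp (PC n) (coinv_ftor n N) (coinv_ftor n N') (DP n (J n N')) (coinv_cmp n N') (coinv_nt n N N' \<psi>) V z"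
      using oV zc V N N' by (simp add: DP_simps del: coinv_ftor_simps)
  qed
qed

end

section \<open>The dual of the values of j_! as transformations into coinvariants\<close>

context univ
begin

text \<open>The inverse of the biduality map, in a mixed form: the inner dual is coded in the
  universe, while \<open>\<xi>\<close> is an honest functional on it, as in the
  \<open>dual_space\<close> of the final statement.\<close>

definition bidual_pt :: "('k, 'u) module \<Rightarrow> ('u \<Rightarrow> 'k) \<Rightarrow> 'u" where
  "bidual_pt X \<xi> = (SOME x. x \<in> carrier X \<and> (\<forall>a\<in>carrier (vdual X). \<xi> a = app X a x))"

context
  fixes X :: "('k, 'u) module"
  assumes X: "fdvs X"
begin

lemma bidual_pt_closed: "\<xi> \<in> lhom (vdual X) scalars \<Longrightarrow> bidual_pt X \<xi> \<in> carrier X"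
  and app_bidual_pt: "\<xi> \<in> lhom (vdual X) scalars \<Longrightarrow> a \<in> carrier (vdual X) \<Longrightarrow> app X a (bidual_pt X \<xi>) = \<xi> a"
proof -
  have e: "\<xi> \<in> lhom (vdual X) scalars \<Longrightarrow> \<exists>x. x \<in> carrier X \<and> (\<forall>a\<in>carrier (vdual X). \<xi> a = app X a x)"
    using app_surj[OF X, of \<xi>] by blast
  from someI_ex[OF e, folded bidual_pt_def] show "\<xi> \<in> lhom (vdual X) scalars \<Longrightarrow> bidual_pt X \<xi> \<in> carrier X"
    by blast
  from someI_ex[OF e, folded bidual_pt_def] show "\<xi> \<in> lhom (vdual X) scalars \<Longrightarrow> a \<in> carrier (vdual X) \<Longrightarrow> app X a (bidual_pt X \<xi>) = \<xi> a"
    by metis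
qed

lemma bidual_pt_unique:
  assumes "\<xi> \<in> lhom (vdual X) scalars" "x \<in> carrier X" "\<And>a. a \<in> carrier (vdual X) \<Longrightarrow> \<xi> a = app X a x"
  shows "bidual_pt X \<xi> = x"
  by (rule app_separates[OF X bidual_pt_closed[OF assms(1)] assms(2)]) (use app_bidual_pt[OF assms(1)] assms(3) in simp)

lemma bidual_pt_lhom: "bidual_pt X \<in> lhom (dual_space (vdual X)) X"
proof (rule lhomI)
  have v: "vs X" "vs (dual_space (vdual X))" "vs (vdual X)" using X by simp_all
  fix \<xi> r assume x: "\<xi> \<in> carrier (dual_space (vdual X))"
  then have l: "\<xi> \<in> lhom (vdual X) scalars" by (simp add: lin_lhom)
  show "bidual_pt X \<xi> \<in> carrier X" by (rule bidual_pt_closed[OF l])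
  show "bidual_pt X (r \<odot>\<^bsub>dual_space (vdual X)\<^esub> \<xi>) = r \<odot>\<^bsub>X\<^esub> bidual_pt X \<xi>"
  proof (rule bidual_pt_unique)
    show "r \<odot>\<^bsub>dual_space (vdual X)\<^esub> \<xi> \<in> lhom (vdual X) scalars"
      using vs_smult[OF v(2) x, of r] lin_lhom[of _ "vdual X" scalars] by simp
  qed (use bidual_pt_closed[OF l] app_bidual_pt[OF l] v in \<open>simp_all add: lhom_smult[OF app_lhom[OF X]]\<close>)
  fix \<zeta> assume z: "\<zeta> \<in> carrier (dual_space (vdual X))"
  then have l': "\<zeta> \<in> lhom (vdual X) scalars" by (simp add: lin_lhom)
  show "bidual_pt X (\<xi> \<oplus>\<^bsub>dual_space (vdual X)\<^esub> \<zeta>) = bidual_pt X \<xi> \<oplus>\<^bsub>X\<^esub> bidual_pt X \<zeta>"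
  proof (rule bidual_pt_unique)
    show "\<xi> \<oplus>\<^bsub>dual_space (vdual X)\<^esub> \<zeta> \<in> lhom (vdual X) scalars"
      using vs_add[OF v(2) x z] lin_lhom[of _ "vdual X" scalars] by simp
  qed (use bidual_pt_closed[OF l] app_bidual_pt[OF l] bidual_pt_closed[OF l'] app_bidual_pt[OF l'] v in \<open>simp_all add: lhom_add[OF app_lhom[OF X]]\<close>)
qed

lemma bidual_pt_bij: "bij_betw (bidual_pt X) (carrier (dual_space (vdual X))) (carrier X)"
proof (rule bij_betw_byWitness[of _ "\<lambda>x. \<lambda>a\<in>carrier (vdual X). app X a x"])
  have v: "vs (vdual X)" using X by simp
  have e: "(\<lambda>a\<in>carrier (vdual X). app X a x) \<in> lin (vdual X) scalars" if "x \<in> carrier X" for x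
    by (rule lin_restrict[OF app_lhom_left[OF X that] v])
  then show "(\<lambda>x. \<lambda>a\<in>carrier (vdual X). app X a x) ` carrier X \<subseteq> carrier (dual_space (vdual X))" by auto
  show "\<forall>x\<in>carrier X. bidual_pt X (\<lambda>a\<in>carrier (vdual X). app X a x) = x"
    using bidual_pt_unique[OF lin_lhom[OF e]] by simp
  show "bidual_pt X ` carrier (dual_space (vdual X)) \<subseteq> carrier X" using bidual_pt_closed lin_lhom by auto
  show "\<forall>\<xi>\<in>carrier (dual_space (vdual X)). (\<lambda>a\<in>carrier (vdual X). app X a (bidual_pt X \<xi>)) = \<xi>"
  proof
    fix \<xi> assume "\<xi> \<in> carrier (dual_space (vdual X))"
    then have l: "\<xi> \<in> lin (vdual X) scalars" by simp
    show "(\<lambda>a\<in>carrier (vdual X). app X a (bidual_pt X \<xi>)) = \<xi>"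
      by (rule lin_eqI[OF e[OF bidual_pt_closed[OF lin_lhom[OF l]]] l]) (simp add: app_bidual_pt[OF lin_lhom[OF l]])
  qed
qed

end

text \<open>Naturality of biduality: precomposing a functional with a transpose applies the original
  map to the point it represents.\<close>

lemma bidual_pt_vdual_map:
  fixes X Y :: "('k, 'u) module"
  assumes X: "fdvs X" and Y: "fdvs Y" and f: "f \<in> lin X Y" and xi: "\<xi> \<in> lin (vdual X) scalars"
  shows "compose (carrier (vdual Y)) \<xi> (vdual_map X Y f) \<in> lin (vdual Y) scalars"
    "bidual_pt Y (compose (carrier (vdual Y)) \<xi> (vdual_map X Y f)) = f (bidual_pt X \<xi>)"
proof -
  note m = vdual_map_lin[OF X Y f] and xl = lin_lhom[OF xi]
  have v: "vs (vdual Y)" using Y by simp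
  show c: "compose (carrier (vdual Y)) \<xi> (vdual_map X Y f) \<in> lin (vdual Y) scalars"
    by (rule lin_compose[OF m xl v])
  show "bidual_pt Y (compose (carrier (vdual Y)) \<xi> (vdual_map X Y f)) = f (bidual_pt X \<xi>)"
  proof (rule bidual_pt_unique[OF Y lin_lhom[OF c] lin_closed[OF f bidual_pt_closed[OF X xl]]])
    fix a assume a: "a \<in> carrier (vdual Y)"
    show "compose (carrier (vdual Y)) \<xi> (vdual_map X Y f) a = app Y a (f (bidual_pt X \<xi>))"
      using app_bidual_pt[OF X xl lin_closed[OF m a]] app_vdual_map[OF X Y f a bidual_pt_closed[OF X xl]] a by (simp add: compose_eq)
  qed
qed

lemma DP_map_lhom:
  assumes F: "linear_functor (Gam n) Vect F" and G: "linear_functor (Gam n) Vect (G :: ('k, 'u) pftor)"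
  shows "DP_map n F G \<in> lhom (Mor (PC n) F G) (Mor (PC n) (DP n G) (DP n F))"
proof (rule lhomI)
  have d: "vdual V \<in> Obj (Gam n)" if "V \<in> Obj (Gam n)" for V :: "('k, 'u) module" using that by simp
  note l = vdual_map_lhom[OF LF_fdvs[OF F d] LF_fdvs[OF G d]]
  fix \<alpha> r assume "\<alpha> \<in> carrier (Mor (PC n) F G)"
  then have a: "\<alpha> \<in> nat_trans (Gam n) Vect F G" by simp
  have ac: "\<alpha> (vdual V) \<in> carrier (Lin (ob F (vdual V)) (ob G (vdual V)))" if "V \<in> Obj (Gam n)" for V :: "('k, 'u) module"
    using nt_lin[OF a d[OF that]] by simp
  show "DP_map n F G \<alpha> \<in> carrier (Mor (PC n) (DP n G) (DP n F))" using DP_map_closed[OF F G a] by simp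
  show "DP_map n F G (r \<odot>\<^bsub>Mor (PC n) F G\<^esub> \<alpha>) = r \<odot>\<^bsub>Mor (PC n) (DP n G) (DP n F)\<^esub> DP_map n F G \<alpha>"
  proof (rule extensionalityI[of _ "Obj (Gam n)"])
    fix V :: "('k, 'u) module" assume V: "V \<in> Obj (Gam n)"
    show "DP_map n F G (r \<odot>\<^bsub>Mor (PC n) F G\<^esub> \<alpha>) V = (r \<odot>\<^bsub>Mor (PC n) (DP n G) (DP n F)\<^esub> DP_map n F G \<alpha>) V"
      using lhom_smult[OF l[OF V V] ac[OF V], of r] V d[OF V] by (simp add: DP_simps(1,3) del: Gam_simps Lin_simps)
  qed (simp_all add: DP_map_def dual_nt_def)
  fix \<beta> assume "\<beta> \<in> carrier (Mor (PC n) F G)"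
  then have b: "\<beta> \<in> nat_trans (Gam n) Vect F G" by simp
  have bc: "\<beta> (vdual V) \<in> carrier (Lin (ob F (vdual V)) (ob G (vdual V)))" if "V \<in> Obj (Gam n)" for V :: "('k, 'u) module"
    using nt_lin[OF b d[OF that]] by simp
  show "DP_map n F G (\<alpha> \<oplus>\<^bsub>Mor (PC n) F G\<^esub> \<beta>) = DP_map n F G \<alpha> \<oplus>\<^bsub>Mor (PC n) (DP n G) (DP n F)\<^esub> DP_map n F G \<beta>"
  proof (rule extensionalityI[of _ "Obj (Gam n)"])
    fix V :: "('k, 'u) module" assume V: "V \<in> Obj (Gam n)"
    show "DP_map n F G (\<alpha> \<oplus>\<^bsub>Mor (PC n) F G\<^esub> \<beta>) V = (DP_map n F G \<alpha> \<oplus>\<^bsub>Mor (PC n) (DP n G) (DP n F)\<^esub> DP_map n F G \<beta>) V"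
      using lhom_add[OF l[OF V V] ac[OF V] bc[OF V]] V d[OF V] by (simp add: DP_simps(1,3) del: Gam_simps Lin_simps)
  qed (simp_all add: DP_map_def dual_nt_def)
qed

lemma jshriek_simps:
  fixes F :: "('k, 'u) pftor"
  assumes "is_rep n M"
  shows "ob (ob (jshriek n) F) M = vdual (small (jlow_space n (DP n F) (dual_rep n M)))"
    "mo (ob (jshriek n) F) M N \<phi> = vdual_map (small (jlow_space n (DP n F) (dual_rep n N)))
      (small (jlow_space n (DP n F) (dual_rep n M)))
      (mo (jlow_ob n (DP n F)) (dual_rep n N) (dual_rep n M) (vdual_map (rsp M) (rsp N) \<phi>))"
    "mo (jshriek n) F G \<alpha> M = vdual_map (small (jlow_space n (DP n G) (dual_rep n M)))
      (small (jlow_space n (DP n F) (dual_rep n M))) (jlow_nt n (DP n G) (DP n F) (DP_map n F G \<alpha>) (dual_rep n M))"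
  using assms by (simp_all add: jshriek_def jlow_def DA_simps)

context
  fixes n :: nat and u :: "('k, 'u) pftor \<Rightarrow> ('k, 'u) module \<Rightarrow> 'u \<Rightarrow> 'u"
  assumes D: "duality (PC n) (DP n) (DP_map n) u"
begin

interpretation D: duality "PC n" "DP n" "DP_map n" u by (rule D)

text \<open>The duality as an adjunction with itself: a transformation into the dual of F
  corresponds to one from F into the dual of its source, by dualizing and composing with the unit at
  F. \<open>Psi\<close> then replaces the target by the isomorphic functor of coinvariants.\<close>

definition Lam :: "('k, 'u) pftor \<Rightarrow> ('k, 'u) rep \<Rightarrow> (('k, 'u) module \<Rightarrow> 'u \<Rightarrow> 'u) \<Rightarrow> ('k, 'u) module \<Rightarrow> 'u \<Rightarrow> 'u" where
  "Lam F N \<zeta> = Cmp (PC n) F (DP n (DP n F)) (DP n (J n N)) (DP_map n (J n N) (DP n F) \<zeta>) (u F)"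

definition Psi :: "('k, 'u) pftor \<Rightarrow> ('k, 'u) rep \<Rightarrow> (('k, 'u) module \<Rightarrow> 'u \<Rightarrow> 'u) \<Rightarrow> ('k, 'u) module \<Rightarrow> 'u \<Rightarrow> 'u" where
  "Psi F N \<zeta> = inv_into (carrier (Mor (PC n) F (coinv_ftor n N)))
     (\<lambda>\<eta>. Cmp (PC n) F (coinv_ftor n N) (DP n (J n N)) (coinv_cmp n N) \<eta>) (Lam F N \<zeta>)"

lemma P_objs: "is_rep n N \<Longrightarrow> J n N \<in> Obj (PC n)" "is_rep n N \<Longrightarrow> coinv_ftor n N \<in> Obj (PC n)"
  using J_linear coinv_ftor_linear by auto

context
  fixes F :: "('k, 'u) pftor" and N :: "('k, 'u) rep"
  assumes F: "F \<in> Obj (PC n)" and N: "is_rep n N"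
begin

lemmas Lam_objs = F P_objs(1)[OF N] P_objs(2)[OF N] D.dob[OF F] D.dob[OF D.dob[OF F]] D.dob[OF P_objs(1)[OF N]]

lemma Lam_lhom: "Lam F N \<in> lhom (Mor (PC n) (J n N) (DP n F)) (Mor (PC n) F (DP n (J n N)))"
proof -
  have l: "linear_functor (Gam n) Vect (J n N)" "linear_functor (Gam n) Vect (DP n F)"
    using Lam_objs by simp_all
  from lhom_compose[OF DP_map_lhom[OF l] lc_left[OF PC_linear_category Lam_objs(1,5,6) D.u_closed[OF F]]]
  show ?thesis by (simp add: Lam_def[abs_def])
qed

lemma Lam_bij: "bij_betw (Lam F N) (carrier (Mor (PC n) (J n N) (DP n F))) (carrier (Mor (PC n) F (DP n (J n N))))"
  using bij_betw_trans[OF D.dmo_bij[OF Lam_objs(2,4)] lc_iso_right_bij[OF PC_linear_category Lam_objs(1,5,6) D.u_iso[OF F]]]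
  by (simp add: Lam_def[abs_def] comp_def)

lemma q_bij: "bij_betw (\<lambda>\<eta>. Cmp (PC n) F (coinv_ftor n N) (DP n (J n N)) (coinv_cmp n N) \<eta>)
    (carrier (Mor (PC n) F (coinv_ftor n N))) (carrier (Mor (PC n) F (DP n (J n N))))"
  by (rule lc_iso_left_bij[OF PC_linear_category Lam_objs(1,3,6) coinv_cmp_iso[OF N]])

lemma coinv_cmp_mor: "coinv_cmp n N \<in> carrier (Mor (PC n) (coinv_ftor n N) (DP n (J n N)))"
  using coinv_cmp_closed[OF N] by simp

lemma Psi_lhom: "Psi F N \<in> lhom (Mor (PC n) (J n N) (DP n F)) (Mor (PC n) F (coinv_ftor n N))"
  using lhom_compose[OF Lam_lhom lhom_inv[OF lc_right[OF PC_linear_category Lam_objs(1,3,6) coinv_cmp_mor] q_bij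
    lc_vs[OF PC_linear_category Lam_objs(1,3)]]] by (simp add: Psi_def[abs_def])

lemma Psi_bij: "bij_betw (Psi F N) (carrier (Mor (PC n) (J n N) (DP n F))) (carrier (Mor (PC n) F (coinv_ftor n N)))"
  using bij_betw_trans[OF Lam_bij bij_betw_inv_into[OF q_bij]] by (simp add: Psi_def[abs_def] comp_def)

lemma q_Psi:
  assumes "\<zeta> \<in> carrier (Mor (PC n) (J n N) (DP n F))"
  shows "Cmp (PC n) F (coinv_ftor n N) (DP n (J n N)) (coinv_cmp n N) (Psi F N \<zeta>) = Lam F N \<zeta>"
  unfolding Psi_def by (rule bij_betw_inv_into_right[OF q_bij lhom_closed[OF Lam_lhom assms]])

lemma Psi_unique:
  assumes "\<zeta> \<in> carrier (Mor (PC n) (J n N) (DP n F))" "\<eta> \<in> carrier (Mor (PC n) F (coinv_ftor n N))"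
    "Cmp (PC n) F (coinv_ftor n N) (DP n (J n N)) (coinv_cmp n N) \<eta> = Lam F N \<zeta>"
  shows "Psi F N \<zeta> = \<eta>"
  by (rule inj_onD[OF bij_betw_imp_inj_on[OF q_bij] _ lhom_closed[OF Psi_lhom assms(1)] assms(2)])
    (simp only: q_Psi[OF assms(1)] assms(3))

end

text \<open>\<open>Psi\<close> involves an inverse, so the claim is tested after composing with
  \<open>coinv_cmp\<close>, which turns both sides into expressions in \<open>Lam\<close>. What
  remains is \<open>coinv_cmp_natural_rep\<close> and contravariance of the duality.\<close>

lemma Psi_natural_rep:
  assumes F: "F \<in> Obj (PC n)" and N: "is_rep n N" and N': "is_rep n N'" and p: "\<psi> \<in> equivariant n N N'"
    and z: "\<zeta> \<in> carrier (Mor (PC n) (J n N) (DP n F))"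
  shows "Psi F N' (Cmp (PC n) (J n N') (J n N) (DP n F) \<zeta> (jh n N N' \<psi>)) =
    Cmp (PC n) F (coinv_ftor n N) (coinv_ftor n N') (coinv_nt n N N' \<psi>) (Psi F N \<zeta>)"
proof -
  note o = Lam_objs[OF F N] and o' = Lam_objs[OF F N']
  note C = PC_linear_category[of n]
  have j: "jh n N N' \<psi> \<in> carrier (Mor (PC n) (J n N') (J n N))" using jh_nt[OF N N' p] by simp
  have c: "coinv_nt n N N' \<psi> \<in> carrier (Mor (PC n) (coinv_ftor n N) (coinv_ftor n N'))"
    using coinv_nt_closed[OF N N' p] by simp
  note q = coinv_cmp_mor[OF F N] and q' = coinv_cmp_mor[OF F N'] and P = lhom_closed[OF Psi_lhom[OF F N] z]
  note Dj = D.dmo[OF o'(2) o(2) j] and Dz = D.dmo[OF o(2,4) z] and uF = D.u_closed[OF F]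
  show ?thesis
  proof (rule Psi_unique[OF F N' lc_cmp[OF C o'(2) o(2,4) j z] lc_cmp[OF C o(1,3) o'(3) P c]])
    have "Cmp (PC n) F (coinv_ftor n N') (DP n (J n N')) (coinv_cmp n N') (Cmp (PC n) F (coinv_ftor n N) (coinv_ftor n N') (coinv_nt n N N' \<psi>) (Psi F N \<zeta>))
      = Cmp (PC n) F (coinv_ftor n N) (DP n (J n N')) (Cmp (PC n) (coinv_ftor n N) (coinv_ftor n N') (DP n (J n N')) (coinv_cmp n N') (coinv_nt n N N' \<psi>)) (Psi F N \<zeta>)"
      by (rule lc_assoc[OF C o(1,3) o'(3,6) P c q', symmetric])
    also have "\<dots> = Cmp (PC n) F (coinv_ftor n N) (DP n (J n N'))
       (Cmp (PC n) (coinv_ftor n N) (DP n (J n N)) (DP n (J n N')) (DP_map n (J n N') (J n N) (jh n N N' \<psi>)) (coinv_cmp n N)) (Psi F N \<zeta>)"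
      by (simp only: coinv_cmp_natural_rep[OF N N' p])
    also have "\<dots> = Cmp (PC n) F (DP n (J n N)) (DP n (J n N')) (DP_map n (J n N') (J n N) (jh n N N' \<psi>)) (Lam F N \<zeta>)"
      by (simp only: lc_assoc[OF C o(1,3,6) o'(6) P q Dj] q_Psi[OF F N z])
    also have "\<dots> = Cmp (PC n) F (DP n (DP n F)) (DP n (J n N'))
       (Cmp (PC n) (DP n (DP n F)) (DP n (J n N)) (DP n (J n N')) (DP_map n (J n N') (J n N) (jh n N N' \<psi>)) (DP_map n (J n N) (DP n F) \<zeta>)) (u F)"
      unfolding Lam_def by (rule lc_assoc[OF C o(1,5,6) o'(6) uF Dz Dj, symmetric])
    also have "\<dots> = Lam F N' (Cmp (PC n) (J n N') (J n N) (DP n F) \<zeta> (jh n N N' \<psi>))"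
      unfolding Lam_def by (simp only: D.dmo_cmp[OF o'(2) o(2,4) j z])
    finally show "Cmp (PC n) F (coinv_ftor n N') (DP n (J n N')) (coinv_cmp n N') (Cmp (PC n) F (coinv_ftor n N) (coinv_ftor n N') (coinv_nt n N N' \<psi>) (Psi F N \<zeta>))
      = Lam F N' (Cmp (PC n) (J n N') (J n N) (DP n F) \<zeta> (jh n N N' \<psi>))" .
  qed
qed

text \<open>Tested after \<open>coinv_cmp\<close> in the same way; the step proper to a change of F
  is naturality of the unit of the duality.\<close>

lemma Psi_natural_ftor:
  assumes F: "F \<in> Obj (PC n)" and G: "G \<in> Obj (PC n)" and N: "is_rep n N" and a: "\<alpha> \<in> carrier (Mor (PC n) F G)"
    and z: "\<zeta> \<in> carrier (Mor (PC n) (J n N) (DP n G))"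
  shows "Psi F N (Cmp (PC n) (J n N) (DP n G) (DP n F) (DP_map n F G \<alpha>) \<zeta>) =
    Cmp (PC n) F G (coinv_ftor n N) (Psi G N \<zeta>) \<alpha>"
proof -
  note o = Lam_objs[OF F N] and o' = Lam_objs[OF G N]
  note C = PC_linear_category[of n]
  note q = coinv_cmp_mor[OF F N] and P = lhom_closed[OF Psi_lhom[OF G N] z]
  note Da = D.dmo[OF F G a] and Dz = D.dmo[OF o'(2,4) z]
  note DDa = D.dmo[OF o'(4) o(4) Da]
  show ?thesis
  proof (rule Psi_unique[OF F N lc_cmp[OF C o(2) o'(4) o(4) z Da] lc_cmp[OF C o(1) o'(1) o(3) a P]])
    have "Cmp (PC n) F (coinv_ftor n N) (DP n (J n N)) (coinv_cmp n N) (Cmp (PC n) F G (coinv_ftor n N) (Psi G N \<zeta>) \<alpha>)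
      = Cmp (PC n) F G (DP n (J n N)) (Lam G N \<zeta>) \<alpha>"
      by (simp only: lc_assoc[OF C F G o(3,6) a P q, symmetric] q_Psi[OF G N z])
    also have "\<dots> = Cmp (PC n) F (DP n (DP n G)) (DP n (J n N)) (DP_map n (J n N) (DP n G) \<zeta>) (Cmp (PC n) F G (DP n (DP n G)) (u G) \<alpha>)"
      unfolding Lam_def by (rule lc_assoc[OF C F G o'(5) o(6) a D.u_closed[OF G] Dz])
    also have "\<dots> = Cmp (PC n) F (DP n (DP n G)) (DP n (J n N)) (DP_map n (J n N) (DP n G) \<zeta>)
        (Cmp (PC n) F (DP n (DP n F)) (DP n (DP n G)) (DP_map n (DP n G) (DP n F) (DP_map n F G \<alpha>)) (u F))"
      by (simp only: D.u_natural[OF F G a])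
    also have "\<dots> = Lam F N (Cmp (PC n) (J n N) (DP n G) (DP n F) (DP_map n F G \<alpha>) \<zeta>)"
      unfolding Lam_def D.dmo_cmp[OF o(2) o'(4) o(4) z Da]
      by (rule lc_assoc[OF C F o(5) o'(5) o(6) D.u_closed[OF F] DDa Dz, symmetric])
    finally show "Cmp (PC n) F (coinv_ftor n N) (DP n (J n N)) (coinv_cmp n N) (Cmp (PC n) F G (coinv_ftor n N) (Psi G N \<zeta>) \<alpha>)
      = Lam F N (Cmp (PC n) (J n N) (DP n G) (DP n F) (DP_map n F G \<alpha>) \<zeta>)" .
  qed
qed

text \<open>The value of j_!F at \<open>M\<close> is the dual of that of j_* of the dual of F at the
  dual of \<open>M\<close>. A functional on it is thus, by biduality, a point of the latter;
  decoding gives a transformation into the dual of F, and \<open>Psi\<close> turns it into one from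
  F to coinvariants.\<close>

definition theta :: "('k, 'u) pftor \<Rightarrow> ('k, 'u) rep \<Rightarrow> ('u \<Rightarrow> 'k) \<Rightarrow> ('k, 'u) module \<Rightarrow> 'u \<Rightarrow> 'u" where
  "theta F M = (\<lambda>\<xi>\<in>carrier (dual_space (ob (ob (jshriek n) F) M)).
     Psi F (dual_rep n M) (dec (jlow_space n (DP n F) (dual_rep n M)) (bidual_pt (small (jlow_space n (DP n F) (dual_rep n M))) \<xi>)))"

context
  fixes F :: "('k, 'u) pftor" and M :: "('k, 'u) rep"
  assumes F: "F \<in> Obj (PC n)" and M: "is_rep n M"
begin

lemma jl_fdvs: "fdvs (jlow_space n (DP n F) (dual_rep n M))" "fdvs (small (jlow_space n (DP n F) (dual_rep n M)) :: ('k, 'u) module)"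
  using fdvs_jlow_space[of n "DP n F" "dual_rep n M"] D.dob[OF F] dual_rep_is_rep[OF M] by (simp_all add: fdvs_small)

lemma theta_lin: "theta F M \<in> lin (dual_space (ob (ob (jshriek n) F) M)) (Mor (PC n) F (coinv_ftor n (dual_rep n M)))"
  unfolding theta_def jshriek_simps[OF M]
  by (rule lin_restrict[OF lhom_compose[OF lhom_compose[OF bidual_pt_lhom[OF jl_fdvs(2)] dec_lhom[OF jl_fdvs(1)]]
      Psi_lhom[OF F dual_rep_is_rep[OF M], folded jlow_space_eq]]]) (use jl_fdvs(2) in simp)

lemma theta_bij: "bij_betw (theta F M) (carrier (dual_space (ob (ob (jshriek n) F) M)))
    (carrier (Mor (PC n) F (coinv_ftor n (dual_rep n M))))"
proof (rule bij_betw_cong[THEN iffD1])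
  show "bij_betw (Psi F (dual_rep n M) \<circ> (dec (jlow_space n (DP n F) (dual_rep n M)) \<circ> bidual_pt (small (jlow_space n (DP n F) (dual_rep n M)))))
      (carrier (dual_space (ob (ob (jshriek n) F) M))) (carrier (Mor (PC n) F (coinv_ftor n (dual_rep n M))))"
    unfolding jshriek_simps[OF M]
    by (rule bij_betw_trans[OF bij_betw_trans[OF bidual_pt_bij[OF jl_fdvs(2)] dec_bij[OF jl_fdvs(1)]]
      Psi_bij[OF F dual_rep_is_rep[OF M], folded jlow_space_eq]])
qed (simp add: theta_def)

lemma theta_arg:
  assumes "\<xi> \<in> carrier (dual_space (ob (ob (jshriek n) F) M))"
  shows "\<xi> \<in> lin (vdual (small (jlow_space n (DP n F) (dual_rep n M)))) scalars"
    "bidual_pt (small (jlow_space n (DP n F) (dual_rep n M))) \<xi> \<in> carrier (small (jlow_space n (DP n F) (dual_rep n M)))"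
    "dec (jlow_space n (DP n F) (dual_rep n M)) (bidual_pt (small (jlow_space n (DP n F) (dual_rep n M))) \<xi>)
      \<in> carrier (Mor (PC n) (J n (dual_rep n M)) (DP n F))"
proof -
  show l: "\<xi> \<in> lin (vdual (small (jlow_space n (DP n F) (dual_rep n M)))) scalars"
    using assms by (simp add: jshriek_simps[OF M])
  show p: "bidual_pt (small (jlow_space n (DP n F) (dual_rep n M))) \<xi> \<in> carrier (small (jlow_space n (DP n F) (dual_rep n M)))"
    by (rule bidual_pt_closed[OF jl_fdvs(2) lin_lhom[OF l]])
  show "dec (jlow_space n (DP n F) (dual_rep n M)) (bidual_pt (small (jlow_space n (DP n F) (dual_rep n M))) \<xi>)
      \<in> carrier (Mor (PC n) (J n (dual_rep n M)) (DP n F))"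
    using dec_closed[OF jl_fdvs(1) p] by simp
qed

end

lemma theta_natural_rep:
  assumes F: "F \<in> Obj (PC n)" and M: "is_rep n M" and N: "is_rep n N" and p: "\<phi> \<in> equivariant n M N"
    and xi: "\<xi> \<in> carrier (dual_space (ob (ob (jshriek n) F) N))"
  shows "theta F M (compose (carrier (ob (ob (jshriek n) F) M)) \<xi> (mo (ob (jshriek n) F) M N \<phi>)) =
    Cmp (PC n) F (coinv_ftor n (dual_rep n N)) (coinv_ftor n (dual_rep n M))
      (coinv_nt n (dual_rep n N) (dual_rep n M) (mo (Rep_dual n) M N \<phi>)) (theta F N \<xi>)"
proof -
  let ?M = "dual_rep n M" and ?N = "dual_rep n N" and ?\<psi> = "vdual_map (rsp M) (rsp N) \<phi>"
  let ?SM = "jlow_space n (DP n F) ?M" and ?SN = "jlow_space n (DP n F) ?N"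
  let ?f = "mo (jlow_ob n (DP n F)) ?N ?M ?\<psi>"
  note fM = jl_fdvs[OF F M] and fN = jl_fdvs[OF F N] and A = theta_arg[OF F N xi]
  note dM = dual_rep_is_rep[OF M] and dN = dual_rep_is_rep[OF N] and e = vdual_map_equivariant[OF M N p]
  have D': "linear_functor (Gam n) Vect (DP n F)" using D.dob[OF F] by simp
  have f: "?f \<in> lin (small ?SN) (small ?SM)"
    using LF_lin[OF jlow_ob_linear[OF D'], of ?N ?M ?\<psi>] dM dN e by simp
  note P = bidual_pt_vdual_map[OF fN(2) fM(2) f A(1)]
  let ?z = "dec ?SN (bidual_pt (small ?SN) \<xi>)"
  have "Cmp (PC n) (J n ?M) (J n ?N) (DP n F) ?z (jh n ?N ?M ?\<psi>) \<in> carrier ?SM"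
    using lhom_closed[OF precompose_lhom[OF D' dN dM e] dec_closed[OF fN(1) A(2)]] .
  then have "dec ?SM (?f (bidual_pt (small ?SN) \<xi>)) = Cmp (PC n) (J n ?M) (J n ?N) (DP n F) ?z (jh n ?N ?M ?\<psi>)"
    unfolding jlow_ob_apply[OF D' dN A(2)] by (rule dec_enc[OF fM(1)])
  then have "theta F M (compose (carrier (vdual (small ?SM))) \<xi> (vdual_map (small ?SN) (small ?SM) ?f)) =
    Psi F ?M (Cmp (PC n) (J n ?M) (J n ?N) (DP n F) ?z (jh n ?N ?M ?\<psi>))"
    using P by (simp add: theta_def jshriek_simps[OF M] del: Fun_simps)
  then show ?thesis
    using Psi_natural_rep[OF F dN dM e A(3)] xi
    by (simp add: jshriek_simps[OF M] Rep_dual_simps theta_def[of F N] del: Fun_simps)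
qed

lemma theta_natural_ftor:
  assumes F: "F \<in> Obj (PC n)" and G: "G \<in> Obj (PC n)" and M: "is_rep n M" and a: "\<alpha> \<in> carrier (Mor (PC n) F G)"
    and xi: "\<xi> \<in> carrier (dual_space (ob (ob (jshriek n) G) M))"
  shows "theta F M (compose (carrier (ob (ob (jshriek n) F) M)) \<xi> (mo (jshriek n) F G \<alpha> M)) =
    Cmp (PC n) F G (coinv_ftor n (dual_rep n M)) (theta G M \<xi>) \<alpha>"
proof -
  let ?M = "dual_rep n M"
  let ?SF = "jlow_space n (DP n F) ?M" and ?SG = "jlow_space n (DP n G) ?M"
  let ?f = "jlow_nt n (DP n G) (DP n F) (DP_map n F G \<alpha>) ?M"
  note fF = jl_fdvs[OF F M] and fG = jl_fdvs[OF G M] and A = theta_arg[OF G M xi]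
  note dM = dual_rep_is_rep[OF M]
  have L: "linear_functor (Gam n) Vect (DP n F)" "linear_functor (Gam n) Vect (DP n G)" using D.dob[OF F] D.dob[OF G] by simp_all
  have Da: "DP_map n F G \<alpha> \<in> nat_trans (Gam n) Vect (DP n G) (DP n F)" using D.dmo[OF F G a] by simp
  have f: "?f \<in> lin (small ?SG) (small ?SF)"
    using nt_lin[OF jlow_nt_closed[OF L(2,1) Da], of ?M] dM by simp
  note P = bidual_pt_vdual_map[OF fG(2) fF(2) f A(1)]
  let ?z = "dec ?SG (bidual_pt (small ?SG) \<xi>)"
  have "Cmp (PC n) (J n ?M) (DP n G) (DP n F) (DP_map n F G \<alpha>) ?z \<in> carrier ?SF"
    using lhom_closed[OF postcompose_lhom[OF L(2,1) Da dM] dec_closed[OF fG(1) A(2)]] .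
  then have "dec ?SF (?f (bidual_pt (small ?SG) \<xi>)) = Cmp (PC n) (J n ?M) (DP n G) (DP n F) (DP_map n F G \<alpha>) ?z"
    unfolding jlow_nt_apply[OF L(2) dM A(2)] by (rule dec_enc[OF fF(1)])
  then have "theta F M (compose (carrier (vdual (small ?SF))) \<xi> (vdual_map (small ?SG) (small ?SF) ?f)) =
    Psi F ?M (Cmp (PC n) (J n ?M) (DP n G) (DP n F) (DP_map n F G \<alpha>) ?z)"
    using P by (simp add: theta_def jshriek_simps[OF M] del: Fun_simps)
  then show ?thesis
    using Psi_natural_ftor[OF F G dM a A(3)] xi
    by (simp add: jshriek_simps[OF M] theta_def[of G M] del: Fun_simps)
qed

end

end

theorem proposition3p2p2:
  fixes \<iota> :: "'k::field list \<Rightarrow> 'u" and n :: nat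
  assumes "CHAR('k) > 0"
    and "inj \<iota>"
    and "n > 0"
  shows
    "adjoint (A_cat n :: ('k, 'u) acat) (P_cat n) (jstar n) (jlow n) \<and>
     (\<forall>F\<in>Obj (P_cat n :: ('k, 'u) pcat). \<forall>M\<in>Obj (Rep n).
       is_copy (Mor (P_cat n) (ob (jstar n) (h_ftor n M)) F) (ob (ob (jlow n) F) M)
         (enc (Mor (P_cat n) (ob (jstar n) (h_ftor n M)) F))) \<and>
     adjoint (P_cat n :: ('k, 'u) pcat) (A_cat n) (jshriek n) (jstar n) \<and>
     (\<exists>\<theta>. (\<forall>F\<in>Obj (P_cat n :: ('k, 'u) pcat). \<forall>M\<in>Obj (Rep n).
            \<theta> F M \<in> lin (dual_space (ob (ob (jshriek n) F) M)) (Mor (P_cat n) F (coinv_ftor n (dual_rep n M))) \<and>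
            bij_betw (\<theta> F M) (carrier (dual_space (ob (ob (jshriek n) F) M)))
              (carrier (Mor (P_cat n) F (coinv_ftor n (dual_rep n M))))) \<and>
         (\<forall>F\<in>Obj (P_cat n). \<forall>M\<in>Obj (Rep n). \<forall>N\<in>Obj (Rep n). \<forall>\<phi>\<in>carrier (Mor (Rep n) M N).
            \<forall>\<xi>\<in>carrier (dual_space (ob (ob (jshriek n) F) N)).
            \<theta> F M (compose (carrier (ob (ob (jshriek n) F) M)) \<xi> (mo (ob (jshriek n) F) M N \<phi>)) =
            Cmp (P_cat n) F (coinv_ftor n (dual_rep n N)) (coinv_ftor n (dual_rep n M))
              (coinv_nt n (dual_rep n N) (dual_rep n M) (mo (Rep_dual n) M N \<phi>)) (\<theta> F N \<xi>)) \<and>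
         (\<forall>F\<in>Obj (P_cat n). \<forall>G\<in>Obj (P_cat n). \<forall>M\<in>Obj (Rep n). \<forall>\<alpha>\<in>carrier (Mor (P_cat n) F G).
            \<forall>\<xi>\<in>carrier (dual_space (ob (ob (jshriek n) G) M)).
            \<theta> F M (compose (carrier (ob (ob (jshriek n) F) M)) \<xi> (mo (jshriek n) F G \<alpha> M)) =
            Cmp (P_cat n) F G (coinv_ftor n (dual_rep n M)) (\<theta> G M \<xi>) \<alpha>))"
proof -
  interpret univ \<iota> by (rule univ.intro[OF assms(2)])
  obtain u where D: "duality (PC n) (DP n) (DP_map n) u" using DP_duality by blast
  \<comment> \<open>The formula for j_*F holds by definition; its content is that the coded value is
    a genuine copy, which is the finiteness proved by polarization.\<close>
  have copy: "is_copy (Mor (PC n) (ob (jstar n) (h_ftor n M)) F) (ob (ob (jlow n) F) M)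
      (enc (Mor (PC n) (ob (jstar n) (h_ftor n M)) F) :: _ \<Rightarrow> 'u)"
    if "F \<in> Obj (PC n :: ('k, 'u) pcat)" "M \<in> Obj (Rep n)" for F and M :: "('k, 'u) rep"
    using small_is_copy[OF fdvs_jlow_space[of n F M]] that by (simp add: jstar_def jlow_def jlow_space_eq)
  show ?thesis
    unfolding A_cat_def P_cat_def
  proof (intro conjI ballI copy jstar_jlow_adjoint jshriek_jstar_adjoint exI[of _ "theta n u"])
  qed (rule theta_lin[OF D] theta_bij[OF D] theta_natural_rep[OF D] theta_natural_ftor[OF D] | assumption | simp)+
qed

end
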